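(* Assume $n_1=n_2=1$, $\Omega=I_1\times I_2$ is a bounded open box, and $\theta<1$. Let $u\in L^\infty(\Omega)$ with $\|u\|_\infty\le1$ and $\mathcal{E}(u)<\infty$. (i) There exists $\bar u\in S(\Omega)$ such that $u-\bar u\in SBV_\theta(\Omega)\cap L^\infty(\Omega)$ and $$\|u-\bar u\|_\infty+|\nabla(u-\bar u)|_\theta(\Omega)\lesssim\big(1+\mathcal{H}^1(I_1)+\mathcal{H}^1(I_2)\big)\Big(\mathcal{E}(u)+\sqrt{\mathcal{E}(u)}\Big).$$ (ii) If moreover $\mu[u]=0$ and $u\notin S(\Omega)$, then there exist non-constant functions $u_l\in SBV_{\theta_l}(I_l)$, $l=1,2$, with $u(x)=u_1(x_1)+u_2(x_2)$ a.e. and $$|\nabla u_1|_{\theta_1}(I_1)\,|\nabla u_2|_{\theta_2}(I_2)\lesssim\mathcal{E}(u).$$ (iii) Consequently, if $u\in L^\infty(\Omega)\cap BV(\Omega)$ satisfies $\mathcal{E}(u)<\infty$ and the distributional gradient $\nabla u$ has no jump part, then $u\in S(\Omega)$.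
   Context: Setting: $\theta_1,\theta_2>0$, $\theta=\theta_1+\theta_2\le1$; $\rho\in L^1(\mathbb{R}^2,\mathbb{R}_+)$ radial, supported in $B_1$, $\int\rho=1$, $\rho_\varepsilon(z)=\varepsilon^{-2}\rho(z/\varepsilon)$. $Du(x,z):=u(x+z)-u(x)$; for $z=(z_1,z_2)$, $z_1$ stands for $(z_1,0)$ and $z_2$ for $(0,z_2)$. $I_l^\varepsilon=\{s\in I_l:\operatorname{dist}(s,\mathbb{R}\setminus I_l)>\varepsilon\}$, $\Omega^\varepsilon=I_1^\varepsilon\times I_2^\varepsilon$, $\mathcal{E}_\varepsilon(u)=\int_{\mathbb{R}^2}\int_{\Omega^\varepsilon}|z|^{-2}|Du(x,z_1)|^{\theta_1}|Du(x,z_2)|^{\theta_2}\,dx\,\rho_\varepsilon(z)dz$, $\mathcal{E}(u)=\liminf_{\varepsilon\downarrow0}\mathcal{E}_\varepsilon(u)$. $\mu[u]=\partial_1\partial_2u$. $S(\Omega)$: measurable functions of the form $u(x)=u_1(x_1)$ a.e. or $u(x)=u_2(x_2)$ a.e. For an open set $U\subset\mathbb{R}^d$ and $\alpha\in(0,1]$, $SBV_\alpha(U)$ is the set of $u\in BV(U)$ whose distributional gradient is purely a jump part, $\nabla u=(u_+-u_-)\nu_u\,\mathcal{H}^{d-1}\llcorner J_u$ ($J_u$ the jump set, $u_\pm$ the one-sided traces, $\nu_u$ the normal), and such that $|\nabla u|_\alpha(U):=\int_{J_u}|u_+-u_-|^\alpha\,d\mathcal{H}^{d-1}<\infty$. $a\lesssim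 b$ means $a\le Cb$ with $C$ depending only on $\theta_1,\theta_2,\rho$. *)

theory Defs
  imports "HOL-Analysis.Analysis" "HOL-Probability.Essential_Supremum"
begin

definition hausdorff_pre :: "nat \<Rightarrow> real \<Rightarrow> 'a::euclidean_space set \<Rightarrow> ennreal" where
  "hausdorff_pre k \<delta> A =
     (INF C \<in> {C :: nat \<Rightarrow> 'a set. A \<subseteq> (\<Union>i. C i) \<and> (\<forall>i. bounded (C i) \<and> diameter (C i) \<le> \<delta>)}.
        (\<Sum>i. ennreal (if C i = {} then 0
                        else unit_ball_vol (real k) / 2 ^ k * diameter (C i) ^ k)))"

definition hausdorff_outer :: "nat \<Rightarrow> 'a::euclidean_space set \<Rightarrow> ennreal" where
  "hausdorff_outer k A = (SUP \<delta> \<in> {0<..}. hausdorff_pre k \<delta> A)"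

definition hausdorff_measure :: "nat \<Rightarrow> 'a::euclidean_space measure" where
  "hausdorff_measure k =
     measure_of UNIV (lambda_system UNIV UNIV (hausdorff_outer k)) (hausdorff_outer k)"

definition pd :: "'a::euclidean_space \<Rightarrow> ('a \<Rightarrow> real) \<Rightarrow> 'a \<Rightarrow> real" where
  "pd b f x = frechet_derivative f (at x) b"

fun Ck :: "nat \<Rightarrow> ('a::euclidean_space \<Rightarrow> real) \<Rightarrow> bool" where
  "Ck 0 f = continuous_on UNIV f"
| "Ck (Suc k) f = ((\<forall>x. f differentiable (at x)) \<and> (\<forall>b\<in>Basis. Ck k (pd b f)))"

definition test_fun :: "'a::euclidean_space set \<Rightarrow> ('a \<Rightarrow> real) \<Rightarrow> bool" where
  "test_fun U \<phi> \<longleftrightarrow> (\<forall>k. Ck k \<phi>) \<and> (\<exists>K. compact K \<and> K \<subseteq> U \<and> (\<forall>x. x \<notin> K \<longrightarrow> \<phi> x = 0))"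

definition test_field :: "'a::euclidean_space set \<Rightarrow> ('a \<Rightarrow> 'a) \<Rightarrow> bool" where
  "test_field U \<phi> \<longleftrightarrow> (\<forall>b\<in>Basis. test_fun U (\<lambda>x. \<phi> x \<bullet> b))"

definition divergence :: "('a::euclidean_space \<Rightarrow> 'a) \<Rightarrow> 'a \<Rightarrow> real" where
  "divergence \<phi> x = (\<Sum>b\<in>Basis. pd b (\<lambda>y. \<phi> y \<bullet> b) x)"

definition BV :: "'a::euclidean_space set \<Rightarrow> ('a \<Rightarrow> real) \<Rightarrow> bool" where
  "BV U u \<longleftrightarrow> set_integrable lebesgue U u \<and>
     (\<exists>M. \<forall>\<phi>. test_field U \<phi> \<and> (\<forall>x. norm (\<phi> x) \<le> 1) \<longrightarrow>
          (LINT x:U|lebesgue. u x * divergence \<phi> x) \<le> M)"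

definition half_ball_plus :: "'a::euclidean_space \<Rightarrow> 'a \<Rightarrow> real \<Rightarrow> 'a set" where
  "half_ball_plus x \<nu> r = {y \<in> ball x r. (y - x) \<bullet> \<nu> > 0}"

definition half_ball_minus :: "'a::euclidean_space \<Rightarrow> 'a \<Rightarrow> real \<Rightarrow> 'a set" where
  "half_ball_minus x \<nu> r = {y \<in> ball x r. (y - x) \<bullet> \<nu> < 0}"

definition approx_jump :: "('a::euclidean_space \<Rightarrow> real) \<Rightarrow> 'a \<Rightarrow> real \<Rightarrow> real \<Rightarrow> 'a \<Rightarrow> bool" where
  "approx_jump u x a b \<nu> \<longleftrightarrow> a \<noteq> b \<and> norm \<nu> = 1 \<and>
     ((\<lambda>r. (\<integral>\<^sup>+ y \<in> half_ball_plus x \<nu> r. ennreal \<bar>u y - a\<bar> \<partial>lebesgue)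
            / emeasure lebesgue (half_ball_plus x \<nu> r)) \<longlongrightarrow> 0) (at_right 0) \<and>
     ((\<lambda>r. (\<integral>\<^sup>+ y \<in> half_ball_minus x \<nu> r. ennreal \<bar>u y - b\<bar> \<partial>lebesgue)
            / emeasure lebesgue (half_ball_minus x \<nu> r)) \<longlongrightarrow> 0) (at_right 0)"

definition jump_set :: "'a::euclidean_space set \<Rightarrow> ('a \<Rightarrow> real) \<Rightarrow> 'a set" where
  "jump_set U u = {x \<in> U. \<exists>a b \<nu>. approx_jump u x a b \<nu>}"

text \<open>|u_+ - u_-|(x), independent of the choice of the jump triple.\<close>
definition jump_size :: "('a::euclidean_space \<Rightarrow> real) \<Rightarrow> 'a \<Rightarrow> real" where
  "jump_size u x = (SOME s. \<exists>a b \<nu>. approx_jump u x a b \<nu> \<and> s = \<bar>a - b\<bar>)"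

text \<open>|nabla u|_alpha(U) = integral over J_u of |u_+ - u_-|^alpha dH^{d-1}.
  For alpha = 1 this is the total variation of the jump part of Du.\<close>
definition jump_var :: "real \<Rightarrow> 'a::euclidean_space set \<Rightarrow> ('a \<Rightarrow> real) \<Rightarrow> ennreal" where
  "jump_var \<alpha> U u = (\<integral>\<^sup>+ x \<in> jump_set U u. ennreal (jump_size u x powr \<alpha>)
                        \<partial>hausdorff_measure (DIM('a) - 1))"

text \<open>SBV_alpha(U): Du = (u_+ - u_-) nu H^{d-1} restricted to J_u, and |nabla u|_alpha(U) finite.\<close>
definition SBV :: "real \<Rightarrow> 'a::euclidean_space set \<Rightarrow> ('a \<Rightarrow> real) \<Rightarrow> bool" where
  "SBV \<alpha> U u \<longleftrightarrow> BV U u \<and>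
     (\<exists>g :: 'a \<Rightarrow> 'a.
        (\<forall>x\<in>jump_set U u. \<exists>a b \<nu>. approx_jump u x a b \<nu> \<and> g x = (a - b) *\<^sub>R \<nu>) \<and>
        set_integrable (hausdorff_measure (DIM('a) - 1)) (jump_set U u) g \<and>
        (\<forall>\<phi>. test_field U \<phi> \<longrightarrow>
            (LINT x:U|lebesgue. u x * divergence \<phi> x) =
            - (LINT x:jump_set U u|hausdorff_measure (DIM('a) - 1). g x \<bullet> \<phi> x))) \<and>
     jump_var \<alpha> U u < \<infinity>"

definition Linf :: "'a::euclidean_space set \<Rightarrow> ('a \<Rightarrow> real) \<Rightarrow> bool" where
  "Linf U u \<longleftrightarrow> u \<in> borel_measurable (lebesgue_on U) \<and> (\<exists>M. AE x in lebesgue_on U. \<bar>u x\<bar> \<le> M)"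

definition Linf_norm :: "'a::euclidean_space set \<Rightarrow> ('a \<Rightarrow> real) \<Rightarrow> ereal" where
  "Linf_norm U u = esssup (lebesgue_on U) (\<lambda>x. ereal \<bar>u x\<bar>)"

definition S_class :: "(real \<times> real) set \<Rightarrow> (real \<times> real \<Rightarrow> real) \<Rightarrow> bool" where
  "S_class \<Omega> u \<longleftrightarrow> u \<in> borel_measurable (lebesgue_on \<Omega>) \<and>
     ((\<exists>u1 :: real \<Rightarrow> real. AE x in lebesgue_on \<Omega>. u x = u1 (fst x)) \<or>
      (\<exists>u2 :: real \<Rightarrow> real. AE x in lebesgue_on \<Omega>. u x = u2 (snd x)))"

definition mu_zero :: "(real \<times> real) set \<Rightarrow> (real \<times> real \<Rightarrow> real) \<Rightarrow> bool" where
  "mu_zero \<Omega> u \<longleftrightarrow> (\<forall>\<phi>. test_fun \<Omega> \<phi> \<longrightarrow>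
      (LINT x:\<Omega>|lebesgue. u x * pd (1, 0) (pd (0, 1) \<phi>) x) = 0)"

definition box2 :: "real \<Rightarrow> real \<Rightarrow> real \<Rightarrow> real \<Rightarrow> (real \<times> real) set" where
  "box2 a1 b1 a2 b2 = {a1<..<b1} \<times> {a2<..<b2}"

definition shrink :: "real \<Rightarrow> real set \<Rightarrow> real set" where
  "shrink \<epsilon> I = {s \<in> I. infdist s (- I) > \<epsilon>}"

definition energy_eps ::
  "real \<Rightarrow> real \<Rightarrow> (real \<times> real \<Rightarrow> real) \<Rightarrow> real set \<Rightarrow> real set \<Rightarrow> real \<Rightarrow> (real \<times> real \<Rightarrow> real) \<Rightarrow> ennreal" where
  "energy_eps \<theta>1 \<theta>2 \<rho> I1 I2 \<epsilon> u =
     (\<integral>\<^sup>+ z. (\<integral>\<^sup>+ x \<in> shrink \<epsilon> I1 \<times> shrink \<epsilon> I2.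
               ennreal (\<bar>u (x + (fst z, 0)) - u x\<bar> powr \<theta>1 * \<bar>u (x + (0, snd z)) - u x\<bar> powr \<theta>2
                        / (norm z)\<^sup>2) \<partial>lebesgue)
            * ennreal (\<rho> ((1 / \<epsilon>) *\<^sub>R z) / \<epsilon>\<^sup>2) \<partial>lebesgue)"

definition energy ::
  "real \<Rightarrow> real \<Rightarrow> (real \<times> real \<Rightarrow> real) \<Rightarrow> real set \<Rightarrow> real set \<Rightarrow> (real \<times> real \<Rightarrow> real) \<Rightarrow> ennreal" where
  "energy \<theta>1 \<theta>2 \<rho> I1 I2 u = Liminf (at_right 0) (\<lambda>\<epsilon>. energy_eps \<theta>1 \<theta>2 \<rho> I1 I2 \<epsilon> u)"

end

theory Submission
  imports Defs
begin

text \<open>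
  Averaging the energy over the directions \<open>z\<close> and over the position of a grid gives arbitrarily fine
  grids on which \<open>u\<close> is sampled well and the sum over all cells of the products
  \<open>\<bar>\<Delta>\<^sub>1u\<bar> powr \<theta>1 * \<bar>\<Delta>\<^sub>2u\<bar> powr \<theta>2\<close>
  of its horizontal and vertical differences is bounded by \<open>\<E>(u)\<close>, up to the
  factor \<open>\<integral> \<rho>(z) \<bar>z\<^sub>1 z\<^sub>2\<bar> / \<bar>z\<bar>\<^sup>2 dz\<close>. In each cell this dominates the \<open>\<theta>\<close>-th power of the mixed
  difference, and at least one of the two families of differences along the boundary of the grid has
  \<open>\<theta>\<close>-variation bounded by \<open>\<E> + \<surd>\<E>\<close>. So the sampled function is a function of one variable plus a
  combination of indicators of quadrants whose masses are bounded in \<open>\<ell>\<^sup>\<theta>\<close>. Because \<open>\<theta> < 1\<close>, such a bound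
  makes the tails of the masses uniformly small in \<open>\<ell>\<^sup>1\<close>, so no diffuse part can appear in the limit:
  \<open>u\<close> itself is a function of one variable plus a countable combination of indicators of quadrants.
  If \<open>\<mu>[u] = 0\<close>, then \<open>u\<close> is additive, the discrete energy is a product of two one-dimensional variations,
  and the same compactness applies to each factor. If \<open>u\<close> has no jumps, the masses of the atoms on
  each line must cancel, and only the function of one variable remains.
\<close>

section \<open>Hausdorff measure\<close>

text \<open>The energy bounds only products of differences in the two variables, never one factor
  alone. In (i), strips of the grid whose boundary increment dominates the mixed differences along
  them keep half of it in every cell; the two variations over such strips therefore have a product
  bounded by the energy, and one of them is at most its square root. Which one may change with the
  scale, so the variable left to the rough summand is settled only along a subsequence. A jump in
  one variable is stored as a quadrant whose corner lies outside the box, so a single compactness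
  statement for atoms serves all cases. In (ii) one factor may tend to 0 or to infinity along the
  scales; either forces \<open>u\<close> into the class \<open>S\<close>, and otherwise the two
  limits multiply to the bound. In (iii) the rough summand may jump as well, so atoms are tested
  only across lines along which it varies: almost every point of such a line is a Lebesgue point of
  it, and it cannot hide a jump there. The constant 12 is 4 times 3: four reflected directions, and
  an offset at which two averaged quantities are at most three times the bounds of their
  means.\<close>

definition hweight :: "nat \<Rightarrow> 'a::euclidean_space set \<Rightarrow> ennreal" where
  "hweight k S = ennreal (if S = {} then 0 else unit_ball_vol (real k) / 2 ^ k * diameter S ^ k)"

definition hcover :: "real \<Rightarrow> 'a::euclidean_space set \<Rightarrow> (nat \<Rightarrow> 'a set) \<Rightarrow> bool" where
  "hcover \<delta> A C \<longleftrightarrow> A \<subseteq> (\<Union>i. C i) \<and> (\<forall>i. bounded (C i) \<and> diameter (C i) \<le> \<delta>)"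

lemma hausdorff_pre_alt: "hausdorff_pre k \<delta> A = (INF C \<in> Collect (hcover \<delta> A). \<Sum>i. hweight k (C i))"
  unfolding hausdorff_pre_def hweight_def hcover_def by simp

lemma hweight_empty [simp]: "hweight k {} = 0"
  by (simp add: hweight_def)

lemma hausdorff_pre_le: "hcover \<delta> A C \<Longrightarrow> hausdorff_pre k \<delta> A \<le> (\<Sum>i. hweight k (C i))"
  unfolding hausdorff_pre_alt by (intro INF_lower) auto

lemma hausdorff_pre_mono: "A \<subseteq> B \<Longrightarrow> hausdorff_pre k \<delta> A \<le> hausdorff_pre k \<delta> B"
  unfolding hausdorff_pre_alt by (intro INF_superset_mono) (auto simp: hcover_def, blast)

lemma hausdorff_pre_antimono: "\<delta> \<le> \<delta>' \<Longrightarrow> hausdorff_pre k \<delta>' A \<le> hausdorff_pre k \<delta> A"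
  unfolding hausdorff_pre_alt by (intro INF_superset_mono) (auto simp: hcover_def, meson order_trans)

lemma hausdorff_pre_empty: "\<delta> > 0 \<Longrightarrow> hausdorff_pre k \<delta> {} = 0"
  using hausdorff_pre_le[of \<delta> "{}" "\<lambda>_. {}" k] by (simp add: hcover_def diameter_def)

lemma hausdorff_pre_subadd:
  "hausdorff_pre k \<delta> (\<Union>i. A i) \<le> (\<Sum>i. hausdorff_pre k \<delta> (A i :: 'a::euclidean_space set))"
proof (rule ennreal_le_epsilon)
  fix e :: real assume e: "0 < e" "(\<Sum>i. hausdorff_pre k \<delta> (A i)) < top"
  have "\<exists>C. hcover \<delta> (A n) C \<and> (\<Sum>i. hweight k (C i)) \<le> hausdorff_pre k \<delta> (A n) + e * (1/2)^(Suc n)" for n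
  proof -
    have "hausdorff_pre k \<delta> (A n) < top"
      using e(2) by (auto simp add: less_top dest!: ennreal_suminf_lessD)
    then have "hausdorff_pre k \<delta> (A n) < hausdorff_pre k \<delta> (A n) + e * (1/2)^Suc n"
      using e by (auto simp: less_top)
    then obtain C where "hcover \<delta> (A n) C" "(\<Sum>i. hweight k (C i)) < hausdorff_pre k \<delta> (A n) + e * (1/2)^Suc n"
      by (subst (asm) (1) hausdorff_pre_alt) (auto simp: INF_less_iff)
    then show ?thesis by (auto intro: less_imp_le)
  qed
  then obtain B where B: "\<And>n. hcover \<delta> (A n) (B n)"
      and Ble: "\<And>n. (\<Sum>i. hweight k (B n i)) \<le> hausdorff_pre k \<delta> (A n) + e * (1/2)^(Suc n)"
    by metis
  define C where "C = case_prod B o prod_decode"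
  have "hcover \<delta> (\<Union>i. A i) C"
    using B unfolding hcover_def C_def
    by (auto simp: subset_eq split_def) (metis fst_conv prod_encode_inverse snd_conv)
  then have "hausdorff_pre k \<delta> (\<Union>i. A i) \<le> (\<Sum>i. hweight k (C i))"
    by (rule hausdorff_pre_le)
  also have "\<dots> = (\<Sum>n. \<Sum>i. hweight k (B n i))"
    using suminf_ennreal_2dimen[of "\<lambda>n. \<Sum>i. hweight k (B n i)" "\<lambda>p. hweight k (case_prod B p)"]
    by (simp add: C_def comp_def)
  also have "\<dots> \<le> (\<Sum>n. hausdorff_pre k \<delta> (A n) + e * (1/2) ^ Suc n)"
    by (intro suminf_le allI Ble) auto
  also have "... = (\<Sum>n. hausdorff_pre k \<delta> (A n)) + (\<Sum>n. ennreal e * ennreal ((1/2) ^ Suc n))"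
    using \<open>0 < e\<close> by (subst suminf_add[symmetric])
                     (auto simp del: ennreal_suminf_cmult simp add: ennreal_mult[symmetric])
  also have "\<dots> = (\<Sum>n. hausdorff_pre k \<delta> (A n)) + e"
    unfolding ennreal_suminf_cmult
    by (subst suminf_ennreal_eq[OF zero_le_power power_half_series]) auto
  finally show "hausdorff_pre k \<delta> (\<Union>i. A i) \<le> (\<Sum>i. hausdorff_pre k \<delta> (A i)) + e" .
qed

lemma hausdorff_outer_mono: "A \<subseteq> B \<Longrightarrow> hausdorff_outer k A \<le> hausdorff_outer k B"
  unfolding hausdorff_outer_def by (intro SUP_mono') (auto intro!: hausdorff_pre_mono)

lemma hausdorff_outer_empty [simp]: "hausdorff_outer k {} = 0"
proof -
  have "(SUP \<delta>\<in>{0<..}. hausdorff_pre k \<delta> ({} :: 'a set)) = (SUP \<delta>\<in>{0::real<..}. 0)"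
    by (intro SUP_cong) (auto simp: hausdorff_pre_empty)
  then show ?thesis unfolding hausdorff_outer_def by simp
qed

lemma hausdorff_outer_subadd: "hausdorff_outer k (\<Union>i. A i) \<le> (\<Sum>i. hausdorff_outer k (A i :: 'a::euclidean_space set))"
  unfolding hausdorff_outer_def
  by (rule SUP_least, rule order_trans[OF hausdorff_pre_subadd])
     (auto intro!: suminf_le SUP_upper)

lemma hausdorff_outer_space: "outer_measure_space (Pow UNIV) (hausdorff_outer k)"
  unfolding outer_measure_space_def positive_def increasing_def countably_subadditive_def
  by (auto intro: hausdorff_outer_mono hausdorff_outer_subadd)

lemma hausdorff_outer_Un: "hausdorff_outer k (A \<union> B) \<le> hausdorff_outer k A + hausdorff_outer k (B :: 'a::euclidean_space set)"
proof -
  have "hausdorff_outer k (\<Union>i::nat. if i = 0 then A else if i = 1 then B else {})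
     \<le> (\<Sum>i::nat. hausdorff_outer k (if i = 0 then A else if i = 1 then B else {}))"
    by (rule hausdorff_outer_subadd)
  also have "(\<Union>i::nat. if i = 0 then A else if i = 1 then B else {}) = A \<union> B"
    by (auto split: if_splits)
  also have "(\<Sum>i::nat. hausdorff_outer k (if i = 0 then A else if i = 1 then B else {}))
     = (\<Sum>i\<in>{0,1::nat}. hausdorff_outer k (if i = 0 then A else if i = 1 then B else {}))"
    by (rule suminf_finite) auto
  finally show ?thesis by simp
qed

text \<open>A covering set of diameter at most \<delta> cannot meet both sets, so every cover splits
  into a cover of \<open>A\<close> and a cover of \<open>B\<close> without using any set
  twice.\<close>

lemma hausdorff_pre_add_separated:
  fixes A B :: "'a::euclidean_space set"
  assumes "\<And>x y. x \<in> A \<Longrightarrow> y \<in> B \<Longrightarrow> dist x y > \<delta>"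
  shows "hausdorff_pre k \<delta> A + hausdorff_pre k \<delta> B \<le> hausdorff_pre k \<delta> (A \<union> B)"
  unfolding hausdorff_pre_alt[of k \<delta> "A \<union> B"]
proof (rule INF_greatest)
  fix C assume "C \<in> Collect (hcover \<delta> (A \<union> B))"
  then have C: "hcover \<delta> (A \<union> B) C" by simp
  define CA where "CA i = (if C i \<inter> A = {} then {} else C i)" for i
  define CB where "CB i = (if C i \<inter> B = {} then {} else C i)" for i
  have sep: "C i \<inter> A = {} \<or> C i \<inter> B = {}" for i
  proof (rule ccontr)
    assume "\<not> ?thesis"
    then obtain x y where "x \<in> C i" "x \<in> A" "y \<in> C i" "y \<in> B" by auto
    then have "dist x y \<le> \<delta>"
      using C diameter_bounded_bound[of "C i" x y] by (auto simp: hcover_def intro: order_trans)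
    with assms[OF \<open>x \<in> A\<close> \<open>y \<in> B\<close>] show False by simp
  qed
  have \<delta>: "0 \<le> \<delta>" using C diameter_ge_0[of "C 0"] unfolding hcover_def by (meson order_trans)
  have "hcover \<delta> A CA" "hcover \<delta> B CB"
  proof -
    have "bounded (CA i)" "bounded (CB i)" "diameter (CA i) \<le> \<delta>" "diameter (CB i) \<le> \<delta>" for i
      using C \<delta> unfolding hcover_def CA_def CB_def by (auto simp: diameter_empty)
    moreover have "A \<subseteq> (\<Union>i. CA i)" "B \<subseteq> (\<Union>i. CB i)"
      using C unfolding hcover_def CA_def CB_def by fastforce+
    ultimately show "hcover \<delta> A CA" "hcover \<delta> B CB" unfolding hcover_def by auto
  qed
  then have "hausdorff_pre k \<delta> A + hausdorff_pre k \<delta> B \<le> (\<Sum>i. hweight k (CA i)) + (\<Sum>i. hweight k (CB i))"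
    by (intro add_mono hausdorff_pre_le)
  also have "\<dots> = (\<Sum>i. hweight k (CA i) + hweight k (CB i))"
    by (intro suminf_add) auto
  also have "\<dots> \<le> (\<Sum>i. hweight k (C i))"
    using sep by (intro suminf_le) (auto simp: CA_def CB_def)
  finally show "hausdorff_pre k \<delta> A + hausdorff_pre k \<delta> B \<le> (\<Sum>i. hweight k (C i))" .
qed

text \<open>The pre-measure is antitone in \<delta>, so both suprema can be taken along a common
  \<delta>, and this \<delta> may be lowered below the gap \<open>d\<close>.\<close>

lemma hausdorff_outer_add_separated:
  fixes A B :: "'a::euclidean_space set"
  assumes d: "0 < d" and sep: "\<And>x y. x \<in> A \<Longrightarrow> y \<in> B \<Longrightarrow> dist x y \<ge> d"
  shows "hausdorff_outer k A + hausdorff_outer k B \<le> hausdorff_outer k (A \<union> B)"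
proof -
  have "hausdorff_outer k A + hausdorff_outer k B = (SUP \<delta>\<in>{0<..}. hausdorff_pre k \<delta> A + hausdorff_pre k \<delta> B)"
    unfolding hausdorff_outer_def
  proof (rule SUP_add_directed_ennreal[symmetric])
    fix i j :: real assume "i \<in> {0<..}" "j \<in> {0<..}"
    then show "\<exists>l\<in>{0<..}. hausdorff_pre k i A + hausdorff_pre k j B \<le> hausdorff_pre k l A + hausdorff_pre k l B"
      by (intro bexI[of _ "min i j"] add_mono hausdorff_pre_antimono) auto
  qed
  also have "\<dots> \<le> hausdorff_outer k (A \<union> B)"
  proof (rule SUP_least)
    fix \<delta> :: real assume "\<delta> \<in> {0<..}"
    define \<delta>' where "\<delta>' = min \<delta> (d/2)"
    have \<delta>': "0 < \<delta>'" "\<delta>' \<le> \<delta>" "\<delta>' < d" using \<open>\<delta> \<in> _\<close> d by (auto simp: \<delta>'_def)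
    have "hausdorff_pre k \<delta> A + hausdorff_pre k \<delta> B \<le> hausdorff_pre k \<delta>' A + hausdorff_pre k \<delta>' B"
      using \<delta>' by (intro add_mono hausdorff_pre_antimono)
    also have "\<dots> \<le> hausdorff_pre k \<delta>' (A \<union> B)"
      using \<delta>' sep by (intro hausdorff_pre_add_separated) (fastforce)
    also have "\<dots> \<le> hausdorff_outer k (A \<union> B)"
      unfolding hausdorff_outer_def using \<delta>' by (intro SUP_upper) auto
    finally show "hausdorff_pre k \<delta> A + hausdorff_pre k \<delta> B \<le> hausdorff_outer k (A \<union> B)" .
  qed
  finally show ?thesis .
qed

text \<open>Caratheodory's argument for metric outer measures. The part of \<open>A - F\<close>
  close to \<open>F\<close> is cut into shells \<open>R i\<close>; shells whose indices differ by
  two have a gap, so the even and the odd ones each have total measure at most that of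
  \<open>A\<close>. Hence the series over all shells converges and its tail, the part of
  \<open>A - F\<close> that is not separated from \<open>F\<close>, vanishes in the limit.\<close>

lemma closed_in_hausdorff_lambda_system:
  fixes F :: "'a::euclidean_space set"
  assumes F: "closed F"
  shows "F \<in> lambda_system UNIV UNIV (hausdorff_outer k)"
proof (cases "F = {}")
  case True then show ?thesis by (simp add: lambda_system_def)
next
  case ne: False
  let ?H = "hausdorff_outer k"
  have main: "?H (A \<inter> F) + ?H (A - F) \<le> ?H A" for A
  proof (cases "?H A = top")
    case True then show ?thesis by simp
  next
    case fin: False
    define D where "D n = {x\<in>A. infdist x F \<ge> 1 / real (Suc n)}" for n
    define R where "R n = {x\<in>A. 1 / real (Suc (Suc n)) \<le> infdist x F \<and> infdist x F < 1 / real (Suc n)}" for n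
    have pos: "x \<notin> F \<Longrightarrow> 0 < infdist x F" for x
      using infdist_pos_not_in_closed[OF F ne] by auto
    have RA: "R n \<subseteq> A" for n by (auto simp: R_def)
    \<comment> \<open>With \<open>p = 0\<close> and \<open>p = 1\<close> these are the even and the
      odd shells; the shell left out in between supplies the gap \<open>c\<close> for the
      induction.\<close>
    have par: "(\<Sum>i<n. ?H (R (2 * i + p))) \<le> ?H A" for n p
    proof -
      have "(\<Sum>i<n. ?H (R (2 * i + p))) \<le> ?H (\<Union>i<n. R (2 * i + p))"
      proof (induction n)
        case (Suc n)
        define c :: real where "c = 1 / real (2 * n + p) - 1 / real (Suc (2 * n + p))"
        have "?H (\<Union>i<n. R (2 * i + p)) + ?H (R (2 * n + p)) \<le> ?H ((\<Union>i<n. R (2 * i + p)) \<union> R (2 * n + p))"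
        \<comment> \<open>For \<open>n = 0\<close> the union is empty and \<open>c\<close> may
          involve a division by 0, so no gap is asked for.\<close>
        proof (cases "n = 0")
          case False
          then have "1 / real (Suc (2 * n + p)) < 1 / real (2 * n + p)" by (intro divide_strict_left_mono) auto
          then have c: "c > 0" by (simp add: c_def)
          show ?thesis
          proof (rule hausdorff_outer_add_separated[OF c])
            fix x y assume "x \<in> (\<Union>i<n. R (2 * i + p))" and y: "y \<in> R (2 * n + p)"
            then obtain i where i: "i < n" "x \<in> R (2 * i + p)" by auto
            then have "1 / real (2 * n + p) \<le> 1 / real (Suc (Suc (2 * i + p)))"
              by (intro divide_left_mono) (auto)
            also have "\<dots> \<le> infdist x F" using i by (auto simp: R_def)
            finally have "c \<le> infdist x F - infdist y F" using y by (auto simp: R_def c_def)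
            also have "\<dots> \<le> dist x y" using infdist_triangle[of x F y] by simp
            finally show "c \<le> dist x y" .
          qed
        qed simp
        then have "(\<Sum>i<n. ?H (R (2 * i + p))) + ?H (R (2 * n + p)) \<le> ?H ((\<Union>i<n. R (2 * i + p)) \<union> R (2 * n + p))"
          using Suc by (meson add_right_mono order_trans)
        also have "(\<Union>i<n. R (2 * i + p)) \<union> R (2 * n + p) = (\<Union>i<Suc n. R (2 * i + p))"
          by (auto simp: less_Suc_eq)
        finally show ?case by simp
      qed simp
      also have "\<dots> \<le> ?H A" using RA by (intro hausdorff_outer_mono) auto
      finally show ?thesis .
    qed
    have dbl: "(\<Sum>i<2 * n. ?H (R i)) = (\<Sum>i<n. ?H (R (2 * i + 0))) + (\<Sum>i<n. ?H (R (2 * i + 1)))" for n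
      by (induction n) (auto simp: algebra_simps)
    then have "(\<Sum>i<2 * n. ?H (R i)) \<le> ?H A + ?H A" for n
      by (subst dbl) (intro add_mono par)
    moreover have "(\<Sum>i<n. ?H (R i)) \<le> (\<Sum>i<2 * n. ?H (R i))" for n
      by (rule sum_mono2) auto
    ultimately have "(\<Sum>i<n. ?H (R i)) \<le> ?H A + ?H A" for n
      by (meson order_trans)
    then have "(\<Sum>i. ?H (R i)) \<le> ?H A + ?H A"
      by (intro suminf_le_const) auto
    then have sumfin: "(\<Sum>i. ?H (R i)) < top" using fin by (auto simp: less_top top_unique intro: le_less_trans)
    have bd: "?H (A \<inter> F) + ?H (A - F) \<le> ?H A + (\<Sum>i. ?H (R (i + N)))" for N
    proof -
      have "A - F \<subseteq> D N \<union> (\<Union>i. R (i + N))"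
      proof
        fix x assume x: "x \<in> A - F"
        show "x \<in> D N \<union> (\<Union>i. R (i + N))"
        proof (cases "x \<in> D N")
          case False
          obtain n where n: "1 / real (Suc n) \<le> infdist x F"
            using reals_Archimedean[OF pos[of x]] x by (auto simp: inverse_eq_divide intro: less_imp_le)
          define m where "m = (LEAST n. 1 / real (Suc n) \<le> infdist x F)"
          have m: "1 / real (Suc m) \<le> infdist x F" unfolding m_def by (rule LeastI[of _ n]) (rule n)
          have "\<not> m \<le> N"
          proof
            assume "m \<le> N"
            then have "1 / real (Suc N) \<le> 1 / real (Suc m)" by (intro divide_left_mono) auto
            with m False x show False by (auto simp: D_def)
          qed
          then obtain j where j: "m = Suc (j + N)" by (metis add.commute less_imp_Suc_add not_le add_Suc_right)
          have "\<not> 1 / real (Suc (j + N)) \<le> infdist x F"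
            using not_less_Least[of "j + N" "\<lambda>n. 1 / real (Suc n) \<le> infdist x F"] j by (simp add: m_def)
          then have "x \<in> R (j + N)" using m x unfolding R_def j by auto
          then show ?thesis by auto
        qed simp
      qed
      then have "?H (A - F) \<le> ?H (D N) + ?H (\<Union>i. R (i + N))"
        by (intro order_trans[OF hausdorff_outer_mono hausdorff_outer_Un])
      also have "\<dots> \<le> ?H (D N) + (\<Sum>i. ?H (R (i + N)))"
        by (intro add_left_mono hausdorff_outer_subadd)
      finally have "?H (A \<inter> F) + ?H (A - F) \<le> (?H (A \<inter> F) + ?H (D N)) + (\<Sum>i. ?H (R (i + N)))"
        by (simp add: add.assoc add_left_mono)
      also have "?H (A \<inter> F) + ?H (D N) \<le> ?H ((A \<inter> F) \<union> D N)"
      proof (rule hausdorff_outer_add_separated[of "1 / real (Suc N)"])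
        fix x y assume "x \<in> A \<inter> F" "y \<in> D N"
        then show "1 / real (Suc N) \<le> dist x y"
          using infdist_le[of x F y] by (auto simp: D_def dist_commute)
      qed simp
      also have "\<dots> \<le> ?H A" by (intro hausdorff_outer_mono) (auto simp: D_def)
      finally show ?thesis by (simp add: add_right_mono)
    qed
    have "(\<lambda>N. \<Sum>i. ?H (R (i + N))) \<longlonglongrightarrow> 0"
      using sumfin
    proof -
      have R: "?H (R i) = ennreal (enn2real (?H (R i)))" for i
        using ennreal_suminf_lessD[OF sumfin, of i] by (simp add: less_top)
      have "(\<Sum>i. ennreal (enn2real (?H (R i)))) \<noteq> top"
        unfolding R[symmetric] using sumfin by simp
      then have sm: "summable (\<lambda>i. enn2real (?H (R i)))"
        by (intro summable_suminf_not_top) auto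
      then have "(\<lambda>N. ennreal (\<Sum>i. enn2real (?H (R (i + N))))) \<longlonglongrightarrow> ennreal 0"
        by (intro tendsto_ennrealI suminf_exist_split2)
      moreover have "ennreal (\<Sum>i. enn2real (?H (R (i + N)))) = (\<Sum>i. ?H (R (i + N)))" for N
      proof -
        have "(\<Sum>i. ennreal (enn2real (?H (R (i + N))))) = ennreal (\<Sum>i. enn2real (?H (R (i + N))))"
          using sm by (intro suminf_ennreal2 summable_ignore_initial_segment) auto
        then show ?thesis unfolding R[symmetric] by simp
      qed
      ultimately show ?thesis by simp
    qed
    then have "(\<lambda>N. ?H A + (\<Sum>i. ?H (R (i + N)))) \<longlonglongrightarrow> ?H A + 0"
      by (intro tendsto_add tendsto_const)
    then show ?thesis
      using bd by (intro LIMSEQ_le_const) auto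
  qed
  have "?H (F \<inter> A) + ?H ((UNIV - F) \<inter> A) = ?H A" for A
  proof (rule antisym)
    show "?H (F \<inter> A) + ?H ((UNIV - F) \<inter> A) \<le> ?H A"
      using main[of A] by (simp add: Int_commute Diff_eq)
    have "?H A \<le> ?H ((F \<inter> A) \<union> ((UNIV - F) \<inter> A))" by (intro hausdorff_outer_mono) auto
    also have "\<dots> \<le> ?H (F \<inter> A) + ?H ((UNIV - F) \<inter> A)" by (rule hausdorff_outer_Un)
    finally show "?H A \<le> ?H (F \<inter> A) + ?H ((UNIV - F) \<inter> A)" .
  qed
  then show ?thesis by (simp add: lambda_system_def)
qed

lemma hausdorff_measure_space:
  "measure_space UNIV (lambda_system UNIV UNIV (hausdorff_outer k)) (hausdorff_outer k :: 'a::euclidean_space set \<Rightarrow> _)"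
proof -
  interpret sigma_algebra "UNIV :: 'a set" "Pow UNIV" by (rule sigma_algebra_Pow)
  show ?thesis using caratheodory_lemma[OF hausdorff_outer_space[of k, where 'a='a]] by simp
qed

lemma sets_hausdorff:
  "sets (hausdorff_measure k :: 'a::euclidean_space measure) = lambda_system UNIV UNIV (hausdorff_outer k)"
  unfolding hausdorff_measure_def
  using hausdorff_measure_space[of k, where 'a='a]
  by (intro sigma_algebra.sets_measure_of_eq) (simp add: measure_space_def)

lemma space_hausdorff [simp]: "space (hausdorff_measure k) = UNIV"
  unfolding hausdorff_measure_def by (simp add: space_measure_of_conv)

lemma emeasure_hausdorff:
  fixes A :: "'a::euclidean_space set"
  shows "A \<in> sets (hausdorff_measure k) \<Longrightarrow> emeasure (hausdorff_measure k) A = hausdorff_outer k A"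
  using hausdorff_measure_space[of k, where 'a='a] unfolding sets_hausdorff
  unfolding hausdorff_measure_def measure_space_def
  by (intro emeasure_measure_of_sigma) auto

lemma borel_sets_hausdorff: "sets borel \<subseteq> sets (hausdorff_measure k :: 'a::euclidean_space measure)"
proof -
  interpret sigma_algebra UNIV "sets (hausdorff_measure k :: 'a measure)"
    using sets.sigma_algebra_axioms[of "hausdorff_measure k :: 'a measure"] by simp
  have "sets (borel :: 'a measure) = sigma_sets UNIV {S. closed S}"
    unfolding borel_eq_closed by simp
  also have "\<dots> \<subseteq> sets (hausdorff_measure k)"
    by (intro sigma_sets_subset) (auto simp: sets_hausdorff closed_in_hausdorff_lambda_system)
  finally show ?thesis .
qed

lemma hausdorff_null_sets:
  assumes "hausdorff_outer k A = 0"
  shows "A \<in> null_sets (hausdorff_measure k)"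
proof -
  have "hausdorff_outer k (A \<inter> X) + hausdorff_outer k ((UNIV - A) \<inter> X) = hausdorff_outer k X" for X
  proof (rule antisym)
    have "hausdorff_outer k (A \<inter> X) = 0"
      using hausdorff_outer_mono[of "A \<inter> X" A k] assms by simp
    then show "hausdorff_outer k (A \<inter> X) + hausdorff_outer k ((UNIV - A) \<inter> X) \<le> hausdorff_outer k X"
      by (simp add: hausdorff_outer_mono)
    have "hausdorff_outer k X \<le> hausdorff_outer k ((A \<inter> X) \<union> ((UNIV - A) \<inter> X))"
      by (intro hausdorff_outer_mono) auto
    also have "\<dots> \<le> hausdorff_outer k (A \<inter> X) + hausdorff_outer k ((UNIV - A) \<inter> X)" by (rule hausdorff_outer_Un)
    finally show "hausdorff_outer k X \<le> hausdorff_outer k (A \<inter> X) + hausdorff_outer k ((UNIV - A) \<inter> X)" .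
  qed
  then have "A \<in> sets (hausdorff_measure k)" by (simp add: sets_hausdorff lambda_system_def)
  then show ?thesis using assms by (auto simp: null_sets_def emeasure_hausdorff)
qed

text \<open>Completeness is what makes integrals over \<open>jump_set\<close> accessible later:
  measurability there is only obtained by agreement almost everywhere with a Borel function.\<close>

lemma complete_hausdorff: "complete_measure (hausdorff_measure k :: 'a::euclidean_space measure)"
proof
  fix A B :: "'a set" assume "A \<subseteq> B" "B \<in> null_sets (hausdorff_measure k)"
  then have "hausdorff_outer k A = 0"
    using hausdorff_outer_mono[of A B k] by (auto simp: null_sets_def emeasure_hausdorff)
  then show "A \<in> sets (hausdorff_measure k)" using hausdorff_null_sets by auto
qed

lemma borel_measurable_hausdorff: "f \<in> borel_measurable borel \<Longrightarrow> f \<in> borel_measurable (hausdorff_measure k)"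
  using borel_sets_hausdorff[of k] by (auto simp: measurable_def)

section \<open>Length on lines and counting of points\<close>

lemma hweight_1: "bounded S \<Longrightarrow> hweight (Suc 0) S = ennreal (diameter S)"
  by (simp add: hweight_def diameter_ge_0)

lemma hausdorff_outer_ge_pre: "\<delta> > 0 \<Longrightarrow> hausdorff_pre k \<delta> A \<le> hausdorff_outer k A"
  unfolding hausdorff_outer_def by (intro SUP_upper) auto

text \<open>For \<open>k = 1\<close> the normalising factor \<open>unit_ball_vol 1 / 2\<close>
  equals 1, so weights are diameters. From above, \<open>n\<close> pieces of equal length at most
  \<delta> suffice. From below, a cover is pulled back to the parameter line, where each piece lies
  in an interval no longer than its diameter, and Lebesgue measure is countably subadditive.\<close>

lemma hausdorff_1_line_segment:
  fixes \<iota> :: "real \<Rightarrow> 'a::euclidean_space"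
  assumes iso: "\<And>s t. dist (\<iota> s) (\<iota> t) = \<bar>s - t\<bar>" and lu: "l \<le> u"
  shows "hausdorff_outer (Suc 0) (\<iota> ` {l<..<u}) = ennreal (u - l)"
proof (rule antisym)
  show "hausdorff_outer (Suc 0) (\<iota> ` {l<..<u}) \<le> ennreal (u - l)"
    unfolding hausdorff_outer_def
  proof (rule SUP_least)
    fix \<delta> :: real assume "\<delta> \<in> {0<..}"
    then have \<delta>: "\<delta> > 0" by simp
    obtain n where n: "(u - l) / \<delta> < real n" using reals_Archimedean2 by blast
    have n0: "n > 0" using n lu \<delta> by (cases n) (auto simp: divide_less_0_iff zero_le_divide_iff not_less)
    define w where "w = (u - l) / real n"
    have w: "0 \<le> w" "w \<le> \<delta>" "real n * w = u - l" using n lu \<delta> n0 by (auto simp: w_def field_simps)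
    define C where "C i = (if i < n then \<iota> ` {l + real i * w .. l + real (Suc i) * w} else {})" for i
    have dC: "diameter (C i) \<le> w" and bC: "bounded (C i)" for i
    proof -
      have *: "\<forall>x\<in>C i. \<forall>y\<in>C i. dist x y \<le> w"
      proof (intro ballI)
        fix x y assume "x \<in> C i" "y \<in> C i"
        then obtain s t where st: "x = \<iota> s" "y = \<iota> t" "s \<in> {l + real i * w .. l + real (Suc i) * w}"
            "t \<in> {l + real i * w .. l + real (Suc i) * w}"
          by (auto simp: C_def split: if_splits)
        have "real (Suc i) * w = real i * w + w" by (simp add: algebra_simps)
        then have "\<bar>s - t\<bar> \<le> w" using st(3,4) by auto
        then show "dist x y \<le> w" unfolding st iso .
      qed
      then show "diameter (C i) \<le> w" using w by (intro diameter_le) (auto simp: dist_norm)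
      show "bounded (C i)" using * unfolding bounded_two_points by blast
    qed
    have "hcover \<delta> (\<iota> ` {l<..<u}) C"
      unfolding hcover_def
    proof (intro conjI allI)
      show "\<iota> ` {l<..<u} \<subseteq> (\<Union>i. C i)"
      proof safe
        fix t assume t: "t \<in> {l<..<u}"
        then have wp: "w > 0" using w n0 by (auto simp: w_def)
        define i where "i = nat \<lfloor>(t - l) / w\<rfloor>"
        have "real i \<le> (t - l) / w" "(t - l) / w < real i + 1"
          using t wp by (auto simp: i_def divide_nonneg_pos)
        then have i: "l + real i * w \<le> t" "t \<le> l + real (Suc i) * w"
          using wp by (auto simp: field_simps)
        have "real i < real n"
        proof (rule ccontr)
          assume "\<not> ?thesis"
          then have "real n * w \<le> real i * w" using wp by (intro mult_right_mono) auto
          then show False using i t w by auto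
        qed
        then have "\<iota> t \<in> C i" using i by (auto simp: C_def)
        then show "\<iota> t \<in> (\<Union>i. C i)" by blast
      qed
      fix i show "bounded (C i)" "diameter (C i) \<le> \<delta>" using bC[of i] dC[of i] w(2) by auto
    qed
    then have "hausdorff_pre (Suc 0) \<delta> (\<iota> ` {l<..<u}) \<le> (\<Sum>i. hweight (Suc 0) (C i))"
      by (rule hausdorff_pre_le)
    also have "\<dots> = (\<Sum>i\<in>{..<n}. hweight (Suc 0) (C i))"
      by (rule suminf_finite) (auto simp: C_def)
    also have "\<dots> \<le> (\<Sum>i\<in>{..<n}. ennreal w)"
      by (intro sum_mono) (simp add: hweight_1 bC dC ennreal_leI)
    also have "\<dots> = ennreal (u - l)"
      using w by (simp add: ennreal_of_nat_eq_real_of_nat ennreal_mult[symmetric])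
    finally show "hausdorff_pre (Suc 0) \<delta> (\<iota> ` {l<..<u}) \<le> ennreal (u - l)" .
  qed
  \<comment> \<open>The single scale 1 is enough for the lower bound, since
    \<open>hausdorff_outer\<close> is the supremum over all scales.\<close>
  have "ennreal (u - l) \<le> hausdorff_pre (Suc 0) 1 (\<iota> ` {l<..<u})"
    unfolding hausdorff_pre_alt
  proof (rule INF_greatest)
    fix C assume "C \<in> Collect (hcover 1 (\<iota> ` {l<..<u}))"
    then have C: "\<iota> ` {l<..<u} \<subseteq> (\<Union>i. C i)" "\<And>i. bounded (C i)" by (auto simp: hcover_def)
    define T where "T i = \<iota> -` C i" for i
    define J where "J i = (if T i = {} then {} else {Inf (T i) .. Sup (T i)})" for i
    have T: "\<bar>s - t\<bar> \<le> diameter (C i)" if "s \<in> T i" "t \<in> T i" for s t i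
      using diameter_bounded_bound[OF C(2)[of i], of "\<iota> s" "\<iota> t"] that by (auto simp: T_def iso)
    have bT: "bdd_above (T i)" "bdd_below (T i)" for i
    proof -
      have "\<exists>e. \<forall>s\<in>T i. \<forall>t\<in>T i. dist s t \<le> e" using T by (auto simp: dist_real_def)
      then have "bounded (T i)" by (simp add: bounded_two_points)
      then show "bdd_above (T i)" "bdd_below (T i)" by (auto intro: bounded_imp_bdd_above bounded_imp_bdd_below)
    qed
    have J: "emeasure lborel (J i) \<le> hweight (Suc 0) (C i)" for i
    proof (cases "T i = {}")
      case False
      have "Sup (T i) - diameter (C i) \<le> Inf (T i)"
      proof (rule cInf_greatest[OF False])
        fix t assume t: "t \<in> T i"
        have "Sup (T i) \<le> t + diameter (C i)"
        proof (rule cSup_least[OF False])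
          fix s assume "s \<in> T i" then show "s \<le> t + diameter (C i)" using T[OF _ t, of s] by linarith
        qed
        then show "Sup (T i) - diameter (C i) \<le> t" by simp
      qed
      then show ?thesis using False C(2)
        by (auto simp: J_def hweight_1 emeasure_lborel_Icc_eq intro!: ennreal_leI diameter_ge_0)
    qed (simp add: J_def)
    have "ennreal (u - l) = emeasure lborel {l<..<u}" using lu by simp
    also have "\<dots> \<le> emeasure lborel (\<Union>i. J i)"
    proof (rule emeasure_mono)
      show "{l<..<u} \<subseteq> (\<Union>i. J i)"
      proof
        fix t assume "t \<in> {l<..<u}"
        then have "\<iota> t \<in> (\<Union>i. C i)" using C(1) by blast
        then obtain i where "t \<in> T i" by (auto simp: T_def)
        then have "t \<in> J i" using bT[of i] by (auto simp: J_def intro: cInf_lower cSup_upper)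
        then show "t \<in> (\<Union>i. J i)" by auto
      qed
    qed (auto simp: J_def)
    also have "\<dots> \<le> (\<Sum>i. emeasure lborel (J i))"
      by (rule emeasure_subadditive_countably) (auto simp: J_def)
    also have "\<dots> \<le> (\<Sum>i. hweight (Suc 0) (C i))"
      by (intro suminf_le J) auto
    finally show "ennreal (u - l) \<le> (\<Sum>i. hweight (Suc 0) (C i))" .
  qed
  also have "\<dots> \<le> hausdorff_outer (Suc 0) (\<iota> ` {l<..<u})"
    by (intro hausdorff_outer_ge_pre) simp
  finally show "ennreal (u - l) \<le> hausdorff_outer (Suc 0) (\<iota> ` {l<..<u})" .
qed

text \<open>The density restricts the Hausdorff measure to the line, and the left inverse \<pi>
  carries it to the reals. Both sides then give every open interval its length, which determines
  \<open>lborel\<close>.\<close>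

lemma hausdorff_1_line:
  fixes \<iota> :: "real \<Rightarrow> 'a::euclidean_space" and \<pi> :: "'a \<Rightarrow> real"
  assumes iso: "\<And>s t. dist (\<iota> s) (\<iota> t) = \<bar>s - t\<bar>" and cl: "closed (range \<iota>)"
    and inv: "\<And>t. \<pi> (\<iota> t) = t" and meas: "\<pi> \<in> borel_measurable borel"
  shows "distr (density (hausdorff_measure (Suc 0)) (indicator (range \<iota>))) borel \<pi> = lborel"
proof (rule lborel_eqI[symmetric])
  let ?H = "hausdorff_measure (Suc 0) :: 'a measure"
  have rng: "range \<iota> \<in> sets borel" using cl by auto
  have [measurable]: "\<pi> \<in> borel_measurable ?H" "range \<iota> \<in> sets ?H"
    using borel_measurable_hausdorff[OF meas] borel_sets_hausdorff rng by blast+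
  fix l u :: real assume "\<And>b. b \<in> Basis \<Longrightarrow> l \<bullet> b \<le> u \<bullet> b"
  then have lu: "l \<le> u" by simp
  have "emeasure (distr (density ?H (indicator (range \<iota>))) borel \<pi>) (box l u)
      = emeasure (density ?H (indicator (range \<iota>))) (\<pi> -` {l<..<u})"
    by (subst emeasure_distr) (auto simp: box_real)
  also have "\<dots> = emeasure ?H (range \<iota> \<inter> \<pi> -` {l<..<u})"
  proof -
    have [measurable]: "\<pi> -` {l<..<u} \<in> sets ?H"
      using measurable_sets[of \<pi> ?H borel "{l<..<u}"] by simp
    have "emeasure (density ?H (indicator (range \<iota>))) (\<pi> -` {l<..<u})
        = (\<integral>\<^sup>+x. indicator (range \<iota>) x * indicator (\<pi> -` {l<..<u}) x \<partial>?H)"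
      by (rule emeasure_density) measurable
    also have "\<dots> = (\<integral>\<^sup>+x. indicator (range \<iota> \<inter> \<pi> -` {l<..<u}) x \<partial>?H)"
      by (intro nn_integral_cong) (simp add: indicator_inter_arith)
    finally show ?thesis by (simp del: vimage_Int)
  qed
  also have "range \<iota> \<inter> \<pi> -` {l<..<u} = \<iota> ` {l<..<u}" using inv by auto
  also have "emeasure ?H (\<iota> ` {l<..<u}) = hausdorff_outer (Suc 0) (\<iota> ` {l<..<u})"
  proof (rule emeasure_hausdorff)
    have "\<iota> ` {l<..<u} = range \<iota> \<inter> (\<pi> -` {l<..<u} \<inter> space ?H)" using inv by auto
    also have "\<dots> \<in> sets ?H" by measurable
    finally show "\<iota> ` {l<..<u} \<in> sets ?H" .
  qed
  also have "\<dots> = ennreal (u - l)" by (rule hausdorff_1_line_segment[OF iso lu])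
  finally show "emeasure (distr (density ?H (indicator (range \<iota>))) borel \<pi>) (box l u)
      = ennreal (\<Prod>b\<in>Basis. (u - l) \<bullet> b)" by simp
qed simp

text \<open>The integrand may be composed with the projection \<open>\<iota> \<circ> \<pi>\<close>,
  which changes nothing on the line; the rest is the push-forward formula.\<close>

lemma
  fixes \<iota> :: "real \<Rightarrow> 'a::euclidean_space" and \<pi> :: "'a \<Rightarrow> real"
  assumes iso: "\<And>s t. dist (\<iota> s) (\<iota> t) = \<bar>s - t\<bar>" and cl: "closed (range \<iota>)"
    and inv: "\<And>t. \<pi> (\<iota> t) = t" and meas: "\<pi> \<in> borel_measurable borel" and \<iota>: "\<iota> \<in> borel_measurable borel"
  shows nn_integral_hausdorff_line:
     "f \<in> borel_measurable borel \<Longrightarrow>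
      (\<integral>\<^sup>+x. indicator (range \<iota>) x * f x \<partial>hausdorff_measure (Suc 0)) = (\<integral>\<^sup>+t. f (\<iota> t) \<partial>lborel)"
   and integral_hausdorff_line:
     "g \<in> borel_measurable borel \<Longrightarrow>
      (LINT x|hausdorff_measure (Suc 0). indicator (range \<iota>) x * g x) = (LINT t|lborel. (g (\<iota> t) :: real))"
proof -
  let ?H = "hausdorff_measure (Suc 0) :: 'a measure"
  have rng: "range \<iota> \<in> sets borel" using cl by auto
  have [measurable]: "\<pi> \<in> borel_measurable ?H" "range \<iota> \<in> sets ?H"
    using borel_measurable_hausdorff[OF meas] borel_sets_hausdorff rng by blast+
  note L = hausdorff_1_line[OF iso cl inv meas]
  have eq: "indicator (range \<iota>) x * f (\<iota> (\<pi> x)) = indicator (range \<iota>) x * f x" for x and f :: "'a \<Rightarrow> 'c::semiring_1"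
    using inv by (auto simp: indicator_def)
  show "(\<integral>\<^sup>+x. indicator (range \<iota>) x * f x \<partial>?H) = (\<integral>\<^sup>+t. f (\<iota> t) \<partial>lborel)"
    if f: "f \<in> borel_measurable borel"
  proof -
    have fi: "(\<lambda>t. f (\<iota> t)) \<in> borel_measurable borel" using \<iota> f by (rule measurable_compose)
    have fp: "(\<lambda>x. f (\<iota> (\<pi> x))) \<in> borel_measurable ?H"
      by (rule measurable_compose[OF _ fi]) measurable
    have "(\<integral>\<^sup>+t. f (\<iota> t) \<partial>lborel) = (\<integral>\<^sup>+t. f (\<iota> t) \<partial>distr (density ?H (indicator (range \<iota>))) borel \<pi>)"
      unfolding L ..
    also have "\<dots> = (\<integral>\<^sup>+x. f (\<iota> (\<pi> x)) \<partial>density ?H (indicator (range \<iota>)))"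
      by (rule nn_integral_distr) (use fi in auto)
    also have "\<dots> = (\<integral>\<^sup>+x. indicator (range \<iota>) x * f (\<iota> (\<pi> x)) \<partial>?H)"
      by (rule nn_integral_density) (use fp in auto)
    finally show ?thesis unfolding eq ..
  qed
  show "(LINT x|hausdorff_measure (Suc 0). indicator (range \<iota>) x * g x) = (LINT t|lborel. g (\<iota> t))"
    if g: "g \<in> borel_measurable borel"
  proof -
    have fi: "(\<lambda>t. g (\<iota> t)) \<in> borel_measurable borel" using \<iota> g by (rule measurable_compose)
    have fp: "(\<lambda>x. g (\<iota> (\<pi> x))) \<in> borel_measurable ?H"
      by (rule measurable_compose[OF _ fi]) measurable
    have d: "density ?H (indicator (range \<iota>)) = density ?H (\<lambda>x. ennreal (indicat_real (range \<iota>) x))"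
      by (simp add: ennreal_indicator)
    have "(LINT t|lborel. g (\<iota> t)) = (LINT t|distr (density ?H (indicator (range \<iota>))) borel \<pi>. g (\<iota> t))"
      unfolding L ..
    also have "\<dots> = (LINT x|density ?H (indicator (range \<iota>)). g (\<iota> (\<pi> x)))"
      by (rule integral_distr) (use fi in auto)
    also have "\<dots> = (LINT x|?H. indicator (range \<iota>) x *\<^sub>R g (\<iota> (\<pi> x)))"
      unfolding d by (rule integral_density) (use fp in auto)
    finally show ?thesis by (simp add: eq)
  qed
qed

lemma hausdorff_singleton_null: "{x} \<in> null_sets (hausdorff_measure (Suc 0))"
proof (rule hausdorff_null_sets)
  have "hausdorff_pre (Suc 0) \<delta> {x} = 0" if "\<delta> > 0" for \<delta>
  proof -
    have "hausdorff_pre (Suc 0) \<delta> {x} \<le> (\<Sum>i::nat. hweight (Suc 0) {x})"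
      using that by (intro hausdorff_pre_le) (auto simp: hcover_def)
    then show ?thesis by (simp add: hweight_1)
  qed
  then have "(SUP \<delta>\<in>{0<..}. hausdorff_pre (Suc 0) \<delta> {x}) = (SUP \<delta>\<in>{0::real<..}. 0)"
    by (intro SUP_cong) auto
  then show "hausdorff_outer (Suc 0) {x} = 0" unfolding hausdorff_outer_def by simp
qed

lemma hausdorff_1_countable_null:
  assumes "countable A" shows "A \<in> null_sets (hausdorff_measure (Suc 0))"
proof -
  have "(\<Union>x\<in>A. {x}) \<in> null_sets (hausdorff_measure (Suc 0))"
    using assms by (intro null_sets_UN') (auto simp: hausdorff_singleton_null)
  then show ?thesis by simp
qed

text \<open>For \<open>k = 0\<close> every non-empty covering set has weight 1, also a single point,
  because \<open>0 ^ 0 = 1\<close>. So points count once, which is what a sum over jumps on the real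
  line needs.\<close>

lemma emeasure_hausdorff_0_singleton: "emeasure (hausdorff_measure 0) {x} = 1"
proof -
  have "{x} \<in> sets (hausdorff_measure 0)"
    using borel_sets_hausdorff[of 0] by (rule subsetD) simp
  then have "emeasure (hausdorff_measure 0) {x} = hausdorff_outer 0 {x}" by (rule emeasure_hausdorff)
  also have "\<dots> = 1"
  proof (rule antisym)
    show "hausdorff_outer 0 {x} \<le> 1"
      unfolding hausdorff_outer_def
    proof (rule SUP_least)
      fix \<delta> :: real assume "\<delta> \<in> {0<..}"
      then have "hausdorff_pre 0 \<delta> {x} \<le> (\<Sum>i::nat. hweight 0 (if i = 0 then {x} else {}))"
        by (intro hausdorff_pre_le) (auto simp: hcover_def)
      also have "\<dots> = (\<Sum>i\<in>{0::nat}. hweight 0 (if i = 0 then {x} else {}))"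
        by (rule suminf_finite) auto
      finally show "hausdorff_pre 0 \<delta> {x} \<le> 1" by (simp add: hweight_def)
    qed
    have "1 \<le> hausdorff_pre 0 1 {x}"
      unfolding hausdorff_pre_alt
    proof (rule INF_greatest)
      fix C assume "C \<in> Collect (hcover 1 {x})"
      then obtain i where "x \<in> C i" by (auto simp: hcover_def)
      then have "1 \<le> (\<Sum>j\<in>{i}. hweight 0 (C j))" by (auto simp: hweight_def)
      also have "\<dots> \<le> (\<Sum>i. hweight 0 (C i))" by (rule sum_le_suminf) auto
      finally show "1 \<le> (\<Sum>i. hweight 0 (C i))" .
    qed
    also have "\<dots> \<le> hausdorff_outer 0 {x}" by (rule hausdorff_outer_ge_pre) simp
    finally show "1 \<le> hausdorff_outer 0 {x}" .
  qed
  finally show ?thesis .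
qed

section \<open>Approximate jumps\<close>

lemma ennreal_divide_mult_cancel: "0 < p \<Longrightarrow> p < top \<Longrightarrow> X / p * p = (X :: ennreal)"
  by (simp add: ennreal_divide_times ennreal_divide_self)

text \<open>The mean distance of \<open>u\<close> to the set \<open>{a, b}\<close> vanishes at
  \<open>x\<close>. No normal enters, which allows two jump triples with different normals to be
  compared.\<close>

definition near_values :: "('a::euclidean_space \<Rightarrow> real) \<Rightarrow> 'a \<Rightarrow> real \<Rightarrow> real \<Rightarrow> bool" where
  "near_values u x a b \<longleftrightarrow>
     ((\<lambda>r. (\<integral>\<^sup>+ y \<in> ball x r. ennreal (min \<bar>u y - a\<bar> \<bar>u y - b\<bar>) \<partial>lebesgue) / emeasure lebesgue (ball x r)) \<longlongrightarrow> 0) (at_right 0)"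

lemma half_ball_minus_uminus: "half_ball_minus x \<nu> r = half_ball_plus x (- \<nu>) r"
  by (auto simp: half_ball_minus_def half_ball_plus_def)

lemma half_ball_borel [measurable, simp]:
  "half_ball_plus x \<nu> r \<in> sets borel" "half_ball_minus x \<nu> r \<in> sets borel"
proof -
  have "open {y. (y - x) \<bullet> \<nu> > 0}" for x \<nu> :: 'a by (intro open_Collect_less continuous_intros)
  then show *: "half_ball_plus x \<nu> r \<in> sets borel" for \<nu> :: 'a
    by (auto simp: half_ball_plus_def Collect_conj_eq)
  show "half_ball_minus x \<nu> r \<in> sets borel"
    unfolding half_ball_minus_uminus by (rule *)
qed

text \<open>The ball of radius \<open>r / 2\<close> centred at
  \<open>x + (r / 2) *\<^sub>R \<nu>\<close> fits into the half-ball. Any fixed fraction of the ball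
  serves for comparing averages, so the exact half is not computed.\<close>

lemma half_ball_plus_emeasure:
  fixes x \<nu> :: "'a::euclidean_space"
  assumes r: "r > 0" and \<nu>: "norm \<nu> = 1"
  shows "emeasure lebesgue (half_ball_plus x \<nu> r) \<ge> ennreal ((1/2) ^ DIM('a)) * emeasure lebesgue (ball x r)"
proof -
  have "ball (x + (r/2) *\<^sub>R \<nu>) (r/2) \<subseteq> half_ball_plus x \<nu> r"
  proof
    fix y assume y: "y \<in> ball (x + (r/2) *\<^sub>R \<nu>) (r/2)"
    define w where "w = y - (x + (r/2) *\<^sub>R \<nu>)"
    have w: "norm w < r / 2" using y by (auto simp: w_def dist_norm norm_minus_commute)
    have yx: "y - x = w + (r/2) *\<^sub>R \<nu>" by (simp add: w_def)
    have "norm (y - x) \<le> norm w + norm ((r/2) *\<^sub>R \<nu>)" unfolding yx by (rule norm_triangle_ineq)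
    then have "norm (y - x) < r" using w \<nu> r by simp
    moreover have "(y - x) \<bullet> \<nu> = w \<bullet> \<nu> + r/2" unfolding yx using \<nu> by (simp add: inner_add_left dot_square_norm)
    moreover have "\<bar>w \<bullet> \<nu>\<bar> \<le> norm w" using Cauchy_Schwarz_ineq2[of w \<nu>] \<nu> by simp
    ultimately show "y \<in> half_ball_plus x \<nu> r" using w by (auto simp: half_ball_plus_def dist_norm norm_minus_commute)
  qed
  then have "emeasure lebesgue (ball (x + (r/2) *\<^sub>R \<nu>) (r/2)) \<le> emeasure lebesgue (half_ball_plus x \<nu> r)"
    by (intro emeasure_mono) auto
  also have "emeasure lebesgue (ball (x + (r/2) *\<^sub>R \<nu>) (r/2)) = ennreal ((1/2) ^ DIM('a)) * emeasure lebesgue (ball x r)"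
    using r by (simp add: emeasure_ball ennreal_mult[symmetric] power_divide field_simps)
  finally show ?thesis .
qed

text \<open>On the half-ball, \<open>\<bar>u y - a\<bar>\<close> plus the distance of
  \<open>u y\<close> to \<open>{c1, c2}\<close> is at least the distance of \<open>a\<close> to that
  set. Both averages vanish in the limit, so this distance is 0.\<close>

lemma near_values_average:
  fixes x \<nu> :: "'a::euclidean_space"
  assumes u [measurable]: "u \<in> borel_measurable borel"
    and nv: "near_values u x c1 c2" and \<nu>: "norm \<nu> = 1"
    and lim: "((\<lambda>r. (\<integral>\<^sup>+ y \<in> half_ball_plus x \<nu> r. ennreal \<bar>u y - a\<bar> \<partial>lebesgue)
            / emeasure lebesgue (half_ball_plus x \<nu> r)) \<longlongrightarrow> 0) (at_right 0)"
  shows "a = c1 \<or> a = c2"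
proof (rule ccontr)
  assume "\<not> ?thesis"
  define \<delta> where "\<delta> = min \<bar>a - c1\<bar> \<bar>a - c2\<bar>"
  have \<delta>: "\<delta> > 0" using \<open>\<not> (a = c1 \<or> a = c2)\<close> by (auto simp: \<delta>_def)
  define m where "m y = min \<bar>u y - c1\<bar> \<bar>u y - c2\<bar>" for y
  have m [measurable]: "m \<in> borel_measurable borel" unfolding m_def by measurable
  have m0: "m y \<ge> 0" for y by (auto simp: m_def)
  let ?B = "\<lambda>r. ball x r" and ?P = "\<lambda>r. half_ball_plus x \<nu> r"
  define A where "A r = (\<integral>\<^sup>+ y \<in> ?P r. ennreal \<bar>u y - a\<bar> \<partial>lebesgue) / emeasure lebesgue (?P r)" for r
  define Bm where "Bm r = (\<integral>\<^sup>+ y \<in> ?B r. ennreal (m y) \<partial>lebesgue) / emeasure lebesgue (?B r)" for r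
  define K where "K = ennreal (2 ^ DIM('a))"
  have le: "ennreal \<delta> \<le> A r + K * Bm r" if r: "r > 0" for r
  proof -
    define p where "p = emeasure lebesgue (?P r)"
    define b where "b = emeasure lebesgue (?B r)"
    have b: "0 < b" "b < top" using r by (auto simp: b_def emeasure_ball)
    have pb: "ennreal ((1/2) ^ DIM('a)) * b \<le> p" unfolding p_def b_def by (rule half_ball_plus_emeasure[OF r \<nu>])
    then have p0: "0 < p" using b by (auto simp: zero_less_iff_neq_zero)
    have pb2: "p \<le> b" unfolding p_def b_def by (intro emeasure_mono) (auto simp: half_ball_plus_def)
    then have p1: "p < top" using b by auto
    have bp: "b \<le> K * p"
    proof -
      have "K * (ennreal ((1/2) ^ DIM('a)) * b) \<le> K * p" using pb by (rule mult_left_mono) simp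
      also have "K * (ennreal ((1/2) ^ DIM('a)) * b) = b"
        by (simp add: K_def mult.assoc[symmetric] ennreal_mult[symmetric] power_mult_distrib[symmetric])
      finally show ?thesis .
    qed
    have "ennreal \<delta> * p = (\<integral>\<^sup>+ y. ennreal \<delta> * indicator (?P r) y \<partial>lborel)"
      by (simp add: p_def nn_integral_cmult_indicator)
    also have "\<dots> \<le> (\<integral>\<^sup>+ y. ennreal \<bar>u y - a\<bar> * indicator (?P r) y + ennreal (m y) * indicator (?P r) y \<partial>lborel)"
    proof (rule nn_integral_mono)
      fix y
      have "\<delta> \<le> \<bar>u y - a\<bar> + m y" by (auto simp: \<delta>_def m_def)
      then have "ennreal \<delta> \<le> ennreal \<bar>u y - a\<bar> + ennreal (m y)"
        using m0[of y] by (subst ennreal_plus[symmetric]) (auto intro!: ennreal_leI simp del: ennreal_plus)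
      then show "ennreal \<delta> * indicator (?P r) y \<le> ennreal \<bar>u y - a\<bar> * indicator (?P r) y + ennreal (m y) * indicator (?P r) y"
        by (auto split: split_indicator)
    qed
    also have "\<dots> = (\<integral>\<^sup>+ y. ennreal \<bar>u y - a\<bar> * indicator (?P r) y \<partial>lborel) + (\<integral>\<^sup>+ y. ennreal (m y) * indicator (?P r) y \<partial>lborel)"
      by (rule nn_integral_add) auto
    also have "(\<integral>\<^sup>+ y. ennreal \<bar>u y - a\<bar> * indicator (?P r) y \<partial>lborel) = A r * p"
      unfolding A_def p_def[symmetric] using p0 p1 by (simp add: ennreal_divide_mult_cancel nn_integral_completion)
    also have "(\<integral>\<^sup>+ y. ennreal (m y) * indicator (?P r) y \<partial>lborel) \<le> (\<integral>\<^sup>+ y. ennreal (m y) * indicator (?B r) y \<partial>lborel)"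
      by (intro nn_integral_mono) (auto simp: half_ball_plus_def split: split_indicator)
    also have "\<dots> = Bm r * b"
      unfolding Bm_def b_def[symmetric] using b by (simp add: ennreal_divide_mult_cancel nn_integral_completion)
    also have "\<dots> \<le> Bm r * (K * p)" using bp by (rule mult_left_mono) simp
    finally have "ennreal \<delta> * p \<le> A r * p + Bm r * (K * p)" by (simp add: add_left_mono)
    then have "p * ennreal \<delta> \<le> p * (A r + K * Bm r)" by (simp add: distrib_left mult_ac)
    then show ?thesis using p0 p1 by (subst (asm) ennreal_mult_le_mult_iff) auto
  qed
  have "((\<lambda>r. A r + K * Bm r) \<longlongrightarrow> 0 + K * 0) (at_right 0)"
    using lim nv unfolding A_def Bm_def near_values_def m_def
    by (intro tendsto_add ennreal_tendsto_cmult) (auto simp: K_def)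
  then have "ennreal \<delta> \<le> 0 + K * 0"
    by (rule tendsto_lowerbound) (auto simp: eventually_at_right_less eventually_at_filter intro!: always_eventually le)
  with \<delta> show False by simp
qed

text \<open>Only the unordered pair of traces is recovered: \<open>(a, b, \<nu>)\<close> and
  \<open>(b, a, - \<nu>)\<close> describe the same jump. This is enough to make
  \<open>jump_size\<close> independent of the choice.\<close>

lemma approx_jump_values:
  assumes u: "u \<in> borel_measurable borel" and nv: "near_values u x c1 c2" and j: "approx_jump u x a b \<nu>"
  shows "{a, b} = {c1, c2}" "\<bar>a - b\<bar> = \<bar>c1 - c2\<bar>"
proof -
  have "a = c1 \<or> a = c2" using near_values_average[OF u nv, of \<nu> a] j by (auto simp: approx_jump_def)
  moreover have "b = c1 \<or> b = c2"
    using near_values_average[OF u nv, of "-\<nu>" b] j by (auto simp: approx_jump_def half_ball_minus_uminus)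
  moreover have "a \<noteq> b" using j by (auto simp: approx_jump_def)
  ultimately show "{a, b} = {c1, c2}" "\<bar>a - b\<bar> = \<bar>c1 - c2\<bar>" by auto
qed

lemma ennreal_inverse_antimono: "a \<le> b \<Longrightarrow> inverse b \<le> inverse (a :: ennreal)"
  unfolding less_eq_ennreal.rep_eq inverse_ennreal.rep_eq by (rule ereal_inverse_antimono) auto

lemma approx_jump_near_values:
  fixes x :: "'a::euclidean_space"
  assumes u [measurable]: "u \<in> borel_measurable borel" and j: "approx_jump u x a b \<nu>"
  shows "near_values u x a b"
proof -
  define A where "A r = (\<integral>\<^sup>+ y \<in> half_ball_plus x \<nu> r. ennreal \<bar>u y - a\<bar> \<partial>lebesgue) / emeasure lebesgue (half_ball_plus x \<nu> r)" for r
  define B where "B r = (\<integral>\<^sup>+ y \<in> half_ball_minus x \<nu> r. ennreal \<bar>u y - b\<bar> \<partial>lebesgue) / emeasure lebesgue (half_ball_minus x \<nu> r)" for r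
  have lim: "((\<lambda>r. A r + B r) \<longlongrightarrow> 0 + 0) (at_right 0)"
    using j unfolding A_def B_def approx_jump_def by (intro tendsto_add) auto
  have \<nu>: "norm \<nu> = 1" using j by (simp add: approx_jump_def)
  have le: "(\<integral>\<^sup>+ y \<in> ball x r. ennreal (min \<bar>u y - a\<bar> \<bar>u y - b\<bar>) \<partial>lebesgue) / emeasure lebesgue (ball x r) \<le> A r + B r"
    if r: "r > 0" for r
  proof -
    have "negligible {y. \<nu> \<bullet> y = \<nu> \<bullet> x}" using \<nu> by (intro negligible_hyperplane) auto
    then have "AE y in lebesgue. y \<notin> {y. \<nu> \<bullet> y = \<nu> \<bullet> x}"
      by (intro AE_not_in) (simp add: negligible_iff_null_sets)
    then have ae: "AE y in lebesgue. (y - x) \<bullet> \<nu> \<noteq> 0"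
      by eventually_elim (auto simp: inner_diff_right inner_diff_left inner_commute)
    have "(\<integral>\<^sup>+ y \<in> ball x r. ennreal (min \<bar>u y - a\<bar> \<bar>u y - b\<bar>) \<partial>lebesgue)
      \<le> (\<integral>\<^sup>+ y. ennreal \<bar>u y - a\<bar> * indicator (half_ball_plus x \<nu> r) y + ennreal \<bar>u y - b\<bar> * indicator (half_ball_minus x \<nu> r) y \<partial>lebesgue)"
      using ae by (intro nn_integral_mono_AE) (auto elim!: eventually_mono simp: half_ball_plus_def half_ball_minus_def
          intro!: ennreal_leI split: split_indicator)
    also have "\<dots> = (\<integral>\<^sup>+ y \<in> half_ball_plus x \<nu> r. ennreal \<bar>u y - a\<bar> \<partial>lebesgue) + (\<integral>\<^sup>+ y \<in> half_ball_minus x \<nu> r. ennreal \<bar>u y - b\<bar> \<partial>lebesgue)"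
      by (subst nn_integral_add) (auto simp: measurable_completion)
    finally have "(\<integral>\<^sup>+ y \<in> ball x r. ennreal (min \<bar>u y - a\<bar> \<bar>u y - b\<bar>) \<partial>lebesgue) / emeasure lebesgue (ball x r)
      \<le> (\<integral>\<^sup>+ y \<in> half_ball_plus x \<nu> r. ennreal \<bar>u y - a\<bar> \<partial>lebesgue) / emeasure lebesgue (ball x r)
        + (\<integral>\<^sup>+ y \<in> half_ball_minus x \<nu> r. ennreal \<bar>u y - b\<bar> \<partial>lebesgue) / emeasure lebesgue (ball x r)"
      by (simp add: add_divide_distrib_ennreal[symmetric] divide_right_mono_ennreal)
    also have "\<dots> \<le> A r + B r"
      unfolding A_def B_def
      unfolding divide_ennreal_def
      by (intro add_mono mult_left_mono) (auto simp: half_ball_plus_def half_ball_minus_def intro!: ennreal_inverse_antimono emeasure_mono)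
    finally show ?thesis .
  qed
  show ?thesis unfolding near_values_def
    by (rule tendsto_sandwich[OF _ _ tendsto_const lim[simplified]])
       (auto simp: eventually_at_filter simp del: emeasure_completion intro!: always_eventually le)
qed

lemma jump_size_eq:
  assumes "u \<in> borel_measurable borel" "approx_jump u x a b \<nu>"
  shows "jump_size u x = \<bar>a - b\<bar>"
proof -
  have "\<exists>s. \<exists>a b \<nu>. approx_jump u x a b \<nu> \<and> s = \<bar>a - b\<bar>" using assms by blast
  from someI_ex[OF this] obtain a' b' \<nu>' where "approx_jump u x a' b' \<nu>'" "jump_size u x = \<bar>a' - b'\<bar>"
    unfolding jump_size_def by blast
  then show ?thesis using approx_jump_values[OF assms(1) approx_jump_near_values[OF assms]] by metis
qed

lemma average_tendsto_0:
  fixes S :: "real \<Rightarrow> 'a::euclidean_space set" and h :: "'a \<Rightarrow> real"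
  assumes lim: "\<And>e. e > 0 \<Longrightarrow> \<exists>r>0. AE y in lebesgue. y \<in> S r \<longrightarrow> h y \<le> e"
    and mono: "\<And>r s. r \<le> s \<Longrightarrow> S r \<subseteq> S s" and meas: "\<And>r. S r \<in> sets lebesgue"
    and fin: "\<And>r. emeasure lebesgue (S r) < top" and pos: "\<And>r. r > 0 \<Longrightarrow> emeasure lebesgue (S r) > 0"
  shows "((\<lambda>r. (\<integral>\<^sup>+ y \<in> S r. ennreal (h y) \<partial>lebesgue) / emeasure lebesgue (S r)) \<longlongrightarrow> 0) (at_right 0)"
proof (rule order_tendstoI)
  fix l :: ennreal assume "0 < l"
  then obtain e :: real where e: "0 < e" "ennreal e < l"
    proof -
    obtain l' where l': "0 < l'" "l' < l" using dense \<open>0 < l\<close> by blast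
    then have "l' < top" using order.strict_trans2 top_greatest by blast
    then obtain e where "l' = ennreal e" "e \<ge> 0" by (cases l') auto
    then show ?thesis using l' that[of e] by simp
  qed
  obtain r0 where r0: "r0 > 0" "AE y in lebesgue. y \<in> S r0 \<longrightarrow> h y \<le> e" using lim[OF e(1)] by auto
  have "(\<integral>\<^sup>+ y \<in> S r. ennreal (h y) \<partial>lebesgue) / emeasure lebesgue (S r) < l" if r: "0 < r" "r < r0" for r
  proof -
    have "(\<integral>\<^sup>+ y \<in> S r. ennreal (h y) \<partial>lebesgue) \<le> (\<integral>\<^sup>+ y. ennreal e * indicator (S r) y \<partial>lebesgue)"
      using r0(2) mono[of r r0] r
      by (intro nn_integral_mono_AE) (auto elim!: eventually_mono intro!: ennreal_leI split: split_indicator)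
    also have "\<dots> = ennreal e * emeasure lebesgue (S r)" by (simp add: meas nn_integral_cmult_indicator)
    finally have "(\<integral>\<^sup>+ y \<in> S r. ennreal (h y) \<partial>lebesgue) / emeasure lebesgue (S r) \<le> ennreal e * emeasure lebesgue (S r) / emeasure lebesgue (S r)"
      by (rule divide_right_mono_ennreal)
    also have "\<dots> = ennreal e" using fin[of r] pos[of r] r by (subst ennreal_mult_divide_eq) auto
    finally show ?thesis using e by auto
  qed
  then show "\<forall>\<^sub>F r in at_right 0. (\<integral>\<^sup>+ y \<in> S r. ennreal (h y) \<partial>lebesgue) / emeasure lebesgue (S r) < l"
    using r0(1) eventually_at_right_real[of 0 r0] by (auto elim!: eventually_mono)
qed auto

lemma near_valuesI:
  fixes x :: "'a::euclidean_space"
  assumes "\<And>e. e > 0 \<Longrightarrow> \<exists>r>0. AE y in lebesgue. y \<in> ball x r \<longrightarrow> \<bar>u y - a\<bar> \<le> e \<or> \<bar>u y - b\<bar> \<le> e"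
  shows "near_values u x a b"
  unfolding near_values_def
proof (rule average_tendsto_0)
  fix e :: real assume "e > 0"
  from assms[OF this] show "\<exists>r>0. AE y in lebesgue. y \<in> ball x r \<longrightarrow> min \<bar>u y - a\<bar> \<bar>u y - b\<bar> \<le> e"
    by (auto simp: min_le_iff_disj)
qed (use emeasure_bounded_finite[OF bounded_ball, of x] in \<open>auto simp: emeasure_ball ennreal_zero_less_mult_iff less_top\<close>)

lemma half_ball_plus_emeasure_pos:
  assumes "r > 0" "norm \<nu> = 1"
  shows "0 < emeasure lebesgue (half_ball_plus x \<nu> r)"
  by (rule less_le_trans[OF _ half_ball_plus_emeasure[OF assms]])
     (use assms in \<open>auto simp: emeasure_ball ennreal_zero_less_mult_iff\<close>)

lemma approx_jumpI:
  fixes x :: "'a::euclidean_space"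
  assumes ab: "a \<noteq> b" and \<nu>: "norm \<nu> = 1"
    and p: "\<And>e. e > 0 \<Longrightarrow> \<exists>r>0. AE y in lebesgue. y \<in> ball x r \<longrightarrow> (y - x) \<bullet> \<nu> > 0 \<longrightarrow> \<bar>u y - a\<bar> \<le> e"
    and m: "\<And>e. e > 0 \<Longrightarrow> \<exists>r>0. AE y in lebesgue. y \<in> ball x r \<longrightarrow> (y - x) \<bullet> \<nu> < 0 \<longrightarrow> \<bar>u y - b\<bar> \<le> e"
  shows "approx_jump u x a b \<nu>"
proof -
  have fin: "emeasure lebesgue (half_ball_plus x \<nu> r) < top" for r \<nu>
    by (rule le_less_trans[OF emeasure_mono[of _ "ball x r"]])
       (use emeasure_bounded_finite[OF bounded_ball, of x r] in \<open>auto simp: half_ball_plus_def less_top\<close>)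
  have *: "((\<lambda>r. (\<integral>\<^sup>+ y \<in> half_ball_plus x \<mu> r. ennreal \<bar>u y - c\<bar> \<partial>lebesgue)
            / emeasure lebesgue (half_ball_plus x \<mu> r)) \<longlongrightarrow> 0) (at_right 0)"
    if "\<And>e. e > 0 \<Longrightarrow> \<exists>r>0. AE y in lebesgue. y \<in> ball x r \<longrightarrow> (y - x) \<bullet> \<mu> > 0 \<longrightarrow> \<bar>u y - c\<bar> \<le> e" "norm \<mu> = 1" for c \<mu>
  proof (rule average_tendsto_0)
    fix e :: real assume "e > 0"
    from that(1)[OF this] show "\<exists>r>0. AE y in lebesgue. y \<in> half_ball_plus x \<mu> r \<longrightarrow> \<bar>u y - c\<bar> \<le> e"
      by (auto simp: half_ball_plus_def elim!: ex_forward)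
  qed (use that(2) fin half_ball_plus_emeasure_pos[of _ \<mu> x] in \<open>auto simp: half_ball_plus_def[of _ _ r for r] \<close>)
  show ?thesis
    unfolding approx_jump_def half_ball_minus_uminus
    using ab \<nu> p m by (intro conjI *) auto
qed

section \<open>Countable combinations of indicators\<close>

lemma test_fun_Ck: "test_fun U \<phi> \<Longrightarrow> Ck k \<phi>"
  by (simp add: test_fun_def)

lemma test_fun_continuous: "test_fun U \<phi> \<Longrightarrow> continuous_on UNIV \<phi>"
  using test_fun_Ck[of U \<phi> 0] by simp

lemma test_fun_differentiable: "test_fun U \<phi> \<Longrightarrow> (\<phi> has_derivative frechet_derivative \<phi> (at x)) (at x)"
  using test_fun_Ck[of U \<phi> "Suc 0"] by (simp add: frechet_derivative_works[symmetric])

lemma pd_eq_0_outside: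
  assumes "closed K" "\<And>x. x \<notin> K \<Longrightarrow> \<phi> x = 0" "x \<notin> K"
  shows "pd b \<phi> x = 0"
proof -
  have "(\<phi> has_derivative (\<lambda>_. 0)) (at x)"
  proof (rule has_derivative_transform_within_open[of "\<lambda>_. 0"])
    show "open (- K)" using assms by auto
  qed (use assms in auto)
  then have "frechet_derivative \<phi> (at x) = (\<lambda>_. 0)" by (rule frechet_derivative_at[symmetric])
  then show ?thesis by (simp add: pd_def)
qed

lemma test_fun_pd:
  assumes "test_fun U \<phi>" "b \<in> Basis"
  shows "test_fun U (pd b \<phi>)"
  unfolding test_fun_def
proof
  show "\<forall>k. Ck k (pd b \<phi>)" using test_fun_Ck[OF assms(1), of "Suc k" for k] assms(2) by simp
  obtain K where K: "compact K" "K \<subseteq> U" "\<forall>x. x \<notin> K \<longrightarrow> \<phi> x = 0" using assms by (auto simp: test_fun_def)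
  then show "\<exists>K. compact K \<and> K \<subseteq> U \<and> (\<forall>x. x \<notin> K \<longrightarrow> pd b \<phi> x = 0)"
    by (intro exI[of _ K]) (auto intro!: pd_eq_0_outside[of K] compact_imp_closed)
qed

lemma test_fun_eq_0: "test_fun U \<phi> \<Longrightarrow> x \<notin> U \<Longrightarrow> \<phi> x = 0"
  by (auto simp: test_fun_def)

lemma test_fun_bounded:
  assumes "test_fun U \<phi>" obtains B where "B > 0" "\<And>x. \<bar>\<phi> x\<bar> \<le> B" "\<And>x. norm x > B \<Longrightarrow> \<phi> x = 0"
proof -
  obtain K where K: "compact K" "K \<subseteq> U" "\<forall>x. x \<notin> K \<longrightarrow> \<phi> x = 0" using assms by (auto simp: test_fun_def)
  have "compact (\<phi> ` K)"
    using K(1) test_fun_continuous[OF assms] by (intro compact_continuous_image) (auto intro: continuous_on_subset)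
  then obtain B1 where B1: "\<And>y. y \<in> \<phi> ` K \<Longrightarrow> norm y \<le> B1" using compact_imp_bounded bounded_iff by metis
  obtain B2 where B2: "\<And>y. y \<in> K \<Longrightarrow> norm y \<le> B2" using K(1) compact_imp_bounded bounded_iff by metis
  show ?thesis
  proof (rule that[of "\<bar>B1\<bar> + \<bar>B2\<bar> + 1"])
    show "\<bar>\<phi> x\<bar> \<le> \<bar>B1\<bar> + \<bar>B2\<bar> + 1" for x
      using B1[of "\<phi> x"] K(3) by (cases "x \<in> K") force+
    show "norm x > \<bar>B1\<bar> + \<bar>B2\<bar> + 1 \<Longrightarrow> \<phi> x = 0" for x
      using B2[of x] K(3) by (cases "x \<in> K") force+
  qed simp
qed

lemma test_fun_borel: "test_fun U \<phi> \<Longrightarrow> \<phi> \<in> borel_measurable borel"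
  by (intro borel_measurable_continuous_onI test_fun_continuous)

lemma test_field_components:
  assumes "test_field U \<phi>" shows "b \<in> Basis \<Longrightarrow> test_fun U (\<lambda>x. \<phi> x \<bullet> b)"
  using assms by (auto simp: test_field_def)

lemma test_field_borel:
  fixes \<phi> :: "'a::euclidean_space \<Rightarrow> 'a"
  assumes "test_field U \<phi>" shows "\<phi> \<in> borel_measurable borel"
proof -
  have "(\<lambda>x. \<Sum>b\<in>Basis. (\<phi> x \<bullet> b) *\<^sub>R b) \<in> borel_measurable borel"
    using test_fun_borel[OF test_field_components[OF assms]]
    by (intro borel_measurable_sum borel_measurable_scaleR) auto
  then show ?thesis by (simp add: euclidean_representation)
qed

lemma test_field_bounded:
  fixes \<phi> :: "'a::euclidean_space \<Rightarrow> 'a"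
  assumes "test_field U \<phi>" obtains B where "B > 0" "\<And>x. norm (\<phi> x) \<le> B"
proof -
  have "\<exists>B>0. \<forall>x. \<bar>\<phi> x \<bullet> b\<bar> \<le> B" if "b \<in> Basis" for b
    using test_fun_bounded[OF test_field_components[OF assms that]] by metis
  then obtain B where B: "\<And>b. b \<in> Basis \<Longrightarrow> B b > 0 \<and> (\<forall>x. \<bar>\<phi> x \<bullet> b\<bar> \<le> B b)" by metis
  show ?thesis
  proof (rule that[of "(\<Sum>b\<in>Basis. B b) + 1"])
    show "0 < sum B Basis + 1" using B by (intro add_nonneg_pos sum_nonneg) (auto intro: less_imp_le)
    fix x
    have "norm (\<phi> x) \<le> (\<Sum>b\<in>Basis. \<bar>\<phi> x \<bullet> b\<bar>)" by (rule norm_le_l1)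
    also have "\<dots> \<le> (\<Sum>b\<in>Basis. B b)" using B by (intro sum_mono) auto
    finally show "norm (\<phi> x) \<le> (\<Sum>b\<in>Basis. B b) + 1" by simp
  qed
qed

lemma divergence_properties:
  fixes \<phi> :: "'a::euclidean_space \<Rightarrow> 'a"
  assumes "test_field U \<phi>"
  shows "divergence \<phi> \<in> borel_measurable borel" "\<exists>B>0. \<forall>x. \<bar>divergence \<phi> x\<bar> \<le> B"
    "x \<notin> U \<Longrightarrow> divergence \<phi> x = 0"
proof -
  have t: "test_fun U (pd b (\<lambda>x. \<phi> x \<bullet> b))" if "b \<in> Basis" for b
    using test_fun_pd[OF test_field_components[OF assms that] that] .
  show "divergence \<phi> \<in> borel_measurable borel"
    unfolding divergence_def using test_fun_borel[OF t] by (intro borel_measurable_sum)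
  show "x \<notin> U \<Longrightarrow> divergence \<phi> x = 0"
    unfolding divergence_def using test_fun_eq_0[OF t] by (intro sum.neutral) auto
  have "\<exists>B>0. \<forall>x. \<bar>pd b (\<lambda>x. \<phi> x \<bullet> b) x\<bar> \<le> B" if "b \<in> Basis" for b
    using test_fun_bounded[OF t[OF that]] by metis
  then obtain B where B: "\<And>b. b \<in> Basis \<Longrightarrow> B b > 0 \<and> (\<forall>x. \<bar>pd b (\<lambda>x. \<phi> x \<bullet> b) x\<bar> \<le> B b)" by metis
  have "\<bar>divergence \<phi> x\<bar> \<le> sum B Basis + 1" for x
  proof -
    have "\<bar>divergence \<phi> x\<bar> \<le> (\<Sum>b\<in>Basis. \<bar>pd b (\<lambda>x. \<phi> x \<bullet> b) x\<bar>)" unfolding divergence_def by (rule sum_abs)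
    also have "\<dots> \<le> (\<Sum>b\<in>Basis. B b)" using B by (intro sum_mono) auto
    finally show ?thesis by simp
  qed
  moreover have "0 < sum B Basis + 1" using B by (intro add_nonneg_pos sum_nonneg) (auto intro: less_imp_le)
  ultimately show "\<exists>B>0. \<forall>x. \<bar>divergence \<phi> x\<bar> \<le> B" by blast
qed

section \<open>Subadditivity of powers with exponent at most one\<close>

lemma powr_add_le:
  fixes x y \<theta> :: real
  assumes "0 \<le> x" "0 \<le> y" "0 < \<theta>" "\<theta> \<le> 1"
  shows "(x + y) powr \<theta> \<le> x powr \<theta> + y powr \<theta>"
proof (cases "x + y = 0")
  case True then show ?thesis using assms by simp
next
  case False
  then have s: "x + y > 0" using assms by simp
  \<comment> \<open>After division by \<open>x + y\<close> the two parts lie in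
    \<open>[0, 1]\<close> and add up to 1; on that interval a power with exponent at most 1 only
    increases them.\<close>
  have le: "t \<le> t powr \<theta>" if "0 \<le> t" "t \<le> 1" for t :: real
  proof (cases "t = 0")
    case False
    then have "t powr 1 \<le> t powr \<theta>" using that assms by (intro powr_mono') auto
    then show ?thesis using False that by simp
  qed simp
  have "1 = x / (x + y) + y / (x + y)" using s by (simp add: add_divide_distrib[symmetric])
  also have "\<dots> \<le> (x / (x + y)) powr \<theta> + (y / (x + y)) powr \<theta>"
    using assms s by (intro add_mono le) auto
  also have "\<dots> = (x powr \<theta> + y powr \<theta>) / (x + y) powr \<theta>"
    using assms s by (simp add: powr_divide add_divide_distrib)
  finally show ?thesis using s by (simp add: field_simps)
qed

lemma powr_sum_le:
  fixes a :: "'i \<Rightarrow> real"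
  assumes "finite I" "\<And>i. i \<in> I \<Longrightarrow> 0 \<le> a i" "0 < \<theta>" "\<theta> \<le> 1"
  shows "(\<Sum>i\<in>I. a i) powr \<theta> \<le> (\<Sum>i\<in>I. a i powr \<theta>)"
  using assms(1,2)
proof (induction I)
  case (insert i I)
  have "(\<Sum>i\<in>insert i I. a i) powr \<theta> \<le> a i powr \<theta> + (\<Sum>i\<in>I. a i) powr \<theta>"
    using insert assms by (simp add: powr_add_le sum_nonneg)
  with insert show ?case by simp
qed simp

lemma powr_suminf_le:
  fixes a :: "nat \<Rightarrow> real"
  assumes "\<And>i. 0 \<le> a i" "0 < \<theta>" "\<theta> \<le> 1" "summable a"
  shows "ennreal ((\<Sum>i. a i) powr \<theta>) \<le> (\<Sum>i. ennreal (a i powr \<theta>))"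
proof (rule LIMSEQ_le_const2)
  have "(\<lambda>n. \<Sum>i<n. a i) \<longlonglongrightarrow> (\<Sum>i. a i)" using assms(4) by (simp add: summable_LIMSEQ)
  then show "(\<lambda>n. ennreal ((\<Sum>i<n. a i) powr \<theta>)) \<longlonglongrightarrow> ennreal ((\<Sum>i. a i) powr \<theta>)"
    using assms by (intro tendsto_ennrealI tendsto_powr2) (auto intro!: always_eventually sum_nonneg)
  show "\<exists>N. \<forall>n\<ge>N. ennreal ((\<Sum>i<n. a i) powr \<theta>) \<le> (\<Sum>i. ennreal (a i powr \<theta>))"
  proof (intro exI allI impI)
    fix n :: nat
    have "ennreal ((\<Sum>i<n. a i) powr \<theta>) \<le> ennreal (\<Sum>i<n. a i powr \<theta>)"
      using assms by (intro ennreal_leI powr_sum_le) auto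
    also have "\<dots> = (\<Sum>i<n. ennreal (a i powr \<theta>))" by (rule sum_ennreal[symmetric]) auto
    also have "\<dots> \<le> (\<Sum>i. ennreal (a i powr \<theta>))" by (rule sum_le_suminf) auto
    finally show "ennreal ((\<Sum>i<n. a i) powr \<theta>) \<le> (\<Sum>i. ennreal (a i powr \<theta>))" .
  qed
qed

section \<open>Series of indicators as special functions of bounded variation\<close>

lemma (in complete_measure) measurable_AE_eq:
  assumes f: "f \<in> measurable M N" and ae: "AE x in M. f x = g x" and g: "g \<in> space M \<rightarrow> space N"
  shows "g \<in> measurable M N"
proof (rule measurableI)
  show "x \<in> space M \<Longrightarrow> g x \<in> space N" for x using g by auto
  fix A assume A: "A \<in> sets N"
  have 1: "f -` A \<inter> space M \<in> sets M" using f A by (rule measurable_sets)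
  have 2: "AE x in M. (x \<in> f -` A \<inter> space M) = (x \<in> g -` A \<inter> space M)"
    using ae by eventually_elim auto
  show "g -` A \<inter> space M \<in> sets M" by (rule in_sets_AE[OF 2 1]) auto
qed

text \<open>Common frame for half-lines on the real line and quadrants in the plane. In both cases
  \<open>\<gamma> n\<close> is the inner unit normal of \<open>A n\<close> on its boundary inside
  \<open>U\<close>, and 0 elsewhere; \<open>gauss\<close> makes it the distributional gradient of
  the indicator, \<open>L\<close> bounds all boundary measures alike, and \<open>N\<close> collects
  the points where edges meet and no single normal exists. Off \<open>N\<close>, the sum
  \<open>G\<close> decides whether there is a jump. \<open>H\<close>, \<open>v\<close> and
  \<open>G\<close> are parameters with defining equations so that an instance can name them
  beforehand.\<close>

locale atom_series =
  fixes U :: "'a::euclidean_space set" and m :: "nat \<Rightarrow> real" and A :: "nat \<Rightarrow> 'a set"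
    and \<gamma> :: "nat \<Rightarrow> 'a \<Rightarrow> 'a" and L :: real and H :: "'a measure" and N :: "'a set" and v :: "'a \<Rightarrow> real"
    and G :: "'a \<Rightarrow> 'a"
  assumes H_def: "H = hausdorff_measure (DIM('a) - 1)"
    and v_def: "v = (\<lambda>x. \<Sum>n. m n * indicator (A n) x)"
    and G_def: "G = (\<lambda>x. \<Sum>n. m n *\<^sub>R \<gamma> n x)"
    and U_open: "open U" and U_bounded: "bounded U"
    and m_summable: "summable (\<lambda>n. \<bar>m n\<bar>)"
    and A_borel: "\<And>n. A n \<in> sets borel"
    and \<gamma>_borel: "\<And>n. \<gamma> n \<in> borel_measurable borel"
    and \<gamma>_norm: "\<And>n x. norm (\<gamma> n x) = 0 \<or> norm (\<gamma> n x) = 1"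
    and \<gamma>_U: "\<And>n x. x \<notin> U \<Longrightarrow> \<gamma> n x = 0"
    and \<gamma>_mass: "\<And>n. (\<integral>\<^sup>+x. ennreal (norm (\<gamma> n x)) \<partial>H) \<le> ennreal L" and L_nonneg: "0 \<le> L"
    and gauss: "\<And>n \<phi>. test_field U \<phi> \<Longrightarrow>
        (LINT x:U|lebesgue. indicator (A n) x * divergence \<phi> x) = - (LINT x|H. \<gamma> n x \<bullet> \<phi> x)"
    and N_null: "N \<in> null_sets H"
    and jump: "\<And>x. x \<in> U \<Longrightarrow> x \<notin> N \<Longrightarrow> G x \<noteq> 0 \<Longrightarrow> \<exists>a b \<nu>. approx_jump v x a b \<nu> \<and> G x = (a - b) *\<^sub>R \<nu>"
    and no_jump: "\<And>x. x \<in> U \<Longrightarrow> x \<notin> N \<Longrightarrow> G x = 0 \<Longrightarrow> x \<notin> jump_set U v"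
begin

lemma \<gamma>_le: "norm (\<gamma> n x) \<le> 1"
  using \<gamma>_norm[of n x] by auto

lemma v_summable: "summable (\<lambda>n. \<bar>m n * indicator (A n) x\<bar>)"
  by (rule summable_comparison_test'[OF m_summable, of 0]) (auto simp: abs_mult split: split_indicator)

lemma v_bound: "\<bar>v x\<bar> \<le> (\<Sum>n. \<bar>m n\<bar>)"
proof -
  have "\<bar>v x\<bar> \<le> (\<Sum>n. \<bar>m n * indicator (A n) x\<bar>)" unfolding v_def by (rule summable_rabs[OF v_summable])
  also have "\<dots> \<le> (\<Sum>n. \<bar>m n\<bar>)"
    by (intro suminf_le v_summable m_summable) (auto split: split_indicator)
  finally show ?thesis .
qed

lemma v_borel: "v \<in> borel_measurable borel"
  unfolding v_def using A_borel by measurable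

lemma G_summable: "summable (\<lambda>n. norm (m n *\<^sub>R \<gamma> n x))"
  by (rule summable_comparison_test'[OF m_summable, of 0]) (use \<gamma>_le in \<open>auto simp: mult_left_le\<close>)

lemma G_borel: "G \<in> borel_measurable borel"
  unfolding G_def using \<gamma>_borel by measurable

lemma borel_H: "f \<in> borel_measurable borel \<Longrightarrow> f \<in> borel_measurable H"
  unfolding H_def by (rule borel_measurable_hausdorff)

lemma \<gamma>_integrable: "integrable H (\<lambda>x. norm (\<gamma> n x))" "(LINT x|H. norm (\<gamma> n x)) \<le> L"
proof -
  have meas: "(\<lambda>x. norm (\<gamma> n x)) \<in> borel_measurable H" using borel_H[OF \<gamma>_borel[of n]] by measurable
  show "integrable H (\<lambda>x. norm (\<gamma> n x))"
    using \<gamma>_mass[of n] by (intro integrableI_bounded meas) (auto intro: le_less_trans)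
  then show "(LINT x|H. norm (\<gamma> n x)) \<le> L"
    using \<gamma>_mass[of n] L_nonneg
    by (subst integral_eq_nn_integral[OF meas]) (auto simp: enn2real_leI)
qed

lemma G_integrable: "integrable H G"
proof -
  have [measurable]: "\<gamma> n \<in> borel_measurable H" for n by (intro borel_H \<gamma>_borel)
  have "integrable H (\<lambda>x. \<Sum>n. m n *\<^sub>R \<gamma> n x)"
  proof (rule integrable_suminf)
    show "integrable H (\<lambda>x. m n *\<^sub>R \<gamma> n x)" for n
      using \<gamma>_integrable(1)[of n] by (subst integrable_norm_iff[symmetric]) auto
    show "AE x in H. summable (\<lambda>n. norm (m n *\<^sub>R \<gamma> n x))" using G_summable by auto
    show "summable (\<lambda>n. LINT x|H. norm (m n *\<^sub>R \<gamma> n x))"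
      by (rule summable_comparison_test'[OF summable_mult2[OF m_summable, of L], of 0])
         (use \<gamma>_integrable in \<open>auto simp: abs_mult intro!: mult_left_mono\<close>)
  qed
  then show ?thesis by (simp add: G_def)
qed

text \<open>Gauss-Green term by term: both series are dominated by a constant times
  \<open>\<bar>m n\<bar>\<close>, since \<open>L\<close> does not depend on \<open>n\<close>. The
  second claim is the variation bound behind \<open>v_BV\<close>.\<close>

lemma integral_v_div:
  assumes \<phi>: "test_field U \<phi>"
  shows "(LINT x:U|lebesgue. v x * divergence \<phi> x) = - (LINT x|H. G x \<bullet> \<phi> x)"
    "(\<And>x. norm (\<phi> x) \<le> 1) \<Longrightarrow> \<bar>LINT x:U|lebesgue. v x * divergence \<phi> x\<bar> \<le> (\<Sum>n. \<bar>m n\<bar>) * L"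
proof -
  obtain D where D: "D > 0" "\<And>x. \<bar>divergence \<phi> x\<bar> \<le> D" using divergence_properties(2)[OF \<phi>] by auto
  obtain B where B: "B > 0" "\<And>x. norm (\<phi> x) \<le> B" using test_field_bounded[OF \<phi>] by auto
  have [measurable]: "divergence \<phi> \<in> borel_measurable borel" "A n \<in> sets borel" "U \<in> sets borel" for n
    using divergence_properties(1)[OF \<phi>] A_borel U_open by auto
  have [measurable]: "\<gamma> n \<in> borel_measurable H" "\<phi> \<in> borel_measurable H" for n
    by (auto intro!: borel_H \<gamma>_borel test_field_borel[OF \<phi>])
  have iU: "integrable lebesgue (indicat_real U)"
    using emeasure_bounded_finite[OF U_bounded] by (intro integrable_real_indicator) (auto simp: less_top)
  have f_int: "integrable lebesgue (\<lambda>x. indicator U x * (m n * indicator (A n) x * divergence \<phi> x))" for n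
  proof (rule Bochner_Integration.integrable_bound[OF integrable_mult_right[OF iU, of "\<bar>m n\<bar> * D"]])
    show "(\<lambda>x. indicator U x * (m n * indicator (A n) x * divergence \<phi> x)) \<in> borel_measurable lebesgue"
      by (intro measurable_completion) measurable
    show "AE x in lebesgue. norm (indicator U x * (m n * indicator (A n) x * divergence \<phi> x)) \<le> norm (\<bar>m n\<bar> * D * indicator U x)"
      using D by (auto simp: abs_mult split: split_indicator intro!: mult_left_mono)
  qed
  have f_norm: "(LINT x|lebesgue. norm (indicator U x * (m n * indicator (A n) x * divergence \<phi> x))) \<le> \<bar>m n\<bar> * (D * (LINT x|lebesgue. indicator U x))" for n
  proof -
    have "(LINT x|lebesgue. norm (indicator U x * (m n * indicator (A n) x * divergence \<phi> x))) \<le> (LINT x|lebesgue. \<bar>m n\<bar> * D * indicator U x)"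
      using D by (intro integral_mono integrable_norm f_int integrable_mult_right iU)
        (auto simp: abs_mult split: split_indicator intro!: mult_left_mono)
    then show ?thesis by (simp add: mult.assoc)
  qed
  have c_int: "integrable H (\<lambda>x. m n * (\<gamma> n x \<bullet> \<phi> x))" for n
  proof (rule Bochner_Integration.integrable_bound[OF integrable_mult_right[OF \<gamma>_integrable(1)[of n], of "\<bar>m n\<bar> * B"]])
    have "\<bar>\<gamma> n x \<bullet> \<phi> x\<bar> \<le> B * norm (\<gamma> n x)" for x
      by (rule order_trans[OF Cauchy_Schwarz_ineq2]) (use B in \<open>auto simp: mult.commute intro: mult_right_mono\<close>)
    then show "AE x in H. norm (m n * (\<gamma> n x \<bullet> \<phi> x)) \<le> norm (\<bar>m n\<bar> * B * norm (\<gamma> n x))"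
      using B by (auto simp: abs_mult mult.assoc intro!: mult_left_mono)
  qed auto
  have c_norm: "(LINT x|H. norm (m n * (\<gamma> n x \<bullet> \<phi> x))) \<le> \<bar>m n\<bar> * (C * L)"
    if C: "\<And>x. norm (\<phi> x) \<le> C" for n C
  proof -
    have C0: "C \<ge> 0" by (rule order_trans[OF norm_ge_zero C])
    have "\<bar>\<gamma> n x \<bullet> \<phi> x\<bar> \<le> C * norm (\<gamma> n x)" for x
      by (rule order_trans[OF Cauchy_Schwarz_ineq2]) (use C in \<open>auto simp: mult.commute intro: mult_right_mono\<close>)
    then have "(LINT x|H. norm (m n * (\<gamma> n x \<bullet> \<phi> x))) \<le> (LINT x|H. \<bar>m n\<bar> * C * norm (\<gamma> n x))"
      by (intro integral_mono integrable_norm c_int integrable_mult_right \<gamma>_integrable)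
         (auto simp: abs_mult mult.assoc intro!: mult_left_mono)
    also have "\<dots> = \<bar>m n\<bar> * C * (LINT x|H. norm (\<gamma> n x))" by simp
    also have "\<dots> \<le> \<bar>m n\<bar> * C * L" using \<gamma>_integrable(2) C0 by (intro mult_left_mono) auto
    finally show ?thesis by (simp add: mult.assoc)
  qed
  have "(LINT x:U|lebesgue. v x * divergence \<phi> x) = (LINT x|lebesgue. (\<Sum>n. indicator U x * (m n * indicator (A n) x * divergence \<phi> x)))"
    unfolding set_lebesgue_integral_def v_def
    by (intro Bochner_Integration.integral_cong refl)
       (simp add: suminf_mult2[OF summable_rabs_cancel[OF v_summable]] suminf_mult[OF summable_mult2[OF summable_rabs_cancel[OF v_summable]]])
  also have "\<dots> = (\<Sum>n. LINT x|lebesgue. indicator U x * (m n * indicator (A n) x * divergence \<phi> x))"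
  proof (rule integral_suminf[OF f_int])
    show "AE x in lebesgue. summable (\<lambda>n. norm (indicator U x * (m n * indicator (A n) x * divergence \<phi> x)))"
    proof (rule AE_I2)
      fix x
      have "summable (\<lambda>n. indicator U x * (\<bar>m n * indicator (A n) x\<bar> * \<bar>divergence \<phi> x\<bar>))"
        by (intro summable_mult summable_mult2 v_summable)
      then show "summable (\<lambda>n. norm (indicator U x * (m n * indicator (A n) x * divergence \<phi> x)))"
        by (simp add: abs_mult)
    qed
    show "summable (\<lambda>n. LINT x|lebesgue. norm (indicator U x * (m n * indicator (A n) x * divergence \<phi> x)))"
      by (rule summable_comparison_test'[OF summable_mult2[OF m_summable], of 0]) (use f_norm in auto)
  qed
  also have "\<dots> = (\<Sum>n. - (LINT x|H. m n * (\<gamma> n x \<bullet> \<phi> x)))"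
  proof (intro suminf_cong)
    fix n
    have "(LINT x|lebesgue. indicator U x * (m n * indicator (A n) x * divergence \<phi> x))
        = m n * (LINT x:U|lebesgue. indicator (A n) x * divergence \<phi> x)"
      unfolding set_lebesgue_integral_def integral_mult_right_zero[symmetric]
      by (intro Bochner_Integration.integral_cong refl) simp
    also have "\<dots> = - (LINT x|H. m n * (\<gamma> n x \<bullet> \<phi> x))" unfolding gauss[OF \<phi>] by simp
    finally show "(LINT x|lebesgue. indicator U x * (m n * indicator (A n) x * divergence \<phi> x)) = - (LINT x|H. m n * (\<gamma> n x \<bullet> \<phi> x))" .
  qed
  finally have 1: "(LINT x:U|lebesgue. v x * divergence \<phi> x) = (\<Sum>n. - (LINT x|H. m n * (\<gamma> n x \<bullet> \<phi> x)))" .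
  have c_sum: "summable (\<lambda>n. LINT x|H. norm (m n * (\<gamma> n x \<bullet> \<phi> x)))"
    by (rule summable_comparison_test'[OF summable_mult2[OF m_summable], of 0]) (use c_norm[OF B(2)] in auto)
  have c_abs: "summable (\<lambda>n. \<bar>LINT x|H. m n * (\<gamma> n x \<bullet> \<phi> x)\<bar>)"
    by (rule summable_comparison_test'[OF c_sum, of 0]) (unfold real_norm_def abs_idempotent, rule integral_abs_bound)
  have cx_sum: "summable (\<lambda>n. norm (m n * (\<gamma> n x \<bullet> \<phi> x)))" for x
  proof (rule summable_comparison_test'[OF summable_mult2[OF G_summable[of x], of "norm (\<phi> x)"], of 0])
    show "norm (norm (m n * (\<gamma> n x \<bullet> \<phi> x))) \<le> norm (m n *\<^sub>R \<gamma> n x) * norm (\<phi> x)" for n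
      using mult_left_mono[OF Cauchy_Schwarz_ineq2, of "\<bar>m n\<bar>" "\<gamma> n x" "\<phi> x"] by (simp add: abs_mult mult.assoc)
  qed
  have "(LINT x|H. G x \<bullet> \<phi> x) = (LINT x|H. (\<Sum>n. m n * (\<gamma> n x \<bullet> \<phi> x)))"
  proof (intro Bochner_Integration.integral_cong refl)
    fix x
    have "(\<lambda>n. m n *\<^sub>R \<gamma> n x) sums G x" unfolding G_def by (rule summable_sums[OF summable_norm_cancel[OF G_summable]])
    then have "(\<lambda>n. (m n *\<^sub>R \<gamma> n x) \<bullet> \<phi> x) sums (G x \<bullet> \<phi> x)" by (rule bounded_linear.sums[OF bounded_linear_inner_left])
    then show "G x \<bullet> \<phi> x = (\<Sum>n. m n * (\<gamma> n x \<bullet> \<phi> x))" by (simp add: sums_iff)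
  qed
  also have "\<dots> = (\<Sum>n. LINT x|H. m n * (\<gamma> n x \<bullet> \<phi> x))"
    by (rule integral_suminf[OF c_int _ c_sum]) (use cx_sum in auto)
  finally show "(LINT x:U|lebesgue. v x * divergence \<phi> x) = - (LINT x|H. G x \<bullet> \<phi> x)"
    unfolding 1 using suminf_minus[OF summable_rabs_cancel[OF c_abs]] by simp
  assume n1: "\<And>x. norm (\<phi> x) \<le> 1"
  have "\<bar>LINT x:U|lebesgue. v x * divergence \<phi> x\<bar> \<le> (\<Sum>n. \<bar>- (LINT x|H. m n * (\<gamma> n x \<bullet> \<phi> x))\<bar>)"
    unfolding 1 by (rule summable_rabs) (use c_abs in simp)
  also have "\<dots> \<le> (\<Sum>n. \<bar>m n\<bar> * (1 * L))"
  proof (intro suminf_le)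
    show "\<bar>- (LINT x|H. m n * (\<gamma> n x \<bullet> \<phi> x))\<bar> \<le> \<bar>m n\<bar> * (1 * L)" for n
      using order_trans[OF integral_abs_bound c_norm[OF n1, of n, unfolded real_norm_def]] by simp
  qed (use c_abs summable_mult2[OF m_summable] in auto)
  also have "\<dots> = (\<Sum>n. \<bar>m n\<bar>) * L" using suminf_mult2[OF m_summable, of L] by simp
  finally show "\<bar>LINT x:U|lebesgue. v x * divergence \<phi> x\<bar> \<le> (\<Sum>n. \<bar>m n\<bar>) * L" .
qed

lemma v_BV: "BV U v"
  unfolding BV_def
proof
  have [measurable]: "U \<in> sets borel" "v \<in> borel_measurable borel" using U_open v_borel by auto
  have iU: "integrable lebesgue (indicat_real U)"
    using emeasure_bounded_finite[OF U_bounded] by (intro integrable_real_indicator) (auto simp: less_top)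
  show "set_integrable lebesgue U v"
    unfolding set_integrable_def
  proof (rule Bochner_Integration.integrable_bound[OF integrable_mult_right[OF iU, of "\<Sum>n. \<bar>m n\<bar>"]])
    show "(\<lambda>x. indicat_real U x *\<^sub>R v x) \<in> borel_measurable lebesgue"
      by (intro measurable_completion) measurable
    show "AE x in lebesgue. norm (indicat_real U x *\<^sub>R v x) \<le> norm ((\<Sum>n. \<bar>m n\<bar>) * indicat_real U x)"
      using v_bound order_trans[OF v_bound abs_ge_self] by (auto split: split_indicator)
  qed
  show "\<exists>M. \<forall>\<phi>. test_field U \<phi> \<and> (\<forall>x. norm (\<phi> x) \<le> 1) \<longrightarrow> (LINT x:U|lebesgue. v x * divergence \<phi> x) \<le> M"
  proof (intro exI allI impI)
    fix \<phi> assume "test_field U \<phi> \<and> (\<forall>x. norm (\<phi> x) \<le> 1)"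
    then have "\<bar>LINT x:U|lebesgue. v x * divergence \<phi> x\<bar> \<le> (\<Sum>n. \<bar>m n\<bar>) * L"
      by (intro integral_v_div(2)) auto
    then show "(LINT x:U|lebesgue. v x * divergence \<phi> x) \<le> (\<Sum>n. \<bar>m n\<bar>) * L" by (simp add: abs_le_iff)
  qed
qed

text \<open>At a jump the size is the norm of \<open>G\<close>, a series of masses times normals.
  The power passes inside the series by subadditivity, and norms in \<open>{0, 1}\<close> are
  unchanged by it, so only the masses acquire the exponent.\<close>

lemma jump_var_le:
  assumes \<theta>: "0 < \<theta>" "\<theta> \<le> 1"
  shows "jump_var \<theta> U v \<le> (\<Sum>n. ennreal (\<bar>m n\<bar> powr \<theta>) * (\<integral>\<^sup>+x. ennreal (norm (\<gamma> n x)) \<partial>H))"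
proof -
  have [measurable]: "\<gamma> n \<in> borel_measurable H" for n by (auto intro!: borel_H \<gamma>_borel)
  have "jump_var \<theta> U v \<le> (\<integral>\<^sup>+x. (\<Sum>n. ennreal (\<bar>m n\<bar> powr \<theta>) * ennreal (norm (\<gamma> n x))) \<partial>H)"
    unfolding jump_var_def H_def[symmetric]
  proof (rule nn_integral_mono_AE)
    have "AE x in H. x \<notin> N" by (rule AE_not_in[OF N_null])
    then show "AE x in H. ennreal (jump_size v x powr \<theta>) * indicator (jump_set U v) x
        \<le> (\<Sum>n. ennreal (\<bar>m n\<bar> powr \<theta>) * ennreal (norm (\<gamma> n x)))"
    proof eventually_elim
      case (elim x)
      show ?case
      proof (cases "x \<in> jump_set U v")
        case True
        then have xU: "x \<in> U" by (auto simp: jump_set_def)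
        with True elim no_jump have "G x \<noteq> 0" by blast
        from jump[OF xU elim this] obtain a b \<nu> where j: "approx_jump v x a b \<nu>" "G x = (a - b) *\<^sub>R \<nu>" by blast
        have "jump_size v x = norm (G x)"
          using jump_size_eq[OF v_borel j(1)] j by (simp add: approx_jump_def)
        also have "\<dots> \<le> (\<Sum>n. norm (m n *\<^sub>R \<gamma> n x))" unfolding G_def by (rule summable_norm[OF G_summable])
        finally have "jump_size v x powr \<theta> \<le> (\<Sum>n. norm (m n *\<^sub>R \<gamma> n x)) powr \<theta>"
          using \<theta> \<open>jump_size v x = norm (G x)\<close> by (intro powr_mono2) auto
        then have "ennreal (jump_size v x powr \<theta>) \<le> ennreal ((\<Sum>n. norm (m n *\<^sub>R \<gamma> n x)) powr \<theta>)" by (rule ennreal_leI)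
        also have "\<dots> \<le> (\<Sum>n. ennreal (norm (m n *\<^sub>R \<gamma> n x) powr \<theta>))"
          by (rule powr_suminf_le) (use \<theta> G_summable in auto)
        also have "\<dots> = (\<Sum>n. ennreal (\<bar>m n\<bar> powr \<theta>) * ennreal (norm (\<gamma> n x)))"
        proof (intro suminf_cong)
          fix n show "ennreal (norm (m n *\<^sub>R \<gamma> n x) powr \<theta>) = ennreal (\<bar>m n\<bar> powr \<theta>) * ennreal (norm (\<gamma> n x))"
            using \<gamma>_norm[of n x] by auto
        qed
        finally show ?thesis using True by simp
      qed simp
    qed
  qed
  also have "\<dots> = (\<Sum>n. ennreal (\<bar>m n\<bar> powr \<theta>) * (\<integral>\<^sup>+x. ennreal (norm (\<gamma> n x)) \<partial>H))"
    by (subst nn_integral_suminf) (auto simp: nn_integral_cmult)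
  finally show ?thesis .
qed

lemma v_SBV:
  assumes \<theta>: "0 < \<theta>" "\<theta> \<le> 1" and fin: "jump_var \<theta> U v < \<infinity>"
  shows "SBV \<theta> U v"
proof -
  interpret complete_measure H unfolding H_def by (rule complete_hausdorff)
  \<comment> \<open>\<open>SBV\<close> asks for a jump triple at every point of the jump set, also
    in the null set \<open>N\<close>, where \<open>G\<close> carries no information; there an
    arbitrary triple is taken.\<close>
  define g where "g x = (if x \<in> U - N then G x else (SOME y. \<exists>a b \<nu>. approx_jump v x a b \<nu> \<and> y = (a - b) *\<^sub>R \<nu>))" for x
  have g: "\<forall>x\<in>jump_set U v. \<exists>a b \<nu>. approx_jump v x a b \<nu> \<and> g x = (a - b) *\<^sub>R \<nu>"
  proof
    fix x assume x: "x \<in> jump_set U v"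
    show "\<exists>a b \<nu>. approx_jump v x a b \<nu> \<and> g x = (a - b) *\<^sub>R \<nu>"
    proof (cases "x \<in> U - N")
      case True
      then show ?thesis using jump[of x] no_jump[of x] x by (auto simp: g_def)
    next
      case False
      have "\<exists>y. \<exists>a b \<nu>. approx_jump v x a b \<nu> \<and> y = (a - b) *\<^sub>R \<nu>" using x by (auto simp: jump_set_def)
      from someI_ex[OF this] show ?thesis using False by (auto simp: g_def)
    qed
  qed
  have ae: "AE x in H. G x = indicator (jump_set U v) x *\<^sub>R g x"
    using AE_not_in[OF N_null]
  proof eventually_elim
    case (elim x)
    show ?case
    proof (cases "x \<in> U")
      case True
      show ?thesis
      proof (cases "G x = 0")
        case True then show ?thesis using no_jump[OF \<open>x \<in> U\<close> elim] by simp
      next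
        case False
        then have "x \<in> jump_set U v" using jump[OF True elim] True by (auto simp: jump_set_def)
        then show ?thesis using True elim by (simp add: g_def)
      qed
    next
      case False
      then show ?thesis using \<gamma>_U[OF False] by (auto simp: G_def jump_set_def)
    qed
  qed
  \<comment> \<open>Neither the jump set nor \<open>g\<close> is known to be Borel. Their product
    agrees almost everywhere with \<open>G\<close>, and the measure is complete.\<close>
  have meas: "(\<lambda>x. indicator (jump_set U v) x *\<^sub>R g x) \<in> borel_measurable H"
    by (rule measurable_AE_eq[OF borel_H[OF G_borel] ae]) auto
  have int: "set_integrable H (jump_set U v) g"
    unfolding set_integrable_def using G_integrable
    by (subst integrable_cong_AE[OF meas borel_H[OF G_borel]]) (use ae in \<open>auto elim: eventually_mono\<close>)
  have eq: "(LINT x:jump_set U v|H. g x \<bullet> \<phi> x) = (LINT x|H. G x \<bullet> \<phi> x)" if \<phi>: "test_field U \<phi>" for \<phi>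
    unfolding set_lebesgue_integral_def
  proof (rule integral_cong_AE)
    have \<phi>m: "\<phi> \<in> borel_measurable H" by (intro borel_H test_field_borel[OF \<phi>])
    have "(\<lambda>x. (indicator (jump_set U v) x *\<^sub>R g x) \<bullet> \<phi> x) \<in> borel_measurable H"
      by (intro borel_measurable_inner meas \<phi>m)
    then show "(\<lambda>x. indicat_real (jump_set U v) x *\<^sub>R (g x \<bullet> \<phi> x)) \<in> borel_measurable H" by simp
    show "(\<lambda>x. G x \<bullet> \<phi> x) \<in> borel_measurable H" by (intro borel_measurable_inner borel_H[OF G_borel] \<phi>m)
    show "AE x in H. indicat_real (jump_set U v) x *\<^sub>R (g x \<bullet> \<phi> x) = G x \<bullet> \<phi> x"
      using ae by eventually_elim simp
  qed
  show ?thesis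
    unfolding SBV_def H_def[symmetric]
    using v_BV g int eq integral_v_div(1) fin by (intro conjI exI[of _ g]) auto
qed

end

text \<open>Beyond some index the masses contribute little, uniformly in \<open>y\<close>; each of
  the finitely many earlier sets is all or nothing on a small ball once \<open>P\<close> cuts out
  one side of \<open>x\<close>.\<close>

lemma atom_sum_limit:
  fixes x :: "'a::metric_space" and A :: "nat \<Rightarrow> 'a set"
  assumes sm: "summable (\<lambda>n. \<bar>m n :: real\<bar>)"
    and loc: "\<And>n. \<exists>r>0. \<forall>y\<in>ball x r. P y \<longrightarrow> (y \<in> A n \<longleftrightarrow> B n)" and e: "e > 0"
  shows "\<exists>r>0. \<forall>y\<in>ball x r. P y \<longrightarrow> \<bar>(\<Sum>n. m n * indicator (A n) y) - (\<Sum>n. m n * of_bool (B n))\<bar> \<le> e"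
proof -
  obtain R where R: "\<And>n. R n > 0" "\<And>n y. y \<in> ball x (R n) \<Longrightarrow> P y \<Longrightarrow> (y \<in> A n \<longleftrightarrow> B n)" using loc by metis
  have "(\<lambda>k. \<Sum>n. \<bar>m (n + k)\<bar>) \<longlonglongrightarrow> 0" using sm by (rule suminf_exist_split2)
  then have "eventually (\<lambda>k. (\<Sum>n. \<bar>m (n + k)\<bar>) < e) sequentially" using e by (rule order_tendstoD(2))
  then obtain k where k: "(\<Sum>n. \<bar>m (n + k)\<bar>) < e" by (auto simp: eventually_sequentially)
  define r where "r = Min (insert 1 (R ` {..<k}))"
  have r: "r > 0" "\<And>n. n < k \<Longrightarrow> r \<le> R n" using R by (auto simp: r_def)
  show ?thesis
  proof (intro exI[of _ r] conjI r(1) ballI impI)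
    fix y assume y: "y \<in> ball x r" "P y"
    define d where "d n = m n * indicator (A n) y - m n * of_bool (B n)" for n
    have d: "\<bar>d n\<bar> \<le> \<bar>m n\<bar>" for n by (auto simp: d_def split: split_indicator)
    have d0: "d n = 0" if "n < k" for n
      using R(2)[of y n] y r(2)[OF that] by (auto simp: d_def split: split_indicator)
    have s1: "summable (\<lambda>n. m n * indicator (A n) y)" "summable (\<lambda>n. m n * of_bool (B n))"
      by (rule summable_comparison_test'[OF sm, of 0]; auto simp: abs_mult split: split_indicator)+
    have s2: "summable (\<lambda>n. \<bar>d n\<bar>)" by (rule summable_comparison_test'[OF sm, of 0]) (use d in auto)
    have s3: "summable (\<lambda>n. \<bar>d (n + k)\<bar>)" using s2 by (rule summable_ignore_initial_segment)
    have "(\<Sum>n. m n * indicator (A n) y) - (\<Sum>n. m n * of_bool (B n)) = (\<Sum>n. d n)"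
      unfolding d_def by (rule suminf_diff[OF s1])
    also have "\<dots> = (\<Sum>n. d (n + k)) + sum d {..<k}"
      by (rule suminf_split_initial_segment) (use s2 summable_rabs_cancel in blast)
    also have "sum d {..<k} = 0" using d0 by simp
    finally have "\<bar>(\<Sum>n. m n * indicator (A n) y) - (\<Sum>n. m n * of_bool (B n))\<bar> = \<bar>\<Sum>n. d (n + k)\<bar>" by simp
    also have "\<dots> \<le> (\<Sum>n. \<bar>d (n + k)\<bar>)" by (rule summable_rabs[OF s3])
    also have "\<dots> \<le> (\<Sum>n. \<bar>m (n + k)\<bar>)"
      by (intro suminf_le d s3 summable_ignore_initial_segment[OF sm])
    finally show "\<bar>(\<Sum>n. m n * indicator (A n) y) - (\<Sum>n. m n * of_bool (B n))\<bar> \<le> e" using k by simp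
  qed
qed

text \<open>The second side contains the hyperplane, in accordance with the open half-lines and
  quadrants, so that the two sides exhaust a ball. If the limits agree, \<open>near_values\<close>
  with two equal values excludes a jump in every direction.\<close>

lemma two_sided_limits_jump:
  fixes x :: "'a::euclidean_space"
  assumes v: "v \<in> borel_measurable borel" and \<nu>: "norm \<nu> = 1"
    and p: "\<And>e. e > 0 \<Longrightarrow> \<exists>r>0. \<forall>y\<in>ball x r. (y - x) \<bullet> \<nu> > 0 \<longrightarrow> \<bar>v y - c1\<bar> \<le> e"
    and q: "\<And>e. e > 0 \<Longrightarrow> \<exists>r>0. \<forall>y\<in>ball x r. (y - x) \<bullet> \<nu> \<le> 0 \<longrightarrow> \<bar>v y - c2\<bar> \<le> e"
  shows "c1 \<noteq> c2 \<Longrightarrow> approx_jump v x c1 c2 \<nu>" "c1 = c2 \<Longrightarrow> \<not> approx_jump v x a b \<mu>"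
proof -
  assume ne: "c1 \<noteq> c2"
  show "approx_jump v x c1 c2 \<nu>"
  proof (rule approx_jumpI[OF ne \<nu>])
    fix e :: real assume "e > 0"
    then obtain r where "r > 0" "\<forall>y\<in>ball x r. (y - x) \<bullet> \<nu> > 0 \<longrightarrow> \<bar>v y - c1\<bar> \<le> e" using p by blast
    then show "\<exists>r>0. AE y in lebesgue. y \<in> ball x r \<longrightarrow> (y - x) \<bullet> \<nu> > 0 \<longrightarrow> \<bar>v y - c1\<bar> \<le> e"
      by (intro exI[of _ r] conjI AE_I2) auto
    obtain r where "r > 0" "\<forall>y\<in>ball x r. (y - x) \<bullet> \<nu> \<le> 0 \<longrightarrow> \<bar>v y - c2\<bar> \<le> e" using q[OF \<open>e > 0\<close>] by blast
    then show "\<exists>r>0. AE y in lebesgue. y \<in> ball x r \<longrightarrow> (y - x) \<bullet> \<nu> < 0 \<longrightarrow> \<bar>v y - c2\<bar> \<le> e"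
      by (intro exI[of _ r] conjI AE_I2) auto
  qed
next
  assume eq: "c1 = c2"
  have nv: "near_values v x c1 c1"
  proof (rule near_valuesI)
    fix e :: real assume e: "e > 0"
    obtain r1 where r1: "r1 > 0" "\<And>y. y \<in> ball x r1 \<Longrightarrow> (y - x) \<bullet> \<nu> > 0 \<Longrightarrow> \<bar>v y - c1\<bar> \<le> e" using p[OF e] by blast
    obtain r2 where r2: "r2 > 0" "\<And>y. y \<in> ball x r2 \<Longrightarrow> (y - x) \<bullet> \<nu> \<le> 0 \<Longrightarrow> \<bar>v y - c2\<bar> \<le> e" using q[OF e] by blast
    show "\<exists>r>0. AE y in lebesgue. y \<in> ball x r \<longrightarrow> \<bar>v y - c1\<bar> \<le> e \<or> \<bar>v y - c1\<bar> \<le> e"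
    proof (intro exI[of _ "min r1 r2"] conjI AE_I2 impI)
      show "y \<in> ball x (min r1 r2) \<Longrightarrow> \<bar>v y - c1\<bar> \<le> e \<or> \<bar>v y - c1\<bar> \<le> e" for y
        using r1(2)[of y] r2(2)[of y] eq by (cases "(y - x) \<bullet> \<nu> > 0") auto
    qed (use r1 r2 in auto)
  qed
  show "\<not> approx_jump v x a b \<mu>"
  proof
    assume j: "approx_jump v x a b \<mu>"
    from approx_jump_values(1)[OF v nv j] have "a = b" by auto
    then show False using j by (simp add: approx_jump_def)
  qed
qed

section \<open>Gauss-Green formula for half-lines and quadrants\<close>

lemma FTC_halfline:
  fixes f f' :: "real \<Rightarrow> real"
  assumes d: "\<And>t. (f has_real_derivative f' t) (at t)" and c: "continuous_on UNIV f'"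
    and z: "\<And>t. \<bar>t\<bar> > R \<Longrightarrow> f t = 0" "\<And>t. \<bar>t\<bar> > R \<Longrightarrow> f' t = 0"
  shows "(LINT t|lborel. indicator {p<..} t * f' t) = - f p" "(LINT t|lborel. f' t) = 0"
proof -
  have FTC: "has_bochner_integral lborel (\<lambda>x. f' x * indicator {a .. b} x) (f b - f a)" if "a \<le> b" for a b
    using d c that by (intro has_bochner_integral_FTC_Icc_real) (auto simp: continuous_on_eq_continuous_at)
  define b where "b = \<bar>R\<bar> + \<bar>p\<bar> + 1"
  have b: "f b = 0" "f (- b) = 0" using z(1)[of b] z(1)[of "-b"] by (auto simp: b_def)
  have "(LINT t|lborel. indicator {p<..} t * f' t) = (LINT t|lborel. f' t * indicator {p .. b} t)"
  proof (rule integral_cong_AE)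
    have f'm: "f' \<in> borel_measurable borel" using c by (rule borel_measurable_continuous_onI)
    then show "(\<lambda>t. indicator {p<..} t * f' t) \<in> borel_measurable lborel" "(\<lambda>t. f' t * indicator {p..b} t) \<in> borel_measurable lborel"
      by measurable
    have "AE t in lborel. t \<noteq> p" by (rule AE_lborel_singleton)
    then show "AE t in lborel. indicator {p<..} t * f' t = f' t * indicator {p..b} t"
    proof eventually_elim
      case (elim t)
      then show ?case using z(2)[of t] by (auto simp: b_def split: split_indicator)
    qed
  qed
  also have "\<dots> = f b - f p" by (rule has_bochner_integral_integral_eq[OF FTC]) (auto simp: b_def)
  finally show "(LINT t|lborel. indicator {p<..} t * f' t) = - f p" using b by simp
  have "f' = (\<lambda>x. f' x * indicator {- b .. b} x)" using z(2) by (force simp: b_def split: split_indicator)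
  moreover have "has_bochner_integral lborel (\<lambda>x. f' x * indicator {- b .. b} x) (f b - f (- b))"
    by (rule FTC) (simp add: b_def)
  ultimately have "has_bochner_integral lborel f' 0" using b by simp
  then show "(LINT t|lborel. f' t) = 0" by (simp add: has_bochner_integral_iff)
qed

lemma has_real_derivative_line:
  assumes "(\<phi> has_derivative D) (at (x + t *\<^sub>R b))"
  shows "((\<lambda>t. \<phi> (x + t *\<^sub>R b)) has_real_derivative D b) (at t)"
proof -
  have "((\<lambda>t. \<phi> (x + t *\<^sub>R b)) has_derivative (\<lambda>h. D (h *\<^sub>R b))) (at t)"
    by (rule has_derivative_compose[of "\<lambda>t. x + t *\<^sub>R b" "\<lambda>h. h *\<^sub>R b", OF _ assms]) (auto intro!: derivative_eq_intros)
  moreover have "D (h *\<^sub>R b) = h * D b" for h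
    using linear_cmul[OF has_derivative_linear[OF assms]] by simp
  moreover have "(\<lambda>h. h * D b) = (\<lambda>h. D b * h)" by (simp add: fun_eq_iff)
  ultimately show ?thesis by (simp add: has_field_derivative_def)
qed

lemma test_fun_halfline:
  fixes \<phi> :: "'a::euclidean_space \<Rightarrow> real"
  assumes \<phi>: "test_fun U \<phi>" and b: "b \<in> Basis"
  shows "(LINT t|lborel. indicator {p<..} t * pd b \<phi> (x + t *\<^sub>R b)) = - \<phi> (x + p *\<^sub>R b)"
    "(LINT t|lborel. pd b \<phi> (x + t *\<^sub>R b)) = 0"
proof -
  note \<phi>' = test_fun_pd[OF \<phi> b]
  obtain R1 where R1: "\<And>x. norm x > R1 \<Longrightarrow> \<phi> x = 0" using test_fun_bounded[OF \<phi>] by metis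
  obtain R2 where R2: "\<And>x. norm x > R2 \<Longrightarrow> pd b \<phi> x = 0" using test_fun_bounded[OF \<phi>'] by metis
  define R where "R = max R1 R2 + norm x"
  have far: "norm (x + t *\<^sub>R b) > max R1 R2" if "\<bar>t\<bar> > R" for t
  proof -
    have "norm (t *\<^sub>R b) - norm x \<le> norm (x + t *\<^sub>R b)" using norm_diff_ineq[of "t *\<^sub>R b" x] by (simp add: add.commute)
    moreover have "norm (t *\<^sub>R b) = \<bar>t\<bar>" using b by simp
    ultimately show ?thesis using that unfolding R_def by linarith
  qed
  have d: "((\<lambda>t. \<phi> (x + t *\<^sub>R b)) has_real_derivative pd b \<phi> (x + t *\<^sub>R b)) (at t)" for t
    unfolding pd_def by (rule has_real_derivative_line[OF test_fun_differentiable[OF \<phi>]])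
  have c: "continuous_on UNIV (\<lambda>t. pd b \<phi> (x + t *\<^sub>R b))"
    by (rule continuous_on_compose2[OF test_fun_continuous[OF \<phi>']]) (auto intro!: continuous_intros)
  have z: "\<bar>t\<bar> > R \<Longrightarrow> \<phi> (x + t *\<^sub>R b) = 0" "\<bar>t\<bar> > R \<Longrightarrow> pd b \<phi> (x + t *\<^sub>R b) = 0" for t
    using R1 R2 far[of t] by auto
  show "(LINT t|lborel. indicator {p<..} t * pd b \<phi> (x + t *\<^sub>R b)) = - \<phi> (x + p *\<^sub>R b)"
    "(LINT t|lborel. pd b \<phi> (x + t *\<^sub>R b)) = 0"
    using FTC_halfline[OF d c z] by auto
qed

lemma set_lebesgue_test:
  assumes "f \<in> borel_measurable borel" "\<And>x. x \<notin> U \<Longrightarrow> f x = (0::real)"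
  shows "(LINT x:U|lebesgue. f x) = (LINT x|lborel. f x)"
proof -
  have "(LINT x:U|lebesgue. f x) = (LINT x|lebesgue. f x)"
    unfolding set_lebesgue_integral_def using assms(2)
    by (intro Bochner_Integration.integral_cong) (auto split: split_indicator)
  then show ?thesis using assms(1) by (simp add: integral_completion)
qed

text \<open>Each half-line has the single boundary point \<open>p n\<close>, which has counting
  measure 1, so the exceptional set is empty. The power sum runs only over atoms inside the
  interval; this leaves room for an atom outside it that acts as a constant.\<close>

lemma atoms_1d:
  fixes m p :: "nat \<Rightarrow> real"
  assumes sm: "summable (\<lambda>n. \<bar>m n\<bar>)" and \<theta>: "0 < \<theta>" "\<theta> \<le> 1"
    and fin: "(\<Sum>n. ennreal (\<bar>m n\<bar> powr \<theta>) * indicator {a<..<b} (p n)) < \<infinity>"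
  shows "SBV \<theta> {a<..<b} (\<lambda>x. \<Sum>n. m n * indicator {p n<..} x)"
    "jump_var \<theta> {a<..<b} (\<lambda>x. \<Sum>n. m n * indicator {p n<..} x) \<le> (\<Sum>n. ennreal (\<bar>m n\<bar> powr \<theta>) * indicator {a<..<b} (p n))"
proof -
  define \<gamma> :: "nat \<Rightarrow> real \<Rightarrow> real" where "\<gamma> n x = indicator {a<..<b} (p n) * indicator {p n} x" for n x
  let ?H = "hausdorff_measure 0 :: real measure"
  have sing [measurable]: "{x} \<in> sets ?H" for x
    using borel_sets_hausdorff[of 0, where 'a = real] by (rule subsetD) simp
  have mass: "(\<integral>\<^sup>+x. ennreal (norm (\<gamma> n x)) \<partial>?H) = indicator {a<..<b} (p n)" for n
  proof -
    have "(\<integral>\<^sup>+x. ennreal (norm (\<gamma> n x)) \<partial>?H) = (\<integral>\<^sup>+x. indicator {a<..<b} (p n) * indicator {p n} x \<partial>?H)"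
      by (intro nn_integral_cong) (auto simp: \<gamma>_def split: split_indicator)
    also have "\<dots> = indicator {a<..<b} (p n)" by (simp add: nn_integral_cmult_indicator emeasure_hausdorff_0_singleton)
    finally show ?thesis .
  qed
  define v where "v = (\<lambda>x. \<Sum>n. m n * indicator {p n<..} x)"
  define G where "G = (\<lambda>x. \<Sum>n. m n *\<^sub>R \<gamma> n x)"
  have jump: "(G x \<noteq> 0 \<longrightarrow> (\<exists>a b \<nu>. approx_jump v x a b \<nu> \<and> G x = (a - b) *\<^sub>R \<nu>)) \<and> (G x = 0 \<longrightarrow> x \<notin> jump_set {a<..<b} v)"
    if x: "x \<in> {a<..<b}" for x
  proof -
    define c1 where "c1 = (\<Sum>n. m n * of_bool (p n \<le> x))"
    define c2 where "c2 = (\<Sum>n. m n * of_bool (p n < x))"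
    have s: "summable (\<lambda>n. m n * of_bool (p n \<le> x))" "summable (\<lambda>n. m n * of_bool (p n < x))"
      by (rule summable_comparison_test'[OF sm, of 0]; simp add: abs_mult)+
    have G: "G x = c1 - c2"
      unfolding G_def c1_def c2_def suminf_diff[OF s]
      using x by (intro suminf_cong) (auto simp: \<gamma>_def split: split_indicator)
    have vb: "v \<in> borel_measurable borel" unfolding v_def by measurable
    have lim1: "\<exists>r>0. \<forall>y\<in>ball x r. (y - x) \<bullet> 1 > 0 \<longrightarrow> \<bar>v y - c1\<bar> \<le> e" if "e > 0" for e
      unfolding v_def c1_def
    proof (rule atom_sum_limit[OF sm _ that])
      fix n
      show "\<exists>r>0. \<forall>y\<in>ball x r. (y - x) \<bullet> 1 > 0 \<longrightarrow> (y \<in> {p n<..} \<longleftrightarrow> p n \<le> x)"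
        by (intro exI[of _ "if p n \<le> x then 1 else p n - x"]) (auto simp: dist_real_def)
    qed
    have lim2: "\<exists>r>0. \<forall>y\<in>ball x r. (y - x) \<bullet> 1 \<le> 0 \<longrightarrow> \<bar>v y - c2\<bar> \<le> e" if "e > 0" for e
      unfolding v_def c2_def
    proof (rule atom_sum_limit[OF sm _ that])
      fix n
      show "\<exists>r>0. \<forall>y\<in>ball x r. (y - x) \<bullet> 1 \<le> 0 \<longrightarrow> (y \<in> {p n<..} \<longleftrightarrow> p n < x)"
        by (intro exI[of _ "if p n < x then x - p n else 1"]) (auto simp: dist_real_def)
    qed
    note J = two_sided_limits_jump[OF vb _ lim1 lim2]
    show ?thesis
    proof (intro conjI impI)
      assume "G x \<noteq> 0"
      then show "\<exists>a b \<nu>. approx_jump v x a b \<nu> \<and> G x = (a - b) *\<^sub>R \<nu>"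
        using J(1) G by (intro exI[of _ c1] exI[of _ c2] exI[of _ "1::real"]) auto
    next
      assume "G x = 0"
      then show "x \<notin> jump_set {a<..<b} v" using J(2) G by (auto simp: jump_set_def)
    qed
  qed
  interpret S: atom_series "{a<..<b}" m "\<lambda>n. {p n<..}" \<gamma> 1 ?H "{}" v G
  proof
    show "(\<integral>\<^sup>+x. ennreal (norm (\<gamma> n x)) \<partial>?H) \<le> ennreal 1" for n
      unfolding mass by (auto split: split_indicator)
    fix n and \<phi> :: "real \<Rightarrow> real" assume \<phi>: "test_field {a<..<b} \<phi>"
    have tf: "test_fun {a<..<b} \<phi>" using test_field_components[OF \<phi>, of 1] by simp
    have [measurable]: "divergence \<phi> \<in> borel_measurable borel" by (rule divergence_properties[OF \<phi>])
    have "(LINT x:{a<..<b}|lebesgue. indicator {p n<..} x * divergence \<phi> x) = (LINT x|lborel. indicator {p n<..} x * divergence \<phi> x)"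
      using divergence_properties(3)[OF \<phi>] by (intro set_lebesgue_test) auto
    also have "\<dots> = - \<phi> (p n)"
      using test_fun_halfline(1)[OF tf, of 1 "p n" 0] by (simp add: divergence_def)
    also have "\<phi> (p n) = (LINT x|?H. \<gamma> n x \<bullet> \<phi> x)"
    proof -
      have "(LINT x|?H. \<gamma> n x \<bullet> \<phi> x) = (LINT x|?H. \<phi> (p n) * indicator {p n} x)"
        using test_fun_eq_0[OF tf, of "p n"]
        by (intro Bochner_Integration.integral_cong) (auto simp: \<gamma>_def split: split_indicator)
      also have "\<dots> = \<phi> (p n)" by (simp add: measure_def emeasure_hausdorff_0_singleton)
      finally show ?thesis by simp
    qed
    finally show "(LINT x:{a<..<b}|lebesgue. indicator {p n<..} x * divergence \<phi> x) = - (LINT x|?H. \<gamma> n x \<bullet> \<phi> x)" .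
  next
    show "\<gamma> n \<in> borel_measurable borel" for n unfolding \<gamma>_def by measurable
  qed (use sm jump v_def G_def in \<open>auto simp: \<gamma>_def split: split_indicator\<close>)
  have jv: "jump_var \<theta> {a<..<b} v \<le> (\<Sum>n. ennreal (\<bar>m n\<bar> powr \<theta>) * indicator {a<..<b} (p n))"
    using S.jump_var_le[OF \<theta>] unfolding mass .
  then show "jump_var \<theta> {a<..<b} (\<lambda>x. \<Sum>n. m n * indicator {p n<..} x) \<le> (\<Sum>n. ennreal (\<bar>m n\<bar> powr \<theta>) * indicator {a<..<b} (p n))"
    unfolding v_def .
  show "SBV \<theta> {a<..<b} (\<lambda>x. \<Sum>n. m n * indicator {p n<..} x)"
    using S.v_SBV[OF \<theta>] jv fin unfolding v_def by (auto intro: le_less_trans)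
qed

lemma sets_borel_real_pair [measurable_cong]:
  "sets (borel :: (real \<times> real) measure) = sets (borel \<Otimes>\<^sub>M borel)"
  by (subst borel_prod) (rule refl)

lemma inner_real_pair [simp]:
  "(y :: real \<times> real) \<bullet> (1, 0) = fst y" "(y :: real \<times> real) \<bullet> (0, 1) = snd y"
  by (auto simp: inner_prod_def)

lemma test_fun_mult_integrable:
  fixes \<psi> :: "'a::euclidean_space \<Rightarrow> real"
  assumes \<psi>: "test_fun U \<psi>" and h: "h \<in> borel_measurable borel" "\<And>x. \<bar>h x\<bar> \<le> C"
  shows "integrable lborel (\<lambda>x. h x * \<psi> x)"
proof -
  obtain B where B: "B > 0" "\<And>x. \<bar>\<psi> x\<bar> \<le> B" "\<And>x. norm x > B \<Longrightarrow> \<psi> x = 0" using test_fun_bounded[OF \<psi>] by metis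
  have [measurable]: "\<psi> \<in> borel_measurable borel" "h \<in> borel_measurable borel" using test_fun_borel[OF \<psi>] h by auto
  have i: "integrable lborel (indicat_real (cball 0 B :: 'a set))"
    using emeasure_bounded_finite[of "cball (0::'a) B"] by (intro integrable_real_indicator) (auto simp: less_top)
  show ?thesis
  proof (rule Bochner_Integration.integrable_bound[OF integrable_mult_right[OF i, of "C * B"]])
    have C: "0 \<le> C" by (rule order_trans[OF abs_ge_zero h(2)])
    have "\<bar>h x * \<psi> x\<bar> \<le> \<bar>C * B * indicator (cball 0 B) x\<bar>" for x
    proof (cases "norm x > B")
      case False
      then show ?thesis using B h(2)[of x] C by (auto simp: abs_mult intro!: mult_mono)
    qed (use B in simp)
    then show "AE x in lborel. norm (h x * \<psi> x) \<le> norm (C * B * indicator (cball 0 B) x)" by simp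
  qed measurable
qed

lemma lborel_fubini:
  fixes f :: "real \<times> real \<Rightarrow> real"
  assumes "integrable lborel f"
  shows "(LINT x|lborel. f x) = (LINT t|lborel. LINT s|lborel. f (s, t))"
    "(LINT x|lborel. f x) = (LINT s|lborel. LINT t|lborel. f (s, t))"
proof -
  have f: "integrable (lborel \<Otimes>\<^sub>M lborel) f" using assms by (simp add: lborel_prod)
  then have f': "integrable (lborel \<Otimes>\<^sub>M lborel) (\<lambda>(s, t). f (s, t))" by simp
  show "(LINT x|lborel. f x) = (LINT t|lborel. LINT s|lborel. f (s, t))"
    using lborel_pair.integral_snd[OF f'] by (simp add: lborel_prod)
  show "(LINT x|lborel. f x) = (LINT s|lborel. LINT t|lborel. f (s, t))"
    using lborel_pair.integral_fst'[OF f] by (simp add: lborel_prod)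
qed

text \<open>The inner integral of Fubini runs in the direction of the derivative, so the factor that
  depends on the other variable comes out and the fundamental theorem applies on each line.\<close>

lemma test_fun_quadrant:
  fixes \<phi> :: "real \<times> real \<Rightarrow> real"
  assumes \<phi>: "test_fun U \<phi>" and g: "g \<in> borel_measurable borel" "\<And>t. \<bar>g t\<bar> \<le> C"
  shows "(LINT x|lborel. indicator {p<..} (fst x) * g (snd x) * pd (1, 0) \<phi> x) = - (LINT t|lborel. g t * \<phi> (p, t))"
    "(LINT x|lborel. indicator {p<..} (snd x) * g (fst x) * pd (0, 1) \<phi> x) = - (LINT t|lborel. g t * \<phi> (t, p))"
    "(LINT x|lborel. g (snd x) * pd (1, 0) \<phi> x) = 0"
    "(LINT x|lborel. g (fst x) * pd (0, 1) \<phi> x) = 0"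
proof -
  have b: "(1::real, 0::real) \<in> Basis" "(0::real, 1::real) \<in> Basis" by (auto simp: Basis_prod_def)
  have [measurable]: "g \<in> borel_measurable borel" by (rule g)
  have gi: "\<bar>indicator S s * g t\<bar> \<le> C" for S s t using g(2)[of t] order_trans[OF abs_ge_zero g(2)] by (auto split: split_indicator)
  note H1 = test_fun_halfline[OF \<phi> b(1)] and H2 = test_fun_halfline[OF \<phi> b(2)]
  show "(LINT x|lborel. indicator {p<..} (fst x) * g (snd x) * pd (1, 0) \<phi> x) = - (LINT t|lborel. g t * \<phi> (p, t))"
  proof (subst lborel_fubini(1))
    show "integrable lborel (\<lambda>x. indicator {p<..} (fst x) * g (snd x) * pd (1, 0) \<phi> x)"
      by (rule test_fun_mult_integrable[OF test_fun_pd[OF \<phi> b(1)]]) (use gi in auto)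
    have "(LINT s|lborel. indicator {p<..} s * g t * pd (1, 0) \<phi> (s, t)) = - (g t * \<phi> (p, t))" for t
    proof -
      have "(LINT s|lborel. indicator {p<..} s * g t * pd (1, 0) \<phi> (s, t)) = (LINT s|lborel. g t * (indicator {p<..} s * pd (1, 0) \<phi> ((0, t) + s *\<^sub>R (1, 0))))"
        by (simp add: mult_ac)
      also have "\<dots> = g t * - \<phi> ((0, t) + p *\<^sub>R (1, 0))" unfolding integral_mult_right_zero H1(1) ..
      finally show ?thesis by simp
    qed
    then show "(LINT t|lborel. LINT s|lborel. indicator {p<..} (fst (s, t)) * g (snd (s, t)) * pd (1, 0) \<phi> (s, t)) = - (LINT t|lborel. g t * \<phi> (p, t))"
      by simp
  qed
  show "(LINT x|lborel. indicator {p<..} (snd x) * g (fst x) * pd (0, 1) \<phi> x) = - (LINT t|lborel. g t * \<phi> (t, p))"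
  proof (subst lborel_fubini(2))
    show "integrable lborel (\<lambda>x. indicator {p<..} (snd x) * g (fst x) * pd (0, 1) \<phi> x)"
      by (rule test_fun_mult_integrable[OF test_fun_pd[OF \<phi> b(2)]]) (use gi in auto)
    have "(LINT s|lborel. indicator {p<..} s * g t * pd (0, 1) \<phi> (t, s)) = - (g t * \<phi> (t, p))" for t
    proof -
      have "(LINT s|lborel. indicator {p<..} s * g t * pd (0, 1) \<phi> (t, s)) = (LINT s|lborel. g t * (indicator {p<..} s * pd (0, 1) \<phi> ((t, 0) + s *\<^sub>R (0, 1))))"
        by (simp add: mult_ac)
      also have "\<dots> = g t * - \<phi> ((t, 0) + p *\<^sub>R (0, 1))" unfolding integral_mult_right_zero H2(1) ..
      finally show ?thesis by simp
    qed
    then show "(LINT s|lborel. LINT t|lborel. indicator {p<..} (snd (s, t)) * g (fst (s, t)) * pd (0, 1) \<phi> (s, t)) = - (LINT t|lborel. g t * \<phi> (t, p))"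
      by simp
  qed
  show "(LINT x|lborel. g (snd x) * pd (1, 0) \<phi> x) = 0"
  proof (subst lborel_fubini(1))
    show "integrable lborel (\<lambda>x. g (snd x) * pd (1, 0) \<phi> x)"
      by (rule test_fun_mult_integrable[OF test_fun_pd[OF \<phi> b(1)]]) (use g in auto)
    show "(LINT t|lborel. LINT s|lborel. g (snd (s, t)) * pd (1, 0) \<phi> (s, t)) = 0"
      using H1(2)[of "(0, t)" for t] by simp
  qed
  show "(LINT x|lborel. g (fst x) * pd (0, 1) \<phi> x) = 0"
  proof (subst lborel_fubini(2))
    show "integrable lborel (\<lambda>x. g (fst x) * pd (0, 1) \<phi> x)"
      by (rule test_fun_mult_integrable[OF test_fun_pd[OF \<phi> b(2)]]) (use g in auto)
    show "(LINT s|lborel. LINT t|lborel. g (fst (s, t)) * pd (0, 1) \<phi> (s, t)) = 0"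
      using H2(2)[of "(s, 0)" for s] by simp
  qed
qed

definition quadrant :: "real \<Rightarrow> real \<Rightarrow> (real \<times> real) set" where
  "quadrant p q = {p<..} \<times> {q<..}"

lemma quadrant_borel [measurable, simp]: "quadrant p q \<in> sets borel"
  by (simp add: quadrant_def borel_Times)

lemma indicator_quadrant: "indicat_real (quadrant p q) x = indicator {p<..} (fst x) * indicator {q<..} (snd x)"
  by (cases x) (auto simp: quadrant_def split: split_indicator)

lemma box2_open [simp]: "open (box2 a1 b1 a2 b2)"
  by (simp add: box2_def open_Times)

lemma box2_bounded [simp]: "bounded (box2 a1 b1 a2 b2)"
  by (simp add: box2_def bounded_Times)

lemma box2_borel [measurable, simp]: "box2 a1 b1 a2 b2 \<in> sets borel"
  by (intro borel_open box2_open)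

text \<open>If no \<open>q k\<close> equals the height of \<open>x\<close>, every vertical
  constraint is decided near \<open>x\<close>, and only the edges over \<open>fst x\<close> separate
  the two sides. The two limits then differ by the atoms with \<open>p n = fst x\<close> and
  \<open>q n < snd x\<close>.\<close>

lemma quadrant_limits_1:
  assumes sm: "summable (\<lambda>n. \<bar>m n :: real\<bar>)" and gen: "\<And>k. q k \<noteq> snd x" and e: "e > 0"
  shows "\<exists>r>0. \<forall>y\<in>ball x r. (y - x) \<bullet> (1, 0) > 0 \<longrightarrow>
      \<bar>(\<Sum>n. m n * indicator (quadrant (p n) (q n)) y) - (\<Sum>n. m n * of_bool (p n \<le> fst x \<and> q n < snd x))\<bar> \<le> e" (is ?A)
    and "\<exists>r>0. \<forall>y\<in>ball x r. (y - x) \<bullet> (1, 0) \<le> 0 \<longrightarrow>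
      \<bar>(\<Sum>n. m n * indicator (quadrant (p n) (q n)) y) - (\<Sum>n. m n * of_bool (p n < fst x \<and> q n < snd x))\<bar> \<le> e" (is ?B)
proof -
  have ball: "\<bar>fst y - fst x\<bar> < r \<and> \<bar>snd y - snd x\<bar> < r" if "y \<in> ball x r" for y r
    using that dist_fst_le[of x y] dist_snd_le[of x y] by (auto simp: dist_real_def abs_minus_commute)
  show ?A
  proof (rule atom_sum_limit[OF sm _ e])
    fix n
    show "\<exists>r>0. \<forall>y\<in>ball x r. (y - x) \<bullet> (1, 0) > 0 \<longrightarrow> (y \<in> quadrant (p n) (q n) \<longleftrightarrow> p n \<le> fst x \<and> q n < snd x)"
      using gen[of n]
      by (intro exI[of _ "min \<bar>q n - snd x\<bar> (if p n \<le> fst x then 1 else p n - fst x)"])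
         (auto dest!: ball simp: quadrant_def mem_Times_iff)
  qed
  show ?B
  proof (rule atom_sum_limit[OF sm _ e])
    fix n
    show "\<exists>r>0. \<forall>y\<in>ball x r. (y - x) \<bullet> (1, 0) \<le> 0 \<longrightarrow> (y \<in> quadrant (p n) (q n) \<longleftrightarrow> p n < fst x \<and> q n < snd x)"
      using gen[of n]
      by (intro exI[of _ "min \<bar>q n - snd x\<bar> (if p n < fst x then fst x - p n else 1)"])
         (auto dest!: ball simp: quadrant_def mem_Times_iff)
  qed
qed

lemma quadrant_limits_2:
  assumes sm: "summable (\<lambda>n. \<bar>m n :: real\<bar>)" and gen: "\<And>k. p k \<noteq> fst x" and e: "e > 0"
  shows "\<exists>r>0. \<forall>y\<in>ball x r. (y - x) \<bullet> (0, 1) > 0 \<longrightarrow>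
      \<bar>(\<Sum>n. m n * indicator (quadrant (p n) (q n)) y) - (\<Sum>n. m n * of_bool (q n \<le> snd x \<and> p n < fst x))\<bar> \<le> e" (is ?A)
    and "\<exists>r>0. \<forall>y\<in>ball x r. (y - x) \<bullet> (0, 1) \<le> 0 \<longrightarrow>
      \<bar>(\<Sum>n. m n * indicator (quadrant (p n) (q n)) y) - (\<Sum>n. m n * of_bool (q n < snd x \<and> p n < fst x))\<bar> \<le> e" (is ?B)
proof -
  have ball: "\<bar>fst y - fst x\<bar> < r \<and> \<bar>snd y - snd x\<bar> < r" if "y \<in> ball x r" for y r
    using that dist_fst_le[of x y] dist_snd_le[of x y] by (auto simp: dist_real_def abs_minus_commute)
  show ?A
  proof (rule atom_sum_limit[OF sm _ e])
    fix n
    show "\<exists>r>0. \<forall>y\<in>ball x r. (y - x) \<bullet> (0, 1) > 0 \<longrightarrow> (y \<in> quadrant (p n) (q n) \<longleftrightarrow> q n \<le> snd x \<and> p n < fst x)"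
      using gen[of n]
      by (intro exI[of _ "min \<bar>p n - fst x\<bar> (if q n \<le> snd x then 1 else q n - snd x)"])
         (auto dest!: ball simp: quadrant_def mem_Times_iff)
  qed
  show ?B
  proof (rule atom_sum_limit[OF sm _ e])
    fix n
    show "\<exists>r>0. \<forall>y\<in>ball x r. (y - x) \<bullet> (0, 1) \<le> 0 \<longrightarrow> (y \<in> quadrant (p n) (q n) \<longleftrightarrow> q n < snd x \<and> p n < fst x)"
      using gen[of n]
      by (intro exI[of _ "min \<bar>p n - fst x\<bar> (if q n < snd x then snd x - q n else 1)"])
         (auto dest!: ball simp: quadrant_def mem_Times_iff)
  qed
qed

lemma vertical_line:
  fixes f :: "real \<times> real \<Rightarrow> ennreal" and g :: "real \<times> real \<Rightarrow> real"
  shows "f \<in> borel_measurable borel \<Longrightarrow>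
      (\<integral>\<^sup>+x. indicator ({s} \<times> UNIV) x * f x \<partial>hausdorff_measure (Suc 0)) = (\<integral>\<^sup>+t. f (s, t) \<partial>lborel)"
   and "g \<in> borel_measurable borel \<Longrightarrow>
      (LINT x|hausdorff_measure (Suc 0). indicator ({s} \<times> UNIV) x * g x) = (LINT t|lborel. (g (s, t) :: real))"
proof -
  have r: "range (Pair s) = {s} \<times> UNIV" by auto
  have c: "closed (range (Pair s))" unfolding r by (intro closed_Times) auto
  note L = nn_integral_hausdorff_line[of "Pair s" snd f] integral_hausdorff_line[of "Pair s" snd g]
  show "f \<in> borel_measurable borel \<Longrightarrow>
      (\<integral>\<^sup>+x. indicator ({s} \<times> UNIV) x * f x \<partial>hausdorff_measure (Suc 0)) = (\<integral>\<^sup>+t. f (s, t) \<partial>lborel)"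
    unfolding r[symmetric] by (rule L(1)[OF _ c]) (auto simp: dist_Pair_Pair dist_real_def)
  show "g \<in> borel_measurable borel \<Longrightarrow>
      (LINT x|hausdorff_measure (Suc 0). indicator ({s} \<times> UNIV) x * g x) = (LINT t|lborel. (g (s, t) :: real))"
    unfolding r[symmetric] by (rule L(2)[OF _ c]) (auto simp: dist_Pair_Pair dist_real_def)
qed

lemma horizontal_line:
  fixes f :: "real \<times> real \<Rightarrow> ennreal" and g :: "real \<times> real \<Rightarrow> real"
  shows "f \<in> borel_measurable borel \<Longrightarrow>
      (\<integral>\<^sup>+x. indicator (UNIV \<times> {s}) x * f x \<partial>hausdorff_measure (Suc 0)) = (\<integral>\<^sup>+t. f (t, s) \<partial>lborel)"
   and "g \<in> borel_measurable borel \<Longrightarrow>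
      (LINT x|hausdorff_measure (Suc 0). indicator (UNIV \<times> {s}) x * g x) = (LINT t|lborel. (g (t, s) :: real))"
proof -
  have r: "range (\<lambda>t. (t, s)) = UNIV \<times> {s}" by auto
  have c: "closed (range (\<lambda>t. (t, s)))" unfolding r by (intro closed_Times) auto
  note L = nn_integral_hausdorff_line[of "\<lambda>t. (t, s)" fst f] integral_hausdorff_line[of "\<lambda>t. (t, s)" fst g]
  show "f \<in> borel_measurable borel \<Longrightarrow>
      (\<integral>\<^sup>+x. indicator (UNIV \<times> {s}) x * f x \<partial>hausdorff_measure (Suc 0)) = (\<integral>\<^sup>+t. f (t, s) \<partial>lborel)"
    unfolding r[symmetric] by (rule L(1)[OF _ c]) (auto simp: dist_Pair_Pair dist_real_def)
  show "g \<in> borel_measurable borel \<Longrightarrow>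
      (LINT x|hausdorff_measure (Suc 0). indicator (UNIV \<times> {s}) x * g x) = (LINT t|lborel. (g (t, s) :: real))"
    unfolding r[symmetric] by (rule L(2)[OF _ c]) (auto simp: dist_Pair_Pair dist_real_def)
qed

lemma Basis_real_pair: "(Basis :: (real \<times> real) set) = {(1, 0), (0, 1)}"
  by (auto simp: Basis_prod_def)

lemma divergence_pair: "divergence \<phi> x = pd (1, 0) (\<lambda>y. \<phi> y \<bullet> (1, 0)) x + pd (0, 1) (\<lambda>y. \<phi> y \<bullet> (0, 1)) x"
  for \<phi> :: "real \<times> real \<Rightarrow> real \<times> real"
  unfolding divergence_def Basis_real_pair by simp

text \<open>The boundary of a quadrant is a vertical and a horizontal half-line, whose parts in the
  box have length at most \<open>b2 - a2\<close> and \<open>b1 - a1\<close>; the sum of these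
  lengths is the factor in the bound.\<close>

lemma atoms_2d:
  fixes m p q :: "nat \<Rightarrow> real"
  assumes ab: "a1 < b1" "a2 < b2"
    and sm: "summable (\<lambda>n. \<bar>m n\<bar>)" and \<theta>: "0 < \<theta>" "\<theta> \<le> 1" and s\<theta>: "summable (\<lambda>n. \<bar>m n\<bar> powr \<theta>)"
  shows "SBV \<theta> (box2 a1 b1 a2 b2) (\<lambda>x. \<Sum>n. m n * indicator (quadrant (p n) (q n)) x)"
    "jump_var \<theta> (box2 a1 b1 a2 b2) (\<lambda>x. \<Sum>n. m n * indicator (quadrant (p n) (q n)) x)
       \<le> ennreal ((\<Sum>n. \<bar>m n\<bar> powr \<theta>) * ((b1 - a1) + (b2 - a2)))"
proof -
  let ?U = "box2 a1 b1 a2 b2"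
  let ?H = "hausdorff_measure (Suc 0) :: (real \<times> real) measure"
  define L where "L = (b1 - a1) + (b2 - a2)"
  \<comment> \<open>The half-lines are open at the corner: both components vanish there, and
    elsewhere at most one of them is 1, so the normal has norm 0 or 1.\<close>
  define h1 h2 :: "nat \<Rightarrow> real \<times> real \<Rightarrow> real"
    where "h1 n x = indicator ?U x * indicator {q n<..} (snd x)" and "h2 n x = indicator ?U x * indicator {p n<..} (fst x)" for n x
  define \<gamma>1 \<gamma>2 :: "nat \<Rightarrow> real \<times> real \<Rightarrow> real"
    where "\<gamma>1 n x = indicator ({p n} \<times> UNIV) x * h1 n x" and "\<gamma>2 n x = indicator (UNIV \<times> {q n}) x * h2 n x" for n x
  define \<gamma> :: "nat \<Rightarrow> real \<times> real \<Rightarrow> real \<times> real" where "\<gamma> n x = (\<gamma>1 n x, \<gamma>2 n x)" for n x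
  have [measurable]: "{p n} \<times> UNIV \<in> sets borel" "UNIV \<times> {q n} \<in> sets borel" for n
    by (auto intro!: borel_closed closed_Times)
  have h_meas [measurable]: "h1 n \<in> borel_measurable borel" "h2 n \<in> borel_measurable borel" for n
    unfolding h1_def h2_def by measurable
  have \<gamma>_meas [measurable]: "\<gamma>1 n \<in> borel_measurable borel" "\<gamma>2 n \<in> borel_measurable borel" for n
    unfolding \<gamma>1_def \<gamma>2_def by measurable
  have \<gamma>_measH [measurable]: "\<gamma>1 n \<in> borel_measurable ?H" "\<gamma>2 n \<in> borel_measurable ?H" for n
    by (auto intro!: borel_measurable_hausdorff \<gamma>_meas)
  have \<gamma>_nonneg: "0 \<le> \<gamma>1 n x" "0 \<le> \<gamma>2 n x" for n x by (auto simp: \<gamma>1_def \<gamma>2_def h1_def h2_def)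
  have norm\<gamma>: "norm (\<gamma> n x) = \<gamma>1 n x + \<gamma>2 n x" "\<gamma>1 n x + \<gamma>2 n x \<in> {0, 1}" for n x
    by (auto simp: \<gamma>_def \<gamma>1_def \<gamma>2_def h1_def h2_def norm_Pair split: split_indicator)
  have mass1: "(\<integral>\<^sup>+x. ennreal (\<gamma>1 n x) \<partial>?H) \<le> ennreal (b2 - a2)" for n
  proof -
    have "(\<integral>\<^sup>+x. ennreal (\<gamma>1 n x) \<partial>?H) = (\<integral>\<^sup>+x. indicator ({p n} \<times> UNIV) x * ennreal (h1 n x) \<partial>?H)"
      by (intro nn_integral_cong) (auto simp: \<gamma>1_def split: split_indicator)
    also have "\<dots> = (\<integral>\<^sup>+t. ennreal (h1 n (p n, t)) \<partial>lborel)" by (rule vertical_line) measurable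
    also have "\<dots> \<le> (\<integral>\<^sup>+t. indicator {a2<..<b2} t \<partial>lborel)"
      by (intro nn_integral_mono) (auto simp: h1_def box2_def split: split_indicator)
    finally show ?thesis using ab by simp
  qed
  have mass2: "(\<integral>\<^sup>+x. ennreal (\<gamma>2 n x) \<partial>?H) \<le> ennreal (b1 - a1)" for n
  proof -
    have "(\<integral>\<^sup>+x. ennreal (\<gamma>2 n x) \<partial>?H) = (\<integral>\<^sup>+x. indicator (UNIV \<times> {q n}) x * ennreal (h2 n x) \<partial>?H)"
      by (intro nn_integral_cong) (auto simp: \<gamma>2_def split: split_indicator)
    also have "\<dots> = (\<integral>\<^sup>+t. ennreal (h2 n (t, q n)) \<partial>lborel)" by (rule horizontal_line) measurable
    also have "\<dots> \<le> (\<integral>\<^sup>+t. indicator {a1<..<b1} t \<partial>lborel)"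
      by (intro nn_integral_mono) (auto simp: h2_def box2_def split: split_indicator)
    finally show ?thesis using ab by simp
  qed
  have mass: "(\<integral>\<^sup>+x. ennreal (norm (\<gamma> n x)) \<partial>?H) \<le> ennreal L" for n
  proof -
    have "(\<integral>\<^sup>+x. ennreal (norm (\<gamma> n x)) \<partial>?H) = (\<integral>\<^sup>+x. ennreal (\<gamma>1 n x) + ennreal (\<gamma>2 n x) \<partial>?H)"
      using norm\<gamma> \<gamma>_nonneg by (intro nn_integral_cong) simp
    also have "\<dots> = (\<integral>\<^sup>+x. ennreal (\<gamma>1 n x) \<partial>?H) + (\<integral>\<^sup>+x. ennreal (\<gamma>2 n x) \<partial>?H)"
      by (rule nn_integral_add) measurable
    also have "\<dots> \<le> ennreal (b2 - a2) + ennreal (b1 - a1)" by (intro add_mono mass1 mass2)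
    finally show ?thesis using ab by (simp add: L_def add.commute ennreal_plus[symmetric] del: ennreal_plus)
  qed
  define v where "v = (\<lambda>x. \<Sum>n. m n * indicator (quadrant (p n) (q n)) x)"
  define G where "G = (\<lambda>x. \<Sum>n. m n *\<^sub>R \<gamma> n x)"
  have vb: "v \<in> borel_measurable borel" unfolding v_def by measurable
  have Gsum: "summable (\<lambda>n. m n * c n)" if "\<And>n. c n \<in> {0, 1::real}" for c
  proof (rule summable_comparison_test'[OF sm, of 0])
    show "norm (m n * c n) \<le> \<bar>m n\<bar>" for n using that[of n] by (auto simp: abs_mult)
  qed
  have \<gamma>01: "\<gamma>1 n x \<in> {0, 1}" "\<gamma>2 n x \<in> {0, 1}" for n x
    by (auto simp: \<gamma>1_def \<gamma>2_def h1_def h2_def split: split_indicator)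
  have G: "G x = (\<Sum>n. m n * \<gamma>1 n x, \<Sum>n. m n * \<gamma>2 n x)" for x
  proof -
    have "(\<lambda>n. (m n * \<gamma>1 n x, m n * \<gamma>2 n x)) sums (\<Sum>n. m n * \<gamma>1 n x, \<Sum>n. m n * \<gamma>2 n x)"
      unfolding sums_def using summable_LIMSEQ[OF Gsum, of "\<lambda>n. \<gamma>1 n x"] summable_LIMSEQ[OF Gsum, of "\<lambda>n. \<gamma>2 n x"] \<gamma>01
      by (simp add: sum_prod tendsto_Pair)
    then show ?thesis by (simp add: G_def \<gamma>_def sums_iff)
  qed
  \<comment> \<open>All crossings of a vertical with a horizontal edge line, not only the corners
    \<open>(p n, q n)\<close>. They are countably many, hence of length 0, and off them only one of
    the two families of edges passes through a point.\<close>
  define N where "N = range (\<lambda>(i, j). (p i, q j))"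
  have N: "N \<in> null_sets ?H" by (rule hausdorff_1_countable_null) (simp add: N_def)
  have jump: "(G x \<noteq> 0 \<longrightarrow> (\<exists>a b \<nu>. approx_jump v x a b \<nu> \<and> G x = (a - b) *\<^sub>R \<nu>)) \<and> (G x = 0 \<longrightarrow> x \<notin> jump_set ?U v)"
    if xU: "x \<in> ?U" and xN: "x \<notin> N" for x
  proof -
    consider "\<And>k. q k \<noteq> snd x" | "\<And>k. p k \<noteq> fst x"
      using xN by (cases x) (force simp: N_def)
    then show ?thesis
    proof cases
      case 1
      define c1 where "c1 = (\<Sum>n. m n * of_bool (p n \<le> fst x \<and> q n < snd x))"
      define c2 where "c2 = (\<Sum>n. m n * of_bool (p n < fst x \<and> q n < snd x))"
      have Gx: "G x = (c1 - c2) *\<^sub>R (1, 0)"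
      proof -
        have "(\<Sum>n. m n * \<gamma>1 n x) = c1 - c2"
          unfolding c1_def c2_def
          by (subst suminf_diff[OF Gsum Gsum])
             (auto intro!: suminf_cong simp: \<gamma>1_def h1_def xU mem_Times_iff split: split_indicator)
        moreover have "\<gamma>2 n x = 0" for n using 1[of n] by (auto simp: \<gamma>2_def mem_Times_iff split: split_indicator)
        ultimately show ?thesis unfolding G by simp
      qed
      have l1: "\<exists>r>0. \<forall>y\<in>ball x r. (y - x) \<bullet> (1, 0) > 0 \<longrightarrow> \<bar>v y - c1\<bar> \<le> e" if "e > 0" for e
        unfolding v_def c1_def by (rule quadrant_limits_1(1)[OF sm 1 that])
      have l2: "\<exists>r>0. \<forall>y\<in>ball x r. (y - x) \<bullet> (1, 0) \<le> 0 \<longrightarrow> \<bar>v y - c2\<bar> \<le> e" if "e > 0" for e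
        unfolding v_def c2_def by (rule quadrant_limits_1(2)[OF sm 1 that])
      note J = two_sided_limits_jump[OF vb _ l1 l2]
      show ?thesis
      proof (intro conjI impI)
        assume "G x \<noteq> 0"
        then have "c1 \<noteq> c2" using Gx by (auto simp: zero_prod_def)
        with J(1) have "approx_jump v x c1 c2 (1, 0)" by (simp add: norm_Pair)
        with Gx show "\<exists>a b \<nu>. approx_jump v x a b \<nu> \<and> G x = (a - b) *\<^sub>R \<nu>" by blast
      next
        assume "G x = 0"
        then show "x \<notin> jump_set ?U v" using J(2) Gx by (auto simp: jump_set_def norm_Pair zero_prod_def)
      qed
    next
      case 2
      define c1 where "c1 = (\<Sum>n. m n * of_bool (q n \<le> snd x \<and> p n < fst x))"
      define c2 where "c2 = (\<Sum>n. m n * of_bool (q n < snd x \<and> p n < fst x))"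
      have Gx: "G x = (c1 - c2) *\<^sub>R (0, 1)"
      proof -
        have "(\<Sum>n. m n * \<gamma>2 n x) = c1 - c2"
          unfolding c1_def c2_def
          by (subst suminf_diff[OF Gsum Gsum])
             (auto intro!: suminf_cong simp: \<gamma>2_def h2_def xU mem_Times_iff split: split_indicator)
        moreover have "\<gamma>1 n x = 0" for n using 2[of n] by (auto simp: \<gamma>1_def mem_Times_iff split: split_indicator)
        ultimately show ?thesis unfolding G by simp
      qed
      have l1: "\<exists>r>0. \<forall>y\<in>ball x r. (y - x) \<bullet> (0, 1) > 0 \<longrightarrow> \<bar>v y - c1\<bar> \<le> e" if "e > 0" for e
        unfolding v_def c1_def by (rule quadrant_limits_2(1)[OF sm 2 that])
      have l2: "\<exists>r>0. \<forall>y\<in>ball x r. (y - x) \<bullet> (0, 1) \<le> 0 \<longrightarrow> \<bar>v y - c2\<bar> \<le> e" if "e > 0" for e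
        unfolding v_def c2_def by (rule quadrant_limits_2(2)[OF sm 2 that])
      note J = two_sided_limits_jump[OF vb _ l1 l2]
      show ?thesis
      proof (intro conjI impI)
        assume "G x \<noteq> 0"
        then have "c1 \<noteq> c2" using Gx by (auto simp: zero_prod_def)
        with J(1) have "approx_jump v x c1 c2 (0, 1)" by (simp add: norm_Pair)
        with Gx show "\<exists>a b \<nu>. approx_jump v x a b \<nu> \<and> G x = (a - b) *\<^sub>R \<nu>" by blast
      next
        assume "G x = 0"
        then show "x \<notin> jump_set ?U v" using J(2) Gx by (auto simp: jump_set_def norm_Pair zero_prod_def)
      qed
    qed
  qed
  have L0: "0 \<le> L" using ab by (simp add: L_def)
  interpret S: atom_series ?U m "\<lambda>n. quadrant (p n) (q n)" \<gamma> L ?H N v G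
  proof
    show "?H = hausdorff_measure (DIM(real \<times> real) - 1)" by simp
    show "\<gamma> n \<in> borel_measurable borel" for n unfolding \<gamma>_def by measurable
    show "norm (\<gamma> n x) = 0 \<or> norm (\<gamma> n x) = 1" for n x using norm\<gamma>[of n x] by auto
    show "x \<notin> ?U \<Longrightarrow> \<gamma> n x = 0" for n x by (simp add: \<gamma>_def \<gamma>1_def \<gamma>2_def h1_def h2_def zero_prod_def)
    fix n and \<phi> :: "real \<times> real \<Rightarrow> real \<times> real" assume \<phi>: "test_field ?U \<phi>"
    define \<phi>1 where "\<phi>1 x = \<phi> x \<bullet> (1, 0)" for x
    define \<phi>2 where "\<phi>2 x = \<phi> x \<bullet> (0, 1)" for x
    have t: "test_fun ?U \<phi>1" "test_fun ?U \<phi>2"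
      using test_field_components[OF \<phi>, of "(1, 0)"] test_field_components[OF \<phi>, of "(0, 1)"]
      by (auto simp: \<phi>1_def[abs_def] \<phi>2_def[abs_def] Basis_real_pair)
    have b: "(1::real, 0::real) \<in> Basis" "(0::real, 1::real) \<in> Basis" by (auto simp: Basis_prod_def)
    have [measurable]: "divergence \<phi> \<in> borel_measurable borel" "\<phi>1 \<in> borel_measurable borel" "\<phi>2 \<in> borel_measurable borel"
      by (auto intro: divergence_properties[OF \<phi>] test_fun_borel[OF t(1)] test_fun_borel[OF t(2)])
    have [measurable]: "\<phi>1 \<in> borel_measurable ?H" "\<phi>2 \<in> borel_measurable ?H"
      by (auto intro: borel_measurable_hausdorff)
    have ind: "indicat_real {q n<..} \<in> borel_measurable borel" "indicat_real {p n<..} \<in> borel_measurable borel" by measurable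
    have "(LINT x:?U|lebesgue. indicator (quadrant (p n) (q n)) x * divergence \<phi> x) = (LINT x|lborel. indicator (quadrant (p n) (q n)) x * divergence \<phi> x)"
      using divergence_properties(3)[OF \<phi>] by (intro set_lebesgue_test) auto
    also have "\<dots> = (LINT x|lborel. indicator {p n<..} (fst x) * indicator {q n<..} (snd x) * pd (1, 0) \<phi>1 x
        + indicator {q n<..} (snd x) * indicator {p n<..} (fst x) * pd (0, 1) \<phi>2 x)"
      by (intro Bochner_Integration.integral_cong refl)
         (simp add: divergence_pair indicator_quadrant \<phi>1_def[abs_def] \<phi>2_def[abs_def] algebra_simps)
    also have "\<dots> = (LINT x|lborel. indicator {p n<..} (fst x) * indicator {q n<..} (snd x) * pd (1, 0) \<phi>1 x)
        + (LINT x|lborel. indicator {q n<..} (snd x) * indicator {p n<..} (fst x) * pd (0, 1) \<phi>2 x)"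
    proof (rule Bochner_Integration.integral_add)
      show "integrable lborel (\<lambda>x. indicat_real {p n<..} (fst x) * indicator {q n<..} (snd x) * pd (1, 0) \<phi>1 x)"
        by (rule test_fun_mult_integrable[OF test_fun_pd[OF t(1) b(1)], of _ 1]) (auto split: split_indicator)
      show "integrable lborel (\<lambda>x. indicat_real {q n<..} (snd x) * indicator {p n<..} (fst x) * pd (0, 1) \<phi>2 x)"
        by (rule test_fun_mult_integrable[OF test_fun_pd[OF t(2) b(2)], of _ 1]) (auto split: split_indicator)
    qed
    also have "(LINT x|lborel. indicator {p n<..} (fst x) * indicator {q n<..} (snd x) * pd (1, 0) \<phi>1 x)
        = - (LINT t|lborel. indicator {q n<..} t * \<phi>1 (p n, t))"
      by (rule test_fun_quadrant(1)[OF t(1) ind(1), of 1]) (auto split: split_indicator)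
    also have "(LINT x|lborel. indicator {q n<..} (snd x) * indicator {p n<..} (fst x) * pd (0, 1) \<phi>2 x)
        = - (LINT t|lborel. indicator {p n<..} t * \<phi>2 (t, q n))"
      by (rule test_fun_quadrant(2)[OF t(2) ind(2), of 1]) (auto split: split_indicator)
    also have "(LINT t|lborel. indicator {q n<..} t * \<phi>1 (p n, t)) = (LINT x|?H. \<gamma>1 n x * \<phi>1 x)"
    proof -
      have "(LINT x|?H. \<gamma>1 n x * \<phi>1 x) = (LINT x|?H. indicator ({p n} \<times> UNIV) x * (h1 n x * \<phi>1 x))"
        by (simp add: \<gamma>1_def mult.assoc)
      also have "\<dots> = (LINT t|lborel. h1 n (p n, t) * \<phi>1 (p n, t))" by (rule vertical_line) measurable
      also have "\<dots> = (LINT t|lborel. indicator {q n<..} t * \<phi>1 (p n, t))"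
        using test_fun_eq_0[OF t(1)] by (intro Bochner_Integration.integral_cong) (auto simp: h1_def split: split_indicator)
      finally show ?thesis by simp
    qed
    also have "(LINT t|lborel. indicator {p n<..} t * \<phi>2 (t, q n)) = (LINT x|?H. \<gamma>2 n x * \<phi>2 x)"
    proof -
      have "(LINT x|?H. \<gamma>2 n x * \<phi>2 x) = (LINT x|?H. indicator (UNIV \<times> {q n}) x * (h2 n x * \<phi>2 x))"
        by (simp add: \<gamma>2_def mult.assoc)
      also have "\<dots> = (LINT t|lborel. h2 n (t, q n) * \<phi>2 (t, q n))" by (rule horizontal_line) measurable
      also have "\<dots> = (LINT t|lborel. indicator {p n<..} t * \<phi>2 (t, q n))"
        using test_fun_eq_0[OF t(2)] by (intro Bochner_Integration.integral_cong) (auto simp: h2_def split: split_indicator)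
      finally show ?thesis by simp
    qed
    also have "- (LINT x|?H. \<gamma>1 n x * \<phi>1 x) + - (LINT x|?H. \<gamma>2 n x * \<phi>2 x) = - (LINT x|?H. \<gamma>1 n x * \<phi>1 x + \<gamma>2 n x * \<phi>2 x)"
    proof -
      obtain B1 where B1: "B1 > 0" "\<And>x. \<bar>\<phi>1 x\<bar> \<le> B1" using test_fun_bounded[OF t(1)] by metis
      obtain B2 where B2: "B2 > 0" "\<And>x. \<bar>\<phi>2 x\<bar> \<le> B2" using test_fun_bounded[OF t(2)] by metis
      have i: "integrable ?H (\<gamma>1 n)" "integrable ?H (\<gamma>2 n)"
        using mass1[of n] mass2[of n] \<gamma>_nonneg by (auto intro!: integrableI_nonneg intro: le_less_trans)
      have "integrable ?H (\<lambda>x. \<gamma>1 n x * \<phi>1 x)"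
        by (rule Bochner_Integration.integrable_bound[OF integrable_mult_right[OF i(1), of B1]])
           (use B1 \<gamma>_nonneg in \<open>auto simp: abs_mult mult.commute intro!: mult_right_mono\<close>)
      moreover have "integrable ?H (\<lambda>x. \<gamma>2 n x * \<phi>2 x)"
        by (rule Bochner_Integration.integrable_bound[OF integrable_mult_right[OF i(2), of B2]])
           (use B2 \<gamma>_nonneg in \<open>auto simp: abs_mult mult.commute intro!: mult_right_mono\<close>)
      ultimately show ?thesis by simp
    qed
    also have "(LINT x|?H. \<gamma>1 n x * \<phi>1 x + \<gamma>2 n x * \<phi>2 x) = (LINT x|?H. \<gamma> n x \<bullet> \<phi> x)"
      by (intro Bochner_Integration.integral_cong refl) (simp add: \<gamma>_def \<phi>1_def \<phi>2_def inner_prod_def)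
    finally show "(LINT x:?U|lebesgue. indicator (quadrant (p n) (q n)) x * divergence \<phi> x) = - (LINT x|?H. \<gamma> n x \<bullet> \<phi> x)" .
  qed (use sm jump v_def G_def N mass L0 in auto)
  have "jump_var \<theta> ?U v \<le> (\<Sum>n. ennreal (\<bar>m n\<bar> powr \<theta>) * ennreal L)"
    by (rule order_trans[OF S.jump_var_le[OF \<theta>]]) (intro suminf_le mult_left_mono mass; simp)
  also have "\<dots> = ennreal (\<Sum>n. \<bar>m n\<bar> powr \<theta> * L)"
    using L0 summable_mult2[OF s\<theta>, of L] by (subst suminf_ennreal2[symmetric]) (auto simp: ennreal_mult)
  also have "(\<Sum>n. \<bar>m n\<bar> powr \<theta> * L) = (\<Sum>n. \<bar>m n\<bar> powr \<theta>) * L" by (rule suminf_mult2[OF s\<theta>, symmetric])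
  finally have jv: "jump_var \<theta> ?U v \<le> ennreal ((\<Sum>n. \<bar>m n\<bar> powr \<theta>) * L)" .
  then show "jump_var \<theta> ?U (\<lambda>x. \<Sum>n. m n * indicator (quadrant (p n) (q n)) x) \<le> ennreal ((\<Sum>n. \<bar>m n\<bar> powr \<theta>) * ((b1 - a1) + (b2 - a2)))"
    unfolding v_def L_def .
  show "SBV \<theta> ?U (\<lambda>x. \<Sum>n. m n * indicator (quadrant (p n) (q n)) x)"
    using S.v_SBV[OF \<theta> le_less_trans[OF jv]] unfolding v_def by simp
qed

section \<open>Grid functions\<close>

definition hdiff :: "(nat \<Rightarrow> nat \<Rightarrow> real) \<Rightarrow> nat \<Rightarrow> nat \<Rightarrow> real" where
  "hdiff U i j = U (Suc i) j - U i j"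

definition vdiff :: "(nat \<Rightarrow> nat \<Rightarrow> real) \<Rightarrow> nat \<Rightarrow> nat \<Rightarrow> real" where
  "vdiff U i j = U i (Suc j) - U i j"

definition mdiff :: "(nat \<Rightarrow> nat \<Rightarrow> real) \<Rightarrow> nat \<Rightarrow> nat \<Rightarrow> real" where
  "mdiff U i j = U (Suc i) (Suc j) - U i (Suc j) - U (Suc i) j + U i j"

text \<open>Multiplied out, this has one term for each corner of the cell, formed by the horizontal
  and the vertical edge that meet there. A single direction sees one corner only; its reflections
  supply the other three.\<close>

definition cell_energy :: "real \<Rightarrow> real \<Rightarrow> (nat \<Rightarrow> nat \<Rightarrow> real) \<Rightarrow> nat \<Rightarrow> nat \<Rightarrow> real" where
  "cell_energy \<theta>1 \<theta>2 U i j =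
     (\<bar>hdiff U i j\<bar> powr \<theta>1 + \<bar>hdiff U i (Suc j)\<bar> powr \<theta>1) * (\<bar>vdiff U i j\<bar> powr \<theta>2 + \<bar>vdiff U (Suc i) j\<bar> powr \<theta>2)"

lemma hdiff_telescope: "hdiff U i j = hdiff U i 0 + (\<Sum>j'<j. mdiff U i j')"
  by (induction j) (auto simp: hdiff_def mdiff_def)

lemma vdiff_telescope: "vdiff U i j = vdiff U 0 j + (\<Sum>i'<i. mdiff U i' j)"
  by (induction i) (auto simp: vdiff_def mdiff_def)

text \<open>The discrete form of the structure sought in the limit: the mixed difference of a cell
  acts as the mass of a quadrant with corner at the upper right node of that cell, and the
  increments along the lower edge act as masses of half-planes.\<close>

lemma grid_decomposition_1: "U i j = U 0 j + (\<Sum>i'<i. hdiff U i' 0) + (\<Sum>i'<i. \<Sum>j'<j. mdiff U i' j')"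
proof (induction i)
  case (Suc i)
  have "U (Suc i) j = U i j + hdiff U i j" by (simp add: hdiff_def)
  then show ?case using Suc hdiff_telescope[of U i j] by simp
qed simp

lemma grid_decomposition_2: "U i j = U i 0 + (\<Sum>j'<j. vdiff U 0 j') + (\<Sum>i'<i. \<Sum>j'<j. mdiff U i' j')"
proof (induction j)
  case (Suc j)
  have "U i (Suc j) = U i j + vdiff U i j" by (simp add: vdiff_def)
  then show ?case using Suc vdiff_telescope[of U i j] by (simp add: sum.distrib)
qed simp

lemma cell_energy_nonneg: "0 \<le> cell_energy \<theta>1 \<theta>2 U i j"
  by (simp add: cell_energy_def)

text \<open>The mixed difference is the difference of the two horizontal increments and also of the
  two vertical ones. Its power \<theta>1 is estimated by the former, its power \<theta>2 by the
  latter, and the two estimates are multiplied.\<close>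

lemma mdiff_le_cell_energy:
  assumes "0 < \<theta>1" "0 < \<theta>2" "\<theta>1 + \<theta>2 \<le> 1"
  shows "\<bar>mdiff U i j\<bar> powr (\<theta>1 + \<theta>2) \<le> cell_energy \<theta>1 \<theta>2 U i j"
proof -
  have "\<bar>mdiff U i j\<bar> powr \<theta>1 \<le> (\<bar>hdiff U i j\<bar> + \<bar>hdiff U i (Suc j)\<bar>) powr \<theta>1"
    using assms by (intro powr_mono2) (auto simp: mdiff_def hdiff_def)
  also have "\<dots> \<le> \<bar>hdiff U i j\<bar> powr \<theta>1 + \<bar>hdiff U i (Suc j)\<bar> powr \<theta>1"
    using assms by (intro powr_add_le) auto
  finally have 1: "\<bar>mdiff U i j\<bar> powr \<theta>1 \<le> \<dots>" .
  have "\<bar>mdiff U i j\<bar> powr \<theta>2 \<le> (\<bar>vdiff U i j\<bar> + \<bar>vdiff U (Suc i) j\<bar>) powr \<theta>2"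
    using assms by (intro powr_mono2) (auto simp: mdiff_def vdiff_def)
  also have "\<dots> \<le> \<bar>vdiff U i j\<bar> powr \<theta>2 + \<bar>vdiff U (Suc i) j\<bar> powr \<theta>2"
    using assms by (intro powr_add_le) auto
  finally have 2: "\<bar>mdiff U i j\<bar> powr \<theta>2 \<le> \<dots>" .
  show ?thesis unfolding cell_energy_def powr_add using 1 2 by (intro mult_mono) auto
qed

lemma half_powr_le_add:
  assumes "0 < \<theta>" "\<bar>x - a\<bar> \<le> \<mu>" "2 * \<mu> < \<bar>a :: real\<bar>" "0 \<le> z"
  shows "(\<bar>a\<bar> / 2) powr \<theta> \<le> \<bar>x\<bar> powr \<theta> + z"
proof -
  have "(\<bar>a\<bar> / 2) powr \<theta> \<le> \<bar>x\<bar> powr \<theta>" using assms by (intro powr_mono2) auto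
  then show ?thesis using assms by simp
qed

text \<open>For strips whose boundary increment is controlled by the mixed differences along them.
  The power sum inherits their bound with the factor \<open>2 powr \<theta> \<le> 2\<close>.\<close>

lemma bad_sum_le:
  fixes m :: "'i \<Rightarrow> 'j \<Rightarrow> real" and a :: "'i \<Rightarrow> real"
  assumes fin: "finite I" "finite J" and \<theta>: "0 < \<theta>" "\<theta> \<le> 1"
    and bad: "\<And>i. i \<in> I \<Longrightarrow> \<bar>a i\<bar> \<le> 2 * (\<Sum>j\<in>J. \<bar>m i j\<bar>)"
  shows "(\<Sum>i\<in>I. \<bar>a i\<bar> powr \<theta>) \<le> 2 * (\<Sum>i\<in>I. \<Sum>j\<in>J. \<bar>m i j\<bar> powr \<theta>)"
  unfolding sum_distrib_left[of 2 "\<lambda>i. \<Sum>j\<in>J. \<bar>m i j\<bar> powr \<theta>"]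
proof (intro sum_mono)
  fix i assume "i \<in> I"
  then have "\<bar>a i\<bar> powr \<theta> \<le> (2 * (\<Sum>j\<in>J. \<bar>m i j\<bar>)) powr \<theta>" using bad \<theta> by (intro powr_mono2) auto
  also have "\<dots> = 2 powr \<theta> * (\<Sum>j\<in>J. \<bar>m i j\<bar>) powr \<theta>" by (simp add: powr_mult sum_nonneg)
  also have "\<dots> \<le> 2 powr 1 * (\<Sum>j\<in>J. \<bar>m i j\<bar> powr \<theta>)"
    using \<theta> fin by (intro mult_mono powr_mono powr_sum_le sum_nonneg) auto
  finally show "\<bar>a i\<bar> powr \<theta> \<le> 2 * (\<Sum>j\<in>J. \<bar>m i j\<bar> powr \<theta>)" by simp
qed

text \<open>The surplus exponent is spent on the sup bound,
  \<open>\<bar>a i\<bar> powr \<theta>' \<le> 2 * B\<close>. A further factor of at most 2 comes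
  from the halving, whence \<open>4 * B\<close>.\<close>

lemma good_sum_le:
  fixes a :: "'i \<Rightarrow> real"
  assumes \<theta>: "0 < \<theta>" "0 < \<theta>'" "\<theta> + \<theta>' \<le> 1" and B: "1 \<le> B" "\<And>i. i \<in> I \<Longrightarrow> \<bar>a i\<bar> \<le> 2 * B"
  shows "(\<Sum>i\<in>I. \<bar>a i\<bar> powr (\<theta> + \<theta>')) \<le> 4 * B * (\<Sum>i\<in>I. (\<bar>a i\<bar> / 2) powr \<theta>)"
  unfolding sum_distrib_left
proof (intro sum_mono)
  fix i assume i: "i \<in> I"
  have "\<bar>a i\<bar> powr (\<theta> + \<theta>') = (2 * (\<bar>a i\<bar> / 2)) powr \<theta> * \<bar>a i\<bar> powr \<theta>'" by (simp add: powr_add)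
  also have "\<dots> = 2 powr \<theta> * (\<bar>a i\<bar> / 2) powr \<theta> * \<bar>a i\<bar> powr \<theta>'" by (subst powr_mult) auto
  also have "\<dots> \<le> 2 * (\<bar>a i\<bar> / 2) powr \<theta> * (2 * B)"
  proof -
    have "(2::real) powr \<theta> \<le> 2 powr 1" using \<theta> by (intro powr_mono) auto
    then have 1: "(2::real) powr \<theta> \<le> 2" by simp
    have "\<bar>a i\<bar> powr \<theta>' \<le> (2 * B) powr \<theta>'" using B(2)[OF i] \<theta> by (intro powr_mono2) auto
    also have "\<dots> \<le> (2 * B) powr 1" using B \<theta> by (intro powr_mono) auto
    finally have 2: "\<bar>a i\<bar> powr \<theta>' \<le> 2 * B" using B by simp
    show ?thesis by (rule mult_mono[OF mult_right_mono[OF 1] 2]) (auto)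
  qed
  finally show "\<bar>a i\<bar> powr (\<theta> + \<theta>') \<le> 4 * B * (\<bar>a i\<bar> / 2) powr \<theta>" by (simp add: mult_ac)
qed

text \<open>A good strip in \<open>GI\<close> keeps half of its lower increment in all cells that
  meet a strip in \<open>GJ\<close>, and vice versa. The cells at the crossings then bound
  \<open>X * Y\<close> by the energy, so \<open>X\<close> or \<open>Y\<close> is at most
  \<open>sqrt M\<close>. All other strips are bad, and their increments are paid for by
  \<open>T\<close>.\<close>

lemma grid_alternative:
  fixes U :: "nat \<Rightarrow> nat \<Rightarrow> real"
  assumes \<theta>: "0 < \<theta>1" "0 < \<theta>2" "\<theta>1 + \<theta>2 \<le> 1" and B: "1 \<le> B"
    and U: "\<And>i j. \<bar>U i j\<bar> \<le> B"
    and M: "(\<Sum>i<N. \<Sum>j<N'. cell_energy \<theta>1 \<theta>2 U i j) \<le> M"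
  defines "T \<equiv> \<Sum>i<N. \<Sum>j<N'. \<bar>mdiff U i j\<bar> powr (\<theta>1 + \<theta>2)"
  shows "(\<Sum>i<N. \<bar>hdiff U i 0\<bar> powr (\<theta>1 + \<theta>2)) + T \<le> 4 * B * (M + sqrt M) \<or>
    (\<Sum>j<N'. \<bar>vdiff U 0 j\<bar> powr (\<theta>1 + \<theta>2)) + T \<le> 4 * B * (M + sqrt M)"
proof -
  let ?\<theta> = "\<theta>1 + \<theta>2"
  have T: "T \<le> M" "0 \<le> T"
  proof -
    have "T \<le> (\<Sum>i<N. \<Sum>j<N'. cell_energy \<theta>1 \<theta>2 U i j)"
      unfolding T_def using \<theta> by (intro sum_mono mdiff_le_cell_energy) auto
    then show "T \<le> M" using M by simp
    show "0 \<le> T" unfolding T_def by (intro sum_nonneg) auto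
  qed
  then have M0: "0 \<le> M" by simp
  \<comment> \<open>With the factor 2, the mixed differences change the increment by less than half
    of its modulus along the whole strip.\<close>
  define GI where "GI = {i. i < N \<and> 2 * (\<Sum>j<N'. \<bar>mdiff U i j\<bar>) < \<bar>hdiff U i 0\<bar>}"
  define GJ where "GJ = {j. j < N' \<and> 2 * (\<Sum>i<N. \<bar>mdiff U i j\<bar>) < \<bar>vdiff U 0 j\<bar>}"
  have fin: "finite GI" "finite GJ" "GI \<subseteq> {..<N}" "GJ \<subseteq> {..<N'}" by (auto simp: GI_def GJ_def)
  define X where "X = (\<Sum>i\<in>GI. (\<bar>hdiff U i 0\<bar> / 2) powr \<theta>1)"
  define Y where "Y = (\<Sum>j\<in>GJ. (\<bar>vdiff U 0 j\<bar> / 2) powr \<theta>2)"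
  have XY0: "0 \<le> X" "0 \<le> Y" by (auto simp: X_def Y_def intro!: sum_nonneg)
  have "X * Y = (\<Sum>i\<in>GI. \<Sum>j\<in>GJ. (\<bar>hdiff U i 0\<bar> / 2) powr \<theta>1 * (\<bar>vdiff U 0 j\<bar> / 2) powr \<theta>2)"
    unfolding X_def Y_def by (rule sum_product)
  also have "\<dots> \<le> (\<Sum>i\<in>GI. \<Sum>j\<in>GJ. cell_energy \<theta>1 \<theta>2 U i j)"
  proof (intro sum_mono)
    fix i j assume ij: "i \<in> GI" "j \<in> GJ"
    have "\<bar>hdiff U i j - hdiff U i 0\<bar> \<le> (\<Sum>j<N'. \<bar>mdiff U i j\<bar>)"
    proof -
      have "\<bar>hdiff U i j - hdiff U i 0\<bar> \<le> (\<Sum>j'<j. \<bar>mdiff U i j'\<bar>)" unfolding hdiff_telescope[of U i j] by simp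
      also have "\<dots> \<le> (\<Sum>j<N'. \<bar>mdiff U i j\<bar>)" using ij by (intro sum_mono2) (auto simp: GJ_def)
      finally show ?thesis .
    qed
    moreover have "\<bar>vdiff U i j - vdiff U 0 j\<bar> \<le> (\<Sum>i<N. \<bar>mdiff U i j\<bar>)"
    proof -
      have "\<bar>vdiff U i j - vdiff U 0 j\<bar> \<le> (\<Sum>i'<i. \<bar>mdiff U i' j\<bar>)" unfolding vdiff_telescope[of U i j] by simp
      also have "\<dots> \<le> (\<Sum>i<N. \<bar>mdiff U i j\<bar>)" using ij by (intro sum_mono2) (auto simp: GI_def)
      finally show ?thesis .
    qed
    ultimately show "(\<bar>hdiff U i 0\<bar> / 2) powr \<theta>1 * (\<bar>vdiff U 0 j\<bar> / 2) powr \<theta>2 \<le> cell_energy \<theta>1 \<theta>2 U i j"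
      unfolding cell_energy_def using ij \<theta>
      by (intro mult_mono half_powr_le_add) (auto simp: GI_def GJ_def)
  qed
  also have "\<dots> \<le> (\<Sum>i<N. \<Sum>j<N'. cell_energy \<theta>1 \<theta>2 U i j)"
  proof -
    have "(\<Sum>i\<in>GI. \<Sum>j\<in>GJ. cell_energy \<theta>1 \<theta>2 U i j) \<le> (\<Sum>i\<in>GI. \<Sum>j<N'. cell_energy \<theta>1 \<theta>2 U i j)"
      using fin by (intro sum_mono sum_mono2) (auto intro!: cell_energy_nonneg)
    also have "\<dots> \<le> (\<Sum>i<N. \<Sum>j<N'. cell_energy \<theta>1 \<theta>2 U i j)"
      using fin by (intro sum_mono2) (auto intro!: sum_nonneg cell_energy_nonneg)
    finally show ?thesis .
  qed
  finally have XY: "X * Y \<le> M" using M by simp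
  have bound: "(\<Sum>i\<in>I. \<bar>a i\<bar> powr ?\<theta>) + T \<le> 4 * B * (M + sqrt M)"
    if X: "(\<Sum>i\<in>GG. (\<bar>a i\<bar> / 2) powr \<theta>) \<le> sqrt M" and \<theta>': "?\<theta> = \<theta> + \<theta>'" "0 < \<theta>" "0 < \<theta>'"
      and I: "finite I" "finite J" "GG \<subseteq> I" and bad: "\<And>i. i \<in> I - GG \<Longrightarrow> \<bar>a i\<bar> \<le> 2 * (\<Sum>j\<in>J. \<bar>m i j\<bar>)"
      and a: "\<And>i. \<bar>a i\<bar> \<le> 2 * B" and mT: "(\<Sum>i\<in>I. \<Sum>j\<in>J. \<bar>m i j\<bar> powr ?\<theta>) = T"
    for GG I J :: "nat set" and a :: "nat \<Rightarrow> real" and m \<theta> \<theta>'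
  proof -
    have "(\<Sum>i\<in>I. \<bar>a i\<bar> powr ?\<theta>) = (\<Sum>i\<in>I - GG. \<bar>a i\<bar> powr ?\<theta>) + (\<Sum>i\<in>GG. \<bar>a i\<bar> powr ?\<theta>)"
      by (rule sum.subset_diff[OF I(3,1)])
    also have "(\<Sum>i\<in>I - GG. \<bar>a i\<bar> powr ?\<theta>) \<le> 2 * (\<Sum>i\<in>I - GG. \<Sum>j\<in>J. \<bar>m i j\<bar> powr ?\<theta>)"
      using I \<theta> bad by (intro bad_sum_le) auto
    also have "(\<Sum>i\<in>I - GG. \<Sum>j\<in>J. \<bar>m i j\<bar> powr ?\<theta>) \<le> T"
      unfolding mT[symmetric] using I by (intro sum_mono2) (auto intro!: sum_nonneg)
    also have "(\<Sum>i\<in>GG. \<bar>a i\<bar> powr ?\<theta>) \<le> 4 * B * (\<Sum>i\<in>GG. (\<bar>a i\<bar> / 2) powr \<theta>)"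
      unfolding \<theta>' using \<theta> \<theta>' B a by (intro good_sum_le) auto
    also have "\<dots> \<le> 4 * B * sqrt M" using X B by (intro mult_left_mono) auto
    finally have "(\<Sum>i\<in>I. \<bar>a i\<bar> powr ?\<theta>) \<le> 2 * T + 4 * B * sqrt M" by simp
    \<comment> \<open>\<open>T\<close> occurs three times, twice from the bad strips and once in the
      claim, and each time it is at most \<open>M\<close>.\<close>
    moreover have "3 * M \<le> 4 * B * M" using B M0 by (intro mult_right_mono) auto
    ultimately show ?thesis using T by (simp add: algebra_simps)
  qed
  have "X \<le> sqrt M \<or> Y \<le> sqrt M"
  proof (rule ccontr)
    assume "\<not> ?thesis"
    then have "sqrt M * sqrt M < X * Y" using M0 by (intro mult_strict_mono') auto
    then show False using XY M0 by simp
  qed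
  then show ?thesis
  proof
    assume X: "X \<le> sqrt M"
    have "(\<Sum>i<N. \<bar>hdiff U i 0\<bar> powr ?\<theta>) + T \<le> 4 * B * (M + sqrt M)"
    proof (rule bound[where GG = GI and J = "{..<N'}" and m = "mdiff U" and \<theta> = \<theta>1 and \<theta>' = \<theta>2])
      show "\<bar>hdiff U i 0\<bar> \<le> 2 * B" for i using U[of i 0] U[of "Suc i" 0] by (simp add: hdiff_def)
    qed (use X \<theta> fin in \<open>auto simp: X_def T_def GI_def\<close>)
    then show ?thesis ..
  next
    assume Y: "Y \<le> sqrt M"
    have "(\<Sum>j<N'. \<bar>vdiff U 0 j\<bar> powr ?\<theta>) + T \<le> 4 * B * (M + sqrt M)"
    proof (rule bound[where GG = GJ and J = "{..<N}" and m = "\<lambda>j i. mdiff U i j" and \<theta> = \<theta>2 and \<theta>' = \<theta>1])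
      show "\<bar>vdiff U 0 i\<bar> \<le> 2 * B" for i using U[of 0 i] U[of 0 "Suc i"] by (simp add: vdiff_def)
      show "(\<Sum>i<N'. \<Sum>j<N. \<bar>mdiff U j i\<bar> powr ?\<theta>) = T" unfolding T_def by (rule sum.swap)
    qed (use Y \<theta> fin in \<open>auto simp: Y_def GJ_def\<close>)
    then show ?thesis ..
  qed
qed

section \<open>Compactness of families of atoms\<close>

lemma sorted_enumeration:
  fixes w :: "'i \<Rightarrow> real"
  assumes "finite I"
  obtains \<sigma> where "bij_betw \<sigma> {..<card I} I" "\<And>i j. i \<le> j \<Longrightarrow> j < card I \<Longrightarrow> w (\<sigma> j) \<le> w (\<sigma> i)"
proof -
  obtain xs where xs: "set xs = I" "distinct xs" using finite_distinct_list[OF assms] by auto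
  define l where "l = sort_key (\<lambda>i. - w i) xs"
  have l: "set l = I" "distinct l" "sorted (map (\<lambda>i. - w i) l)" using xs by (auto simp: l_def)
  have len: "length l = card I" using l distinct_card by metis
  show ?thesis
  proof (rule that[of "\<lambda>n. l ! n"])
    show "bij_betw ((!) l) {..<card I} I" using l len by (intro bij_betw_nth) auto
    fix i j assume ij: "i \<le> j" "j < card I"
    have "map (\<lambda>i. - w i) l ! i \<le> map (\<lambda>i. - w i) l ! j"
      by (rule sorted_nth_mono[OF l(3)]) (use ij len in auto)
    then show "w (l ! j) \<le> w (l ! i)" using ij len by simp
  qed
qed

text \<open>Tychonoff's theorem in place of a diagonal argument: a countable power of a compact
  metric space is sequentially compact.\<close>

lemma compact_functions_subsequence:
  fixes f :: "nat \<Rightarrow> nat \<Rightarrow> 'b::metric_space"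
  assumes X: "compact X" and f: "\<And>k n. f k n \<in> X"
  obtains l r where "\<And>n. l n \<in> X" "strict_mono (r :: nat \<Rightarrow> nat)" "\<And>n. (\<lambda>k. f (r k) n) \<longlonglongrightarrow> l n"
proof -
  have "compactin (product_topology (\<lambda>_. euclidean) UNIV) (PiE UNIV (\<lambda>_::nat. X))"
    using X by (subst compactin_PiE) auto
  then have "compact (PiE UNIV (\<lambda>_::nat. X))" by (simp add: euclidean_product_topology)
  then have "seq_compact (PiE UNIV (\<lambda>_::nat. X))" by (rule compact_imp_seq_compact)
  moreover have "\<forall>k. f k \<in> PiE UNIV (\<lambda>_::nat. X)" using f by auto
  ultimately obtain l r where l: "l \<in> PiE UNIV (\<lambda>_::nat. X)" "strict_mono r" "(f \<circ> r) \<longlonglongrightarrow> l"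
    unfolding seq_compact_def by metis
  have "(\<lambda>k. f (r k) n) \<longlonglongrightarrow> l n" for n
  proof -
    have "isCont (\<lambda>g. g n) l" for l :: "nat \<Rightarrow> 'b"
    proof -
      have "continuous_on UNIV (\<lambda>g::nat \<Rightarrow> 'b. g n)" by (rule continuous_on_product_coordinates)
      then show ?thesis unfolding continuous_on_eq_continuous_at[OF open_UNIV] by (rule bspec) simp
    qed
    from isCont_tendsto_compose[OF this l(3)] show ?thesis by (simp add: comp_def)
  qed
  with l that show ?thesis by (auto simp: PiE_iff)
qed

text \<open>Sorted by decreasing modulus, the \<open>n\<close>-th mass satisfies
  \<open>real (Suc n) * \<bar>m\<bar> powr \<theta> \<le> S1\<close>, hence is at most a multiple of
  \<open>real (Suc n) powr (- (1 / \<theta>))\<close>, uniformly in \<open>k\<close>. This majorant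
  is summable because \<open>1 / \<theta> > 1\<close>, and Tannery's theorem exchanges limit and
  sum. Continuity of \<open>g\<close> is asked for only at the limit positions, since
  \<open>g\<close> will be an indicator.\<close>

lemma atoms_compactness:
  fixes I :: "nat \<Rightarrow> 'i set" and m :: "nat \<Rightarrow> 'i \<Rightarrow> real" and loc :: "nat \<Rightarrow> 'i \<Rightarrow> 'b::metric_space"
  assumes \<theta>: "0 < \<theta>" "\<theta> < 1" and K: "compact K" "K \<noteq> {}"
    and fin: "\<And>k. finite (I k)" and loc: "\<And>k i. i \<in> I k \<Longrightarrow> loc k i \<in> K"
    and S: "\<And>k. (\<Sum>i\<in>I k. \<bar>m k i\<bar> powr \<theta>) \<le> S k" "S \<longlonglongrightarrow> S0"
  obtains r m' p' where "strict_mono (r :: nat \<Rightarrow> nat)" "\<And>n. p' n \<in> K"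
    "summable (\<lambda>n. \<bar>m' n\<bar> powr \<theta>)" "(\<Sum>n. \<bar>m' n\<bar> powr \<theta>) \<le> S0" "summable (\<lambda>n. \<bar>m' n\<bar>)"
    "\<And>D n. (\<And>k i. i \<in> I k \<Longrightarrow> \<bar>m k i\<bar> \<le> D) \<Longrightarrow> 0 \<le> D \<Longrightarrow> \<bar>m' n\<bar> \<le> D"
    "\<And>g. (\<And>n. isCont g (p' n)) \<Longrightarrow> (\<And>y. \<bar>g y\<bar> \<le> 1) \<Longrightarrow>
        (\<lambda>k. \<Sum>i\<in>I (r k). m (r k) i * g (loc (r k) i)) \<longlonglongrightarrow> (\<Sum>n. m' n * g (p' n))"
proof -
  obtain y0 where y0: "y0 \<in> K" using K by auto
  obtain S1 where S1: "\<And>k. \<bar>S k\<bar> \<le> S1"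
    using convergent_imp_Bseq[OF convergentI[OF S(2)]] by (auto simp: Bseq_def)
  have "\<exists>\<sigma>. bij_betw \<sigma> {..<card (I k)} (I k) \<and> (\<forall>i j. i \<le> j \<longrightarrow> j < card (I k) \<longrightarrow> \<bar>m k (\<sigma> j)\<bar> \<le> \<bar>m k (\<sigma> i)\<bar>)" for k
    using sorted_enumeration[OF fin[of k], of "\<lambda>i. \<bar>m k i\<bar>"] by metis
  then obtain \<sigma> where \<sigma>: "\<And>k. bij_betw (\<sigma> k) {..<card (I k)} (I k)"
    "\<And>k i j. i \<le> j \<Longrightarrow> j < card (I k) \<Longrightarrow> \<bar>m k (\<sigma> k j)\<bar> \<le> \<bar>m k (\<sigma> k i)\<bar>" by metis
  \<comment> \<open>Finite families become sequences: beyond their length the mass is 0, at an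
    arbitrary point of \<open>K\<close>.\<close>
  define f where "f k n = (if n < card (I k) then (m k (\<sigma> k n), loc k (\<sigma> k n)) else (0, y0))" for k n
  have sum_eq: "(\<Sum>i\<in>I k. h (m k i) (loc k i)) = (\<Sum>n<card (I k). h (fst (f k n)) (snd (f k n)))" for k and h :: "real \<Rightarrow> 'b \<Rightarrow> real"
    by (subst sum.reindex_bij_betw[OF \<sigma>(1)[of k], symmetric]) (auto simp: f_def)
  define c where "c n = (S1 / real (Suc n)) powr (1 / \<theta>)" for n
  have S10: "0 \<le> S1" using S1[of 0] by simp
  have part: "(\<Sum>n<N. \<bar>fst (f k n)\<bar> powr \<theta>) \<le> S k" for k N
  proof -
    have "(\<Sum>n<N. \<bar>fst (f k n)\<bar> powr \<theta>) = (\<Sum>n\<in>{..<N} \<inter> {..<card (I k)}. \<bar>fst (f k n)\<bar> powr \<theta>)"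
      by (rule sum.mono_neutral_right) (auto simp: f_def)
    also have "\<dots> \<le> (\<Sum>n<card (I k). \<bar>fst (f k n)\<bar> powr \<theta>)" by (rule sum_mono2) auto
    also have "\<dots> \<le> S k" using S(1)[of k] sum_eq[of "\<lambda>a b. \<bar>a\<bar> powr \<theta>" k] by simp
    finally show ?thesis .
  qed
  have fc: "\<bar>fst (f k n)\<bar> \<le> c n" for k n
  proof (cases "n < card (I k)")
    case True
    have "real (Suc n) * \<bar>fst (f k n)\<bar> powr \<theta> = (\<Sum>i<Suc n. \<bar>fst (f k n)\<bar> powr \<theta>)" by simp
    also have "\<dots> \<le> (\<Sum>i<Suc n. \<bar>fst (f k i)\<bar> powr \<theta>)"
      using True \<theta> \<sigma>(2)[of _ n k] by (intro sum_mono powr_mono2) (auto simp: f_def)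
    also have "\<dots> \<le> S1" using part[of k "Suc n"] S1[of k] by simp
    finally have "\<bar>fst (f k n)\<bar> powr \<theta> \<le> S1 / real (Suc n)" by (simp add: field_simps)
    then have "(\<bar>fst (f k n)\<bar> powr \<theta>) powr (1 / \<theta>) \<le> c n" unfolding c_def using \<theta> by (intro powr_mono2) auto
    then show ?thesis using \<theta> by (simp add: powr_powr)
  qed (simp add: f_def c_def)
  have c0: "c n \<le> c 0" for n
    unfolding c_def using \<theta> S10 by (intro powr_mono2 divide_left_mono) auto
  have csum: "summable c"
  proof -
    have "summable (\<lambda>n. real n powr (- (1 / \<theta>)))" using \<theta> by (subst summable_real_powr_iff) (simp add: field_simps)
    then have "summable (\<lambda>n. real (Suc n) powr (- (1 / \<theta>)))" by (subst summable_Suc_iff)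
    then have "summable (\<lambda>n. S1 powr (1 / \<theta>) * real (Suc n) powr (- (1 / \<theta>)))" by (rule summable_mult)
    moreover have "c = (\<lambda>n. S1 powr (1 / \<theta>) * real (Suc n) powr (- (1 / \<theta>)))"
      unfolding c_def using S10 by (simp add: powr_divide powr_minus_divide)
    ultimately show ?thesis by simp
  qed
  have "compact ({- c 0..c 0} \<times> K)" using K by (intro compact_Times) auto
  moreover have "f k n \<in> {- c 0..c 0} \<times> K" for k n
    using fc[of k n] c0[of n] loc[of "\<sigma> k n" k] bij_betwE[OF \<sigma>(1)[of k]] y0 by (auto simp: f_def mem_Times_iff)
  ultimately obtain l r where l: "\<And>n. l n \<in> {- c 0..c 0} \<times> K" "strict_mono r" "\<And>n. (\<lambda>k. f (r k) n) \<longlonglongrightarrow> l n"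
    using compact_functions_subsequence[of "{- c 0..c 0} \<times> K" f] by metis
  define m' where "m' n = fst (l n)" for n
  define p' where "p' n = snd (l n)" for n
  have lim: "(\<lambda>k. fst (f (r k) n)) \<longlonglongrightarrow> m' n" "(\<lambda>k. snd (f (r k) n)) \<longlonglongrightarrow> p' n" for n
    unfolding m'_def p'_def by (intro tendsto_fst tendsto_snd l(3))+
  have m'c: "\<bar>m' n\<bar> \<le> c n" for n
    by (rule LIMSEQ_le_const2[OF tendsto_rabs[OF lim(1)]]) (use fc in auto)
  have Sr: "(\<lambda>k. S (r k)) \<longlonglongrightarrow> S0" using LIMSEQ_subseq_LIMSEQ[OF S(2) l(2)] by (simp add: comp_def)
  have part': "(\<Sum>n<N. \<bar>m' n\<bar> powr \<theta>) \<le> S0" for N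
  proof (rule LIMSEQ_le[OF _ Sr])
    show "(\<lambda>k. \<Sum>n<N. \<bar>fst (f (r k) n)\<bar> powr \<theta>) \<longlonglongrightarrow> (\<Sum>n<N. \<bar>m' n\<bar> powr \<theta>)"
      using \<theta> by (intro tendsto_sum tendsto_powr2 tendsto_rabs lim) (auto intro!: always_eventually)
  qed (use part in auto)
  show ?thesis
  proof (rule that[OF l(2)])
    show "p' n \<in> K" for n using l(1)[of n] by (auto simp: p'_def mem_Times_iff)
    show s\<theta>: "summable (\<lambda>n. \<bar>m' n\<bar> powr \<theta>)"
      by (rule bounded_imp_summable[where B = S0]) (use part'[of "Suc n" for n] in \<open>auto simp: lessThan_Suc_atMost\<close>)
    show "(\<Sum>n. \<bar>m' n\<bar> powr \<theta>) \<le> S0" by (rule suminf_le_const[OF s\<theta> part'])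
    show "summable (\<lambda>n. \<bar>m' n\<bar>)" by (rule summable_comparison_test'[OF csum, of 0]) (use m'c in auto)
    show "\<bar>m' n\<bar> \<le> D" if D: "\<And>k i. i \<in> I k \<Longrightarrow> \<bar>m k i\<bar> \<le> D" "0 \<le> D" for D n
    proof (rule LIMSEQ_le_const2[OF tendsto_rabs[OF lim(1)]])
      have "\<bar>fst (f k n)\<bar> \<le> D" for k using D bij_betwE[OF \<sigma>(1)[of k]] by (auto simp: f_def)
      then show "\<exists>N. \<forall>k\<ge>N. \<bar>fst (f (r k) n)\<bar> \<le> D" by auto
    qed
    fix g :: "'b \<Rightarrow> real" assume g: "\<And>n. isCont g (p' n)" "\<And>y. \<bar>g y\<bar> \<le> 1"
    \<comment> \<open>The majorant \<open>c\<close> does not depend on \<open>k\<close>, so no mass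
      escapes into ever smaller atoms.\<close>
    have "(\<lambda>k. \<Sum>n. fst (f (r k) n) * g (snd (f (r k) n))) \<longlonglongrightarrow> (\<Sum>n. m' n * g (p' n))"
    proof (rule tannerys_theorem[THEN conjunct2, THEN conjunct2])
      show "((\<lambda>k. fst (f (r k) n) * g (snd (f (r k) n))) \<longlongrightarrow> m' n * g (p' n)) sequentially" for n
        by (intro tendsto_mult lim isCont_tendsto_compose[OF g(1)])
      have "norm (fst (f (r k) n) * g (snd (f (r k) n))) \<le> c n" for n k
      proof -
        have "\<bar>fst (f (r k) n)\<bar> * \<bar>g (snd (f (r k) n))\<bar> \<le> \<bar>fst (f (r k) n)\<bar> * 1"
          by (intro mult_left_mono g) auto
        then show ?thesis using fc[of "r k" n] by (simp add: abs_mult)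
      qed
      then show "\<forall>\<^sub>F (n, k) in at_top \<times>\<^sub>F sequentially. norm (fst (f (r k) n) * g (snd (f (r k) n))) \<le> c n"
        by (intro always_eventually) auto
    qed (use csum in auto)
    moreover have "(\<Sum>n. fst (f k n) * g (snd (f k n))) = (\<Sum>i\<in>I k. m k i * g (loc k i))" for k
      unfolding sum_eq[of "\<lambda>a b. a * g b"] by (rule suminf_finite) (auto simp: f_def)
    ultimately show "(\<lambda>k. \<Sum>i\<in>I (r k). m (r k) i * g (loc (r k) i)) \<longlonglongrightarrow> (\<Sum>n. m' n * g (p' n))" by simp
  qed
qed

section \<open>Discretisation of the energy\<close>

lemma shrink_interval:
  assumes "0 < \<epsilon>" shows "shrink \<epsilon> {a<..<b} = {a + \<epsilon><..<b - \<epsilon>}"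
proof (intro equalityI subsetI)
  fix s assume "s \<in> shrink \<epsilon> {a<..<b}"
  then have s: "infdist s (- {a<..<b}) > \<epsilon>" by (auto simp: shrink_def)
  have "infdist s (- {a<..<b}) \<le> dist s a" "infdist s (- {a<..<b}) \<le> dist s b" by (auto intro!: infdist_le)
  then show "s \<in> {a + \<epsilon><..<b - \<epsilon>}"
    using s \<open>s \<in> shrink \<epsilon> {a<..<b}\<close> by (auto simp: shrink_def dist_real_def)
next
  fix s assume s: "s \<in> {a + \<epsilon><..<b - \<epsilon>}"
  have ne: "- {a<..<b} \<noteq> {}" using s by (auto intro!: exI[of _ a])
  have "min (s - a) (b - s) \<le> infdist s (- {a<..<b})"
    unfolding infdist_notempty[OF ne] using ne by (intro cINF_greatest) (auto simp: dist_real_def)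
  then show "s \<in> shrink \<epsilon> {a<..<b}" using s assms by (auto simp: shrink_def)
qed

lemma nn_integral_translate:
  fixes f :: "'a::euclidean_space \<Rightarrow> ennreal"
  assumes [measurable]: "f \<in> borel_measurable borel"
  shows "(\<integral>\<^sup>+x. f (x + v) \<partial>lborel) = (\<integral>\<^sup>+x. f x \<partial>lborel)"
proof -
  have "(\<integral>\<^sup>+x. f x \<partial>lborel) = (\<integral>\<^sup>+x. f x \<partial>distr lborel borel ((+) v))" by (simp add: lborel_distr_plus)
  also have "\<dots> = (\<integral>\<^sup>+x. f (v + x) \<partial>lborel)" by (rule nn_integral_distr) auto
  finally show ?thesis by (simp add: add.commute)
qed

lemma nn_integral_scale:
  fixes f :: "real \<times> real \<Rightarrow> ennreal"
  assumes [measurable]: "f \<in> borel_measurable borel" and c: "c > 0"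
  shows "(\<integral>\<^sup>+x. f x \<partial>lborel) = (\<integral>\<^sup>+x. ennreal (c\<^sup>2) * f (c *\<^sub>R x) \<partial>lborel)"
proof -
  have "(\<integral>\<^sup>+x. f x \<partial>lborel) = (\<integral>\<^sup>+x. f x \<partial>density (distr lborel borel (\<lambda>x. 0 + c *\<^sub>R x)) (\<lambda>_. \<bar>c\<bar> ^ DIM(real \<times> real)))"
    using c by (subst lborel_affine[of c 0]) auto
  also have "\<dots> = (\<integral>\<^sup>+x. ennreal (\<bar>c\<bar> ^ DIM(real \<times> real)) * f x \<partial>distr lborel borel (\<lambda>x. 0 + c *\<^sub>R x))"
    by (rule nn_integral_density) auto
  also have "\<dots> = (\<integral>\<^sup>+x. ennreal (c\<^sup>2) * f (c *\<^sub>R x) \<partial>lborel)"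
    using c by (subst nn_integral_distr) (auto simp: power2_eq_square numeral_2_eq_2)
  finally show ?thesis .
qed

lemma nn_integral_reflect:
  fixes f :: "real \<times> real \<Rightarrow> ennreal"
  assumes [measurable]: "f \<in> borel_measurable borel" and st: "\<bar>s\<bar> = 1" "\<bar>t\<bar> = 1"
  shows "(\<integral>\<^sup>+x. f (s * fst x, t * snd x) \<partial>lborel) = (\<integral>\<^sup>+x. f x \<partial>lborel)"
proof -
  define c where "c j = (if j = (1, 0) then s else t)" for j :: "real \<times> real"
  define T where "T x = 0 + (\<Sum>j\<in>Basis. (c j * (x \<bullet> j)) *\<^sub>R j)" for x :: "real \<times> real"
  have T: "T x = (s * fst x, t * snd x)" for x by (simp add: T_def Basis_real_pair c_def)
  have c: "c j \<noteq> 0" "\<bar>c j\<bar> = 1" for j using st by (auto simp: c_def)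
  have "lborel = density (distr lborel borel T) (\<lambda>_. (\<Prod>j\<in>Basis. \<bar>c j\<bar>))"
    unfolding T_def[abs_def] by (rule lborel_affine_euclidean) (use c in auto)
  also have "\<dots> = distr lborel borel T" by (simp add: c density_1)
  finally have "(\<integral>\<^sup>+x. f x \<partial>lborel) = (\<integral>\<^sup>+x. f x \<partial>distr lborel borel T)" by simp
  also have "\<dots> = (\<integral>\<^sup>+x. f (T x) \<partial>lborel)" by (rule nn_integral_distr) (auto simp: T[abs_def])
  finally show ?thesis by (simp add: T)
qed

text \<open>Inner integral of the energy, without the weight in \<open>z\<close>. The steps
  \<open>h\<close> and \<open>l\<close> are signed, because each corner of a cell looks into the
  cell in its own direction.\<close>

definition dir_energy :: "real \<Rightarrow> real \<Rightarrow> (real \<times> real \<Rightarrow> real) \<Rightarrow> (real \<times> real) set \<Rightarrow> real \<Rightarrow> real \<Rightarrow> ennreal" where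
  "dir_energy \<theta>1 \<theta>2 w S h l =
    (\<integral>\<^sup>+ x. ennreal (\<bar>w (x + (h, 0)) - w x\<bar> powr \<theta>1 * \<bar>w (x + (0, l)) - w x\<bar> powr \<theta>2) * indicator S x \<partial>lborel)"

definition cell_density :: "real \<Rightarrow> real \<Rightarrow> (real \<times> real \<Rightarrow> real) \<Rightarrow> real \<Rightarrow> real \<Rightarrow> real \<times> real \<Rightarrow> real" where
  "cell_density \<theta>1 \<theta>2 w h l x =
    (\<bar>w (x + (h, 0)) - w x\<bar> powr \<theta>1 + \<bar>w (x + (h, l)) - w (x + (0, l))\<bar> powr \<theta>1) *
    (\<bar>w (x + (0, l)) - w x\<bar> powr \<theta>2 + \<bar>w (x + (h, l)) - w (x + (h, 0))\<bar> powr \<theta>2)"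

lemma translate_measurable [measurable (raw)]:
  fixes w :: "real \<times> real \<Rightarrow> real"
  assumes "w \<in> borel_measurable borel" shows "(\<lambda>x. w (x + v)) \<in> borel_measurable borel"
  by (rule measurable_compose[OF borel_measurable_continuous_onI assms]) (intro continuous_intros)

text \<open>The density splits into four corner terms. Translated to its own corner, each becomes an
  integrand of \<open>dir_energy\<close> whose steps point back into the cell; the condition on
  \<open>Q\<close> keeps all four corners in \<open>S\<close>.\<close>

lemma cell_integral_le:
  fixes w :: "real \<times> real \<Rightarrow> real"
  assumes w: "w \<in> borel_measurable borel" and S: "S \<in> sets borel"
    and Q: "\<And>x. x \<in> Q \<Longrightarrow> x \<in> S \<and> x + (h, 0) \<in> S \<and> x + (0, l) \<in> S \<and> x + (h, l) \<in> S"
  shows "(\<integral>\<^sup>+x. ennreal (cell_density \<theta>1 \<theta>2 w h l x) * indicator Q x \<partial>lborel)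
    \<le> dir_energy \<theta>1 \<theta>2 w S h l + dir_energy \<theta>1 \<theta>2 w S (- h) l + dir_energy \<theta>1 \<theta>2 w S h (- l) + dir_energy \<theta>1 \<theta>2 w S (- h) (- l)"
proof -
  note [measurable] = w S
  define \<Phi> where "\<Phi> s t y = ennreal (\<bar>w (y + (s, 0)) - w y\<bar> powr \<theta>1 * \<bar>w (y + (0, t)) - w y\<bar> powr \<theta>2) * indicator S y" for s t y
  have [measurable]: "\<Phi> s t \<in> borel_measurable borel" for s t
    unfolding \<Phi>_def by measurable
  have [measurable]: "(\<lambda>y. \<Phi> s t (y + v)) \<in> borel_measurable borel" for s t v
    by (rule measurable_compose[OF borel_measurable_continuous_onI \<open>\<Phi> s t \<in> borel_measurable borel\<close>]) (intro continuous_intros)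
  have "(\<integral>\<^sup>+x. ennreal (cell_density \<theta>1 \<theta>2 w h l x) * indicator Q x \<partial>lborel)
     \<le> (\<integral>\<^sup>+x. \<Phi> h l x + \<Phi> (- h) l (x + (h, 0)) + \<Phi> h (- l) (x + (0, l)) + \<Phi> (- h) (- l) (x + (h, l)) \<partial>lborel)"
  proof (intro nn_integral_mono)
    fix x
    show "ennreal (cell_density \<theta>1 \<theta>2 w h l x) * indicator Q x
       \<le> \<Phi> h l x + \<Phi> (- h) l (x + (h, 0)) + \<Phi> h (- l) (x + (0, l)) + \<Phi> (- h) (- l) (x + (h, l))"
    proof (cases "x \<in> Q")
      case True
      have "ennreal (cell_density \<theta>1 \<theta>2 w h l x) = \<Phi> h l x + \<Phi> (- h) l (x + (h, 0)) + \<Phi> h (- l) (x + (0, l)) + \<Phi> (- h) (- l) (x + (h, l))"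
        using Q[OF True] unfolding \<Phi>_def cell_density_def
        by (simp add: ennreal_plus[symmetric] add.assoc abs_minus_commute algebra_simps zero_prod_def[symmetric] del: ennreal_plus)
      then show ?thesis using True by simp
    qed simp
  qed
  also have "\<dots> = (\<integral>\<^sup>+x. \<Phi> h l x \<partial>lborel) + (\<integral>\<^sup>+x. \<Phi> (- h) l (x + (h, 0)) \<partial>lborel)
      + (\<integral>\<^sup>+x. \<Phi> h (- l) (x + (0, l)) \<partial>lborel) + (\<integral>\<^sup>+x. \<Phi> (- h) (- l) (x + (h, l)) \<partial>lborel)"
    by (simp add: nn_integral_add)
  also have "\<dots> = dir_energy \<theta>1 \<theta>2 w S h l + dir_energy \<theta>1 \<theta>2 w S (- h) l + dir_energy \<theta>1 \<theta>2 w S h (- l) + dir_energy \<theta>1 \<theta>2 w S (- h) (- l)"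
    by (simp add: nn_integral_translate) (simp add: \<Phi>_def dir_energy_def)
  finally show ?thesis .
qed

lemma dir_energy_measurable:
  assumes w: "w \<in> borel_measurable borel" and S [measurable]: "S \<in> sets borel"
  shows "(\<lambda>z. dir_energy \<theta>1 \<theta>2 w S (fst z) (snd z)) \<in> borel_measurable borel"
proof -
  have c: "(\<lambda>p. w (f p)) \<in> borel_measurable (borel :: ((real \<times> real) \<times> (real \<times> real)) measure)" if "continuous_on UNIV f" for f
    by (rule measurable_compose[OF borel_measurable_continuous_onI w]) (rule that)
  have "(\<lambda>p. ennreal (\<bar>w (snd p + (fst (fst p), 0)) - w (snd p)\<bar> powr \<theta>1 * \<bar>w (snd p + (0, snd (fst p))) - w (snd p)\<bar> powr \<theta>2) * indicator S (snd p))
     \<in> borel_measurable (borel :: ((real \<times> real) \<times> (real \<times> real)) measure)"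
  proof -
    have [measurable]: "(\<lambda>p. w (snd p + (fst (fst p), 0))) \<in> borel_measurable (borel :: ((real \<times> real) \<times> (real \<times> real)) measure)"
      "(\<lambda>p. w (snd p + (0, snd (fst p)))) \<in> borel_measurable (borel :: ((real \<times> real) \<times> (real \<times> real)) measure)"
      "(\<lambda>p. w (snd p)) \<in> borel_measurable (borel :: ((real \<times> real) \<times> (real \<times> real)) measure)"
      by (intro c continuous_intros)+
    have [measurable]: "(\<lambda>p. indicator S (snd p) :: ennreal) \<in> borel_measurable (borel :: ((real \<times> real) \<times> (real \<times> real)) measure)"
      by (rule measurable_compose[OF borel_measurable_continuous_onI]) (auto intro: continuous_intros)
    show ?thesis by measurable
  qed
  then have "(\<lambda>p. ennreal (\<bar>w (snd p + (fst (fst p), 0)) - w (snd p)\<bar> powr \<theta>1 * \<bar>w (snd p + (0, snd (fst p))) - w (snd p)\<bar> powr \<theta>2) * indicator S (snd p))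
     \<in> borel_measurable (borel \<Otimes>\<^sub>M lborel)"
    by (subst measurable_cong_sets[OF _ refl, of _ "borel :: ((real \<times> real) \<times> (real \<times> real)) measure"])
       (auto simp: borel_prod[symmetric] intro: sets_pair_measure_cong)
  from lborel.borel_measurable_nn_integral_fst[OF this] show ?thesis by (simp add: dir_energy_def)
qed

lemma AE_translate:
  fixes v :: "'a::euclidean_space"
  assumes "AE x in lebesgue. P x" shows "AE x in lebesgue. P (x + v)"
proof -
  have "AE x in lborel. P x" using assms by (simp add: AE_completion_iff)
  then obtain N where N: "\<And>x. x \<notin> N \<Longrightarrow> P x" "N \<in> null_sets lborel" by (rule AE_E3) auto
  have "AE x in lborel. P (x + v)"
    by (rule AE_I'[OF null_sets_translation[OF N(2), of "- v"]]) (use N(1) in auto)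
  then show ?thesis by (simp add: AE_completion_iff)
qed

text \<open>The kernel vanishes unless \<open>norm z < \<epsilon>\<close>, and from the shrunk box
  such steps do not leave the box. Since translates of null sets are null, \<open>u\<close> may be
  replaced by a Borel function that vanishes outside the box.\<close>

lemma energy_eps_cong:
  fixes u w :: "real \<times> real \<Rightarrow> real"
  assumes \<epsilon>: "\<epsilon> > 0" and \<rho>: "\<forall>z. norm z \<ge> 1 \<longrightarrow> \<rho> z = 0"
    and ae: "AE x in lebesgue. x \<in> box2 a1 b1 a2 b2 \<longrightarrow> u x = w x"
  shows "energy_eps \<theta>1 \<theta>2 \<rho> {a1<..<b1} {a2<..<b2} \<epsilon> u = energy_eps \<theta>1 \<theta>2 \<rho> {a1<..<b1} {a2<..<b2} \<epsilon> w"
  unfolding energy_eps_def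
proof (rule nn_integral_cong)
  fix z :: "real \<times> real"
  let ?S = "shrink \<epsilon> {a1<..<b1} \<times> shrink \<epsilon> {a2<..<b2}"
  show "(\<integral>\<^sup>+ x \<in> ?S. ennreal (\<bar>u (x + (fst z, 0)) - u x\<bar> powr \<theta>1 * \<bar>u (x + (0, snd z)) - u x\<bar> powr \<theta>2 / (norm z)\<^sup>2) \<partial>lebesgue)
            * ennreal (\<rho> ((1 / \<epsilon>) *\<^sub>R z) / \<epsilon>\<^sup>2) =
     (\<integral>\<^sup>+ x \<in> ?S. ennreal (\<bar>w (x + (fst z, 0)) - w x\<bar> powr \<theta>1 * \<bar>w (x + (0, snd z)) - w x\<bar> powr \<theta>2 / (norm z)\<^sup>2) \<partial>lebesgue)
            * ennreal (\<rho> ((1 / \<epsilon>) *\<^sub>R z) / \<epsilon>\<^sup>2)"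
  proof (cases "norm z < \<epsilon>")
    case False
    then have "norm ((1 / \<epsilon>) *\<^sub>R z) \<ge> 1" using \<epsilon> by simp
    then have "\<rho> ((1 / \<epsilon>) *\<^sub>R z) = 0" using \<rho> by blast
    then show ?thesis by simp
  next
    case True
    then have z: "\<bar>fst z\<bar> < \<epsilon>" "\<bar>snd z\<bar> < \<epsilon>"
      using norm_fst_le[of "fst z" "snd z"] norm_snd_le[of "snd z" "fst z"] by auto
    show ?thesis
    proof (intro arg_cong2[where f = "\<lambda>x y. x * y"] nn_integral_cong_AE refl)
      show "AE x in lebesgue. ennreal (\<bar>u (x + (fst z, 0)) - u x\<bar> powr \<theta>1 * \<bar>u (x + (0, snd z)) - u x\<bar> powr \<theta>2 / (norm z)\<^sup>2) * indicator ?S x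
        = ennreal (\<bar>w (x + (fst z, 0)) - w x\<bar> powr \<theta>1 * \<bar>w (x + (0, snd z)) - w x\<bar> powr \<theta>2 / (norm z)\<^sup>2) * indicator ?S x"
        using ae AE_translate[OF ae, of "(fst z, 0)"] AE_translate[OF ae, of "(0, snd z)"]
      proof eventually_elim
        case (elim x)
        show ?case
        proof (cases "x \<in> ?S")
          case True
          then have "x \<in> box2 a1 b1 a2 b2" "x + (fst z, 0) \<in> box2 a1 b1 a2 b2" "x + (0, snd z) \<in> box2 a1 b1 a2 b2"
            using z \<epsilon> by (auto simp: shrink_interval box2_def mem_Times_iff)
          with elim show ?thesis by simp
        qed simp
      qed
    qed
  qed
qed

lemma energy_cong:
  fixes u w :: "real \<times> real \<Rightarrow> real"
  assumes \<rho>: "\<forall>z. norm z \<ge> 1 \<longrightarrow> \<rho> z = 0"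
    and ae: "AE x in lebesgue. x \<in> box2 a1 b1 a2 b2 \<longrightarrow> u x = w x"
  shows "energy \<theta>1 \<theta>2 \<rho> {a1<..<b1} {a2<..<b2} u = energy \<theta>1 \<theta>2 \<rho> {a1<..<b1} {a2<..<b2} w"
  unfolding energy_def using energy_eps_cong[OF _ \<rho> ae]
  by (intro Liminf_eq) (auto simp: eventually_at_filter)

section \<open>Averaging over the direction\<close>

locale kernel =
  fixes \<rho> :: "real \<times> real \<Rightarrow> real"
  assumes \<rho>_nonneg: "\<And>z. \<rho> z \<ge> 0" and \<rho>_integrable: "integrable lborel \<rho>"
    and \<rho>_radial: "\<And>y z. norm y = norm z \<Longrightarrow> \<rho> y = \<rho> z"
    and \<rho>_support: "\<And>z. norm z \<ge> 1 \<Longrightarrow> \<rho> z = 0"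
    and \<rho>_mass: "(\<integral>z. \<rho> z \<partial>lborel) = 1"
begin

text \<open>Passing from an integral over positions to a sum over cells divides by the cell area,
  \<open>\<bar>fst z * snd z\<bar>\<close> up to scaling, while the energy divides by
  \<open>(norm z)\<^sup>2\<close>. This is the mean of the ratio under \<rho>.\<close>

definition "\<rho>_const = (\<integral>z. \<rho> z * (\<bar>fst z * snd z\<bar> / (norm z)\<^sup>2) \<partial>lborel)"

lemma \<rho>_measurable [measurable]: "\<rho> \<in> borel_measurable borel"
  using \<rho>_integrable by auto

lemma angle_le: "\<bar>fst z * snd z\<bar> / (norm z)\<^sup>2 \<le> 1" for z :: "real \<times> real"
proof -
  have "0 \<le> (\<bar>fst z\<bar> - \<bar>snd z\<bar>)\<^sup>2" by simp
  then have "2 * (\<bar>fst z\<bar> * \<bar>snd z\<bar>) \<le> (fst z)\<^sup>2 + (snd z)\<^sup>2" by (simp add: power2_diff)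
  moreover have "0 \<le> \<bar>fst z\<bar> * \<bar>snd z\<bar>" by simp
  moreover have "(norm z)\<^sup>2 = (fst z)\<^sup>2 + (snd z)\<^sup>2" by (cases z) (simp add: norm_Pair)
  ultimately have "\<bar>fst z * snd z\<bar> \<le> (norm z)\<^sup>2" unfolding abs_mult by linarith
  then show ?thesis by (auto simp: divide_le_eq_1)
qed

lemma \<rho>_const_integrable: "integrable lborel (\<lambda>z. \<rho> z * (\<bar>fst z * snd z\<bar> / (norm z)\<^sup>2))"
proof (rule Bochner_Integration.integrable_bound[OF \<rho>_integrable])
  show "(\<lambda>z. \<rho> z * (\<bar>fst z * snd z\<bar> / (norm z)\<^sup>2)) \<in> borel_measurable lborel" by measurable
  show "AE z in lborel. norm (\<rho> z * (\<bar>fst z * snd z\<bar> / (norm z)\<^sup>2)) \<le> norm (\<rho> z)"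
  proof (rule AE_I2)
    fix z :: "real \<times> real"
    have "\<rho> z * (\<bar>fst z * snd z\<bar> / (norm z)\<^sup>2) \<le> \<rho> z * 1" by (intro mult_left_mono angle_le \<rho>_nonneg)
    then show "norm (\<rho> z * (\<bar>fst z * snd z\<bar> / (norm z)\<^sup>2)) \<le> norm (\<rho> z)" using \<rho>_nonneg[of z] by (simp add: abs_mult)
  qed
qed

text \<open>The ratio vanishes only on the two axes, a null set, so a zero mean would make \<rho>
  vanish almost everywhere, against its total mass 1.\<close>

lemma \<rho>_const_pos: "\<rho>_const > 0"
proof -
  have nn: "0 \<le> \<rho> z * (\<bar>fst z * snd z\<bar> / (norm z)\<^sup>2)" for z
    by (intro mult_nonneg_nonneg divide_nonneg_nonneg \<rho>_nonneg) auto
  have "\<rho>_const \<ge> 0" unfolding \<rho>_const_def by (rule Bochner_Integration.integral_nonneg) (rule nn)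
  moreover have "\<rho>_const \<noteq> 0"
  proof
    assume "\<rho>_const = 0"
    then have "AE z in lborel. \<rho> z * (\<bar>fst z * snd z\<bar> / (norm z)\<^sup>2) = 0"
      unfolding \<rho>_const_def using nn by (subst (asm) integral_nonneg_eq_0_iff_AE[OF \<rho>_const_integrable]) auto
    moreover have "AE z in lborel. fst z \<noteq> 0 \<and> snd (z :: real \<times> real) \<noteq> 0"
    proof -
      have "negligible {z :: real \<times> real. (1, 0) \<bullet> z = 0}" "negligible {z :: real \<times> real. (0, 1) \<bullet> z = 0}"
        by (intro negligible_hyperplane; simp add: zero_prod_def)+
      then have "AE z in lebesgue. z \<notin> {z :: real \<times> real. (1, 0) \<bullet> z = 0}" "AE z in lebesgue. z \<notin> {z :: real \<times> real. (0, 1) \<bullet> z = 0}"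
        by (intro AE_not_in; simp add: negligible_iff_null_sets)+
      then have "AE z in lebesgue. fst z \<noteq> 0 \<and> snd (z :: real \<times> real) \<noteq> 0"
        by eventually_elim (auto simp: inner_prod_def)
      then show ?thesis by (simp add: AE_completion_iff)
    qed
    ultimately have "AE z in lborel. \<rho> z = 0" by eventually_elim (auto simp: zero_prod_def)
    then have "(\<integral>z. \<rho> z \<partial>lborel) = 0" by (rule integral_eq_zero_AE)
    then show False using \<rho>_mass by simp
  qed
  ultimately show ?thesis by simp
qed

text \<open>Substituting \<open>\<epsilon> *\<^sub>R z\<close> for \<open>z\<close> freezes the
  kernel: the Jacobian \<open>\<epsilon>\<^sup>2\<close> cancels its normalisation, and only the
  weight and the steps keep \<epsilon>.\<close>

lemma energy_eps_eq:
  fixes a1 b1 a2 b2 :: real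
  assumes w [measurable]: "w \<in> borel_measurable borel" and \<epsilon>: "\<epsilon> > 0"
  defines "S \<equiv> {a1 + \<epsilon><..<b1 - \<epsilon>} \<times> {a2 + \<epsilon><..<b2 - \<epsilon>}"
  shows "energy_eps \<theta>1 \<theta>2 \<rho> {a1<..<b1} {a2<..<b2} \<epsilon> w
    = (\<integral>\<^sup>+z. dir_energy \<theta>1 \<theta>2 w S (\<epsilon> * fst z) (\<epsilon> * snd z) * ennreal (\<rho> z / (\<epsilon> * norm z)\<^sup>2) \<partial>lborel)"
proof -
  have [measurable]: "S \<in> sets borel" unfolding S_def by (intro borel_Times) auto
  note [measurable] = dir_energy_measurable[OF w \<open>S \<in> sets borel\<close>]
  have inner: "(\<integral>\<^sup>+ x \<in> S. ennreal (\<bar>w (x + (fst z, 0)) - w x\<bar> powr \<theta>1 * \<bar>w (x + (0, snd z)) - w x\<bar> powr \<theta>2 / (norm z)\<^sup>2) \<partial>lebesgue)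
     = dir_energy \<theta>1 \<theta>2 w S (fst z) (snd z) * ennreal (1 / (norm z)\<^sup>2)" for z
  proof -
    have "(\<integral>\<^sup>+ x \<in> S. ennreal (\<bar>w (x + (fst z, 0)) - w x\<bar> powr \<theta>1 * \<bar>w (x + (0, snd z)) - w x\<bar> powr \<theta>2 / (norm z)\<^sup>2) \<partial>lebesgue)
      = (\<integral>\<^sup>+ x. ennreal (\<bar>w (x + (fst z, 0)) - w x\<bar> powr \<theta>1 * \<bar>w (x + (0, snd z)) - w x\<bar> powr \<theta>2) * indicator S x * ennreal (1 / (norm z)\<^sup>2) \<partial>lborel)"
      unfolding nn_integral_completion
      by (intro nn_integral_cong) (auto simp: ennreal_mult[symmetric] split: split_indicator)
    also have "\<dots> = dir_energy \<theta>1 \<theta>2 w S (fst z) (snd z) * ennreal (1 / (norm z)\<^sup>2)"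
      unfolding dir_energy_def by (rule nn_integral_multc) measurable
    finally show ?thesis .
  qed
  have "energy_eps \<theta>1 \<theta>2 \<rho> {a1<..<b1} {a2<..<b2} \<epsilon> w
     = (\<integral>\<^sup>+z. dir_energy \<theta>1 \<theta>2 w S (fst z) (snd z) * ennreal (1 / (norm z)\<^sup>2) * ennreal (\<rho> ((1 / \<epsilon>) *\<^sub>R z) / \<epsilon>\<^sup>2) \<partial>lborel)"
    unfolding energy_eps_def shrink_interval[OF \<epsilon>] S_def[symmetric] inner by (rule nn_integral_completion)
  also have "\<dots> = (\<integral>\<^sup>+z. ennreal (\<epsilon>\<^sup>2) * (dir_energy \<theta>1 \<theta>2 w S (fst (\<epsilon> *\<^sub>R z)) (snd (\<epsilon> *\<^sub>R z)) * ennreal (1 / (norm (\<epsilon> *\<^sub>R z))\<^sup>2) * ennreal (\<rho> ((1 / \<epsilon>) *\<^sub>R (\<epsilon> *\<^sub>R z)) / \<epsilon>\<^sup>2)) \<partial>lborel)"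
    by (rule nn_integral_scale[OF _ \<epsilon>]) measurable
  also have "\<dots> = (\<integral>\<^sup>+z. dir_energy \<theta>1 \<theta>2 w S (\<epsilon> * fst z) (\<epsilon> * snd z) * ennreal (\<rho> z / (\<epsilon> * norm z)\<^sup>2) \<partial>lborel)"
  proof (intro nn_integral_cong)
    fix z
    have "ennreal (\<epsilon>\<^sup>2) * (ennreal (1 / (norm (\<epsilon> *\<^sub>R z))\<^sup>2) * ennreal (\<rho> ((1 / \<epsilon>) *\<^sub>R (\<epsilon> *\<^sub>R z)) / \<epsilon>\<^sup>2)) = ennreal (\<rho> z / (\<epsilon> * norm z)\<^sup>2)"
      using \<epsilon> \<rho>_nonneg[of z] by (simp add: ennreal_mult[symmetric] power_mult_distrib power2_eq_square field_simps)
    note X = this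
    have "ennreal (\<epsilon>\<^sup>2) * (D * P * Q) = D * (ennreal (\<epsilon>\<^sup>2) * (P * Q))" for D P Q by (simp only: mult_ac)
    from this[of "dir_energy \<theta>1 \<theta>2 w S (\<epsilon> * fst z) (\<epsilon> * snd z)" "ennreal (1 / (norm (\<epsilon> *\<^sub>R z))\<^sup>2)" "ennreal (\<rho> ((1 / \<epsilon>) *\<^sub>R (\<epsilon> *\<^sub>R z)) / \<epsilon>\<^sup>2)"]
    show "ennreal (\<epsilon>\<^sup>2) * (dir_energy \<theta>1 \<theta>2 w S (fst (\<epsilon> *\<^sub>R z)) (snd (\<epsilon> *\<^sub>R z)) * ennreal (1 / (norm (\<epsilon> *\<^sub>R z))\<^sup>2) * ennreal (\<rho> ((1 / \<epsilon>) *\<^sub>R (\<epsilon> *\<^sub>R z)) / \<epsilon>\<^sup>2))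
      = dir_energy \<theta>1 \<theta>2 w S (\<epsilon> * fst z) (\<epsilon> * snd z) * ennreal (\<rho> z / (\<epsilon> * norm z)\<^sup>2)"
      unfolding X by (simp only: fst_scaleR snd_scaleR real_scaleR_def)
  qed
  finally show ?thesis .
qed

text \<open>Averaging over \<open>z\<close>: since \<open>\<rho>\<close> is radial, the reflections of \<open>z\<close> in the two axes can be
  averaged together, so one direction serves all four sign combinations.\<close>

lemma good_direction:
  fixes a1 b1 a2 b2 :: real
  assumes w [measurable]: "w \<in> borel_measurable borel" and \<epsilon>: "\<epsilon> > 0" and E: "0 \<le> E"
    "energy_eps \<theta>1 \<theta>2 \<rho> {a1<..<b1} {a2<..<b2} \<epsilon> w < ennreal E"
  defines "S \<equiv> {a1 + \<epsilon><..<b1 - \<epsilon>} \<times> {a2 + \<epsilon><..<b2 - \<epsilon>}"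
  obtains h l where "0 < h" "h < \<epsilon>" "0 < l" "l < \<epsilon>"
    "dir_energy \<theta>1 \<theta>2 w S h l + dir_energy \<theta>1 \<theta>2 w S (- h) l + dir_energy \<theta>1 \<theta>2 w S h (- l) + dir_energy \<theta>1 \<theta>2 w S (- h) (- l)
      \<le> ennreal (4 * E / \<rho>_const * (h * l))"
proof -
  have Sb: "S \<in> sets borel" unfolding S_def by (intro borel_Times) auto
  note [measurable] = dir_energy_measurable[OF w Sb]
  let ?D = "\<lambda>h l. dir_energy \<theta>1 \<theta>2 w S h l"
  define W where "W z = ennreal (\<rho> z / (\<epsilon> * norm z)\<^sup>2)" for z
  have [measurable]: "W \<in> borel_measurable borel" unfolding W_def by measurable
  have Dm: "(\<lambda>z. ?D (s * fst z) (t * snd z)) \<in> borel_measurable borel" for s t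
    using measurable_compose[OF _ dir_energy_measurable[OF w Sb], of "\<lambda>z. (s * fst z, t * snd z)" borel] by simp
  have e: "energy_eps \<theta>1 \<theta>2 \<rho> {a1<..<b1} {a2<..<b2} \<epsilon> w = (\<integral>\<^sup>+z. ?D (s * \<epsilon> * fst z) (t * \<epsilon> * snd z) * W z \<partial>lborel)"
    if "\<bar>s\<bar> = 1" "\<bar>t\<bar> = 1" for s t
  proof -
    have f: "(\<lambda>z. ?D (\<epsilon> * fst z) (\<epsilon> * snd z) * W z) \<in> borel_measurable borel" using Dm[of \<epsilon> \<epsilon>] by measurable
    have W: "W (s * fst z, t * snd z) = W z" for z
    proof -
      have "s\<^sup>2 = 1" "t\<^sup>2 = 1" using that by (metis power2_abs one_power2)+
      then have "norm (s * fst z, t * snd z) = norm z" by (cases z) (simp add: norm_Pair power_mult_distrib)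
      then show ?thesis using \<rho>_radial[of "(s * fst z, t * snd z)" z] by (simp add: W_def)
    qed
    show ?thesis
      unfolding energy_eps_eq[OF w \<epsilon>] S_def[symmetric] W_def[symmetric]
      using nn_integral_reflect[OF f that] by (simp add: W mult_ac)
  qed
  define D4 where "D4 z = ?D (\<epsilon> * fst z) (\<epsilon> * snd z) + ?D (- \<epsilon> * fst z) (\<epsilon> * snd z) + ?D (\<epsilon> * fst z) (- \<epsilon> * snd z) + ?D (- \<epsilon> * fst z) (- \<epsilon> * snd z)" for z
  let ?e = "energy_eps \<theta>1 \<theta>2 \<rho> {a1<..<b1} {a2<..<b2} \<epsilon> w"
  have D4: "(\<integral>\<^sup>+z. D4 z * W z \<partial>lborel) = 4 * ?e"
  proof -
    have [measurable]: "(\<lambda>z. ?D (\<epsilon> * fst z) (\<epsilon> * snd z)) \<in> borel_measurable borel" "(\<lambda>z. ?D (- (\<epsilon> * fst z)) (\<epsilon> * snd z)) \<in> borel_measurable borel"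
      "(\<lambda>z. ?D (\<epsilon> * fst z) (- (\<epsilon> * snd z))) \<in> borel_measurable borel" "(\<lambda>z. ?D (- (\<epsilon> * fst z)) (- (\<epsilon> * snd z))) \<in> borel_measurable borel"
      using Dm[of \<epsilon> \<epsilon>] Dm[of "- \<epsilon>" \<epsilon>] Dm[of \<epsilon> "- \<epsilon>"] Dm[of "- \<epsilon>" "- \<epsilon>"] by simp_all
    have "(\<integral>\<^sup>+z. D4 z * W z \<partial>lborel) = (\<integral>\<^sup>+z. ?D (\<epsilon> * fst z) (\<epsilon> * snd z) * W z \<partial>lborel) + (\<integral>\<^sup>+z. ?D (- \<epsilon> * fst z) (\<epsilon> * snd z) * W z \<partial>lborel)
      + (\<integral>\<^sup>+z. ?D (\<epsilon> * fst z) (- \<epsilon> * snd z) * W z \<partial>lborel) + (\<integral>\<^sup>+z. ?D (- \<epsilon> * fst z) (- \<epsilon> * snd z) * W z \<partial>lborel)"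
      unfolding D4_def distrib_right by (simp add: nn_integral_add)
    also have "\<dots> = ?e + ?e + ?e + ?e"
      using e[of 1 1] e[of "-1" 1] e[of 1 "-1"] e[of "-1" "-1"] by simp
    also have "\<dots> = 4 * ?e" by (simp add: mult_2[symmetric] distrib_right[symmetric] add.assoc)
    finally show ?thesis .
  qed
  \<comment> \<open>A function with integral \<open>4 * E\<close>, more than the integral of
    \<open>D4 z * W z\<close>, so it is larger at some point. Its shape is chosen so that division
    by \<open>W z\<close> leaves a constant times the cell area.\<close>
  define g where "g z = 4 * E / \<rho>_const * (\<rho> z * (\<bar>fst z * snd z\<bar> / (norm z)\<^sup>2))" for z
  have g0: "0 \<le> g z" for z unfolding g_def using E \<rho>_const_pos \<rho>_nonneg[of z] by auto
  have "(\<integral>\<^sup>+z. ennreal (g z) \<partial>lborel) = ennreal (\<integral>z. g z \<partial>lborel)"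
    using g0 unfolding g_def by (intro nn_integral_eq_integral integrable_mult_right \<rho>_const_integrable) auto
  also have "(\<integral>z. g z \<partial>lborel) = 4 * E"
    unfolding g_def integral_mult_right_zero \<rho>_const_def[symmetric] using \<rho>_const_pos by simp
  finally have G: "(\<integral>\<^sup>+z. ennreal (g z) \<partial>lborel) = ennreal (4 * E)" .
  have "\<exists>z. D4 z * W z < ennreal (g z)"
  proof (rule ccontr)
    assume "\<not> ?thesis"
    then have "(\<integral>\<^sup>+z. ennreal (g z) \<partial>lborel) \<le> (\<integral>\<^sup>+z. D4 z * W z \<partial>lborel)" by (intro nn_integral_mono) (auto simp: not_less)
    then have "4 * ennreal E \<le> 4 * ?e" unfolding D4 G using E by (simp add: ennreal_mult)
    then have "ennreal E \<le> ?e" by (simp add: ennreal_mult_le_mult_iff)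
    then show False using E by auto
  qed
  then obtain z where z: "D4 z * W z < ennreal (g z)" by blast
  \<comment> \<open>Strictness forces \<rho> to be positive at \<open>z\<close> and both coordinates
    to be non-zero; hence \<open>norm z < 1\<close>, and the steps are positive and below
    \<epsilon>.\<close>
  then have "g z > 0" using not_less_zero by (metis ennreal_neg not_less)
  then have \<rho>z: "\<rho> z > 0" and z0: "fst z \<noteq> 0" "snd z \<noteq> 0"
    using \<rho>_nonneg[of z] by (auto simp: g_def less_le zero_less_mult_iff)
  have nz: "norm z < 1" using \<rho>_support[of z] \<rho>z by (cases "norm z \<ge> 1") auto
  have zn0: "norm z > 0" using z0 by auto
  show ?thesis
  proof (rule that[of "\<epsilon> * \<bar>fst z\<bar>" "\<epsilon> * \<bar>snd z\<bar>"])
    show "0 < \<epsilon> * \<bar>fst z\<bar>" "0 < \<epsilon> * \<bar>snd z\<bar>" using \<epsilon> z0 by auto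
    have "\<bar>fst z\<bar> < 1" "\<bar>snd z\<bar> < 1" using nz norm_fst_le[of "fst z" "snd z"] norm_snd_le[of "snd z" "fst z"] by auto
    then show "\<epsilon> * \<bar>fst z\<bar> < \<epsilon>" "\<epsilon> * \<bar>snd z\<bar> < \<epsilon>" using \<epsilon> by auto
    let ?h = "\<epsilon> * \<bar>fst z\<bar>" and ?l = "\<epsilon> * \<bar>snd z\<bar>"
    have "?D ?h ?l + ?D (- ?h) ?l + ?D ?h (- ?l) + ?D (- ?h) (- ?l) = D4 z"
      unfolding D4_def by (cases "fst z < 0"; cases "snd z < 0") (simp_all add: ac_simps)
    moreover have "D4 z \<le> ennreal (4 * E / \<rho>_const * (?h * ?l))"
    proof -
      define c where "c = (\<epsilon> * norm z)\<^sup>2 / \<rho> z"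
      have c: "c > 0" using zn0 \<epsilon> \<rho>z by (simp add: c_def)
      have "D4 z = D4 z * (W z * ennreal c)"
        using zn0 \<epsilon> \<rho>z by (simp add: W_def c_def ennreal_mult[symmetric])
      also have "\<dots> = D4 z * W z * ennreal c" by (simp add: mult.assoc)
      also have "\<dots> \<le> ennreal (g z) * ennreal c" using z by (intro mult_right_mono) auto
      also have "\<dots> = ennreal (g z * c)" using g0 c by (simp add: ennreal_mult)
      also have "g z * c = 4 * E / \<rho>_const * (?h * ?l)"
        using zn0 \<rho>z by (simp add: g_def c_def abs_mult power_mult_distrib power2_eq_square)
      finally show ?thesis .
    qed
    ultimately show "?D ?h ?l + ?D (- ?h) ?l + ?D ?h (- ?l) + ?D (- ?h) (- ?l) \<le> ennreal (4 * E / \<rho>_const * (?h * ?l))" by simp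
  qed
qed

text \<open>A finite lower limit is nearly attained at arbitrarily small \<epsilon>. The slack
  \<delta> keeps the inequality strict even for zero energy, as \<open>good_direction\<close>
  requires.\<close>

lemma good_scale:
  assumes w: "w \<in> borel_measurable borel" and fin: "energy \<theta>1 \<theta>2 \<rho> {a1<..<b1} {a2<..<b2} w < \<infinity>"
    and \<epsilon>0: "\<epsilon>0 > 0" and \<delta>: "\<delta> > 0"
  obtains \<epsilon> h l where "0 < \<epsilon>" "\<epsilon> < \<epsilon>0" "0 < h" "h < \<epsilon>" "0 < l" "l < \<epsilon>"
    "(\<integral>\<^sup>+x. ennreal (cell_density \<theta>1 \<theta>2 w h l x) * indicator ({a1 + \<epsilon><..<b1 - \<epsilon> - h} \<times> {a2 + \<epsilon><..<b2 - \<epsilon> - l}) x \<partial>lborel)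
      \<le> ennreal (4 * (enn2real (energy \<theta>1 \<theta>2 \<rho> {a1<..<b1} {a2<..<b2} w) + \<delta>) / \<rho>_const * (h * l))"
proof -
  let ?E = "energy \<theta>1 \<theta>2 \<rho> {a1<..<b1} {a2<..<b2} w"
  let ?e = "\<lambda>\<epsilon>. energy_eps \<theta>1 \<theta>2 \<rho> {a1<..<b1} {a2<..<b2} \<epsilon> w"
  define Er where "Er = enn2real ?E + \<delta>"
  have lt: "?E < ennreal Er"
  proof -
    have "?E = ennreal (enn2real ?E)" using fin by simp
    also have "\<dots> < ennreal Er" using \<delta> by (intro ennreal_lessI) (auto simp: Er_def add_nonneg_pos)
    finally show ?thesis .
  qed
  have "\<exists>\<epsilon>. 0 < \<epsilon> \<and> \<epsilon> < \<epsilon>0 \<and> ?e \<epsilon> < ennreal Er"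
  proof (rule ccontr)
    assume "\<not> ?thesis"
    then have "eventually (\<lambda>\<epsilon>. ennreal Er \<le> ?e \<epsilon>) (at_right 0)"
      by (intro eventually_mono[OF eventually_at_right_real[OF \<epsilon>0]]) (metis greaterThanLessThan_iff not_less)
    then have "ennreal Er \<le> ?E" unfolding energy_def by (rule Liminf_bounded)
    then show False using lt by simp
  qed
  then obtain \<epsilon> where \<epsilon>: "0 < \<epsilon>" "\<epsilon> < \<epsilon>0" "?e \<epsilon> < ennreal Er" by blast
  have Er0: "0 \<le> Er" using \<delta> by (simp add: Er_def)
  obtain h l where hl: "0 < h" "h < \<epsilon>" "0 < l" "l < \<epsilon>" and
    le: "dir_energy \<theta>1 \<theta>2 w ({a1 + \<epsilon><..<b1 - \<epsilon>} \<times> {a2 + \<epsilon><..<b2 - \<epsilon>}) h l + dir_energy \<theta>1 \<theta>2 w ({a1 + \<epsilon><..<b1 - \<epsilon>} \<times> {a2 + \<epsilon><..<b2 - \<epsilon>}) (- h) l + dir_energy \<theta>1 \<theta>2 w ({a1 + \<epsilon><..<b1 - \<epsilon>} \<times> {a2 + \<epsilon><..<b2 - \<epsilon>}) h (- l) + dir_energy \<theta>1 \<theta>2 w ({a1 + \<epsilon><..<b1 - \<epsilon>} \<times> {a2 + \<epsilon><..<b2 - \<epsilon>}) (- h) (- l)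
      \<le> ennreal (4 * Er / \<rho>_const * (h * l))"
    by (rule good_direction[OF w \<epsilon>(1) Er0 \<epsilon>(3)])
  show ?thesis
  proof (rule that[OF \<epsilon>(1,2) hl])
    show "(\<integral>\<^sup>+x. ennreal (cell_density \<theta>1 \<theta>2 w h l x) * indicator ({a1 + \<epsilon><..<b1 - \<epsilon> - h} \<times> {a2 + \<epsilon><..<b2 - \<epsilon> - l}) x \<partial>lborel)
      \<le> ennreal (4 * (enn2real ?E + \<delta>) / \<rho>_const * (h * l))"
      unfolding Er_def[symmetric]
      by (rule order_trans[OF cell_integral_le[OF w] le]) (use hl in \<open>auto intro!: borel_Times\<close>)
  qed
qed

end

section \<open>Continuity of translations in the mean and the choice of the grid offset\<close>

lemma cball_borel [measurable]: "cball (x :: 'a::euclidean_space) r \<in> sets borel"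
  by (intro borel_closed closed_cball)

text \<open>A measurable function is almost everywhere a limit of continuous ones; truncation at
  \<open>B\<close> makes the convergence dominated on a ball.\<close>

lemma L1_continuous_approx:
  fixes w :: "'a::euclidean_space \<Rightarrow> real"
  assumes w [measurable]: "w \<in> borel_measurable borel" and B: "\<And>x. \<bar>w x\<bar> \<le> B" and e: "e > 0"
  obtains g where "continuous_on UNIV g" "(\<integral>\<^sup>+x. ennreal \<bar>w x - g x\<bar> * indicator (cball 0 R) x \<partial>lborel) \<le> ennreal e"
proof -
  have "w \<in> borel_measurable lebesgue" by (intro measurable_completion) measurable
  then have "w measurable_on UNIV" by (rule lebesgue_measurable_imp_measurable_on) simp
  then obtain N g where N: "negligible N" and g: "\<And>n. continuous_on UNIV (g n)" "\<And>x. x \<notin> N \<Longrightarrow> (\<lambda>n. g n x) \<longlonglongrightarrow> w x"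
    by (auto simp: measurable_on_def)
  define g' where "g' n x = max (- B) (min B (g n x))" for n x
  have g'c: "continuous_on UNIV (g' n)" for n unfolding g'_def using g(1) by (intro continuous_intros)
  have [measurable]: "g' n \<in> borel_measurable borel" for n by (rule borel_measurable_continuous_onI[OF g'c])
  have B0: "0 \<le> B" by (rule order_trans[OF abs_ge_zero B])
  have g'B: "\<bar>g' n x\<bar> \<le> B" for n x using B0 by (auto simp: g'_def)
  have "(\<lambda>n. \<integral>\<^sup>+x. ennreal \<bar>w x - g' n x\<bar> * indicator (cball 0 R) x \<partial>lborel) \<longlonglongrightarrow> (\<integral>\<^sup>+x. 0 \<partial>(lborel :: 'a measure))"
  proof (rule nn_integral_dominated_convergence[where w = "\<lambda>x. ennreal (2 * B) * indicator (cball 0 R) x"])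
    show "AE x in lborel. ennreal \<bar>w x - g' n x\<bar> * indicator (cball 0 R) x \<le> ennreal (2 * B) * indicator (cball 0 R) x" for n
    proof (rule AE_I2)
      fix x
      have "\<bar>w x - g' n x\<bar> \<le> 2 * B" using B[of x] g'B[of n x] by linarith
      then show "ennreal \<bar>w x - g' n x\<bar> * indicator (cball 0 R) x \<le> ennreal (2 * B) * indicator (cball 0 R) x"
        by (intro mult_right_mono ennreal_leI) auto
    qed
    show "(\<integral>\<^sup>+x. ennreal (2 * B) * indicator (cball 0 R) x \<partial>(lborel :: 'a measure)) < \<infinity>"
      using emeasure_bounded_finite[of "cball (0::'a) R"] by (simp add: nn_integral_cmult_indicator ennreal_mult_less_top)
    have "AE x in lebesgue. x \<notin> N" using N by (intro AE_not_in) (simp add: negligible_iff_null_sets)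
    then have "AE x in lborel. x \<notin> N" by (simp add: AE_completion_iff)
    then show "AE x in lborel. (\<lambda>n. ennreal \<bar>w x - g' n x\<bar> * indicator (cball 0 R) x) \<longlonglongrightarrow> 0"
    proof eventually_elim
      case (elim x)
      have "(\<lambda>n. g' n x) \<longlonglongrightarrow> max (- B) (min B (w x))" unfolding g'_def using g(2)[OF elim] by (intro tendsto_intros)
      also have "max (- B) (min B (w x)) = w x" using B[of x] by auto
      finally have "(\<lambda>n. \<bar>w x - g' n x\<bar>) \<longlonglongrightarrow> \<bar>w x - w x\<bar>" by (intro tendsto_intros)
      then have "(\<lambda>n. ennreal \<bar>w x - g' n x\<bar>) \<longlonglongrightarrow> ennreal 0" by (intro tendsto_ennrealI) simp
      then show ?case by (cases "x \<in> cball 0 R") auto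
    qed
  next
    show "(\<lambda>x. ennreal \<bar>w x - g' n x\<bar> * indicator (cball 0 R) x) \<in> borel_measurable lborel" for n by measurable
    show "(\<lambda>x. ennreal (2 * B) * indicator (cball 0 R) x) \<in> borel_measurable (lborel :: 'a measure)" by measurable
  qed simp
  then have "eventually (\<lambda>n. (\<integral>\<^sup>+x. ennreal \<bar>w x - g' n x\<bar> * indicator (cball 0 R) x \<partial>lborel) < ennreal e) sequentially"
    using e by (intro order_tendstoD(2)) auto
  then obtain n where "(\<integral>\<^sup>+x. ennreal \<bar>w x - g' n x\<bar> * indicator (cball 0 R) x \<partial>lborel) < ennreal e"
    by (auto simp: eventually_sequentially)
  then show ?thesis using that[OF g'c[of n]] by simp
qed

text \<open>A continuous approximation is uniformly continuous on a ball, and \<open>w\<close>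
  vanishes far out. The radius \<open>R + 2\<close> leaves room for points of norm at most
  \<open>R + 1\<close> together with their translates by less than 1; for all other points both
  values of \<open>w\<close> are 0.\<close>

lemma L1_translation_continuous:
  fixes w :: "'a::euclidean_space \<Rightarrow> real"
  assumes w [measurable]: "w \<in> borel_measurable borel" and B: "\<And>x. \<bar>w x\<bar> \<le> B"
    and supp: "bounded S" "\<And>x. x \<notin> S \<Longrightarrow> w x = 0" and e: "e > 0"
  shows "\<exists>d>0. \<forall>z. norm z < d \<longrightarrow> (\<integral>\<^sup>+y. ennreal \<bar>w (y + z) - w y\<bar> \<partial>lborel) \<le> ennreal e"
proof -
  obtain R where R: "\<And>x. x \<in> S \<Longrightarrow> norm x \<le> R" using supp(1) bounded_iff by blast
  let ?K = "cball (0::'a) (R + 2)"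
  obtain g where gc: "continuous_on UNIV g" and g: "(\<integral>\<^sup>+x. ennreal \<bar>w x - g x\<bar> * indicator ?K x \<partial>lborel) \<le> ennreal (e / 3)"
    using L1_continuous_approx[OF w B, of "e / 3" "R + 2"] e by auto
  have [measurable]: "g \<in> borel_measurable borel" by (rule borel_measurable_continuous_onI[OF gc])
  define V where "V = measure lborel ?K + 1"
  have V: "V > 0" by (simp add: V_def add_nonneg_pos)
  have "uniformly_continuous_on ?K g"
    by (rule compact_uniformly_continuous) (use gc in \<open>auto intro: continuous_on_subset\<close>)
  then obtain d where d: "d > 0" "\<And>x y. x \<in> ?K \<Longrightarrow> y \<in> ?K \<Longrightarrow> dist y x < d \<Longrightarrow> dist (g y) (g x) < e / (3 * V)"
    unfolding uniformly_continuous_on_def using e V by (metis divide_pos_pos mult_pos_pos zero_less_numeral)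
  show ?thesis
  proof (intro exI[of _ "min d 1"] conjI allI impI)
    fix z :: 'a assume z: "norm z < min d 1"
    have Rz: "y \<in> ?K \<and> y + z \<in> ?K" if "norm y \<le> R + 1" for y
      using that z norm_triangle_ineq[of y z] by auto
    define W where "W y = ennreal \<bar>w y - g y\<bar> * indicator ?K y" for y
    have [measurable]: "W \<in> borel_measurable borel" unfolding W_def by measurable
    have [measurable]: "(\<lambda>y. W (y + z)) \<in> borel_measurable borel"
      by (rule measurable_compose[OF borel_measurable_continuous_onI \<open>W \<in> _\<close>]) (intro continuous_intros)
    have "(\<integral>\<^sup>+y. ennreal \<bar>w (y + z) - w y\<bar> \<partial>lborel) \<le> (\<integral>\<^sup>+y. W (y + z) + W y + ennreal (e / (3 * V)) * indicator ?K y \<partial>lborel)"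
    proof (rule nn_integral_mono)
      fix y
      show "ennreal \<bar>w (y + z) - w y\<bar> \<le> W (y + z) + W y + ennreal (e / (3 * V)) * indicator ?K y"
      proof (cases "norm y \<le> R + 1")
        case True
        note K = Rz[OF True]
        have "dist (g (y + z)) (g y) < e / (3 * V)" using K z by (intro d) (auto simp: dist_norm)
        then have "\<bar>w (y + z) - w y\<bar> \<le> \<bar>w (y + z) - g (y + z)\<bar> + \<bar>w y - g y\<bar> + e / (3 * V)"
          by (auto simp: dist_real_def)
        then have "ennreal \<bar>w (y + z) - w y\<bar> \<le> ennreal (\<bar>w (y + z) - g (y + z)\<bar> + \<bar>w y - g y\<bar> + e / (3 * V))" by (rule ennreal_leI)
        also have "\<dots> = ennreal \<bar>w (y + z) - g (y + z)\<bar> + ennreal \<bar>w y - g y\<bar> + ennreal (e / (3 * V))"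
          using e V by (simp add: ennreal_plus[symmetric] del: ennreal_plus)
        finally show ?thesis using K by (simp add: W_def)
      next
        case False
        have "y \<notin> S" using R[of y] False by auto
        moreover have "y + z \<notin> S" using R[of "y + z"] False z norm_triangle_ineq4[of "y + z" z] by auto
        ultimately show ?thesis using supp(2) by simp
      qed
    qed
    also have "\<dots> = (\<integral>\<^sup>+y. W (y + z) \<partial>lborel) + (\<integral>\<^sup>+y. W y \<partial>lborel) + ennreal (e / (3 * V)) * emeasure lborel ?K"
      by (simp add: nn_integral_add nn_integral_cmult_indicator)
    also have "(\<integral>\<^sup>+y. W (y + z) \<partial>lborel) = (\<integral>\<^sup>+y. W y \<partial>lborel)" by (rule nn_integral_translate) measurable
    also have "ennreal (e / (3 * V)) * emeasure lborel ?K \<le> ennreal (e / 3)"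
    proof -
      have "emeasure lborel ?K = ennreal (measure lborel ?K)"
        using emeasure_bounded_finite[of ?K] by (intro emeasure_eq_ennreal_measure) (auto simp: less_top)
      then have "ennreal (e / (3 * V)) * emeasure lborel ?K = ennreal (e / (3 * V) * measure lborel ?K)"
        using e V by (simp only: ennreal_mult[OF divide_nonneg_nonneg measure_nonneg])
      also have "\<dots> \<le> ennreal (e / (3 * V) * V)"
        using e V by (intro ennreal_leI mult_left_mono) (auto simp: V_def)
      finally show ?thesis using V by simp
    qed
    also have "(\<integral>\<^sup>+y. W y \<partial>lborel) \<le> ennreal (e / 3)" using g by (simp add: W_def)
    finally have "(\<integral>\<^sup>+y. ennreal \<bar>w (y + z) - w y\<bar> \<partial>lborel) \<le> ennreal (e / 3) + ennreal (e / 3) + ennreal (e / 3)"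
      by (simp add: add_mono)
    also have "\<dots> = ennreal e" using e by (simp add: ennreal_plus[symmetric] del: ennreal_plus)
    finally show "(\<integral>\<^sup>+y. ennreal \<bar>w (y + z) - w y\<bar> \<partial>lborel) \<le> ennreal e" .
  qed (use d in auto)
qed

lemma sum_cell_indicators_le:
  assumes "h > 0"
  shows "(\<Sum>i<N. indicator {0<..<h} (y - real i * h)) \<le> (indicator {0<..<real N * h} y :: ennreal)"
proof (induction N)
  case (Suc N)
  have "(\<Sum>i<Suc N. indicator {0<..<h} (y - real i * h)) \<le> indicator {0<..<real N * h} y + (indicator {0<..<h} (y - real N * h) :: ennreal)"
    using Suc by (simp add: add_right_mono)
  also have "\<dots> \<le> indicator {0<..<real (Suc N) * h} y"
  proof -
    define K where "K = real N * h"
    have "0 \<le> K" "real (Suc N) * h = K + h" using assms by (auto simp: algebra_simps K_def)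
    then show ?thesis using assms unfolding K_def[symmetric] by (auto split: split_indicator)
  qed
  finally show ?case .
qed simp

text \<open>Open cells are disjoint, so their indicators add up to at most 1; the grid lines left
  out are null.\<close>

definition grid_cell :: "real \<Rightarrow> real \<Rightarrow> (real \<times> real) set" where
  "grid_cell h l = {0<..<h} \<times> {0<..<l}"

definition grid_corner :: "real \<Rightarrow> real \<Rightarrow> real \<Rightarrow> real \<Rightarrow> nat \<Rightarrow> nat \<Rightarrow> real \<times> real" where
  "grid_corner c1 c2 h l i j = (c1 + real i * h, c2 + real j * l)"

context
  fixes c1 c2 h l :: real and N N' :: nat
  assumes hl: "h > 0" "l > 0"
begin

abbreviation cell :: "(real \<times> real) set" where "cell \<equiv> grid_cell h l"

abbreviation corner :: "nat \<Rightarrow> nat \<Rightarrow> real \<times> real" where "corner \<equiv> grid_corner c1 c2 h l"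

lemma cell_borel [measurable]: "cell \<in> sets borel"
  unfolding grid_cell_def by (intro borel_Times) auto

lemma sum_cells_le:
  "(\<Sum>i<N. \<Sum>j<N'. indicator cell (x - corner i j)) \<le> (indicator ({c1<..<c1 + real N * h} \<times> {c2<..<c2 + real N' * l}) x :: ennreal)"
proof -
  have "(\<Sum>i<N. \<Sum>j<N'. indicator cell (x - corner i j)) =
     (\<Sum>i<N. indicator {0<..<h} ((fst x - c1) - real i * h)) * (\<Sum>j<N'. indicator {0<..<l} ((snd x - c2) - real j * l) :: ennreal)"
    unfolding sum_product
    by (intro sum.cong refl) (cases x, auto simp: grid_cell_def grid_corner_def algebra_simps split: split_indicator)
  also have "\<dots> \<le> indicator {0<..<real N * h} (fst x - c1) * indicator {0<..<real N' * l} (snd x - c2)"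
    using hl by (intro mult_mono sum_cell_indicators_le) auto
  also have "\<dots> = indicator ({c1<..<c1 + real N * h} \<times> {c2<..<c2 + real N' * l}) x"
    by (cases x) (auto split: split_indicator)
  finally show ?thesis .
qed

text \<open>Integrating the sum over all nodes over one cell of offsets amounts to integrating over
  the rectangle tiled by the cells.\<close>

lemma sum_cell_integrals_le:
  fixes f :: "real \<times> real \<Rightarrow> ennreal"
  assumes f [measurable]: "f \<in> borel_measurable borel"
    and Q: "{c1<..<c1 + real N * h} \<times> {c2<..<c2 + real N' * l} \<subseteq> Q"
  shows "(\<integral>\<^sup>+t. (\<Sum>i<N. \<Sum>j<N'. f (t + corner i j)) * indicator cell t \<partial>lborel) \<le> (\<integral>\<^sup>+x. f x * indicator Q x \<partial>lborel)"
proof -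
  have tr [measurable]: "(\<lambda>t. f (t + v)) \<in> borel_measurable borel" for v
    by (rule measurable_compose[OF borel_measurable_continuous_onI f]) (intro continuous_intros)
  have [measurable]: "(\<lambda>t. indicator cell (t - v) :: ennreal) \<in> borel_measurable borel" for v
    by (rule measurable_compose[OF borel_measurable_continuous_onI]) (auto intro!: continuous_intros)
  have "(\<integral>\<^sup>+t. (\<Sum>i<N. \<Sum>j<N'. f (t + corner i j)) * indicator cell t \<partial>lborel)
     = (\<Sum>i<N. \<Sum>j<N'. (\<integral>\<^sup>+t. f (t + corner i j) * indicator cell t \<partial>lborel))"
  proof -
    have "(\<integral>\<^sup>+t. (\<Sum>i<N. \<Sum>j<N'. f (t + corner i j)) * indicator cell t \<partial>lborel)
       = (\<integral>\<^sup>+t. (\<Sum>i<N. \<Sum>j<N'. f (t + corner i j) * indicator cell t) \<partial>lborel)"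
      by (simp only: sum_distrib_right)
    also have "\<dots> = (\<Sum>i<N. (\<integral>\<^sup>+t. (\<Sum>j<N'. f (t + corner i j) * indicator cell t) \<partial>lborel))"
      by (rule nn_integral_sum) measurable
    also have "\<dots> = (\<Sum>i<N. \<Sum>j<N'. (\<integral>\<^sup>+t. f (t + corner i j) * indicator cell t \<partial>lborel))"
      by (intro sum.cong refl nn_integral_sum) measurable
    finally show ?thesis .
  qed
  also have "\<dots> = (\<Sum>i<N. \<Sum>j<N'. (\<integral>\<^sup>+t. f t * indicator cell (t - corner i j) \<partial>lborel))"
  proof (intro sum.cong refl)
    fix i j
    show "(\<integral>\<^sup>+t. f (t + corner i j) * indicator cell t \<partial>lborel) = (\<integral>\<^sup>+t. f t * indicator cell (t - corner i j) \<partial>lborel)"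
      using nn_integral_translate[of "\<lambda>t. f t * indicator cell (t - corner i j)" "corner i j"] by simp
  qed
  also have "\<dots> = (\<integral>\<^sup>+t. f t * (\<Sum>i<N. \<Sum>j<N'. indicator cell (t - corner i j)) \<partial>lborel)"
  proof -
    have "(\<integral>\<^sup>+t. f t * (\<Sum>i<N. \<Sum>j<N'. indicator cell (t - corner i j)) \<partial>lborel)
       = (\<integral>\<^sup>+t. (\<Sum>i<N. \<Sum>j<N'. f t * indicator cell (t - corner i j)) \<partial>lborel)"
      by (simp only: sum_distrib_left)
    also have "\<dots> = (\<Sum>i<N. (\<integral>\<^sup>+t. (\<Sum>j<N'. f t * indicator cell (t - corner i j)) \<partial>lborel))"
      by (rule nn_integral_sum) measurable
    also have "\<dots> = (\<Sum>i<N. \<Sum>j<N'. (\<integral>\<^sup>+t. f t * indicator cell (t - corner i j) \<partial>lborel))"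
      by (intro sum.cong refl nn_integral_sum) measurable
    finally show ?thesis by simp
  qed
  also have "\<dots> \<le> (\<integral>\<^sup>+x. f x * indicator Q x \<partial>lborel)"
  proof (intro nn_integral_mono mult_left_mono)
    fix x :: "real \<times> real"
    show "(\<Sum>i<N. \<Sum>j<N'. indicator cell (x - corner i j)) \<le> (indicator Q x :: ennreal)"
      by (rule order_trans[OF sum_cells_le]) (use Q in \<open>auto split: split_indicator\<close>)
  qed simp
  finally show ?thesis .
qed

text \<open>Averaged over the offset, the cell sum \<open>F\<close> has mean at most
  \<open>M\<close> and the sampling error \<open>D\<close> has mean at most
  \<open>4 * \<omega>\<close>. After normalisation their sum has mean at most 2, so at some offset
  it does not exceed 3, which bounds both at once.\<close>

lemma grid_offset:
  fixes w :: "real \<times> real \<Rightarrow> real"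
  assumes w: "w \<in> borel_measurable borel" and f: "f \<in> borel_measurable borel" and pos: "M > 0" "\<omega> > 0"
    and M: "(\<integral>\<^sup>+x. f x * indicator ({c1<..<c1 + real N * h} \<times> {c2<..<c2 + real N' * l}) x \<partial>lborel) \<le> ennreal (M * (h * l))"
    and \<omega>: "\<And>z. \<bar>fst z\<bar> < h \<Longrightarrow> \<bar>snd z\<bar> < l \<Longrightarrow> (\<integral>\<^sup>+y. ennreal \<bar>w (y + z) - w y\<bar> \<partial>lborel) \<le> ennreal \<omega>"
  obtains t where "t \<in> cell" "(\<Sum>i<N. \<Sum>j<N'. f (t + corner i j)) \<le> ennreal (3 * M)"
    "(\<integral>\<^sup>+s. (\<Sum>i<N. \<Sum>j<N'. ennreal \<bar>w (t + corner i j) - w (s + corner i j)\<bar>) * indicator cell s \<partial>lborel) \<le> ennreal (12 * \<omega>)"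
proof -
  note [measurable] = w f
  have trw [measurable]: "(\<lambda>t. w (t + v)) \<in> borel_measurable borel" "(\<lambda>t. f (t + v)) \<in> borel_measurable borel" for v
    by (rule measurable_compose[OF borel_measurable_continuous_onI]; auto intro!: continuous_intros)+
  have c4: "(\<lambda>p. w (\<phi> p)) \<in> borel_measurable (borel :: ((real \<times> real) \<times> (real \<times> real)) measure)" if "continuous_on UNIV \<phi>" for \<phi>
    by (rule measurable_compose[OF borel_measurable_continuous_onI w]) (rule that)
  have sets4: "borel_measurable (lborel \<Otimes>\<^sub>M lborel) = borel_measurable (borel :: ((real \<times> real) \<times> (real \<times> real)) measure)"
    by (simp add: lborel_prod)
  define F where "F t = (\<Sum>i<N. \<Sum>j<N'. f (t + corner i j))" for t
  define d where "d t s = (\<Sum>i<N. \<Sum>j<N'. ennreal \<bar>w (t + corner i j) - w (s + corner i j)\<bar>)" for t s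
  define D where "D t = (\<integral>\<^sup>+s. d t s * indicator cell s \<partial>lborel)" for t
  have Fm [measurable]: "F \<in> borel_measurable borel" unfolding F_def by measurable
  have d4 [measurable]: "(\<lambda>p. d (fst p) (snd p)) \<in> borel_measurable (borel :: ((real \<times> real) \<times> (real \<times> real)) measure)"
  proof -
    have [measurable]: "(\<lambda>p. w (fst p + v)) \<in> borel_measurable (borel :: ((real \<times> real) \<times> (real \<times> real)) measure)"
      "(\<lambda>p. w (snd p + v)) \<in> borel_measurable (borel :: ((real \<times> real) \<times> (real \<times> real)) measure)" for v
      by (intro c4 continuous_intros)+
    show ?thesis unfolding d_def by measurable
  qed
  have ind4 [measurable]: "(\<lambda>p. indicator cell (\<phi> p) :: ennreal) \<in> borel_measurable (borel :: ((real \<times> real) \<times> (real \<times> real)) measure)" if "continuous_on UNIV \<phi>" for \<phi>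
    by (rule measurable_compose[OF borel_measurable_continuous_onI[OF that]]) measurable
  have Dm [measurable]: "D \<in> borel_measurable borel"
  proof -
    have [measurable]: "(\<lambda>p. indicator cell (snd p) :: ennreal) \<in> borel_measurable (borel :: ((real \<times> real) \<times> (real \<times> real)) measure)"
      by (intro ind4 continuous_intros)
    have "(\<lambda>p. d (fst p) (snd p) * indicator cell (snd p)) \<in> borel_measurable (lborel \<Otimes>\<^sub>M lborel)"
      unfolding sets4 by measurable
    from lborel.borel_measurable_nn_integral_fst[OF this] show ?thesis by (simp add: D_def[abs_def])
  qed
  have cellm: "emeasure lborel cell = ennreal (h * l)"
  proof -
    have "cell = box (0, 0) (h, l)" unfolding grid_cell_def by (auto simp: box_def Basis_real_pair)
    then show ?thesis using hl by (simp add: emeasure_lborel_box_eq Basis_real_pair)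
  qed
  \<comment> \<open>The difference of two points of a cell lies in \<open>Z\<close>, which has the
    area of four cells; this is the 4 in \<open>4 * \<omega>\<close>.\<close>
  define Z where "Z = {- h<..<h} \<times> {- l<..<l}"
  have Zm: "emeasure lborel Z = ennreal (4 * (h * l))" and [measurable]: "Z \<in> sets borel"
  proof -
    have Z: "Z = box (- h, - l) (h, l)" unfolding Z_def by (auto simp: box_def Basis_real_pair)
    then show "emeasure lborel Z = ennreal (4 * (h * l))" using hl by (simp add: emeasure_lborel_box_eq Basis_real_pair)
    show "Z \<in> sets borel" unfolding Z by simp
  qed
  have FI: "(\<integral>\<^sup>+t. F t * indicator cell t \<partial>lborel) \<le> ennreal (M * (h * l))"
    unfolding F_def by (rule order_trans[OF sum_cell_integrals_le[OF f order_refl] M])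
  have DI: "(\<integral>\<^sup>+t. D t * indicator cell t \<partial>lborel) \<le> ennreal (4 * \<omega> * (h * l))"
  proof -
    have "D t * indicator cell t \<le> (\<integral>\<^sup>+z. indicator Z z * (d t (t + z) * indicator cell t) \<partial>lborel)" for t
    proof (cases "t \<in> cell")
      case True
      have [measurable]: "(\<lambda>s. d t s) \<in> borel_measurable borel" unfolding d_def by measurable
      have "D t = (\<integral>\<^sup>+z. d t (z + t) * indicator cell (z + t) \<partial>lborel)"
        unfolding D_def by (rule nn_integral_translate[symmetric]) measurable
      also have "\<dots> \<le> (\<integral>\<^sup>+z. indicator Z z * (d t (t + z) * indicator cell t) \<partial>lborel)"
        using True by (intro nn_integral_mono) (auto simp: Z_def grid_cell_def add.commute split: split_indicator)
      finally show ?thesis using True by simp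
    qed simp
    then have "(\<integral>\<^sup>+t. D t * indicator cell t \<partial>lborel) \<le> (\<integral>\<^sup>+t. \<integral>\<^sup>+z. indicator Z z * (d t (t + z) * indicator cell t) \<partial>lborel \<partial>lborel)"
      by (intro nn_integral_mono)
    also have "\<dots> = (\<integral>\<^sup>+z. \<integral>\<^sup>+t. indicator Z z * (d t (t + z) * indicator cell t) \<partial>lborel \<partial>lborel)"
    proof -
      have [measurable]: "(\<lambda>p. d (fst p) (fst p + snd p)) \<in> borel_measurable (borel :: ((real \<times> real) \<times> (real \<times> real)) measure)"
        using measurable_compose[OF borel_measurable_continuous_onI d4, of "\<lambda>p. (fst p, fst p + snd p)"]
        by (simp add: continuous_intros continuous_on_Pair)
      have [measurable]: "(\<lambda>p. indicator Z (snd p) :: ennreal) \<in> borel_measurable (borel :: ((real \<times> real) \<times> (real \<times> real)) measure)"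
        by (rule measurable_compose[OF borel_measurable_continuous_onI]) (auto intro: continuous_intros)
      have [measurable]: "(\<lambda>p. indicator cell (fst p) :: ennreal) \<in> borel_measurable (borel :: ((real \<times> real) \<times> (real \<times> real)) measure)"
        by (intro ind4 continuous_intros)
      have "(\<lambda>p. indicator Z (snd p) * (d (fst p) (fst p + snd p) * indicator cell (fst p))) \<in> borel_measurable (lborel \<Otimes>\<^sub>M lborel)"
        unfolding sets4 by measurable
      from lborel_pair.Fubini[OF this] show ?thesis by simp
    qed
    also have "\<dots> \<le> (\<integral>\<^sup>+z. ennreal \<omega> * indicator Z z \<partial>lborel)"
    proof (intro nn_integral_mono)
      fix z :: "real \<times> real"
      show "(\<integral>\<^sup>+t. indicator Z z * (d t (t + z) * indicator cell t) \<partial>lborel) \<le> ennreal \<omega> * indicator Z z"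
      proof (cases "z \<in> Z")
        case True
        have "(\<integral>\<^sup>+t. d t (t + z) * indicator cell t \<partial>lborel) = (\<integral>\<^sup>+t. (\<Sum>i<N. \<Sum>j<N'. ennreal \<bar>w ((t + corner i j) + z) - w (t + corner i j)\<bar>) * indicator cell t \<partial>lborel)"
          unfolding d_def by (simp add: abs_minus_commute algebra_simps)
        also have "\<dots> \<le> (\<integral>\<^sup>+x. ennreal \<bar>w (x + z) - w x\<bar> * indicator UNIV x \<partial>lborel)"
          by (rule sum_cell_integrals_le) auto
        also have "\<dots> \<le> ennreal \<omega>" using \<omega>[of z] True by (auto simp: Z_def mem_Times_iff abs_less_iff)
        finally show ?thesis using True by simp
      qed simp
    qed
    also have "\<dots> = ennreal \<omega> * ennreal (4 * (h * l))" by (simp add: nn_integral_cmult_indicator Zm)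
    also have "\<dots> = ennreal (4 * \<omega> * (h * l))" using pos hl by (simp add: ennreal_mult[symmetric] mult_ac)
    finally show ?thesis .
  qed
  define f' where "f' t = F t * ennreal (1 / M) + D t * ennreal (1 / (4 * \<omega>))" for t
  have "\<exists>t\<in>cell. f' t \<le> 3"
  proof (rule ccontr)
    assume neg: "\<not> ?thesis"
    have "3 * ennreal (h * l) = (\<integral>\<^sup>+t. 3 * indicator cell t \<partial>lborel)" by (simp add: nn_integral_cmult_indicator cellm)
    also have "\<dots> \<le> (\<integral>\<^sup>+t. F t * indicator cell t * ennreal (1 / M) + D t * indicator cell t * ennreal (1 / (4 * \<omega>)) \<partial>lborel)"
      using neg by (intro nn_integral_mono) (auto simp: f'_def not_le less_imp_le split: split_indicator)
    also have "\<dots> = (\<integral>\<^sup>+t. F t * indicator cell t \<partial>lborel) * ennreal (1 / M) + (\<integral>\<^sup>+t. D t * indicator cell t \<partial>lborel) * ennreal (1 / (4 * \<omega>))"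
      by (simp add: nn_integral_add nn_integral_multc)
    also have "\<dots> \<le> ennreal (M * (h * l)) * ennreal (1 / M) + ennreal (4 * \<omega> * (h * l)) * ennreal (1 / (4 * \<omega>))"
      by (intro add_mono mult_right_mono FI DI) auto
    also have "\<dots> = ennreal (2 * (h * l))"
      using pos hl by (simp add: ennreal_mult[symmetric] ennreal_plus[symmetric] del: ennreal_plus)
    finally have "ennreal (3 * (h * l)) \<le> ennreal (2 * (h * l))" using hl by (simp add: ennreal_mult)
    then show False using hl by (simp add: ennreal_le_iff mult_le_cancel_right)
  qed
  then obtain t where t: "t \<in> cell" "f' t \<le> 3" by blast
  have scale: "x \<le> ennreal (3 * K)" if "x * ennreal (1 / K) \<le> 3" "K > 0" for x K
  proof -
    have "x = x * ennreal (1 / K) * ennreal K" using that by (simp add: mult.assoc ennreal_mult[symmetric])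
    also have "\<dots> \<le> 3 * ennreal K" using that by (intro mult_right_mono) auto
    also have "\<dots> = ennreal (3 * K)" using that by (simp add: ennreal_mult)
    finally show ?thesis .
  qed
  have "F t * ennreal (1 / M) \<le> f' t" "D t * ennreal (1 / (4 * \<omega>)) \<le> f' t"
    unfolding f'_def by (auto intro: add_increasing add_increasing2)
  then have "F t * ennreal (1 / M) \<le> 3" "D t * ennreal (1 / (4 * \<omega>)) \<le> 3"
    using t(2) by (blast intro: order_trans)+
  from scale[OF this(1)] scale[OF this(2)] pos have "F t \<le> ennreal (3 * M)" "D t \<le> ennreal (12 * \<omega>)" by (auto simp: mult.assoc[symmetric])
  with that[OF t(1)] show ?thesis by (simp add: F_def D_def d_def)
qed

end

text \<open>\<open>U k\<close> holds the samples on the \<open>k\<close>-th grid. They are taken at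
  points \<open>(f i, g j)\<close> of product form, which is what additive functions need; only the
  nodes up to \<open>N k\<close> and \<open>N' k\<close> are known to lie in the box.
  \<open>convergence\<close> speaks of the piecewise constant interpolants, along the whole
  sequence.\<close>

locale grid_sequence =
  fixes a1 b1 a2 b2 :: real and w :: "real \<times> real \<Rightarrow> real" and \<theta>1 \<theta>2 :: real
    and c1 c2 h l :: "nat \<Rightarrow> real" and N N' :: "nat \<Rightarrow> nat" and U :: "nat \<Rightarrow> nat \<Rightarrow> nat \<Rightarrow> real" and M :: "nat \<Rightarrow> real"
  assumes steps: "\<And>k. h k > 0" "\<And>k. l k > 0" "h \<longlonglongrightarrow> 0" "l \<longlonglongrightarrow> 0"
    and left: "\<And>k. a1 < c1 k" "\<And>k. a2 < c2 k" "c1 \<longlonglongrightarrow> a1" "c2 \<longlonglongrightarrow> a2"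
    and right: "\<And>k. c1 k + real (N k) * h k < b1" "\<And>k. c2 k + real (N' k) * l k < b2"
      "(\<lambda>k. c1 k + real (N k) * h k) \<longlonglongrightarrow> b1" "(\<lambda>k. c2 k + real (N' k) * l k) \<longlonglongrightarrow> b2"
    and sampled: "\<And>k. \<exists>f g. \<forall>i j. U k i j = w (f i, g j) \<and> (i \<le> N k \<longrightarrow> f i \<in> {a1<..<b1}) \<and> (j \<le> N' k \<longrightarrow> g j \<in> {a2<..<b2})"
    and energy_bound: "\<And>k. (\<Sum>i<N k. \<Sum>j<N' k. cell_energy \<theta>1 \<theta>2 (U k) i j) \<le> M k"
    and convergence: "AE x in lborel. x \<in> box2 a1 b1 a2 b2 \<longrightarrow>
      (\<lambda>k. U k (nat \<lfloor>(fst x - c1 k) / h k\<rfloor>) (nat \<lfloor>(snd x - c2 k) / l k\<rfloor>)) \<longlonglongrightarrow> w x"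

section \<open>Construction of the sequence of grids\<close>

lemma AE_fst_snd_neq:
  "AE x in lborel. fst (x :: real \<times> real) \<noteq> c" "AE x in lborel. snd (x :: real \<times> real) \<noteq> c"
proof -
  have "negligible {z :: real \<times> real. (1, 0) \<bullet> z = c}" "negligible {z :: real \<times> real. (0, 1) \<bullet> z = c}"
    by (intro negligible_hyperplane; simp add: zero_prod_def)+
  then have "AE z in lebesgue. z \<notin> {z :: real \<times> real. (1, 0) \<bullet> z = c}" "AE z in lebesgue. z \<notin> {z :: real \<times> real. (0, 1) \<bullet> z = c}"
    by (intro AE_not_in; simp add: negligible_iff_null_sets)+
  then show "AE x in lborel. fst (x :: real \<times> real) \<noteq> c" "AE x in lborel. snd (x :: real \<times> real) \<noteq> c"
    by (auto simp: AE_completion_iff inner_prod_def)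
qed

lemma cell_index:
  fixes y h :: real
  assumes h: "h > 0" and y: "0 < y" "y < real N * h" and gen: "\<And>i. y \<noteq> real i * h"
  shows "nat \<lfloor>y / h\<rfloor> < N" "y - real (nat \<lfloor>y / h\<rfloor>) * h \<in> {0<..<h}"
proof -
  define i where "i = nat \<lfloor>y / h\<rfloor>"
  have i: "real i \<le> y / h" "y / h < real i + 1"
    using y h by (auto simp: i_def)
  then have i': "real i * h \<le> y" "y < real i * h + h" using h by (auto simp: field_simps)
  have "real i * h < real N * h" using i' y by linarith
  then show "nat \<lfloor>y / h\<rfloor> < N" using h unfolding i_def by simp
  have "real i * h < y" using i' gen[of i] by linarith
  then show "y - real (nat \<lfloor>y / h\<rfloor>) * h \<in> {0<..<h}" using i' unfolding i_def[symmetric] by auto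
qed

text \<open>The grid has to stop one step before the right margin, and rounding loses less than
  another step; together with the margin itself less than \<open>3 * \<epsilon>\<close> is missing
  on the right.\<close>

lemma shrinking_grid:
  fixes a b \<epsilon> h :: real
  assumes h: "0 < h" "h < \<epsilon>" and \<epsilon>: "\<epsilon> < (b - a) / 10"
  defines "N \<equiv> nat \<lfloor>(b - a - 2 * \<epsilon> - h) / h\<rfloor>"
  shows "a + \<epsilon> + real N * h \<le> b - \<epsilon> - h" "b - 3 * \<epsilon> < a + \<epsilon> + real N * h"
proof -
  have pos: "0 \<le> b - a - 2 * \<epsilon> - h" using h \<epsilon> by (simp add: field_simps)
  have N: "real N \<le> (b - a - 2 * \<epsilon> - h) / h" "(b - a - 2 * \<epsilon> - h) / h < real N + 1"
    using pos h by (auto simp: N_def)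
  then have "real N * h \<le> b - a - 2 * \<epsilon> - h" "b - a - 2 * \<epsilon> - h < real N * h + h"
    using h by (auto simp: field_simps)
  then show "a + \<epsilon> + real N * h \<le> b - \<epsilon> - h" "b - 3 * \<epsilon> < a + \<epsilon> + real N * h" using h by auto
qed

context kernel begin

text \<open>The construction for one index: scale, direction and offset, with margins below \<eta>
  and sampling error at most \<omega>. The constant 12 is 4 from the reflected directions times 3
  from the offset.\<close>

lemma grid_step:
  fixes w :: "real \<times> real \<Rightarrow> real" and a1 b1 a2 b2 :: real
  assumes ab: "a1 < b1" "a2 < b2"
    and w: "w \<in> borel_measurable borel" and B: "\<And>x. \<bar>w x\<bar> \<le> B" and supp: "\<And>x. x \<notin> box2 a1 b1 a2 b2 \<Longrightarrow> w x = 0"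
    and fin: "energy \<theta>1 \<theta>2 \<rho> {a1<..<b1} {a2<..<b2} w < \<infinity>" and \<eta>: "\<eta> > 0" and \<omega>: "\<omega> > 0"
  shows "\<exists>c1 c2 h l N N' t. 0 < h \<and> 0 < l \<and> h < \<eta> \<and> l < \<eta> \<and> a1 < c1 \<and> c1 < a1 + \<eta> \<and> a2 < c2 \<and> c2 < a2 + \<eta> \<and>
    c1 + real N * h + h < b1 \<and> b1 - \<eta> < c1 + real N * h \<and> c2 + real N' * l + l < b2 \<and> b2 - \<eta> < c2 + real N' * l \<and>
    t \<in> {0<..<h} \<times> {0<..<l} \<and>
    (\<Sum>i<N. \<Sum>j<N'. cell_energy \<theta>1 \<theta>2 (\<lambda>i j. w (c1 + fst t + real i * h, c2 + snd t + real j * l)) i j)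
      \<le> 12 * (enn2real (energy \<theta>1 \<theta>2 \<rho> {a1<..<b1} {a2<..<b2} w) + \<eta>) / \<rho>_const \<and>
    (\<integral>\<^sup>+s. (\<Sum>i<N. \<Sum>j<N'. ennreal \<bar>w (c1 + fst t + real i * h, c2 + snd t + real j * l) - w (c1 + fst s + real i * h, c2 + snd s + real j * l)\<bar>)
        * indicator ({0<..<h} \<times> {0<..<l}) s \<partial>lborel) \<le> ennreal \<omega>"
proof -
  let ?E = "enn2real (energy \<theta>1 \<theta>2 \<rho> {a1<..<b1} {a2<..<b2} w)"
  note [measurable] = w
  have \<omega>12: "\<omega> / 12 > 0" using \<omega> by simp
  obtain d where d: "d > 0" "\<And>z. norm z < d \<Longrightarrow> (\<integral>\<^sup>+y. ennreal \<bar>w (y + z) - w y\<bar> \<partial>lborel) \<le> ennreal (\<omega> / 12)"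
    using L1_translation_continuous[OF w B box2_bounded supp \<omega>12] by blast
  \<comment> \<open>\<open>d / 2\<close> keeps every step with components below \<epsilon>0 shorter
    than \<open>d\<close>; \<open>\<eta> / 3\<close> matches the missing margin of
    \<open>3 * \<epsilon>\<close>; the tenths are the hypothesis of
    \<open>shrinking_grid\<close>.\<close>
  define \<epsilon>0 where "\<epsilon>0 = Min {d / 2, \<eta> / 3, (b1 - a1) / 10, (b2 - a2) / 10}"
  have \<epsilon>0: "\<epsilon>0 > 0" "\<epsilon>0 \<le> d / 2" "\<epsilon>0 \<le> \<eta> / 3" "\<epsilon>0 \<le> (b1 - a1) / 10" "\<epsilon>0 \<le> (b2 - a2) / 10"
  proof -
    show "\<epsilon>0 > 0" unfolding \<epsilon>0_def using d(1) \<eta> ab by (subst Min_gr_iff) auto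
    show "\<epsilon>0 \<le> d / 2" "\<epsilon>0 \<le> \<eta> / 3" "\<epsilon>0 \<le> (b1 - a1) / 10" "\<epsilon>0 \<le> (b2 - a2) / 10"
      unfolding \<epsilon>0_def by (intro Min_le; simp)+
  qed
  obtain \<epsilon> h l where e: "0 < \<epsilon>" "\<epsilon> < \<epsilon>0" "0 < h" "h < \<epsilon>" "0 < l" "l < \<epsilon>" and
    Q: "(\<integral>\<^sup>+x. ennreal (cell_density \<theta>1 \<theta>2 w h l x) * indicator ({a1 + \<epsilon><..<b1 - \<epsilon> - h} \<times> {a2 + \<epsilon><..<b2 - \<epsilon> - l}) x \<partial>lborel)
      \<le> ennreal (4 * (?E + \<eta>) / \<rho>_const * (h * l))"
    by (rule good_scale[OF w fin \<epsilon>0(1) \<eta>])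
  define c1 where "c1 = a1 + \<epsilon>"
  define c2 where "c2 = a2 + \<epsilon>"
  define N where "N = nat \<lfloor>(b1 - a1 - 2 * \<epsilon> - h) / h\<rfloor>"
  define N' where "N' = nat \<lfloor>(b2 - a2 - 2 * \<epsilon> - l) / l\<rfloor>"
  have G1: "c1 + real N * h \<le> b1 - \<epsilon> - h" "b1 - 3 * \<epsilon> < c1 + real N * h"
    unfolding c1_def N_def by (rule shrinking_grid; use e \<epsilon>0 in linarith)+
  have G2: "c2 + real N' * l \<le> b2 - \<epsilon> - l" "b2 - 3 * \<epsilon> < c2 + real N' * l"
    unfolding c2_def N'_def by (rule shrinking_grid; use e \<epsilon>0 in linarith)+
  define M where "M = 4 * (?E + \<eta>) / \<rho>_const"
  have M0: "M > 0" unfolding M_def using \<eta> \<rho>_const_pos by (intro divide_pos_pos mult_pos_pos add_nonneg_pos) auto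
  have fm: "(\<lambda>x. ennreal (cell_density \<theta>1 \<theta>2 w h l x)) \<in> borel_measurable borel" unfolding cell_density_def by measurable
  have Q': "(\<integral>\<^sup>+x. ennreal (cell_density \<theta>1 \<theta>2 w h l x) * indicator ({c1<..<c1 + real N * h} \<times> {c2<..<c2 + real N' * l}) x \<partial>lborel)
      \<le> ennreal (M * (h * l))"
  proof (rule order_trans[OF _ Q[folded M_def]], intro nn_integral_mono mult_left_mono)
    fix x :: "real \<times> real"
    show "(indicator ({c1<..<c1 + real N * h} \<times> {c2<..<c2 + real N' * l}) x :: ennreal) \<le> indicator ({a1 + \<epsilon><..<b1 - \<epsilon> - h} \<times> {a2 + \<epsilon><..<b2 - \<epsilon> - l}) x"
      using G1 G2 by (auto simp: c1_def c2_def split: split_indicator)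
  qed simp
  have \<omega>': "(\<integral>\<^sup>+y. ennreal \<bar>w (y + z) - w y\<bar> \<partial>lborel) \<le> ennreal (\<omega> / 12)" if "\<bar>fst z\<bar> < h" "\<bar>snd z\<bar> < l" for z
  proof (rule d(2))
    have "norm z \<le> norm (fst z) + norm (snd z)" using norm_Pair_le[of "fst z" "snd z"] by simp
    then show "norm z < d" using that e \<epsilon>0 by auto
  qed
  obtain t where t: "t \<in> grid_cell h l"
    "(\<Sum>i<N. \<Sum>j<N'. ennreal (cell_density \<theta>1 \<theta>2 w h l (t + grid_corner c1 c2 h l i j))) \<le> ennreal (3 * M)"
    "(\<integral>\<^sup>+s. (\<Sum>i<N. \<Sum>j<N'. ennreal \<bar>w (t + grid_corner c1 c2 h l i j) - w (s + grid_corner c1 c2 h l i j)\<bar>) * indicator (grid_cell h l) s \<partial>lborel) \<le> ennreal (12 * (\<omega> / 12))"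
    by (rule grid_offset[OF e(3,5) w fm M0 \<omega>12 Q' \<omega>'])
  let ?U = "\<lambda>i j. w (c1 + fst t + real i * h, c2 + snd t + real j * l)"
  have cd: "cell_density \<theta>1 \<theta>2 w h l (t + grid_corner c1 c2 h l i j) = cell_energy \<theta>1 \<theta>2 ?U i j" for i j
  proof -
    define P where "P i j = (c1 + fst t + real i * h, c2 + snd t + real j * l)" for i j
    have "t + grid_corner c1 c2 h l i j = P i j" "P i j + (h, 0) = P (Suc i) j" "P i j + (0, l) = P i (Suc j)" "P i j + (h, l) = P (Suc i) (Suc j)"
      by (cases t; simp add: P_def grid_corner_def algebra_simps)+
    then show ?thesis unfolding cell_density_def cell_energy_def hdiff_def vdiff_def P_def[symmetric] by simp
  qed
  have "(\<Sum>i<N. \<Sum>j<N'. ennreal (cell_density \<theta>1 \<theta>2 w h l (t + grid_corner c1 c2 h l i j))) = ennreal (\<Sum>i<N. \<Sum>j<N'. cell_energy \<theta>1 \<theta>2 ?U i j)"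
    unfolding cd by (simp add: sum_ennreal cell_energy_nonneg sum_nonneg)
  then have "(\<Sum>i<N. \<Sum>j<N'. cell_energy \<theta>1 \<theta>2 ?U i j) \<le> 3 * M"
    using t(2) M0 by (simp add: ennreal_le_iff)
  also have "3 * M = 12 * (?E + \<eta>) / \<rho>_const" by (simp add: M_def)
  finally have S: "(\<Sum>i<N. \<Sum>j<N'. cell_energy \<theta>1 \<theta>2 ?U i j) \<le> 12 * (?E + \<eta>) / \<rho>_const" .
  have D: "(\<integral>\<^sup>+s. (\<Sum>i<N. \<Sum>j<N'. ennreal \<bar>?U i j - w (c1 + fst s + real i * h, c2 + snd s + real j * l)\<bar>)
        * indicator ({0<..<h} \<times> {0<..<l}) s \<partial>lborel) \<le> ennreal \<omega>"
  proof -
    have "s + grid_corner c1 c2 h l i j = (c1 + fst s + real i * h, c2 + snd s + real j * l)" for s i j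
      by (cases s) (simp add: grid_corner_def)
    then show ?thesis using t(3) by (simp add: grid_cell_def)
  qed
  show ?thesis
  proof (intro exI conjI)
    show "0 < h" "0 < l" "h < \<eta>" "l < \<eta>" using e \<epsilon>0 by linarith+
    show "a1 < c1" "c1 < a1 + \<eta>" "a2 < c2" "c2 < a2 + \<eta>" unfolding c1_def c2_def using e \<epsilon>0 by linarith+
    show "c1 + real N * h + h < b1" "b1 - \<eta> < c1 + real N * h" "c2 + real N' * l + l < b2" "b2 - \<eta> < c2 + real N' * l"
      using G1 G2 e \<epsilon>0 by linarith+
    show "t \<in> {0<..<h} \<times> {0<..<l}" using t(1) unfolding grid_cell_def .
    show "(\<Sum>i<N. \<Sum>j<N'. cell_energy \<theta>1 \<theta>2 ?U i j) \<le> 12 * (?E + \<eta>) / \<rho>_const" by (rule S)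
    show "(\<integral>\<^sup>+s. (\<Sum>i<N. \<Sum>j<N'. ennreal \<bar>?U i j - w (c1 + fst s + real i * h, c2 + snd s + real j * l)\<bar>)
        * indicator ({0<..<h} \<times> {0<..<l}) s \<partial>lborel) \<le> ennreal \<omega>" by (rule D)
  qed
qed

text \<open>The sampling errors are prescribed as \<open>(1 / 2) ^ Suc k\<close>, a summable
  sequence. Summing them under the integral gives convergence of the interpolants almost everywhere
  without passing to a subsequence.\<close>

lemma grid_sequence_exists:
  fixes w :: "real \<times> real \<Rightarrow> real" and a1 b1 a2 b2 :: real
  assumes ab: "a1 < b1" "a2 < b2"
    and w: "w \<in> borel_measurable borel" and B: "\<And>x. \<bar>w x\<bar> \<le> B" and supp: "\<And>x. x \<notin> box2 a1 b1 a2 b2 \<Longrightarrow> w x = 0"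
    and fin: "energy \<theta>1 \<theta>2 \<rho> {a1<..<b1} {a2<..<b2} w < \<infinity>"
  obtains c1 c2 h l N N' U M where "grid_sequence a1 b1 a2 b2 w \<theta>1 \<theta>2 c1 c2 h l N N' U M"
    "M \<longlonglongrightarrow> 12 * enn2real (energy \<theta>1 \<theta>2 \<rho> {a1<..<b1} {a2<..<b2} w) / \<rho>_const"
proof -
  let ?E = "enn2real (energy \<theta>1 \<theta>2 \<rho> {a1<..<b1} {a2<..<b2} w)"
  note [measurable] = w
  define \<eta> where "\<eta> k = 1 / real (Suc k)" for k
  have \<eta>: "\<eta> k > 0" for k by (simp add: \<eta>_def)
  have \<eta>0: "\<eta> \<longlonglongrightarrow> 0" unfolding \<eta>_def using LIMSEQ_Suc[OF lim_1_over_n] by simp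
  define \<omega> :: "nat \<Rightarrow> real" where "\<omega> k = (1 / 2) ^ Suc k" for k
  have \<omega>: "\<omega> k > 0" for k by (simp add: \<omega>_def)
  define P where "P k c1 c2 h l N N' t \<longleftrightarrow> 0 < h \<and> 0 < l \<and> h < \<eta> k \<and> l < \<eta> k \<and> a1 < c1 \<and> c1 < a1 + \<eta> k \<and> a2 < c2 \<and> c2 < a2 + \<eta> k \<and>
    c1 + real N * h + h < b1 \<and> b1 - \<eta> k < c1 + real N * h \<and> c2 + real N' * l + l < b2 \<and> b2 - \<eta> k < c2 + real N' * l \<and>
    t \<in> {0<..<h} \<times> {0<..<l} \<and>
    (\<Sum>i<N. \<Sum>j<N'. cell_energy \<theta>1 \<theta>2 (\<lambda>i j. w (c1 + fst t + real i * h, c2 + snd t + real j * l)) i j)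
      \<le> 12 * (?E + \<eta> k) / \<rho>_const \<and>
    (\<integral>\<^sup>+s. (\<Sum>i<N. \<Sum>j<N'. ennreal \<bar>w (c1 + fst t + real i * h, c2 + snd t + real j * l) - w (c1 + fst s + real i * h, c2 + snd s + real j * l)\<bar>)
        * indicator ({0<..<h} \<times> {0<..<l}) s \<partial>lborel) \<le> ennreal (\<omega> k)" for k c1 c2 h l N N' t
  have "\<forall>k. \<exists>c1 c2 h l N N' t. P k c1 c2 h l N N' t"
    unfolding P_def using grid_step[OF ab w B supp fin \<eta> \<omega>] by (intro allI)
  then obtain c1 c2 h l N N' t where P: "\<And>k. P k (c1 k) (c2 k) (h k) (l k) (N k) (N' k) (t k)"
    by metis
  have hl: "\<And>k. 0 < h k" "\<And>k. 0 < l k" "\<And>k. h k < \<eta> k" "\<And>k. l k < \<eta> k" and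
    c: "\<And>k. a1 < c1 k" "\<And>k. c1 k < a1 + \<eta> k" "\<And>k. a2 < c2 k" "\<And>k. c2 k < a2 + \<eta> k" and
    r: "\<And>k. c1 k + real (N k) * h k + h k < b1" "\<And>k. b1 - \<eta> k < c1 k + real (N k) * h k"
       "\<And>k. c2 k + real (N' k) * l k + l k < b2" "\<And>k. b2 - \<eta> k < c2 k + real (N' k) * l k" and
    t: "\<And>k. t k \<in> {0<..<h k} \<times> {0<..<l k}" and
    S: "\<And>k. (\<Sum>i<N k. \<Sum>j<N' k. cell_energy \<theta>1 \<theta>2 (\<lambda>i j. w (c1 k + fst (t k) + real i * h k, c2 k + snd (t k) + real j * l k)) i j) \<le> 12 * (?E + \<eta> k) / \<rho>_const" and
    D: "\<And>k. (\<integral>\<^sup>+s. (\<Sum>i<N k. \<Sum>j<N' k. ennreal \<bar>w (c1 k + fst (t k) + real i * h k, c2 k + snd (t k) + real j * l k) - w (c1 k + fst s + real i * h k, c2 k + snd s + real j * l k)\<bar>)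
        * indicator ({0<..<h k} \<times> {0<..<l k}) s \<partial>lborel) \<le> ennreal (\<omega> k)"
    using P unfolding P_def by blast+
  define U where "U k i j = w (c1 k + fst (t k) + real i * h k, c2 k + snd (t k) + real j * l k)" for k i j
  define M where "M k = 12 * (?E + \<eta> k) / \<rho>_const" for k
  \<comment> \<open>The interpolation error, written cell by cell. The cells are disjoint, so at
    most one summand is non-zero at a given point.\<close>
  define \<psi> where "\<psi> k x = (\<Sum>i<N k. \<Sum>j<N' k. ennreal \<bar>U k i j - w x\<bar> * indicator ({0<..<h k} \<times> {0<..<l k}) (x - (c1 k + real i * h k, c2 k + real j * l k)))" for k x
  have cellb [measurable]: "{0<..<h k} \<times> {0<..<l k} \<in> sets borel" for k by (intro borel_Times) auto
  have indm [measurable]: "(\<lambda>x. indicator ({0<..<h k} \<times> {0<..<l k}) (x - v) :: ennreal) \<in> borel_measurable borel" for k v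
    by (rule measurable_compose[OF borel_measurable_continuous_onI borel_measurable_indicator[OF cellb]]) (intro continuous_intros)
  have \<psi>m [measurable]: "\<psi> k \<in> borel_measurable borel" for k unfolding \<psi>_def by measurable
  have \<psi>I: "(\<integral>\<^sup>+x. \<psi> k x \<partial>lborel) \<le> ennreal (\<omega> k)" for k
  proof -
    have "(\<integral>\<^sup>+x. \<psi> k x \<partial>lborel) = (\<Sum>i<N k. \<integral>\<^sup>+x. (\<Sum>j<N' k. ennreal \<bar>U k i j - w x\<bar> * indicator ({0<..<h k} \<times> {0<..<l k}) (x - (c1 k + real i * h k, c2 k + real j * l k))) \<partial>lborel)"
      unfolding \<psi>_def by (rule nn_integral_sum) measurable
    also have "\<dots> = (\<Sum>i<N k. \<Sum>j<N' k. \<integral>\<^sup>+x. ennreal \<bar>U k i j - w x\<bar> * indicator ({0<..<h k} \<times> {0<..<l k}) (x - (c1 k + real i * h k, c2 k + real j * l k)) \<partial>lborel)"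
      by (intro sum.cong refl nn_integral_sum) measurable
    also have "\<dots> = (\<Sum>i<N k. \<Sum>j<N' k. \<integral>\<^sup>+s. ennreal \<bar>U k i j - w (c1 k + fst s + real i * h k, c2 k + snd s + real j * l k)\<bar> * indicator ({0<..<h k} \<times> {0<..<l k}) s \<partial>lborel)"
    proof (intro sum.cong refl)
      fix i j
      let ?v = "(c1 k + real i * h k, c2 k + real j * l k)"
      have "(\<integral>\<^sup>+x. ennreal \<bar>U k i j - w x\<bar> * indicator ({0<..<h k} \<times> {0<..<l k}) (x - ?v) \<partial>lborel)
        = (\<integral>\<^sup>+s. ennreal \<bar>U k i j - w (s + ?v)\<bar> * indicator ({0<..<h k} \<times> {0<..<l k}) (s + ?v - ?v) \<partial>lborel)"
        by (rule nn_integral_translate[symmetric]) measurable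
      also have "\<dots> = (\<integral>\<^sup>+s. ennreal \<bar>U k i j - w (c1 k + fst s + real i * h k, c2 k + snd s + real j * l k)\<bar> * indicator ({0<..<h k} \<times> {0<..<l k}) s \<partial>lborel)"
      proof (intro nn_integral_cong)
        fix s
        have "s + ?v = (c1 k + fst s + real i * h k, c2 k + snd s + real j * l k)" "s + ?v - ?v = s" by (cases s; simp)+
        then show "ennreal \<bar>U k i j - w (s + ?v)\<bar> * indicator ({0<..<h k} \<times> {0<..<l k}) (s + ?v - ?v)
          = ennreal \<bar>U k i j - w (c1 k + fst s + real i * h k, c2 k + snd s + real j * l k)\<bar> * indicator ({0<..<h k} \<times> {0<..<l k}) s" by simp
      qed
      finally show "(\<integral>\<^sup>+x. ennreal \<bar>U k i j - w x\<bar> * indicator ({0<..<h k} \<times> {0<..<l k}) (x - ?v) \<partial>lborel)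
        = (\<integral>\<^sup>+s. ennreal \<bar>U k i j - w (c1 k + fst s + real i * h k, c2 k + snd s + real j * l k)\<bar> * indicator ({0<..<h k} \<times> {0<..<l k}) s \<partial>lborel)" .
    qed
    also have "\<dots> = (\<integral>\<^sup>+s. (\<Sum>i<N k. \<Sum>j<N' k. ennreal \<bar>U k i j - w (c1 k + fst s + real i * h k, c2 k + snd s + real j * l k)\<bar>)
        * indicator ({0<..<h k} \<times> {0<..<l k}) s \<partial>lborel)"
    proof -
      have [measurable]: "(\<lambda>s. w (c1 k + fst s + v, c2 k + snd s + v')) \<in> borel_measurable borel" for v v'
        by (rule measurable_compose[OF borel_measurable_continuous_onI w]) (intro continuous_intros)
      have "(\<integral>\<^sup>+s. (\<Sum>i<N k. \<Sum>j<N' k. ennreal \<bar>U k i j - w (c1 k + fst s + real i * h k, c2 k + snd s + real j * l k)\<bar>)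
        * indicator ({0<..<h k} \<times> {0<..<l k}) s \<partial>lborel)
        = (\<integral>\<^sup>+s. (\<Sum>i<N k. \<Sum>j<N' k. ennreal \<bar>U k i j - w (c1 k + fst s + real i * h k, c2 k + snd s + real j * l k)\<bar>
        * indicator ({0<..<h k} \<times> {0<..<l k}) s) \<partial>lborel)" by (simp only: sum_distrib_right)
      also have "\<dots> = (\<Sum>i<N k. \<integral>\<^sup>+s. (\<Sum>j<N' k. ennreal \<bar>U k i j - w (c1 k + fst s + real i * h k, c2 k + snd s + real j * l k)\<bar>
        * indicator ({0<..<h k} \<times> {0<..<l k}) s) \<partial>lborel)"
        by (rule nn_integral_sum) measurable
      also have "\<dots> = (\<Sum>i<N k. \<Sum>j<N' k. \<integral>\<^sup>+s. ennreal \<bar>U k i j - w (c1 k + fst s + real i * h k, c2 k + snd s + real j * l k)\<bar>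
        * indicator ({0<..<h k} \<times> {0<..<l k}) s \<partial>lborel)"
        by (intro sum.cong refl nn_integral_sum) measurable
      finally show ?thesis by simp
    qed
    also have "\<dots> \<le> ennreal (\<omega> k)" using D[of k] by (simp only: U_def)
    finally show ?thesis .
  qed
  have "(\<integral>\<^sup>+x. (\<Sum>k. \<psi> k x) \<partial>lborel) = (\<Sum>k. \<integral>\<^sup>+x. \<psi> k x \<partial>lborel)" by (rule nn_integral_suminf) measurable
  also have "\<dots> \<le> (\<Sum>k. ennreal (\<omega> k))" by (intro suminf_le \<psi>I) auto
  also have "\<dots> = 1" unfolding \<omega>_def by (subst suminf_ennreal_eq[OF _ power_half_series]) auto
  finally have "(\<integral>\<^sup>+x. (\<Sum>k. \<psi> k x) \<partial>lborel) \<noteq> \<infinity>" by (auto simp: top_unique)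
  then have \<psi>fin: "AE x in lborel. (\<Sum>k. \<psi> k x) \<noteq> \<infinity>" by (intro nn_integral_PInf_AE) auto
  \<comment> \<open>The lines of all grids together form a null set; off them the integer part
    selects the open cell that contains the point.\<close>
  have gen: "AE x in lborel. \<forall>k i. fst x \<noteq> c1 k + real i * h k \<and> snd x \<noteq> c2 k + real i * l k"
    by (simp add: AE_all_countable AE_fst_snd_neq AE_conj_iff)
  have squeeze: "f \<longlonglongrightarrow> a" if "\<And>k. a - \<eta> k < f k" "\<And>k. f k < a + \<eta> k" for f :: "nat \<Rightarrow> real" and a
  proof (rule tendsto_sandwich)
    show "(\<lambda>k. a - \<eta> k) \<longlonglongrightarrow> a" using tendsto_diff[OF tendsto_const \<eta>0, of a] by simp
    show "(\<lambda>k. a + \<eta> k) \<longlonglongrightarrow> a" using tendsto_add[OF tendsto_const \<eta>0, of a] by simp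
  qed (use that in \<open>auto intro!: always_eventually less_imp_le\<close>)
  have c1l: "c1 \<longlonglongrightarrow> a1"
  proof (rule squeeze)
    show "a1 - \<eta> k < c1 k" for k using c(1)[of k] \<eta>[of k] by linarith
  qed (rule c)
  have c2l: "c2 \<longlonglongrightarrow> a2"
  proof (rule squeeze)
    show "a2 - \<eta> k < c2 k" for k using c(3)[of k] \<eta>[of k] by linarith
  qed (rule c)
  have hl0: "h \<longlonglongrightarrow> 0" "l \<longlonglongrightarrow> 0"
  proof -
    show "h \<longlonglongrightarrow> 0"
    proof (rule squeeze)
      show "0 - \<eta> k < h k" "h k < 0 + \<eta> k" for k using hl(1)[of k] hl(3)[of k] by linarith+
    qed
    show "l \<longlonglongrightarrow> 0"
    proof (rule squeeze)
      show "0 - \<eta> k < l k" "l k < 0 + \<eta> k" for k using hl(2)[of k] hl(4)[of k] by linarith+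
    qed
  qed
  have rl: "(\<lambda>k. c1 k + real (N k) * h k) \<longlonglongrightarrow> b1" "(\<lambda>k. c2 k + real (N' k) * l k) \<longlonglongrightarrow> b2"
  proof -
    show "(\<lambda>k. c1 k + real (N k) * h k) \<longlonglongrightarrow> b1"
    proof (rule squeeze)
      show "c1 k + real (N k) * h k < b1 + \<eta> k" for k using r(1)[of k] hl(1)[of k] \<eta>[of k] by linarith
    qed (rule r)
    show "(\<lambda>k. c2 k + real (N' k) * l k) \<longlonglongrightarrow> b2"
    proof (rule squeeze)
      show "c2 k + real (N' k) * l k < b2 + \<eta> k" for k using r(3)[of k] hl(2)[of k] \<eta>[of k] by linarith
    qed (rule r)
  qed
  have "grid_sequence a1 b1 a2 b2 w \<theta>1 \<theta>2 c1 c2 h l N N' U M"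
  proof
    show "c1 k + real (N k) * h k < b1" "c2 k + real (N' k) * l k < b2" for k using r(1,3)[of k] hl[of k] by linarith+
    show "\<exists>f g. \<forall>i j. U k i j = w (f i, g j) \<and> (i \<le> N k \<longrightarrow> f i \<in> {a1<..<b1}) \<and> (j \<le> N' k \<longrightarrow> g j \<in> {a2<..<b2})" for k
    proof (intro exI allI conjI impI)
      show "U k i j = w (c1 k + fst (t k) + real i * h k, c2 k + snd (t k) + real j * l k)" for i j by (simp add: U_def)
      show "c1 k + fst (t k) + real i * h k \<in> {a1<..<b1}" if "i \<le> N k" for i
      proof -
        have "0 \<le> real i * h k" "real i * h k \<le> real (N k) * h k" using that hl(1)[of k] by (auto intro!: mult_right_mono)
        moreover have "0 < fst (t k)" "fst (t k) < h k" using t[of k] by (auto simp: mem_Times_iff)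
        ultimately show ?thesis using c(1)[of k] r(1)[of k] unfolding greaterThanLessThan_iff by linarith
      qed
      show "c2 k + snd (t k) + real j * l k \<in> {a2<..<b2}" if "j \<le> N' k" for j
      proof -
        have "0 \<le> real j * l k" "real j * l k \<le> real (N' k) * l k" using that hl(2)[of k] by (auto intro!: mult_right_mono)
        moreover have "0 < snd (t k)" "snd (t k) < l k" using t[of k] by (auto simp: mem_Times_iff)
        ultimately show ?thesis using c(3)[of k] r(3)[of k] unfolding greaterThanLessThan_iff by linarith
      qed
    qed
    show "(\<Sum>i<N k. \<Sum>j<N' k. cell_energy \<theta>1 \<theta>2 (U k) i j) \<le> M k" for k
      using S[of k] by (simp add: M_def U_def[abs_def])
    show "AE x in lborel. x \<in> box2 a1 b1 a2 b2 \<longrightarrow>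
      (\<lambda>k. U k (nat \<lfloor>(fst x - c1 k) / h k\<rfloor>) (nat \<lfloor>(snd x - c2 k) / l k\<rfloor>)) \<longlonglongrightarrow> w x"
      using \<psi>fin gen
    proof eventually_elim
      case (elim x)
      show ?case
      proof
        assume x: "x \<in> box2 a1 b1 a2 b2"
        define I where "I k = nat \<lfloor>(fst x - c1 k) / h k\<rfloor>" for k
        define J where "J k = nat \<lfloor>(snd x - c2 k) / l k\<rfloor>" for k
        have fin: "\<psi> k x < top" for k using elim(1) by (auto dest!: ennreal_suminf_lessD simp: less_top)
        define p where "p k = enn2real (\<psi> k x)" for k
        have p: "\<psi> k x = ennreal (p k)" "0 \<le> p k" for k using fin[of k] by (auto simp: p_def)
        have "summable p" using elim(1) p by (intro summable_suminf_not_top) auto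
        then have p0: "p \<longlonglongrightarrow> 0" by (rule summable_LIMSEQ_zero)
        have xb: "a1 < fst x" "fst x < b1" "a2 < snd x" "snd x < b2" using x by (auto simp: box2_def)
        have ev: "\<forall>\<^sub>F k in sequentially. c1 k < fst x \<and> fst x < c1 k + real (N k) * h k \<and> c2 k < snd x \<and> snd x < c2 k + real (N' k) * l k"
          using xb by (intro eventually_conj order_tendstoD(2)[OF c1l] order_tendstoD(2)[OF c2l] order_tendstoD(1)[OF rl(1)] order_tendstoD(1)[OF rl(2)])
        have "\<forall>\<^sub>F k in sequentially. norm (U k (I k) (J k) - w x) \<le> p k"
          using ev
        proof eventually_elim
          case (elim k)
          have g1: "fst x - c1 k \<noteq> real i * h k" and g2: "snd x - c2 k \<noteq> real i * l k" for i
            using \<open>\<forall>k i. fst x \<noteq> c1 k + real i * h k \<and> snd x \<noteq> c2 k + real i * l k\<close>[rule_format, of k i] by auto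
          note i1 = cell_index[OF hl(1)[of k] _ _ g1, of "N k", folded I_def]
          note i2 = cell_index[OF hl(2)[of k] _ _ g2, of "N' k", folded J_def]
          have I: "I k < N k" "J k < N' k" using i1(1) i2(1) elim by auto
          have inn: "x - (c1 k + real (I k) * h k, c2 k + real (J k) * l k) \<in> {0<..<h k} \<times> {0<..<l k}"
            using i1(2) i2(2) elim by (cases x) (auto simp: algebra_simps)
          have "ennreal \<bar>U k (I k) (J k) - w x\<bar> = ennreal \<bar>U k (I k) (J k) - w x\<bar> * indicator ({0<..<h k} \<times> {0<..<l k}) (x - (c1 k + real (I k) * h k, c2 k + real (J k) * l k))"
            using inn by simp
          also have "\<dots> \<le> (\<Sum>j<N' k. ennreal \<bar>U k (I k) j - w x\<bar> * indicator ({0<..<h k} \<times> {0<..<l k}) (x - (c1 k + real (I k) * h k, c2 k + real j * l k)))"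
            using I by (intro member_le_sum[of "J k" _ "\<lambda>j. ennreal \<bar>U k (I k) j - w x\<bar> * indicator ({0<..<h k} \<times> {0<..<l k}) (x - (c1 k + real (I k) * h k, c2 k + real j * l k))"]) auto
          also have "\<dots> \<le> \<psi> k x"
            unfolding \<psi>_def using I by (intro member_le_sum[of "I k" _ "\<lambda>i. \<Sum>j<N' k. ennreal \<bar>U k i j - w x\<bar> * indicator ({0<..<h k} \<times> {0<..<l k}) (x - (c1 k + real i * h k, c2 k + real j * l k))"]) auto
          finally show ?case unfolding p(1) using p(2) by (simp add: ennreal_le_iff)
        qed
        then have "(\<lambda>k. U k (I k) (J k) - w x) \<longlonglongrightarrow> 0" by (rule Lim_null_comparison[OF _ p0])
        then show "(\<lambda>k. U k (nat \<lfloor>(fst x - c1 k) / h k\<rfloor>) (nat \<lfloor>(snd x - c2 k) / l k\<rfloor>)) \<longlonglongrightarrow> w x"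
          unfolding I_def[symmetric] J_def[symmetric] by (simp add: LIM_zero_iff)
      qed
    qed
  qed (use hl c c1l c2l hl0 rl in auto)
  moreover have "M \<longlonglongrightarrow> 12 * (?E + 0) / \<rho>_const" unfolding M_def using \<rho>_const_pos by (intro tendsto_intros \<eta>0) auto
  ultimately show ?thesis using that by simp
qed

end

section \<open>Passage to the limit\<close>

text \<open>The variable is the corner of the quadrant, while the point \<open>(a, b)\<close> is
  fixed. There are countably many limit corners, so almost every point avoids the lines through
  them.\<close>

lemma isCont_of_bool_quadrant:
  fixes y0 :: "real \<times> real"
  assumes "fst y0 \<noteq> a" "snd y0 \<noteq> b"
  shows "isCont (\<lambda>y. of_bool (fst y \<le> a \<and> snd y \<le> b) :: real) y0"
proof -
  have le: "\<forall>\<^sub>F y in at y0. (f y \<le> c) = (f y0 \<le> c)" if "isCont f y0" "f y0 \<noteq> c" for f :: "real \<times> real \<Rightarrow> real" and c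
  proof (cases "f y0 < c")
    case True
    then have "\<forall>\<^sub>F y in at y0. f y < c" using that(1) by (intro order_tendstoD(2)) (simp add: isCont_def)
    then show ?thesis using True by (auto elim: eventually_mono)
  next
    case False
    then have "f y0 > c" using that by auto
    then have "\<forall>\<^sub>F y in at y0. f y > c" using that(1) by (intro order_tendstoD(1)) (simp add: isCont_def)
    then show ?thesis using \<open>f y0 > c\<close> by (auto elim: eventually_mono)
  qed
  have "\<forall>\<^sub>F y in at y0. (of_bool (fst y \<le> a \<and> snd y \<le> b) :: real) = of_bool (fst y0 \<le> a \<and> snd y0 \<le> b)"
    using le[of fst a] le[of snd b] assms by (auto elim: eventually_elim2 intro!: isCont_fst isCont_snd)
  then show ?thesis unfolding isCont_def by (rule tendsto_eventually)
qed

text \<open>\<pi> is the coordinate on which the rough summand \<open>ub\<close> depends;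
  \<open>ub\<close> is only measurable and bounded. \<open>K\<close> confines the corners, which in
  the additive case forces the quadrants to be half-planes inside the box. The bound
  \<open>4 * B\<close> reflects that a mixed difference has four terms.\<close>

definition atom_decomposition :: "real \<Rightarrow> (real \<times> real) set \<Rightarrow> (real \<times> real) set \<Rightarrow> real \<Rightarrow> real \<Rightarrow>
    (real \<times> real \<Rightarrow> real) \<Rightarrow> (real \<times> real \<Rightarrow> real) \<Rightarrow> (real \<Rightarrow> real) \<Rightarrow> (nat \<Rightarrow> real) \<Rightarrow> (nat \<Rightarrow> real) \<Rightarrow> (nat \<Rightarrow> real) \<Rightarrow> bool" where
  "atom_decomposition \<theta> X K B S w \<pi> ub m p q \<longleftrightarrow>
    ub \<in> borel_measurable borel \<and> (\<forall>y. \<bar>ub y\<bar> \<le> B) \<and> (\<forall>n. (p n, q n) \<in> K) \<and>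
    summable (\<lambda>n. \<bar>m n\<bar> powr \<theta>) \<and> (\<Sum>n. \<bar>m n\<bar> powr \<theta>) \<le> S \<and> summable (\<lambda>n. \<bar>m n\<bar>) \<and>
    (\<forall>n. \<bar>m n\<bar> \<le> 4 * B) \<and>
    (AE x in lborel. x \<in> X \<longrightarrow> w x = ub (\<pi> x) + (\<Sum>n. m n * indicator (quadrant (p n) (q n)) x))"

text \<open>The atoms converge along a subsequence at almost every point. The rest,
  \<open>ubk\<close>, then converges as a difference of convergent sequences, and being a function
  of \<pi> alone it has a limit of the same kind.\<close>

lemma atoms_limit:
  fixes w :: "real \<times> real \<Rightarrow> real" and uk :: "nat \<Rightarrow> real \<times> real \<Rightarrow> real" and ubk :: "nat \<Rightarrow> real \<Rightarrow> real"
    and \<pi> :: "real \<times> real \<Rightarrow> real" and I :: "nat \<Rightarrow> 'i set" and m :: "nat \<Rightarrow> 'i \<Rightarrow> real" and loc :: "nat \<Rightarrow> 'i \<Rightarrow> real \<times> real"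
  assumes conv: "AE x in lborel. x \<in> X \<longrightarrow> (\<lambda>k. uk k x) \<longlonglongrightarrow> w x"
    and rep: "\<And>x. x \<in> X \<Longrightarrow> \<forall>\<^sub>F k in sequentially. uk k x = ubk k (\<pi> x)
        + (\<Sum>i\<in>I k. m k i * of_bool (fst (loc k i) \<le> fst x \<and> snd (loc k i) \<le> snd x))"
    and ubk: "\<And>k. ubk k \<in> borel_measurable borel" "\<And>k y. \<bar>ubk k y\<bar> \<le> B"
    and \<theta>: "0 < \<theta>" "\<theta> < 1" and K: "compact K" "K \<noteq> {}"
    and fin: "\<And>k. finite (I k)" and loc: "\<And>k i. i \<in> I k \<Longrightarrow> loc k i \<in> K"
    and S: "\<And>k. (\<Sum>i\<in>I k. \<bar>m k i\<bar> powr \<theta>) \<le> S k" "S \<longlonglongrightarrow> S0"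
    and D: "\<And>k i. i \<in> I k \<Longrightarrow> \<bar>m k i\<bar> \<le> 4 * B"
  shows "\<exists>ub m' p q. atom_decomposition \<theta> X K B S0 w \<pi> ub m' p q"
proof -
  obtain r m' loc' where r: "strict_mono (r :: nat \<Rightarrow> nat)" and loc': "\<And>n. loc' n \<in> K" and
    m': "summable (\<lambda>n. \<bar>m' n\<bar> powr \<theta>)" "(\<Sum>n. \<bar>m' n\<bar> powr \<theta>) \<le> S0" "summable (\<lambda>n. \<bar>m' n\<bar>)" and
    D': "\<And>D n. (\<And>k i. i \<in> I k \<Longrightarrow> \<bar>m k i\<bar> \<le> D) \<Longrightarrow> 0 \<le> D \<Longrightarrow> \<bar>m' n\<bar> \<le> D" and
    lim: "\<And>g. (\<And>n. isCont g (loc' n)) \<Longrightarrow> (\<And>y. \<bar>g y\<bar> \<le> 1) \<Longrightarrow>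
        (\<lambda>k. \<Sum>i\<in>I (r k). m (r k) i * g (loc (r k) i)) \<longlonglongrightarrow> (\<Sum>n. m' n * g (loc' n))"
    by (rule atoms_compactness[OF \<theta> K fin loc S]) blast+
  \<comment> \<open>\<open>lim\<close> is unspecified where the sequence diverges. Clipping to
    \<open>[- B, B]\<close> secures the bound everywhere and changes nothing where the sequence
    converges.\<close>
  define ub where "ub y = max (- B) (min B (lim (\<lambda>k. ubk (r k) y)))" for y
  have B0: "0 \<le> B" by (rule order_trans[OF abs_ge_zero ubk(2)])
  have ubm: "ub \<in> borel_measurable borel"
    unfolding ub_def using ubk(1) by (intro borel_measurable_max borel_measurable_min borel_measurable_const borel_measurable_lim_metric) auto
  have gen: "AE x in lborel. \<forall>n. fst (loc' n) \<noteq> fst x \<and> snd (loc' n) \<noteq> snd x"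
    using AE_fst_snd_neq by (auto simp: AE_all_countable AE_conj_iff eq_commute[of "fst (loc' n)" for n] eq_commute[of "snd (loc' n)" for n])
  have AEw: "AE x in lborel. x \<in> X \<longrightarrow> w x = ub (\<pi> x) + (\<Sum>n. m' n * indicator (quadrant (fst (loc' n)) (snd (loc' n))) x)"
    using conv gen
  proof eventually_elim
    case (elim x)
    show ?case
    proof
      assume x: "x \<in> X"
      define v where "v = (\<Sum>n. m' n * of_bool (fst (loc' n) \<le> fst x \<and> snd (loc' n) \<le> snd x))"
      \<comment> \<open>The limit produces closed quadrants, the decomposition uses open ones; they
        agree at \<open>x\<close>, whose coordinates differ from those of all limit corners.\<close>
      have v: "v = (\<Sum>n. m' n * indicator (quadrant (fst (loc' n)) (snd (loc' n))) x)"
        unfolding v_def using elim(2)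
        by (intro suminf_cong) (cases x, auto simp: quadrant_def less_le split: split_indicator)
      have "(\<lambda>k. \<Sum>i\<in>I (r k). m (r k) i * of_bool (fst (loc (r k) i) \<le> fst x \<and> snd (loc (r k) i) \<le> snd x)) \<longlonglongrightarrow> v"
        unfolding v_def using elim(2) by (intro lim isCont_of_bool_quadrant) auto
      moreover have "(\<lambda>k. uk (r k) x) \<longlonglongrightarrow> w x"
        using LIMSEQ_subseq_LIMSEQ[OF elim(1)[rule_format, OF x] r] by (simp add: comp_def)
      ultimately have "(\<lambda>k. uk (r k) x - (\<Sum>i\<in>I (r k). m (r k) i * of_bool (fst (loc (r k) i) \<le> fst x \<and> snd (loc (r k) i) \<le> snd x))) \<longlonglongrightarrow> w x - v"
        by (intro tendsto_diff)
      moreover have "\<forall>\<^sub>F k in sequentially. uk (r k) x - (\<Sum>i\<in>I (r k). m (r k) i * of_bool (fst (loc (r k) i) \<le> fst x \<and> snd (loc (r k) i) \<le> snd x)) = ubk (r k) (\<pi> x)"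
        using eventually_subseq[OF r rep[OF x]] by (auto elim: eventually_mono)
      ultimately have L: "(\<lambda>k. ubk (r k) (\<pi> x)) \<longlonglongrightarrow> w x - v" by (rule Lim_transform_eventually)
      have "\<bar>w x - v\<bar> \<le> B" by (rule LIMSEQ_le_const2[OF tendsto_rabs[OF L]]) (use ubk(2) in auto)
      then have "ub (\<pi> x) = w x - v" unfolding ub_def limI[OF L] by auto
      then show "w x = ub (\<pi> x) + (\<Sum>n. m' n * indicator (quadrant (fst (loc' n)) (snd (loc' n))) x)" using v by simp
    qed
  qed
  show ?thesis
    unfolding atom_decomposition_def
  proof (intro exI conjI allI)
    show "ub \<in> borel_measurable borel" by (rule ubm)
    show "\<bar>ub y\<bar> \<le> B" for y using B0 by (auto simp: ub_def)
    show "(fst (loc' n), snd (loc' n)) \<in> K" for n using loc' by simp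
    show "\<bar>m' n\<bar> \<le> 4 * B" for n by (rule D'[OF D]) (use B0 in auto)
  qed (use m' AEw in auto)
qed

section \<open>Grid functions written as sums of atoms\<close>

lemma sum_prod_Suc_right:
  "(\<Sum>x\<in>{..<N} \<times> {..<Suc N'}. F (fst x) (snd x)) = (\<Sum>i<N. F i 0) + (\<Sum>i<N. \<Sum>j<N'. F i (Suc j) :: real)"
  unfolding split_beta'[symmetric] sum.cartesian_product[symmetric] sum.lessThan_Suc_shift
  by (simp add: sum.distrib)

lemma sum_prod_Suc_left:
  "(\<Sum>x\<in>{..<Suc N} \<times> {..<N'}. F (fst x) (snd x)) = (\<Sum>j<N'. F 0 j) + (\<Sum>i<N. \<Sum>j<N'. F (Suc i) j :: real)"
  unfolding split_beta'[symmetric] sum.cartesian_product[symmetric] sum.lessThan_Suc_shift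
  by simp

text \<open>The increment from \<open>i\<close> to \<open>Suc i\<close> is felt once the node
  \<open>c + real (Suc i) * h\<close> is reached; hence the shift by one in all positions of
  atoms.\<close>

lemma lessThan_index:
  fixes y c h :: real
  assumes h: "h > 0" and y: "c < y" "y < c + real N * h"
  shows "{..<nat \<lfloor>(y - c) / h\<rfloor>} = {i\<in>{..<N}. c + real (Suc i) * h \<le> y}"
proof -
  have "i < nat \<lfloor>(y - c) / h\<rfloor> \<longleftrightarrow> c + real (Suc i) * h \<le> y" for i
  proof -
    have "i < nat \<lfloor>(y - c) / h\<rfloor> \<longleftrightarrow> Suc i \<le> nat \<lfloor>(y - c) / h\<rfloor>" by auto
    also have "\<dots> \<longleftrightarrow> real (Suc i) \<le> (y - c) / h"
    proof -
      have "Suc i \<le> nat z \<longleftrightarrow> int (Suc i) \<le> z" for z by linarith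
      then show ?thesis by (simp add: le_floor_iff)
    qed
    also have "\<dots> \<longleftrightarrow> c + real (Suc i) * h \<le> y" using h by (auto simp: field_simps)
    finally show ?thesis .
  qed
  moreover have "i < N" if "c + real (Suc i) * h \<le> y" for i
  proof -
    have "real (Suc i) * h < real N * h" using that y by linarith
    then show ?thesis using h by simp
  qed
  ultimately show ?thesis by auto
qed

lemma sum_lessThan_index:
  fixes y c h :: real
  assumes "h > 0" "c < y" "y < c + real N * h"
  shows "(\<Sum>i<nat \<lfloor>(y - c) / h\<rfloor>. F i) = (\<Sum>i<N. F i * of_bool (c + real (Suc i) * h \<le> y) :: real)"
proof -
  have "(\<Sum>i\<in>{i\<in>{..<N}. c + real (Suc i) * h \<le> y}. F i) = (\<Sum>i<N. if c + real (Suc i) * h \<le> y then F i else 0)"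
    by (rule sum.inter_filter) simp
  also have "\<dots> = (\<Sum>i<N. F i * of_bool (c + real (Suc i) * h \<le> y))" by (intro sum.cong refl) simp
  finally show ?thesis unfolding lessThan_index[OF assms] .
qed

lemma sum_sum_lessThan_index:
  fixes y c h y' c' h' :: real
  assumes "h > 0" "c < y" "y < c + real N * h" "h' > 0" "c' < y'" "y' < c' + real N' * h'"
  shows "(\<Sum>i<nat \<lfloor>(y - c) / h\<rfloor>. \<Sum>j<nat \<lfloor>(y' - c') / h'\<rfloor>. F i j)
    = (\<Sum>i<N. \<Sum>j<N'. F i j * of_bool (c + real (Suc i) * h \<le> y \<and> c' + real (Suc j) * h' \<le> y') :: real)"
  unfolding sum_lessThan_index[OF assms(1-3)] sum_lessThan_index[OF assms(4-6)] sum_distrib_right of_bool_conj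
  by (simp only: mult_ac)

lemma grid_row_measurable:
  fixes f :: "nat \<Rightarrow> real" and c h :: real shows "(\<lambda>y. f (nat \<lfloor>(y - c) / h\<rfloor>)) \<in> borel_measurable borel"
proof -
  have "(\<lambda>y. \<lfloor>(y - c) / h\<rfloor>) \<in> measurable borel (count_space UNIV)" by measurable
  then show ?thesis by (rule measurable_compose) simp
qed

context grid_sequence
begin

text \<open>Allows the locale to be instantiated again after each selection of indices.\<close>

lemma grid_subsequence:
  assumes s: "strict_mono (s :: nat \<Rightarrow> nat)"
  shows "grid_sequence a1 b1 a2 b2 w \<theta>1 \<theta>2 (c1 \<circ> s) (c2 \<circ> s) (h \<circ> s) (l \<circ> s) (N \<circ> s) (N' \<circ> s) (U \<circ> s) (M \<circ> s)"
proof
  note sub = LIMSEQ_subseq_LIMSEQ[OF _ s]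
  show "(h \<circ> s) \<longlonglongrightarrow> 0" "(l \<circ> s) \<longlonglongrightarrow> 0" "(c1 \<circ> s) \<longlonglongrightarrow> a1" "(c2 \<circ> s) \<longlonglongrightarrow> a2"
    by (intro sub steps left)+
  show "(\<lambda>k. (c1 \<circ> s) k + real ((N \<circ> s) k) * (h \<circ> s) k) \<longlonglongrightarrow> b1"
    "(\<lambda>k. (c2 \<circ> s) k + real ((N' \<circ> s) k) * (l \<circ> s) k) \<longlonglongrightarrow> b2"
    using sub[OF right(3)] sub[OF right(4)] by (simp_all add: comp_def)
  show "AE x in lborel. x \<in> box2 a1 b1 a2 b2 \<longrightarrow>
      (\<lambda>k. (U \<circ> s) k (nat \<lfloor>(fst x - (c1 \<circ> s) k) / (h \<circ> s) k\<rfloor>) (nat \<lfloor>(snd x - (c2 \<circ> s) k) / (l \<circ> s) k\<rfloor>)) \<longlonglongrightarrow> w x"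
    using convergence
  proof eventually_elim
    case (elim x)
    show ?case
    proof
      assume "x \<in> box2 a1 b1 a2 b2"
      from sub[OF elim[rule_format, OF this]]
      show "(\<lambda>k. (U \<circ> s) k (nat \<lfloor>(fst x - (c1 \<circ> s) k) / (h \<circ> s) k\<rfloor>) (nat \<lfloor>(snd x - (c2 \<circ> s) k) / (l \<circ> s) k\<rfloor>)) \<longlonglongrightarrow> w x"
        by (simp add: comp_def)
    qed
  qed
qed (use steps left right sampled energy_bound in auto)

lemma eventually_inside:
  assumes "x \<in> box2 a1 b1 a2 b2"
  shows "\<forall>\<^sub>F k in sequentially. c1 k < fst x \<and> fst x < c1 k + real (N k) * h k \<and> c2 k < snd x \<and> snd x < c2 k + real (N' k) * l k"
  using assms by (intro eventually_conj order_tendstoD(2)[OF left(3)] order_tendstoD(2)[OF left(4)]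
      order_tendstoD(1)[OF right(3)] order_tendstoD(1)[OF right(4)]) (auto simp: box2_def)

lemma node_1: "i < N k \<Longrightarrow> a1 - 1 \<le> c1 k + real (Suc i) * h k \<and> c1 k + real (Suc i) * h k \<le> b1"
proof -
  assume i: "i < N k"
  have "real (Suc i) * h k \<le> real (N k) * h k" using i steps(1)[of k] by (intro mult_right_mono) auto
  moreover have "0 \<le> real (Suc i) * h k" using steps(1)[of k] by simp
  ultimately show ?thesis using left(1)[of k] right(1)[of k] by linarith
qed

lemma node_2: "i < N' k \<Longrightarrow> a2 - 1 \<le> c2 k + real (Suc i) * l k \<and> c2 k + real (Suc i) * l k \<le> b2"
proof -
  assume i: "i < N' k"
  have "real (Suc i) * l k \<le> real (N' k) * l k" using i steps(2)[of k] by (intro mult_right_mono) auto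
  moreover have "0 \<le> real (Suc i) * l k" using steps(2)[of k] by simp
  ultimately show ?thesis using left(2)[of k] right(2)[of k] by linarith
qed

lemma box_nondegenerate: "a1 < b1" "a2 < b2"
proof -
  have "0 \<le> real (N 0) * h 0" "0 \<le> real (N' 0) * l 0" using steps(1)[of 0] steps(2)[of 0] by auto
  then show "a1 < b1" "a2 < b2" using left(1)[of 0] left(2)[of 0] right(1)[of 0] right(2)[of 0] by linarith+
qed

abbreviation "uk k x \<equiv> U k (nat \<lfloor>(fst x - c1 k) / h k\<rfloor>) (nat \<lfloor>(snd x - c2 k) / l k\<rfloor>)"

text \<open>Enlarged by 1 to the left and below, to hold the boundary atoms at \<open>a1 - 1\<close>
  or \<open>a2 - 1\<close>.\<close>

definition "atom_region = {a1 - 1..b1} \<times> {a2 - 1..b2}"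

lemma atom_region: "compact atom_region" "atom_region \<noteq> {}"
  using box_nondegenerate by (auto simp: atom_region_def intro!: compact_Times)

lemma U_bounded:
  assumes "\<And>x. \<bar>w x\<bar> \<le> B" shows "\<bar>U k i j\<bar> \<le> B"
  using sampled[of k] assms by metis

text \<open>In the second index, 0 is reserved for the increments along the lower edge. Their
  corners are placed at height \<open>a2 - 1\<close>, below the box, so that inside it these
  quadrants are half-planes in the first coordinate. The index \<open>Suc j\<close> carries the
  mixed differences, and the left column \<open>U k 0\<close> remains as the function of the second
  coordinate.\<close>

lemma structure_1:
  assumes \<theta>: "0 < \<theta>" "\<theta> < 1" and wB: "\<And>x. \<bar>w x\<bar> \<le> B"
    and S: "\<And>k. (\<Sum>i<N k. \<bar>hdiff (U k) i 0\<bar> powr \<theta>) + (\<Sum>i<N k. \<Sum>j<N' k. \<bar>mdiff (U k) i j\<bar> powr \<theta>) \<le> S k" "S \<longlonglongrightarrow> S0"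
  shows "\<exists>ub m p q. atom_decomposition \<theta> (box2 a1 b1 a2 b2) atom_region B S0 w snd ub m p q"
proof -
  define I where "I k = {..<N k} \<times> {..<Suc (N' k)}" for k
  define m where "m k x = (case snd x of 0 \<Rightarrow> hdiff (U k) (fst x) 0 | Suc j \<Rightarrow> mdiff (U k) (fst x) j)" for k x
  define loc where "loc k x = (c1 k + real (Suc (fst x)) * h k, case snd x of 0 \<Rightarrow> a2 - 1 | Suc j \<Rightarrow> c2 k + real (Suc j) * l k)" for k x
  define ubk where "ubk k y = U k 0 (nat \<lfloor>(y - c2 k) / l k\<rfloor>)" for k y
  have B0: "0 \<le> B" by (rule order_trans[OF abs_ge_zero wB])
  have UB: "\<bar>U k i j\<bar> \<le> B" for k i j by (rule U_bounded[OF wB])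
  show ?thesis
  proof (rule atoms_limit[where \<pi> = snd and I = I and m = m and loc = loc and ubk = ubk and B = B and \<theta> = \<theta>
        and K = atom_region and S = S, OF convergence])
    fix x assume x: "x \<in> box2 a1 b1 a2 b2"
    show "\<forall>\<^sub>F k in sequentially. uk k x = ubk k (snd x) + (\<Sum>i\<in>I k. m k i * of_bool (fst (loc k i) \<le> fst x \<and> snd (loc k i) \<le> snd x))"
      using eventually_inside[OF x]
    proof eventually_elim
      case (elim k)
      let ?F = "\<lambda>i j. m k (i, j) * of_bool (fst (loc k (i, j)) \<le> fst x \<and> snd (loc k (i, j)) \<le> snd x)"
      have xa: "a2 - 1 \<le> snd x" using x by (auto simp: box2_def)
      have "(\<Sum>i\<in>I k. m k i * of_bool (fst (loc k i) \<le> fst x \<and> snd (loc k i) \<le> snd x)) = (\<Sum>i<N k. ?F i 0) + (\<Sum>i<N k. \<Sum>j<N' k. ?F i (Suc j))"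
        unfolding I_def by (subst sum_prod_Suc_right[symmetric]) simp
      also have "(\<Sum>i<N k. ?F i 0) = (\<Sum>i<nat \<lfloor>(fst x - c1 k) / h k\<rfloor>. hdiff (U k) i 0)"
        using elim xa by (subst sum_lessThan_index[OF steps(1)]) (auto simp: m_def loc_def)
      also have "(\<Sum>i<N k. \<Sum>j<N' k. ?F i (Suc j)) = (\<Sum>i<nat \<lfloor>(fst x - c1 k) / h k\<rfloor>. \<Sum>j<nat \<lfloor>(snd x - c2 k) / l k\<rfloor>. mdiff (U k) i j)"
        using elim by (subst sum_sum_lessThan_index[OF steps(1) _ _ steps(2)]) (auto simp: m_def loc_def)
      finally show ?case unfolding ubk_def
        using grid_decomposition_1[of "U k" "nat \<lfloor>(fst x - c1 k) / h k\<rfloor>" "nat \<lfloor>(snd x - c2 k) / l k\<rfloor>"]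
        by (simp only: add.assoc)
    qed
  next
    show "ubk k \<in> borel_measurable borel" for k unfolding ubk_def by (rule grid_row_measurable)
    show "loc k i \<in> atom_region" if "i \<in> I k" for k i
      using that node_1[of "fst i" k] node_2[of _ k] box_nondegenerate by (auto simp: I_def loc_def atom_region_def split: nat.split)
    have "(\<Sum>i\<in>I k. \<bar>m k i\<bar> powr \<theta>) = (\<Sum>i<N k. \<bar>m k (i, 0)\<bar> powr \<theta>) + (\<Sum>i<N k. \<Sum>j<N' k. \<bar>m k (i, Suc j)\<bar> powr \<theta>)" for k
      unfolding I_def using sum_prod_Suc_right[of "\<lambda>i j. \<bar>m k (i, j)\<bar> powr \<theta>"] by simp
    then show "(\<Sum>i\<in>I k. \<bar>m k i\<bar> powr \<theta>) \<le> S k" for k using S(1)[of k] by (simp add: m_def)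
    show "\<bar>m k i\<bar> \<le> 4 * B" for k i
    proof (cases "snd i")
      case 0
      then show ?thesis using UB[of k "Suc (fst i)" 0] UB[of k "fst i" 0] B0 by (simp add: m_def hdiff_def)
    next
      case (Suc j)
      then show ?thesis using UB[of k "Suc (fst i)" "Suc j"] UB[of k "fst i" "Suc j"] UB[of k "Suc (fst i)" j] UB[of k "fst i" j]
        by (simp add: m_def mdiff_def)
    qed
  qed (use \<theta> S(2) UB atom_region in \<open>auto simp: ubk_def I_def\<close>)
qed

text \<open>The same with the coordinates exchanged: increments along the left edge become atoms at
  abscissa \<open>a1 - 1\<close>, and the bottom row remains.\<close>

lemma structure_2:
  assumes \<theta>: "0 < \<theta>" "\<theta> < 1" and wB: "\<And>x. \<bar>w x\<bar> \<le> B"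
    and S: "\<And>k. (\<Sum>j<N' k. \<bar>vdiff (U k) 0 j\<bar> powr \<theta>) + (\<Sum>i<N k. \<Sum>j<N' k. \<bar>mdiff (U k) i j\<bar> powr \<theta>) \<le> S k" "S \<longlonglongrightarrow> S0"
  shows "\<exists>ub m p q. atom_decomposition \<theta> (box2 a1 b1 a2 b2) atom_region B S0 w fst ub m p q"
proof -
  define I where "I k = {..<Suc (N k)} \<times> {..<N' k}" for k
  define m where "m k x = (case fst x of 0 \<Rightarrow> vdiff (U k) 0 (snd x) | Suc i \<Rightarrow> mdiff (U k) i (snd x))" for k x
  define loc where "loc k x = (case fst x of 0 \<Rightarrow> a1 - 1 | Suc i \<Rightarrow> c1 k + real (Suc i) * h k, c2 k + real (Suc (snd x)) * l k)" for k x
  define ubk where "ubk k y = U k (nat \<lfloor>(y - c1 k) / h k\<rfloor>) 0" for k y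
  have B0: "0 \<le> B" by (rule order_trans[OF abs_ge_zero wB])
  have UB: "\<bar>U k i j\<bar> \<le> B" for k i j by (rule U_bounded[OF wB])
  show ?thesis
  proof (rule atoms_limit[where \<pi> = fst and I = I and m = m and loc = loc and ubk = ubk and B = B and \<theta> = \<theta>
        and K = atom_region and S = S, OF convergence])
    fix x assume x: "x \<in> box2 a1 b1 a2 b2"
    show "\<forall>\<^sub>F k in sequentially. uk k x = ubk k (fst x) + (\<Sum>i\<in>I k. m k i * of_bool (fst (loc k i) \<le> fst x \<and> snd (loc k i) \<le> snd x))"
      using eventually_inside[OF x]
    proof eventually_elim
      case (elim k)
      let ?F = "\<lambda>i j. m k (i, j) * of_bool (fst (loc k (i, j)) \<le> fst x \<and> snd (loc k (i, j)) \<le> snd x)"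
      have xa: "a1 - 1 \<le> fst x" using x by (auto simp: box2_def)
      have "(\<Sum>i\<in>I k. m k i * of_bool (fst (loc k i) \<le> fst x \<and> snd (loc k i) \<le> snd x)) = (\<Sum>j<N' k. ?F 0 j) + (\<Sum>i<N k. \<Sum>j<N' k. ?F (Suc i) j)"
        unfolding I_def by (subst sum_prod_Suc_left[symmetric]) simp
      also have "(\<Sum>j<N' k. ?F 0 j) = (\<Sum>j<nat \<lfloor>(snd x - c2 k) / l k\<rfloor>. vdiff (U k) 0 j)"
        using elim xa by (subst sum_lessThan_index[OF steps(2)]) (auto simp: m_def loc_def)
      also have "(\<Sum>i<N k. \<Sum>j<N' k. ?F (Suc i) j) = (\<Sum>i<nat \<lfloor>(fst x - c1 k) / h k\<rfloor>. \<Sum>j<nat \<lfloor>(snd x - c2 k) / l k\<rfloor>. mdiff (U k) i j)"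
        using elim by (subst sum_sum_lessThan_index[OF steps(1) _ _ steps(2)]) (auto simp: m_def loc_def)
      finally show ?case unfolding ubk_def
        using grid_decomposition_2[of "U k" "nat \<lfloor>(fst x - c1 k) / h k\<rfloor>" "nat \<lfloor>(snd x - c2 k) / l k\<rfloor>"]
        by (simp only: add.assoc)
    qed
  next
    show "ubk k \<in> borel_measurable borel" for k
      unfolding ubk_def using grid_row_measurable[of "\<lambda>i. U k i 0"] .
    show "loc k i \<in> atom_region" if "i \<in> I k" for k i
      using that node_1[of _ k] node_2[of "snd i" k] box_nondegenerate by (auto simp: I_def loc_def atom_region_def split: nat.split)
    have "(\<Sum>i\<in>I k. \<bar>m k i\<bar> powr \<theta>) = (\<Sum>j<N' k. \<bar>m k (0, j)\<bar> powr \<theta>) + (\<Sum>i<N k. \<Sum>j<N' k. \<bar>m k (Suc i, j)\<bar> powr \<theta>)" for k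
      unfolding I_def using sum_prod_Suc_left[of "\<lambda>i j. \<bar>m k (i, j)\<bar> powr \<theta>"] by simp
    then show "(\<Sum>i\<in>I k. \<bar>m k i\<bar> powr \<theta>) \<le> S k" for k using S(1)[of k] by (simp add: m_def)
    show "\<bar>m k i\<bar> \<le> 4 * B" for k i
    proof (cases "fst i")
      case 0
      then show ?thesis using UB[of k 0 "Suc (snd i)"] UB[of k 0 "snd i"] B0 by (simp add: m_def vdiff_def)
    next
      case (Suc j)
      then show ?thesis using UB[of k "Suc j" "Suc (snd i)"] UB[of k j "Suc (snd i)"] UB[of k "Suc j" "snd i"] UB[of k j "snd i"]
        by (simp add: m_def mdiff_def)
    qed
  qed (use \<theta> S(2) UB atom_region in \<open>auto simp: ubk_def I_def\<close>)
qed

end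

lemma atom_decomposition_zero:
  assumes "atom_decomposition \<theta> X K B 0 w \<pi> ub m p q" "0 < \<theta>"
  shows "AE x in lborel. x \<in> X \<longrightarrow> w x = ub (\<pi> x)"
proof -
  have s: "summable (\<lambda>n. \<bar>m n\<bar> powr \<theta>)" and le: "(\<Sum>n. \<bar>m n\<bar> powr \<theta>) \<le> 0"
    using assms by (auto simp: atom_decomposition_def)
  have "\<bar>m n\<bar> powr \<theta> = 0" for n
  proof -
    have "\<bar>m n\<bar> powr \<theta> \<le> (\<Sum>n. \<bar>m n\<bar> powr \<theta>)" using sum_le_suminf[OF s, of "{n}"] by simp
    with le show ?thesis by (metis antisym order_trans powr_ge_zero)
  qed
  then have "m n = 0" for n by simp
  then show ?thesis using assms by (simp add: atom_decomposition_def)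
qed

text \<open>One of the two alternatives holds on every grid, but not always the same one. One of
  them holds on infinitely many grids, and this decides \<pi>.\<close>

lemma (in kernel) decomposition_exists:
  fixes w :: "real \<times> real \<Rightarrow> real" and a1 b1 a2 b2 :: real
  assumes \<theta>: "0 < \<theta>1" "0 < \<theta>2" "\<theta>1 + \<theta>2 < 1" and ab: "a1 < b1" "a2 < b2"
    and w: "w \<in> borel_measurable borel" and B: "1 \<le> B" "\<And>x. \<bar>w x\<bar> \<le> B" and supp: "\<And>x. x \<notin> box2 a1 b1 a2 b2 \<Longrightarrow> w x = 0"
    and fin: "energy \<theta>1 \<theta>2 \<rho> {a1<..<b1} {a2<..<b2} w < \<infinity>"
  defines "M0 \<equiv> 12 * enn2real (energy \<theta>1 \<theta>2 \<rho> {a1<..<b1} {a2<..<b2} w) / \<rho>_const"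
  shows "\<exists>\<pi>\<in>{fst, snd}. \<exists>ub m p q. atom_decomposition (\<theta>1 + \<theta>2) (box2 a1 b1 a2 b2) ({a1 - 1..b1} \<times> {a2 - 1..b2}) B
    (4 * B * (M0 + sqrt M0)) w \<pi> ub m p q"
proof -
  let ?\<theta> = "\<theta>1 + \<theta>2"
  obtain c1 c2 h l N N' U M where G: "grid_sequence a1 b1 a2 b2 w \<theta>1 \<theta>2 c1 c2 h l N N' U M" and M: "M \<longlonglongrightarrow> M0"
    unfolding M0_def by (rule grid_sequence_exists[OF ab w B(2) supp fin])
  interpret G: grid_sequence a1 b1 a2 b2 w \<theta>1 \<theta>2 c1 c2 h l N N' U M by (rule G)
  have \<theta>': "0 < ?\<theta>" "?\<theta> < 1" "?\<theta> \<le> 1" using \<theta> by auto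
  define S where "S k = 4 * B * (M k + sqrt (M k))" for k
  have S: "S \<longlonglongrightarrow> 4 * B * (M0 + sqrt M0)" unfolding S_def by (intro tendsto_intros M)
  define T where "T k = (\<Sum>i<N k. \<Sum>j<N' k. \<bar>mdiff (U k) i j\<bar> powr ?\<theta>)" for k
  define P where "P k \<longleftrightarrow> (\<Sum>i<N k. \<bar>hdiff (U k) i 0\<bar> powr ?\<theta>) + T k \<le> S k" for k
  define Q where "Q k \<longleftrightarrow> (\<Sum>j<N' k. \<bar>vdiff (U k) 0 j\<bar> powr ?\<theta>) + T k \<le> S k" for k
  have "P k \<or> Q k" for k
    unfolding P_def Q_def T_def S_def
    by (rule grid_alternative[OF \<theta>(1,2) \<theta>'(3) B(1) G.U_bounded[OF B(2)] G.energy_bound])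
  then have "infinite {k. P k} \<or> infinite {k. Q k}"
    using infinite_UNIV_nat finite_subset[of UNIV "{k. P k} \<union> {k. Q k}"] by auto
  then show ?thesis
  proof
    assume "infinite {k. P k}"
    then obtain s where s: "strict_mono (s :: nat \<Rightarrow> nat)" "\<And>k. P (s k)" using infinite_enumerate by blast
    interpret s: grid_sequence a1 b1 a2 b2 w \<theta>1 \<theta>2 "c1 \<circ> s" "c2 \<circ> s" "h \<circ> s" "l \<circ> s" "N \<circ> s" "N' \<circ> s" "U \<circ> s" "M \<circ> s"
      by (rule G.grid_subsequence[OF s(1)])
    have "\<exists>ub m p q. atom_decomposition ?\<theta> (box2 a1 b1 a2 b2) s.atom_region B (4 * B * (M0 + sqrt M0)) w snd ub m p q"
      by (rule s.structure_1[OF \<theta>'(1,2) B(2) _ LIMSEQ_subseq_LIMSEQ[OF S s(1)]]) (use s(2) in \<open>auto simp: P_def T_def\<close>)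
    then show ?thesis by (auto simp: s.atom_region_def)
  next
    assume "infinite {k. Q k}"
    then obtain s where s: "strict_mono (s :: nat \<Rightarrow> nat)" "\<And>k. Q (s k)" using infinite_enumerate by blast
    interpret s: grid_sequence a1 b1 a2 b2 w \<theta>1 \<theta>2 "c1 \<circ> s" "c2 \<circ> s" "h \<circ> s" "l \<circ> s" "N \<circ> s" "N' \<circ> s" "U \<circ> s" "M \<circ> s"
      by (rule G.grid_subsequence[OF s(1)])
    have "\<exists>ub m p q. atom_decomposition ?\<theta> (box2 a1 b1 a2 b2) s.atom_region B (4 * B * (M0 + sqrt M0)) w fst ub m p q"
      by (rule s.structure_2[OF \<theta>'(1,2) B(2) _ LIMSEQ_subseq_LIMSEQ[OF S s(1)]]) (use s(2) in \<open>auto simp: Q_def T_def\<close>)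
    then show ?thesis by (auto simp: s.atom_region_def)
  qed
qed

section \<open>Additive functions on grids\<close>

context grid_sequence
begin

text \<open>Without mixed differences only the boundary increments are left, so the exponent can be
  that of a single variable. The region has constant second coordinate, hence the limit atoms are
  half-planes inside the box too.\<close>

lemma additive_structure_1:
  assumes \<theta>: "0 < \<theta>" "\<theta> < 1" and wB: "\<And>x. \<bar>w x\<bar> \<le> B"
    and m0: "\<And>k i j. i < N k \<Longrightarrow> j < N' k \<Longrightarrow> mdiff (U k) i j = 0"
    and S: "\<And>k. (\<Sum>i<N k. \<bar>hdiff (U k) i 0\<bar> powr \<theta>) \<le> S k" "S \<longlonglongrightarrow> S0"
  shows "\<exists>ub m p q. atom_decomposition \<theta> (box2 a1 b1 a2 b2) ({a1 - 1..b1} \<times> {a2 - 1}) B S0 w snd ub m p q"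
proof (rule atoms_limit[where \<pi> = snd and I = "\<lambda>k. {..<N k}" and m = "\<lambda>k i. hdiff (U k) i 0"
      and loc = "\<lambda>k i. (c1 k + real (Suc i) * h k, a2 - 1)" and ubk = "\<lambda>k y. U k 0 (nat \<lfloor>(y - c2 k) / l k\<rfloor>)" and B = B
      and \<theta> = \<theta> and S = S, OF convergence])
  have UB: "\<bar>U k i j\<bar> \<le> B" for k i j by (rule U_bounded[OF wB])
  fix x assume x: "x \<in> box2 a1 b1 a2 b2"
  show "\<forall>\<^sub>F k in sequentially. uk k x = U k 0 (nat \<lfloor>(snd x - c2 k) / l k\<rfloor>)
     + (\<Sum>i\<in>{..<N k}. hdiff (U k) i 0 * of_bool (fst (c1 k + real (Suc i) * h k, a2 - 1) \<le> fst x \<and> snd (c1 k + real (Suc i) * h k, a2 - 1) \<le> snd x))"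
    using eventually_inside[OF x]
  proof eventually_elim
    case (elim k)
    have xa: "a2 - 1 \<le> snd x" using x by (auto simp: box2_def)
    have "(\<Sum>i<nat \<lfloor>(fst x - c1 k) / h k\<rfloor>. \<Sum>j<nat \<lfloor>(snd x - c2 k) / l k\<rfloor>. mdiff (U k) i j) = 0"
      using elim m0 by (subst sum_sum_lessThan_index[OF steps(1) _ _ steps(2)]) (auto intro!: sum.neutral)
    then have "uk k x = U k 0 (nat \<lfloor>(snd x - c2 k) / l k\<rfloor>) + (\<Sum>i<nat \<lfloor>(fst x - c1 k) / h k\<rfloor>. hdiff (U k) i 0)"
      using grid_decomposition_1[of "U k" "nat \<lfloor>(fst x - c1 k) / h k\<rfloor>" "nat \<lfloor>(snd x - c2 k) / l k\<rfloor>"] by linarith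
    also have "(\<Sum>i<nat \<lfloor>(fst x - c1 k) / h k\<rfloor>. hdiff (U k) i 0) = (\<Sum>i\<in>{..<N k}. hdiff (U k) i 0 * of_bool (fst (c1 k + real (Suc i) * h k, a2 - 1) \<le> fst x \<and> snd (c1 k + real (Suc i) * h k, a2 - 1) \<le> snd x))"
      using elim xa by (subst sum_lessThan_index[OF steps(1)]) auto
    finally show ?case .
  qed
next
  show "(\<lambda>y. U k 0 (nat \<lfloor>(y - c2 k) / l k\<rfloor>)) \<in> borel_measurable borel" for k by (rule grid_row_measurable)
  show "compact ({a1 - 1..b1} \<times> {a2 - 1})" by (intro compact_Times) auto
  show "{a1 - 1..b1} \<times> {a2 - 1} \<noteq> {}" using box_nondegenerate by auto
  show "(c1 k + real (Suc i) * h k, a2 - 1) \<in> {a1 - 1..b1} \<times> {a2 - 1}" if "i \<in> {..<N k}" for k i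
    using node_1[of i k] that by auto
  show "\<bar>hdiff (U k) i 0\<bar> \<le> 4 * B" for k i
    using U_bounded[OF wB, of k "Suc i" 0] U_bounded[OF wB, of k i 0] by (simp add: hdiff_def)
qed (use \<theta> S U_bounded[OF wB] in auto)

lemma additive_structure_2:
  assumes \<theta>: "0 < \<theta>" "\<theta> < 1" and wB: "\<And>x. \<bar>w x\<bar> \<le> B"
    and m0: "\<And>k i j. i < N k \<Longrightarrow> j < N' k \<Longrightarrow> mdiff (U k) i j = 0"
    and S: "\<And>k. (\<Sum>j<N' k. \<bar>vdiff (U k) 0 j\<bar> powr \<theta>) \<le> S k" "S \<longlonglongrightarrow> S0"
  shows "\<exists>ub m p q. atom_decomposition \<theta> (box2 a1 b1 a2 b2) ({a1 - 1} \<times> {a2 - 1..b2}) B S0 w fst ub m p q"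
proof (rule atoms_limit[where \<pi> = fst and I = "\<lambda>k. {..<N' k}" and m = "\<lambda>k j. vdiff (U k) 0 j"
      and loc = "\<lambda>k j. (a1 - 1, c2 k + real (Suc j) * l k)" and ubk = "\<lambda>k y. U k (nat \<lfloor>(y - c1 k) / h k\<rfloor>) 0" and B = B
      and \<theta> = \<theta> and S = S, OF convergence])
  fix x assume x: "x \<in> box2 a1 b1 a2 b2"
  show "\<forall>\<^sub>F k in sequentially. uk k x = U k (nat \<lfloor>(fst x - c1 k) / h k\<rfloor>) 0
     + (\<Sum>j\<in>{..<N' k}. vdiff (U k) 0 j * of_bool (fst (a1 - 1, c2 k + real (Suc j) * l k) \<le> fst x \<and> snd (a1 - 1, c2 k + real (Suc j) * l k) \<le> snd x))"
    using eventually_inside[OF x]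
  proof eventually_elim
    case (elim k)
    have xa: "a1 - 1 \<le> fst x" using x by (auto simp: box2_def)
    have "(\<Sum>i<nat \<lfloor>(fst x - c1 k) / h k\<rfloor>. \<Sum>j<nat \<lfloor>(snd x - c2 k) / l k\<rfloor>. mdiff (U k) i j) = 0"
      using elim m0 by (subst sum_sum_lessThan_index[OF steps(1) _ _ steps(2)]) (auto intro!: sum.neutral)
    then have "uk k x = U k (nat \<lfloor>(fst x - c1 k) / h k\<rfloor>) 0 + (\<Sum>j<nat \<lfloor>(snd x - c2 k) / l k\<rfloor>. vdiff (U k) 0 j)"
      using grid_decomposition_2[of "U k" "nat \<lfloor>(fst x - c1 k) / h k\<rfloor>" "nat \<lfloor>(snd x - c2 k) / l k\<rfloor>"] by linarith
    also have "(\<Sum>j<nat \<lfloor>(snd x - c2 k) / l k\<rfloor>. vdiff (U k) 0 j) = (\<Sum>j\<in>{..<N' k}. vdiff (U k) 0 j * of_bool (fst (a1 - 1, c2 k + real (Suc j) * l k) \<le> fst x \<and> snd (a1 - 1, c2 k + real (Suc j) * l k) \<le> snd x))"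
      using elim xa by (subst sum_lessThan_index[OF steps(2)]) auto
    finally show ?case .
  qed
next
  show "(\<lambda>y. U k (nat \<lfloor>(y - c1 k) / h k\<rfloor>) 0) \<in> borel_measurable borel" for k
    using grid_row_measurable[of "\<lambda>i. U k i 0"] .
  show "compact ({a1 - 1} \<times> {a2 - 1..b2})" by (intro compact_Times) auto
  show "{a1 - 1} \<times> {a2 - 1..b2} \<noteq> {}" using box_nondegenerate by auto
  show "(a1 - 1, c2 k + real (Suc i) * l k) \<in> {a1 - 1} \<times> {a2 - 1..b2}" if "i \<in> {..<N' k}" for k i
    using node_2[of i k] that by auto
  show "\<bar>vdiff (U k) 0 i\<bar> \<le> 4 * B" for k i
    using U_bounded[OF wB, of k 0 "Suc i"] U_bounded[OF wB, of k 0 i] by (simp add: vdiff_def)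
qed (use \<theta> S U_bounded[OF wB] in auto)

text \<open>The differences of an additive function do not depend on the other index, so a cell
  energy is four equal products and the double sum factorises.\<close>

lemma additive_energy:
  assumes add: "\<And>x. x \<in> box2 a1 b1 a2 b2 \<Longrightarrow> w x = f1 (fst x) + f2 (snd x)"
  shows "\<And>i j. i < N k \<Longrightarrow> j < N' k \<Longrightarrow> mdiff (U k) i j = 0"
    "4 * ((\<Sum>i<N k. \<bar>hdiff (U k) i 0\<bar> powr \<theta>1) * (\<Sum>j<N' k. \<bar>vdiff (U k) 0 j\<bar> powr \<theta>2)) \<le> M k"
proof -
  obtain f g where fg: "\<And>i j. U k i j = w (f i, g j)" "\<And>i. i \<le> N k \<Longrightarrow> f i \<in> {a1<..<b1}" "\<And>j. j \<le> N' k \<Longrightarrow> g j \<in> {a2<..<b2}"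
    using sampled[of k] by blast
  have U: "U k i j = f1 (f i) + f2 (g j)" if "i \<le> N k" "j \<le> N' k" for i j
    unfolding fg(1) using fg(2,3) that by (subst add) (auto simp: box2_def)
  show "\<And>i j. i < N k \<Longrightarrow> j < N' k \<Longrightarrow> mdiff (U k) i j = 0" by (simp add: mdiff_def U)
  have "cell_energy \<theta>1 \<theta>2 (U k) i j = 4 * (\<bar>hdiff (U k) i 0\<bar> powr \<theta>1 * \<bar>vdiff (U k) 0 j\<bar> powr \<theta>2)" if "i < N k" "j < N' k" for i j
    using that by (simp add: cell_energy_def hdiff_def vdiff_def U)
  then have "(\<Sum>i<N k. \<Sum>j<N' k. cell_energy \<theta>1 \<theta>2 (U k) i j) = (\<Sum>i<N k. \<Sum>j<N' k. 4 * (\<bar>hdiff (U k) i 0\<bar> powr \<theta>1 * \<bar>vdiff (U k) 0 j\<bar> powr \<theta>2))"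
    by (intro sum.cong) auto
  also have "\<dots> = 4 * ((\<Sum>i<N k. \<bar>hdiff (U k) i 0\<bar> powr \<theta>1) * (\<Sum>j<N' k. \<bar>vdiff (U k) 0 j\<bar> powr \<theta>2))"
    unfolding sum_product by (simp only: sum_distrib_left)
  finally show "4 * ((\<Sum>i<N k. \<bar>hdiff (U k) i 0\<bar> powr \<theta>1) * (\<Sum>j<N' k. \<bar>vdiff (U k) 0 j\<bar> powr \<theta>2)) \<le> M k"
    using energy_bound[of k] by simp
qed

end

text \<open>Only the product is bounded, so along a subsequence \<alpha> tends to 0, to infinity
  (then \<beta> tends to 0) or to some \<open>A > 0\<close>. In the last case the two limiting
  bounds multiply to \<open>M0 / 4\<close>.\<close>

lemma product_bound_alternative:
  fixes \<alpha> \<beta> M :: "nat \<Rightarrow> real"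
  assumes nn: "\<And>k. 0 \<le> \<alpha> k" "\<And>k. 0 \<le> \<beta> k" and prod: "\<And>k. 4 * (\<alpha> k * \<beta> k) \<le> M k" and M: "M \<longlonglongrightarrow> M0"
  obtains s where "strict_mono (s :: nat \<Rightarrow> nat)" "(\<lambda>k. \<alpha> (s k)) \<longlonglongrightarrow> 0"
    | s T where "strict_mono (s :: nat \<Rightarrow> nat)" "\<And>k. \<beta> (s k) \<le> T k" "T \<longlonglongrightarrow> 0"
    | s A T where "strict_mono (s :: nat \<Rightarrow> nat)" "0 < A" "(\<lambda>k. \<alpha> (s k)) \<longlonglongrightarrow> A" "\<And>k. \<beta> (s k) \<le> T k" "T \<longlonglongrightarrow> M0 / (4 * A)"
proof -
  obtain s where s: "strict_mono (s :: nat \<Rightarrow> nat)" "monoseq (\<lambda>n. \<alpha> (s n))" using seq_monosub by blast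
  have le: "\<beta> k \<le> M k / (4 * \<alpha> k)" if "\<alpha> k > 0" for k using prod[of k] that by (simp add: field_simps)
  show ?thesis
  proof (cases "Bseq (\<lambda>n. \<alpha> (s n))")
    case True
    then have "convergent (\<lambda>n. \<alpha> (s n))" using s(2) by (rule Bseq_monoseq_convergent)
    then obtain A where A: "(\<lambda>n. \<alpha> (s n)) \<longlonglongrightarrow> A" by (auto simp: convergent_def)
    have A0: "0 \<le> A" by (rule LIMSEQ_le_const[OF A]) (use nn in auto)
    show ?thesis
    proof (cases "A = 0")
      case True then show ?thesis using that(1)[OF s(1)] A by simp
    next
      case False
      then have Apos: "0 < A" using A0 by simp
      then have "\<forall>\<^sub>F n in sequentially. 0 < \<alpha> (s n)" by (intro order_tendstoD(1)[OF A])
      then obtain k0 where k0: "\<And>n. n \<ge> k0 \<Longrightarrow> 0 < \<alpha> (s n)" by (auto simp: eventually_sequentially)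
      define s' where "s' n = s (n + k0)" for n
      \<comment> \<open>Finitely many indices are dropped, because the bound on \<beta> divides by
        \<alpha> and has to hold for all indices.\<close>
      have s': "strict_mono s'" using s(1) by (auto simp: s'_def strict_mono_def)
      have A': "(\<lambda>n. \<alpha> (s' n)) \<longlonglongrightarrow> A" unfolding s'_def by (rule LIMSEQ_ignore_initial_segment[OF A])
      show ?thesis
      proof (rule that(3)[OF s' Apos A'])
        show "\<beta> (s' k) \<le> M (s' k) / (4 * \<alpha> (s' k))" for k by (rule le) (simp add: s'_def k0)
        show "(\<lambda>k. M (s' k) / (4 * \<alpha> (s' k))) \<longlonglongrightarrow> M0 / (4 * A)"
          using LIMSEQ_subseq_LIMSEQ[OF M s'] Apos by (intro tendsto_intros A') (auto simp: comp_def)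
      qed
    qed
  next
    case False
    \<comment> \<open>A decreasing sequence of non-negative numbers would be bounded.\<close>
    have inc: "incseq (\<lambda>n. \<alpha> (s n))"
    proof (rule ccontr)
      assume "\<not> ?thesis"
      then have dec: "\<alpha> (s n) \<le> \<alpha> (s m)" if "m \<le> n" for m n using s(2) that by (auto simp: monoseq_def incseq_def)
      have "Bseq (\<lambda>n. \<alpha> (s n))" by (rule BseqI'[of _ "\<alpha> (s 0)"]) (use dec[of 0] nn in auto)
      with False show False by simp
    qed
    have top: "filterlim (\<lambda>n. \<alpha> (s n)) at_top sequentially"
      unfolding filterlim_at_top
    proof
      fix Z :: real
      have "\<exists>n. \<alpha> (s n) > \<bar>Z\<bar>"
      proof (rule ccontr)
        assume "\<not> ?thesis"
        then have "Bseq (\<lambda>n. \<alpha> (s n))" using nn by (intro BseqI'[of _ "\<bar>Z\<bar>"]) (auto simp: not_less)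
        with False show False by simp
      qed
      then obtain n where n: "\<alpha> (s n) > \<bar>Z\<bar>" by blast
      have "Z \<le> \<alpha> (s m)" if "m \<ge> n" for m using incseqD[OF inc that] n by linarith
      then show "\<forall>\<^sub>F n in sequentially. Z \<le> \<alpha> (s n)" by (auto simp: eventually_sequentially)
    qed
    then have "\<forall>\<^sub>F n in sequentially. 1 \<le> \<alpha> (s n)" by (simp add: filterlim_at_top)
    then obtain k0 where k0: "\<And>n. n \<ge> k0 \<Longrightarrow> 1 \<le> \<alpha> (s n)" by (auto simp: eventually_sequentially)
    define s' where "s' n = s (n + k0)" for n
    have s': "strict_mono s'" using s(1) by (auto simp: s'_def strict_mono_def)
    have top': "filterlim (\<lambda>n. \<alpha> (s' n)) at_top sequentially"
      unfolding s'_def by (rule filterlim_compose[OF top]) (rule filterlim_add_const_nat_at_top)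
    show ?thesis
    proof (rule that(2)[OF s'])
      show "\<beta> (s' k) \<le> M (s' k) / (4 * \<alpha> (s' k))" for k using k0[of "k + k0"] by (intro le) (simp add: s'_def)
      have "(\<lambda>k. M (s' k) * (1/4) * inverse (\<alpha> (s' k))) \<longlonglongrightarrow> M0 * (1/4) * 0"
        using LIMSEQ_subseq_LIMSEQ[OF M s'] by (intro tendsto_mult tendsto_const tendsto_inverse_0_at_top top') (simp add: comp_def)
      moreover have "M (s' k) * (1/4) * inverse (\<alpha> (s' k)) = M (s' k) / (4 * \<alpha> (s' k))" for k
        by (simp add: inverse_eq_divide)
      ultimately show "(\<lambda>k. M (s' k) / (4 * \<alpha> (s' k))) \<longlonglongrightarrow> 0" by (simp only: mult_zero_right)
    qed
  qed
qed

section \<open>Vanishing mixed derivative\<close>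

text \<open>The classical flat function \<open>exp (- (1 / t))\<close>, with a polynomial in
  \<open>1 / t\<close> as a factor so that the family is closed under differentiation.\<close>

definition eflat :: "real poly \<Rightarrow> real \<Rightarrow> real" where
  "eflat p t = (if t > 0 then poly p (1 / t) * exp (- (1 / t)) else 0)"

text \<open>With \<open>s = 1 / t\<close>, differentiating \<open>p(s) exp(-s)\<close> in
  \<open>t\<close> produces the factor \<open>s\<^sup>2\<close> and the polynomial
  \<open>p - p'\<close>.\<close>

definition eflat_deriv :: "real poly \<Rightarrow> real poly" where
  "eflat_deriv p = [:0, 0, 1:] * (p - pderiv p)"

lemma poly_exp_minus_tendsto_0: "((\<lambda>s. poly p s * exp (- s)) \<longlongrightarrow> (0 :: real)) at_top"
proof -
  have "((\<lambda>s. \<Sum>i\<le>degree p. coeff p i * (s ^ i / exp s)) \<longlongrightarrow> (\<Sum>i\<le>degree p. coeff p i * 0)) at_top"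
    by (intro tendsto_sum tendsto_mult tendsto_const tendsto_power_div_exp_0)
  moreover have "(\<lambda>s. \<Sum>i\<le>degree p. coeff p i * (s ^ i / exp s)) = (\<lambda>s. poly p s * exp (- s))"
    by (simp add: poly_altdef exp_minus divide_inverse sum_distrib_right mult.assoc)
  ultimately show ?thesis by simp
qed

lemma eflat_has_derivative: "(eflat p has_real_derivative eflat (eflat_deriv p) t) (at t)"
proof -
  consider "t > 0" | "t < 0" | "t = 0" by linarith
  then show ?thesis
  proof cases
    case 1
    have "((\<lambda>t. poly p (1 / t) * exp (- (1 / t))) has_real_derivative
        poly (pderiv p) (1 / t) * (- (1 / t\<^sup>2)) * exp (- (1 / t)) + exp (- (1 / t)) * (1 / t\<^sup>2) * poly p (1 / t)) (at t)"
      using 1 by (auto intro!: derivative_eq_intros DERIV_chain2[OF poly_DERIV] simp: power2_eq_square)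
    moreover have "poly (pderiv p) (1 / t) * (- (1 / t\<^sup>2)) * exp (- (1 / t)) + exp (- (1 / t)) * (1 / t\<^sup>2) * poly p (1 / t) = eflat (eflat_deriv p) t"
      using 1 by (simp add: eflat_def eflat_deriv_def field_simps power2_eq_square)
    ultimately show ?thesis
      by (subst DERIV_cong_ev[OF refl _ refl, of _ "\<lambda>t. poly p (1 / t) * exp (- (1 / t))"])
         (use 1 eventually_nhds_in_open[of "{0<..}" t] in \<open>auto simp: eflat_def elim!: eventually_mono\<close>)
  next
    case 2
    have "((\<lambda>t. 0) has_real_derivative eflat (eflat_deriv p) t) (at t)"
      using 2 by (simp add: eflat_def)
    then show ?thesis
      by (subst DERIV_cong_ev[OF refl _ refl, of _ "\<lambda>_. 0"])
         (use 2 eventually_nhds_in_open[of "{..<0}" t] in \<open>auto simp: eflat_def elim!: eventually_mono\<close>)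
  next
    case 3
    have "((\<lambda>h. eflat p h / h) \<longlongrightarrow> 0) (at 0)"
    proof (rule filterlim_split_at)
      have "\<forall>\<^sub>F h in at_left 0. eflat p h / h = 0"
        by (auto simp: eventually_at_filter eflat_def)
      then show "((\<lambda>h. eflat p h / h) \<longlongrightarrow> 0) (at_left 0)" by (rule tendsto_eventually)
      \<comment> \<open>With \<open>s = inverse h\<close> the difference quotient at 0 from the
        right is \<open>s p(s) exp(-s)\<close>, a polynomial against an exponential.\<close>
      have "((\<lambda>h. poly ([:0, 1:] * p) (inverse h) * exp (- inverse h)) \<longlongrightarrow> 0) (at_right (0 :: real))"
        by (rule filterlim_compose[OF poly_exp_minus_tendsto_0 filterlim_inverse_at_top_right])
      moreover have "\<forall>\<^sub>F h in at_right 0. poly ([:0, 1:] * p) (inverse h) * exp (- inverse h) = eflat p h / h"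
        by (auto simp: eventually_at_filter eflat_def field_simps)
      ultimately show "((\<lambda>h. eflat p h / h) \<longlongrightarrow> 0) (at_right 0)" by (rule Lim_transform_eventually)
    qed
    then show ?thesis using 3 by (simp add: has_field_derivative_iff eflat_def)
  qed
qed

lemma eflat_bounds: "0 \<le> eflat 1 t" "eflat 1 t \<le> 1"
  by (auto simp: eflat_def)

lemma eflat_scaled_tendsto: "(\<lambda>k. eflat 1 (real (Suc k) * s)) \<longlonglongrightarrow> of_bool (s > 0)"
proof (cases "s > 0")
  case True
  have "(\<lambda>k. inverse (real (Suc k)) * (1 / s)) \<longlonglongrightarrow> 0 * (1 / s)"
    by (intro tendsto_mult tendsto_const LIMSEQ_inverse_real_of_nat)
  then have "(\<lambda>k. exp (- (inverse (real (Suc k)) * (1 / s)))) \<longlonglongrightarrow> exp (- (0 * (1 / s)))"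
    by (intro tendsto_exp tendsto_minus)
  moreover have "eflat 1 (real (Suc k) * s) = exp (- (inverse (real (Suc k)) * (1 / s)))" for k
    using True by (simp add: eflat_def divide_inverse)
  ultimately show ?thesis using True by simp
next
  case False
  then have "eflat 1 (real (Suc k) * s) = 0" for k by (simp add: eflat_def mult_le_0_iff not_less)
  then show ?thesis using False by simp
qed

section \<open>Smooth bump functions\<close>

lemma Ck_mono: "Ck (Suc k) f \<Longrightarrow> Ck k f"
proof (induction k arbitrary: f)
  case 0
  then show ?case
    by (auto intro!: differentiable_imp_continuous_on simp: differentiable_on_def differentiable_at_withinI)
next
  case (Suc k)
  then have "\<forall>x. f differentiable at x" "\<forall>b\<in>Basis. Ck (Suc k) (pd b f)" by simp_all
  with Suc.IH show ?case by simp
qed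

lemma pd_eq: "(f has_derivative D) (at x) \<Longrightarrow> pd b f x = D b"
  unfolding pd_def by (simp add: frechet_derivative_at[symmetric])

lemma Ck_add: "Ck k f \<Longrightarrow> Ck k g \<Longrightarrow> Ck k (\<lambda>x. f x + g x)"
proof (induction k arbitrary: f g)
  case (Suc k)
  have d: "f differentiable at x" "g differentiable at x" for x using Suc.prems by auto
  have "pd b (\<lambda>x. f x + g x) = (\<lambda>x. pd b f x + pd b g x)" for b
  proof
    fix x
    have "((\<lambda>x. f x + g x) has_derivative (\<lambda>h. frechet_derivative f (at x) h + frechet_derivative g (at x) h)) (at x)"
      using d by (intro has_derivative_add) (simp_all add: frechet_derivative_works[symmetric])
    then show "pd b (\<lambda>x. f x + g x) x = pd b f x + pd b g x" by (subst pd_eq) (auto simp: pd_def)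
  qed
  then show ?case using Suc d by (auto intro!: differentiable_add)
qed (auto intro: continuous_on_add)

lemma Ck_mult: "Ck k f \<Longrightarrow> Ck k g \<Longrightarrow> Ck k (\<lambda>x. f x * g x)"
proof (induction k arbitrary: f g)
  case (Suc k)
  have d: "f differentiable at x" "g differentiable at x" for x using Suc.prems by auto
  have "pd b (\<lambda>x. f x * g x) = (\<lambda>x. f x * pd b g x + pd b f x * g x)" for b
  proof
    fix x
    have "((\<lambda>x. f x * g x) has_derivative (\<lambda>h. f x * frechet_derivative g (at x) h + frechet_derivative f (at x) h * g x)) (at x)"
      using d by (intro has_derivative_mult) (simp_all add: frechet_derivative_works[symmetric])
    then show "pd b (\<lambda>x. f x * g x) x = f x * pd b g x + pd b f x * g x" by (subst pd_eq) (auto simp: pd_def)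
  qed
  then show ?case using Suc d Ck_mono[OF Suc.prems(1)] Ck_mono[OF Suc.prems(2)] by (auto intro!: Ck_add differentiable_mult)
qed (auto intro: continuous_on_mult)

lemma eflat_linear_has_derivative:
  fixes b :: "'a::euclidean_space"
  shows "((\<lambda>x. d * eflat p (s * (x \<bullet> b) + c)) has_derivative (\<lambda>h. d * (eflat (eflat_deriv p) (s * (x \<bullet> b) + c) * (s * (h \<bullet> b))))) (at x)"
proof -
  have lin: "((\<lambda>x. s * (x \<bullet> b) + c) has_derivative (\<lambda>h. s * (h \<bullet> b))) (at x)"
    by (auto intro!: derivative_eq_intros)
  have "((\<lambda>x. eflat p (s * (x \<bullet> b) + c)) has_derivative (\<lambda>h. eflat (eflat_deriv p) (s * (x \<bullet> b) + c) * (s * (h \<bullet> b)))) (at x)"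
    by (rule has_derivative_compose[OF lin eflat_has_derivative[unfolded has_field_derivative_def]])
  then show ?thesis by (rule has_derivative_mult_right)
qed

text \<open>The prefactor and the polynomial are both general in the induction, since each
  derivative changes both.\<close>

lemma Ck_eflat_linear: "Ck k (\<lambda>x. d * eflat p (s * (x \<bullet> b) + c))"
proof (induction k arbitrary: d p)
  case 0
  show ?case
    using has_derivative_continuous[OF eflat_linear_has_derivative[where d = d and p = p and s = s and b = b and c = c]]
    by (simp add: continuous_on_eq_continuous_at)
next
  case (Suc k)
  have "pd b' (\<lambda>x. d * eflat p (s * (x \<bullet> b) + c)) = (\<lambda>x. (d * s * (b' \<bullet> b)) * eflat (eflat_deriv p) (s * (x \<bullet> b) + c))" for b'
    by (rule ext, subst pd_eq[OF eflat_linear_has_derivative]) (simp add: mult_ac)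
  moreover have "(\<lambda>x. d * eflat p (s * (x \<bullet> b) + c)) differentiable (at x)" for x
    unfolding differentiable_def by (rule exI, rule eflat_linear_has_derivative)
  ultimately show ?case using Suc by simp
qed

text \<open>No plateau is built in: growing \<open>k\<close> steepens both ends, and the bumps
  converge boundedly to the indicator of the open interval.\<close>

definition bump1 :: "real \<Rightarrow> real \<Rightarrow> nat \<Rightarrow> real \<Rightarrow> real" where
  "bump1 a b k t = eflat 1 (real (Suc k) * (t - a)) * eflat 1 (real (Suc k) * (b - t))"

definition bump1' :: "real \<Rightarrow> real \<Rightarrow> nat \<Rightarrow> real \<Rightarrow> real" where
  "bump1' a b k t = real (Suc k) * (eflat (eflat_deriv 1) (real (Suc k) * (t - a)) * eflat 1 (real (Suc k) * (b - t))
     - eflat 1 (real (Suc k) * (t - a)) * eflat (eflat_deriv 1) (real (Suc k) * (b - t)))"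

lemma bump1_deriv: "(bump1 a b k has_real_derivative bump1' a b k t) (at t)"
  unfolding bump1_def[abs_def] bump1'_def
  by (auto intro!: derivative_eq_intros DERIV_chain2[OF eflat_has_derivative] simp: algebra_simps)

lemma bump1_bounds: "0 \<le> bump1 a b k t" "bump1 a b k t \<le> 1"
  unfolding bump1_def using eflat_bounds by (auto intro!: mult_le_one)

lemma bump1_tendsto: "(\<lambda>k. bump1 a b k t) \<longlonglongrightarrow> of_bool (a < t \<and> t < b)"
  using tendsto_mult[OF eflat_scaled_tendsto[of "t - a"] eflat_scaled_tendsto[of "b - t"]]
  by (simp add: bump1_def of_bool_conj)

lemma bump1_outside: "t \<notin> {a..b} \<Longrightarrow> bump1 a b k t = 0"
  by (auto simp: bump1_def eflat_def zero_less_mult_iff)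

definition bump2 :: "real \<Rightarrow> real \<Rightarrow> real \<Rightarrow> real \<Rightarrow> nat \<Rightarrow> real \<times> real \<Rightarrow> real" where
  "bump2 a b c d k x = bump1 a b k (fst x) * bump1 c d k (snd x)"

lemma bump2_test_fun:
  assumes "a1 < a" "b < b1" "a2 < c" "d < b2"
  shows "test_fun (box2 a1 b1 a2 b2) (bump2 a b c d k)"
  unfolding test_fun_def
proof
  let ?K = "real (Suc k)"
  have eq: "bump2 a b c d k = (\<lambda>x. ((1 * eflat 1 (?K * (x \<bullet> (1, 0)) + - (?K * a))) * (1 * eflat 1 ((- ?K) * (x \<bullet> (1, 0)) + ?K * b)))
     * ((1 * eflat 1 (?K * (x \<bullet> (0, 1)) + - (?K * c))) * (1 * eflat 1 ((- ?K) * (x \<bullet> (0, 1)) + ?K * d))))"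
    by (rule ext) (simp add: bump2_def bump1_def algebra_simps)
  show "\<forall>n. Ck n (bump2 a b c d k)"
    unfolding eq by (intro allI, rule Ck_mult[OF Ck_mult[OF Ck_eflat_linear Ck_eflat_linear] Ck_mult[OF Ck_eflat_linear Ck_eflat_linear]])
  show "\<exists>K. compact K \<and> K \<subseteq> box2 a1 b1 a2 b2 \<and> (\<forall>x. x \<notin> K \<longrightarrow> bump2 a b c d k x = 0)"
  proof (intro exI[of _ "{a..b} \<times> {c..d}"] conjI allI impI)
    show "compact ({a..b} \<times> {c..d})" by (intro compact_Times) auto
    show "{a..b} \<times> {c..d} \<subseteq> box2 a1 b1 a2 b2" using assms by (auto simp: box2_def)
    show "x \<notin> {a..b} \<times> {c..d} \<Longrightarrow> bump2 a b c d k x = 0" for x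
      using bump1_outside by (auto simp: bump2_def mem_Times_iff)
  qed
qed

lemma pd_product:
  fixes A C :: "real \<Rightarrow> real"
  assumes "\<And>t. (A has_real_derivative A' t) (at t)" "\<And>t. (C has_real_derivative C' t) (at t)"
  shows "pd (1, 0) (\<lambda>x. A (fst x) * C (snd x)) = (\<lambda>x. A' (fst x) * C (snd x))"
    "pd (0, 1) (\<lambda>x. A (fst x) * C (snd x)) = (\<lambda>x. A (fst x) * C' (snd x))"
proof -
  have "((\<lambda>x. A (fst x) * C (snd x)) has_derivative (\<lambda>h. A (fst x) * (C' (snd x) * snd h) + (A' (fst x) * fst h) * C (snd x))) (at x)" for x :: "real \<times> real"
    by (intro has_derivative_mult has_derivative_compose[OF _ assms(1)[unfolded has_field_derivative_def]] has_derivative_compose[OF _ assms(2)[unfolded has_field_derivative_def]])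
       (auto intro!: derivative_eq_intros)
  note D = pd_eq[OF this]
  show "pd (1, 0) (\<lambda>x. A (fst x) * C (snd x)) = (\<lambda>x. A' (fst x) * C (snd x))"
    "pd (0, 1) (\<lambda>x. A (fst x) * C (snd x)) = (\<lambda>x. A (fst x) * C' (snd x))"
    by (auto simp: D)
qed

text \<open>\<open>mu_zero\<close> fixes one order of the derivatives, while a function of the first
  variable is removed by the other order. For products the symmetry can be read off.\<close>

lemma differentiable_mixed_bump2:
  "pd (0, 1) (pd (1, 0) (bump2 a b c d k)) = pd (1, 0) (pd (0, 1) (bump2 a b c d k))"
proof -
  have e: "\<exists>f. \<forall>t. (bump1' a b k has_real_derivative f t) (at t)" for a b
    unfolding bump1'_def
    by (rule exI, rule allI) (rule derivative_eq_intros DERIV_chain2[OF eflat_has_derivative] refl)+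
  obtain f where f: "\<And>t. (bump1' a b k has_real_derivative f t) (at t)" using e by blast
  obtain g where g: "\<And>t. (bump1' c d k has_real_derivative g t) (at t)" using e by blast
  show ?thesis
    unfolding bump2_def[abs_def] pd_product[OF bump1_deriv bump1_deriv]
      pd_product[OF f bump1_deriv] pd_product[OF bump1_deriv g] ..
qed

text \<open>The mixed distributional derivative of the indicator of a quadrant is the unit mass at
  its corner.\<close>

lemma test_fun_quadrant_mixed:
  fixes \<phi> :: "real \<times> real \<Rightarrow> real"
  assumes \<phi>: "test_fun U \<phi>"
  shows "(LINT x|lborel. indicator (quadrant p q) x * pd (1, 0) (pd (0, 1) \<phi>) x) = \<phi> (p, q)"
proof -
  have b: "(0::real, 1::real) \<in> Basis" by (auto simp: Basis_prod_def)
  note \<psi> = test_fun_pd[OF \<phi> b]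
  have "(LINT x|lborel. indicator (quadrant p q) x * pd (1, 0) (pd (0, 1) \<phi>) x)
     = - (LINT t|lborel. indicator {q<..} t * pd (0, 1) \<phi> (p, t))"
    unfolding indicator_quadrant by (rule test_fun_quadrant(1)[OF \<psi>, of _ 1]) (auto split: split_indicator)
  also have "\<dots> = \<phi> (p, q)"
    using test_fun_halfline(1)[OF \<phi> b, of q "(p, 0)"] by simp
  finally show ?thesis .
qed

text \<open>Integration against a mixed derivative annihilates every function of one variable and
  evaluates each quadrant at its corner. So the vanishing of the mixed derivative of
  \<open>u\<close> becomes a relation between the masses alone.\<close>

lemma mu_zero_bump:
  fixes u :: "real \<times> real \<Rightarrow> real"
  assumes mu: "mu_zero (box2 a1 b1 a2 b2) u" and ae: "AE x in lborel. x \<in> box2 a1 b1 a2 b2 \<longrightarrow> u x = ub (\<pi> x) + (\<Sum>n. m n * indicator (quadrant (p n) (q n)) x)"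
    and \<pi>: "\<pi> = fst \<or> \<pi> = snd" and ub: "ub \<in> borel_measurable borel" "\<And>y. \<bar>ub y\<bar> \<le> B"
    and sm: "summable (\<lambda>n. \<bar>m n\<bar>)" and abcd: "a1 < a" "b < b1" "a2 < c" "d < b2"
  shows "(\<Sum>n. m n * bump2 a b c d k (p n, q n)) = 0"
proof -
  let ?\<phi> = "bump2 a b c d k" and ?U = "box2 a1 b1 a2 b2"
  note [measurable] = ub(1)
  have \<phi>: "test_fun ?U ?\<phi>" by (rule bump2_test_fun[OF abcd])
  have bs: "(0::real, 1::real) \<in> Basis" "(1::real, 0::real) \<in> Basis" by (auto simp: Basis_prod_def)
  define \<psi> where "\<psi> = pd (1, 0) (pd (0, 1) ?\<phi>)"
  have \<psi>: "test_fun ?U \<psi>" unfolding \<psi>_def by (intro test_fun_pd \<phi> bs)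
  have [measurable]: "\<psi> \<in> borel_measurable borel" by (rule test_fun_borel[OF \<psi>])
  have \<pi>m [measurable]: "\<pi> \<in> borel_measurable borel" using \<pi> by auto
  have v: "summable (\<lambda>n. \<bar>m n * indicator (quadrant (p n) (q n)) x\<bar>)" for x
    by (rule summable_comparison_test'[OF sm, of 0]) (auto simp: abs_mult split: split_indicator)
  define V where "V x = (\<Sum>n. m n * indicator (quadrant (p n) (q n)) x)" for x
  have [measurable]: "V \<in> borel_measurable borel" unfolding V_def by measurable
  have VB: "\<bar>V x\<bar> \<le> (\<Sum>n. \<bar>m n\<bar>)" for x
    unfolding V_def by (rule order_trans[OF summable_rabs[OF v]]) (intro suminf_le v sm, auto split: split_indicator)
  have i1: "integrable lborel (\<lambda>x. ub (\<pi> x) * \<psi> x)" by (rule test_fun_mult_integrable[OF \<psi> _ ub(2)]) measurable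
  have i2: "integrable lborel (\<lambda>x. V x * \<psi> x)" by (rule test_fun_mult_integrable[OF \<psi> _ VB]) measurable
  have i3: "integrable lborel (\<lambda>x. (m n * indicator (quadrant (p n) (q n)) x) * \<psi> x)" for n
    by (rule test_fun_mult_integrable[OF \<psi>, of _ "\<bar>m n\<bar>"]) (auto split: split_indicator)
  have i4: "integrable lborel \<psi>" using test_fun_mult_integrable[OF \<psi>, of "\<lambda>_. 1" 1] by simp
  have "0 = (LINT x:?U|lebesgue. u x * \<psi> x)" using mu \<phi> by (simp add: mu_zero_def \<psi>_def)
  also have "\<dots> = (LINT x|lebesgue. (ub (\<pi> x) + V x) * \<psi> x)"
  proof -
    have "AE x in lebesgue. x \<in> ?U \<longrightarrow> u x = ub (\<pi> x) + V x" using ae unfolding V_def by (rule AE_completion)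
    then have eq: "AE x in lebesgue. (ub (\<pi> x) + V x) * \<psi> x = indicator ?U x *\<^sub>R (u x * \<psi> x)"
      using test_fun_eq_0[OF \<psi>] by (auto elim!: eventually_mono split: split_indicator)
    have m1: "(\<lambda>x. (ub (\<pi> x) + V x) * \<psi> x) \<in> borel_measurable lebesgue" by (intro measurable_completion) measurable
    have m2: "(\<lambda>x. indicator ?U x *\<^sub>R (u x * \<psi> x)) \<in> borel_measurable lebesgue"
      by (rule complete_measure.measurable_AE_eq[OF completion.complete_measure_axioms m1 eq]) auto
    show ?thesis unfolding set_lebesgue_integral_def
      by (rule integral_cong_AE[OF m2 m1]) (use eq in \<open>auto elim: eventually_mono\<close>)
  qed
  also have "\<dots> = (LINT x|lborel. (ub (\<pi> x) + V x) * \<psi> x)" by (rule integral_completion) measurable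
  also have "\<dots> = (LINT x|lborel. ub (\<pi> x) * \<psi> x) + (LINT x|lborel. V x * \<psi> x)"
    unfolding distrib_right by (rule Bochner_Integration.integral_add[OF i1 i2])
  also have "(LINT x|lborel. ub (\<pi> x) * \<psi> x) = 0"
    using \<pi>
  proof
    assume "\<pi> = snd"
    then show ?thesis unfolding \<psi>_def using test_fun_quadrant(3)[OF test_fun_pd[OF \<phi> bs(1)] ub] by simp
  next
    assume "\<pi> = fst"
    then show ?thesis unfolding \<psi>_def differentiable_mixed_bump2[symmetric]
      using test_fun_quadrant(4)[OF test_fun_pd[OF \<phi> bs(2)] ub] by simp
  qed
  also have "(LINT x|lborel. V x * \<psi> x) = (LINT x|lborel. (\<Sum>n. (m n * indicator (quadrant (p n) (q n)) x) * \<psi> x))"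
    unfolding V_def by (intro Bochner_Integration.integral_cong refl suminf_mult2 summable_rabs_cancel[OF v])
  also have "\<dots> = (\<Sum>n. LINT x|lborel. (m n * indicator (quadrant (p n) (q n)) x) * \<psi> x)"
  proof (rule integral_suminf[OF i3])
    show "AE x in lborel. summable (\<lambda>n. norm ((m n * indicator (quadrant (p n) (q n)) x) * \<psi> x))"
      using summable_mult2[OF v] by (simp add: abs_mult)
    show "summable (\<lambda>n. LINT x|lborel. norm ((m n * indicator (quadrant (p n) (q n)) x) * \<psi> x))"
    proof (rule summable_comparison_test'[OF summable_mult2[OF sm, of "LINT x|lborel. \<bar>\<psi> x\<bar>"], of 0])
      fix n
      have "(LINT x|lborel. norm ((m n * indicator (quadrant (p n) (q n)) x) * \<psi> x)) \<le> (LINT x|lborel. \<bar>m n\<bar> * \<bar>\<psi> x\<bar>)"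
        by (intro integral_mono integrable_norm i3 integrable_mult_right) (use i4 in \<open>auto simp: abs_mult split: split_indicator\<close>)
      then show "norm (LINT x|lborel. norm ((m n * indicator (quadrant (p n) (q n)) x) * \<psi> x)) \<le> \<bar>m n\<bar> * (LINT x|lborel. \<bar>\<psi> x\<bar>)" by simp
    qed
  qed
  also have "\<dots> = (\<Sum>n. m n * ?\<phi> (p n, q n))"
  proof (intro suminf_cong)
    fix n
    have "(LINT x|lborel. (m n * indicator (quadrant (p n) (q n)) x) * \<psi> x) = m n * (LINT x|lborel. indicator (quadrant (p n) (q n)) x * \<psi> x)"
      unfolding integral_mult_right_zero[symmetric] by (simp add: mult.assoc)
    then show "(LINT x|lborel. (m n * indicator (quadrant (p n) (q n)) x) * \<psi> x) = m n * ?\<phi> (p n, q n)"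
      unfolding \<psi>_def test_fun_quadrant_mixed[OF \<phi>] .
  qed
  finally show ?thesis by simp
qed

lemma suminf_limit_bounded:
  fixes m :: "nat \<Rightarrow> real" and g :: "nat \<Rightarrow> nat \<Rightarrow> real"
  assumes sm: "summable (\<lambda>n. \<bar>m n\<bar>)" and g: "\<And>n. (\<lambda>k. g k n) \<longlonglongrightarrow> g' n" "\<And>k n. \<bar>g k n\<bar> \<le> 1"
  shows "(\<lambda>k. \<Sum>n. m n * g k n) \<longlonglongrightarrow> (\<Sum>n. m n * g' n)"
proof (rule tannerys_theorem[THEN conjunct2, THEN conjunct2, of "\<lambda>n k. m n * g k n" "\<lambda>n. m n * g' n" sequentially "\<lambda>n. \<bar>m n\<bar>"])
  show "((\<lambda>k. m n * g k n) \<longlongrightarrow> m n * g' n) sequentially" for n by (intro tendsto_mult tendsto_const g)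
  have "norm (m n * g k n) \<le> \<bar>m n\<bar>" for n k
    using mult_left_mono[OF g(2)[of k n], of "\<bar>m n\<bar>"] by (simp add: abs_mult)
  then show "\<forall>\<^sub>F (n, k) in at_top \<times>\<^sub>F sequentially. norm (m n * g k n) \<le> \<bar>m n\<bar>"
    by (intro always_eventually) auto
qed (use sm in auto)

text \<open>Bumps sharpened to the indicator of an open rectangle show that the atoms in a rectangle
  well inside the box have total mass 0; then its left and lower sides are moved out to the boundary
  of the box.\<close>

lemma mu_zero_interior_atoms:
  fixes u :: "real \<times> real \<Rightarrow> real"
  assumes mu: "mu_zero (box2 a1 b1 a2 b2) u" and ae: "AE x in lborel. x \<in> box2 a1 b1 a2 b2 \<longrightarrow> u x = ub (\<pi> x) + (\<Sum>n. m n * indicator (quadrant (p n) (q n)) x)"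
    and \<pi>: "\<pi> = fst \<or> \<pi> = snd" and ub: "ub \<in> borel_measurable borel" "\<And>y. \<bar>ub y\<bar> \<le> B"
    and sm: "summable (\<lambda>n. \<bar>m n\<bar>)" and x: "x \<in> box2 a1 b1 a2 b2"
  shows "(\<Sum>n. m n * of_bool (a1 < p n \<and> p n < fst x \<and> a2 < q n \<and> q n < snd x)) = 0"
proof -
  have rect: "(\<Sum>n. m n * of_bool (a < p n \<and> p n < fst x \<and> c < q n \<and> q n < snd x)) = 0" if ac: "a1 < a" "a2 < c" for a c
  proof (rule LIMSEQ_unique)
    show "(\<lambda>k. \<Sum>n. m n * bump2 a (fst x) c (snd x) k (p n, q n)) \<longlonglongrightarrow> (\<Sum>n. m n * of_bool (a < p n \<and> p n < fst x \<and> c < q n \<and> q n < snd x))"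
    proof (rule suminf_limit_bounded[OF sm])
      show "(\<lambda>k. bump2 a (fst x) c (snd x) k (p n, q n)) \<longlonglongrightarrow> of_bool (a < p n \<and> p n < fst x \<and> c < q n \<and> q n < snd x)" for n
        using tendsto_mult[OF bump1_tendsto[of a "fst x" "p n"] bump1_tendsto[of c "snd x" "q n"]]
        by (simp add: bump2_def of_bool_conj[symmetric] conj_assoc)
      show "\<bar>bump2 a (fst x) c (snd x) k (p n, q n)\<bar> \<le> 1" for k n
        using bump1_bounds by (auto simp: bump2_def abs_mult intro!: mult_le_one)
    qed
    have "(\<Sum>n. m n * bump2 a (fst x) c (snd x) k (p n, q n)) = 0" for k
      by (rule mu_zero_bump[OF mu ae \<pi> ub sm ac(1) _ ac(2)]) (use x in \<open>auto simp: box2_def\<close>)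
    then show "(\<lambda>k. \<Sum>n. m n * bump2 a (fst x) c (snd x) k (p n, q n)) \<longlonglongrightarrow> 0" by simp
  qed
  have ev: "(\<lambda>k. of_bool (a + 1 / real (Suc k) < t) :: real) \<longlonglongrightarrow> of_bool (a < t)" for a t :: real
  proof (cases "a < t")
    case True
    have "(\<lambda>k. a + 1 / real (Suc k)) \<longlonglongrightarrow> a + 0" by (intro tendsto_intros) (use LIMSEQ_Suc[OF lim_1_over_n] in simp)
    then have "\<forall>\<^sub>F k in sequentially. a + 1 / real (Suc k) < t" using True by (intro order_tendstoD(2)) auto
    then have "\<forall>\<^sub>F k in sequentially. (of_bool (a + 1 / real (Suc k) < t) :: real) = of_bool (a < t)" using True by (auto elim: eventually_mono)
    then show ?thesis by (rule tendsto_eventually)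
  next
    case False
    have "\<not> a + 1 / real (Suc k) < t" for k
    proof -
      have "0 < 1 / real (Suc k)" by simp
      then show ?thesis using False by linarith
    qed
    then show ?thesis using False by simp
  qed
  show ?thesis
  proof (rule LIMSEQ_unique)
    show "(\<lambda>k. \<Sum>n. m n * of_bool (a1 + 1 / real (Suc k) < p n \<and> p n < fst x \<and> a2 + 1 / real (Suc k) < q n \<and> q n < snd x))
      \<longlonglongrightarrow> (\<Sum>n. m n * of_bool (a1 < p n \<and> p n < fst x \<and> a2 < q n \<and> q n < snd x))"
    proof (rule suminf_limit_bounded[OF sm])
      show "(\<lambda>k. of_bool (a1 + 1 / real (Suc k) < p n \<and> p n < fst x \<and> a2 + 1 / real (Suc k) < q n \<and> q n < snd x) :: real)
        \<longlonglongrightarrow> of_bool (a1 < p n \<and> p n < fst x \<and> a2 < q n \<and> q n < snd x)" for n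
        unfolding of_bool_conj by (intro tendsto_mult ev tendsto_const)
    qed auto
    show "(\<lambda>k. \<Sum>n. m n * of_bool (a1 + 1 / real (Suc k) < p n \<and> p n < fst x \<and> a2 + 1 / real (Suc k) < q n \<and> q n < snd x)) \<longlonglongrightarrow> 0"
      by (subst rect) auto
  qed
qed

text \<open>Once the interior atoms cancel, only corners with \<open>p n \<le> a1\<close> or
  \<open>q n \<le> a2\<close> are left, and inside the box their quadrants are half-planes or
  everything. A corner with both properties is counted in \<open>g2\<close> only.\<close>

lemma mu_zero_additive:
  fixes u :: "real \<times> real \<Rightarrow> real"
  assumes mu: "mu_zero (box2 a1 b1 a2 b2) u" and ae: "AE x in lborel. x \<in> box2 a1 b1 a2 b2 \<longrightarrow> u x = ub (\<pi> x) + (\<Sum>n. m n * indicator (quadrant (p n) (q n)) x)"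
    and \<pi>: "\<pi> = fst \<or> \<pi> = snd" and ub: "ub \<in> borel_measurable borel" "\<And>y. \<bar>ub y\<bar> \<le> B"
    and sm: "summable (\<lambda>n. \<bar>m n\<bar>)"
  shows "\<exists>f1 f2 D. f1 \<in> borel_measurable borel \<and> f2 \<in> borel_measurable borel \<and> (\<forall>t. \<bar>f1 t\<bar> \<le> D) \<and> (\<forall>t. \<bar>f2 t\<bar> \<le> D) \<and>
    (AE x in lborel. x \<in> box2 a1 b1 a2 b2 \<longrightarrow> u x = f1 (fst x) + f2 (snd x))"
proof -
  define g1 where "g1 t = (\<Sum>n. m n * (of_bool (a1 < p n \<and> q n \<le> a2) * indicator {p n<..} t))" for t
  define g2 where "g2 t = (\<Sum>n. m n * (of_bool (p n \<le> a1) * indicator {q n<..} t))" for t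
  have sb: "summable (\<lambda>n. m n * c n)" "\<bar>\<Sum>n. m n * c n\<bar> \<le> (\<Sum>n. \<bar>m n\<bar>)" if "\<And>n. \<bar>c n\<bar> \<le> 1" for c
  proof -
    have le: "norm \<bar>m n * c n\<bar> \<le> \<bar>m n\<bar>" for n using mult_left_mono[OF that[of n], of "\<bar>m n\<bar>"] by (simp add: abs_mult)
    have s: "summable (\<lambda>n. \<bar>m n * c n\<bar>)" by (rule summable_comparison_test'[OF sm, of 0]) (rule le)
    then show "summable (\<lambda>n. m n * c n)" by (rule summable_rabs_cancel)
    show "\<bar>\<Sum>n. m n * c n\<bar> \<le> (\<Sum>n. \<bar>m n\<bar>)"
      by (rule order_trans[OF summable_rabs[OF s] suminf_le[OF _ s sm]]) (use le in auto)
  qed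
  have g: "g1 \<in> borel_measurable borel" "g2 \<in> borel_measurable borel" unfolding g1_def g2_def by measurable
  have gB: "\<bar>g1 t\<bar> \<le> (\<Sum>n. \<bar>m n\<bar>)" "\<bar>g2 t\<bar> \<le> (\<Sum>n. \<bar>m n\<bar>)" for t
    unfolding g1_def g2_def by (rule sb; auto split: split_indicator)+
  have v: "(\<Sum>n. m n * indicator (quadrant (p n) (q n)) x) = g1 (fst x) + g2 (snd x)" if x: "x \<in> box2 a1 b1 a2 b2" for x
  proof -
    have "(\<Sum>n. m n * indicator (quadrant (p n) (q n)) x)
        = (\<Sum>n. m n * indicator (quadrant (p n) (q n)) x) - (\<Sum>n. m n * of_bool (a1 < p n \<and> p n < fst x \<and> a2 < q n \<and> q n < snd x))"
      using mu_zero_interior_atoms[OF mu ae \<pi> ub sm x] by simp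
    also have "\<dots> = (\<Sum>n. m n * indicator (quadrant (p n) (q n)) x - m n * of_bool (a1 < p n \<and> p n < fst x \<and> a2 < q n \<and> q n < snd x))"
      by (rule suminf_diff[OF sb(1) sb(1)]) (auto split: split_indicator)
    also have "\<dots> = (\<Sum>n. m n * (of_bool (a1 < p n \<and> q n \<le> a2) * indicator {p n<..} (fst x)) + m n * (of_bool (p n \<le> a1) * indicator {q n<..} (snd x)))"
      using x by (intro suminf_cong) (cases x, auto simp: quadrant_def box2_def split: split_indicator)
    also have "\<dots> = g1 (fst x) + g2 (snd x)"
      unfolding g1_def g2_def by (rule suminf_add[symmetric, OF sb(1) sb(1)]) (auto split: split_indicator)
    finally show ?thesis .
  qed
  let ?D = "\<bar>B\<bar> + (\<Sum>n. \<bar>m n\<bar>)"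
  have D0: "0 \<le> (\<Sum>n. \<bar>m n\<bar>)" by (rule suminf_nonneg[OF sm]) auto
  have bd: "\<bar>ub t + g t\<bar> \<le> ?D" "\<bar>g t\<bar> \<le> ?D" if "\<bar>g t\<bar> \<le> (\<Sum>n. \<bar>m n\<bar>)" for g t
    using that ub(2)[of t] by linarith+
  show ?thesis
    using \<pi>
  proof
    assume "\<pi> = fst"
    then show ?thesis
      using ae g ub(1) bd gB v
      by (intro exI[of _ "\<lambda>t. ub t + g1 t"] exI[of _ g2] exI[of _ ?D]) (auto elim!: eventually_mono)
  next
    assume "\<pi> = snd"
    then show ?thesis
      using ae g ub(1) bd gB v
      by (intro exI[of _ g1] exI[of _ "\<lambda>t. ub t + g2 t"] exI[of _ ?D]) (auto elim!: eventually_mono)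
  qed
qed

section \<open>Functions without jumps\<close>

text \<open>Differentiation of integrals is applied to \<open>\<bar>f y - c\<bar>\<close> for
  rational \<open>c\<close>, a countable family with a common null set. Then \<open>f t\<close> is
  within \<open>e / 3\<close> of some such \<open>c\<close>, and the three errors add up to
  \<open>e\<close>.\<close>

lemma right_lebesgue_points:
  fixes f :: "real \<Rightarrow> real"
  assumes f [measurable]: "f \<in> borel_measurable borel" and B: "\<And>x. \<bar>f x\<bar> \<le> B"
  shows "AE t in lborel. \<forall>e>0. \<exists>d>0. \<forall>h. 0 < h \<and> h < d \<longrightarrow>
    (\<integral>\<^sup>+y. ennreal \<bar>f y - f t\<bar> * indicator {t..t + h} y \<partial>lborel) \<le> ennreal (e * h)"
proof -
  define g where "g c y = \<bar>f y - c\<bar>" for c y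
  have int: "g c integrable_on cbox a b" for c a b
  proof -
    have "set_integrable lebesgue (cbox a b) (g c)"
      unfolding set_integrable_def
    proof (rule Bochner_Integration.integrable_bound[where f = "\<lambda>x. (B + \<bar>c\<bar>) * indicator (cbox a b) x"])
      show "integrable lebesgue (\<lambda>x. (B + \<bar>c\<bar>) * indicat_real (cbox a b) x)"
        by (intro integrable_mult_right integrable_real_indicator) (auto simp: less_top emeasure_lborel_cbox_eq emeasure_lborel_Icc_eq)
      show "(\<lambda>x. indicat_real (cbox a b) x *\<^sub>R g c x) \<in> borel_measurable lebesgue"
        unfolding g_def by (intro measurable_completion) measurable
      have "\<bar>f x - c\<bar> \<le> \<bar>B + \<bar>c\<bar>\<bar>" for x using B[of x] by linarith
      then show "AE x in lebesgue. norm (indicat_real (cbox a b) x *\<^sub>R g c x) \<le> norm ((B + \<bar>c\<bar>) * indicat_real (cbox a b) x)"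
        by (auto simp: g_def split: split_indicator)
    qed
    then show ?thesis by (rule set_lebesgue_integral_eq_integral(1))
  qed
  have ex: "\<exists>N. negligible N \<and> (\<forall>x e. x \<notin> N \<longrightarrow> 0 < e \<longrightarrow>
      (\<exists>d>0. \<forall>h. 0 < h \<and> h < d \<longrightarrow> \<bar>integral {x..x + h} (g c) / h - g c x\<bar> < e))" for c
  proof -
    obtain N where N: "negligible N" "\<And>x e. x \<notin> N \<Longrightarrow> 0 < e \<Longrightarrow> \<exists>d>0. \<forall>h. 0 < h \<and> h < d \<longrightarrow>
        norm (integral (cbox x (x + h *\<^sub>R One)) (g c) /\<^sub>R h ^ DIM(real) - g c x) < e"
      using integrable_ccontinuous_explicit[of "g c", OF int] by blast
    have "integral (cbox x (x + h *\<^sub>R One)) (g c) /\<^sub>R h ^ DIM(real) = integral {x..x + h} (g c) / h" for x h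
      by (simp add: field_simps)
    then show ?thesis using N by (intro exI[of _ N]) simp
  qed
  then obtain N where N: "\<And>c. negligible (N c)"
    "\<And>c x e. x \<notin> N c \<Longrightarrow> 0 < e \<Longrightarrow> \<exists>d>0. \<forall>h. 0 < h \<and> h < d \<longrightarrow> \<bar>integral {x..x + h} (g c) / h - g c x\<bar> < e"
    by metis
  have "negligible (\<Union>c\<in>\<rat>. N c)" by (intro negligible_countable_Union) (use N(1) countable_rat in auto)
  then have "AE t in lebesgue. t \<notin> (\<Union>c\<in>\<rat>. N c)" by (intro AE_not_in) (simp add: negligible_iff_null_sets)
  then have "AE t in lborel. t \<notin> (\<Union>c\<in>\<rat>. N c)" by (simp add: AE_completion_iff)
  then show ?thesis
  proof eventually_elim
    case (elim t)
    show ?case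
    proof (intro allI impI)
      fix e :: real assume e: "e > 0"
      obtain c where c: "c \<in> \<rat>" "f t - e / 3 < c" "c < f t + e / 3"
        using Rats_dense_in_real[of "f t - e / 3" "f t + e / 3"] e by auto
      obtain d where d: "d > 0" "\<And>h. 0 < h \<Longrightarrow> h < d \<Longrightarrow> \<bar>integral {t..t + h} (g c) / h - g c t\<bar> < e / 3"
        using N(2)[of t c "e / 3"] elim c(1) e by auto
      show "\<exists>d>0. \<forall>h. 0 < h \<and> h < d \<longrightarrow> (\<integral>\<^sup>+y. ennreal \<bar>f y - f t\<bar> * indicator {t..t + h} y \<partial>lborel) \<le> ennreal (e * h)"
      proof (intro exI[of _ d] conjI d(1) allI impI)
        fix h assume h: "0 < h \<and> h < d"
        have gt: "g c t < e / 3" using c unfolding g_def by linarith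
        have "integral {t..t + h} (g c) / h < e / 3 + e / 3" using d(2)[of h] h gt by linarith
        then have I: "integral {t..t + h} (g c) < (e / 3 + e / 3) * h" using h by (simp add: pos_divide_less_eq)
        have "(g c has_integral integral {t..t + h} (g c)) {t..t + h}"
          using int[of c t "t + h"] by (simp add: has_integral_integral[symmetric])
        then have G: "(\<integral>\<^sup>+y. ennreal (g c y) * indicator {t..t + h} y \<partial>lborel) = ennreal (integral {t..t + h} (g c))"
          by (rule nn_integral_has_integral_lebesgue'[rotated]) (simp add: g_def)
        have "(\<integral>\<^sup>+y. ennreal \<bar>f y - f t\<bar> * indicator {t..t + h} y \<partial>lborel)
          \<le> (\<integral>\<^sup>+y. ennreal (g c y) * indicator {t..t + h} y + ennreal (e / 3) * indicator {t..t + h} y \<partial>lborel)"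
        proof (rule nn_integral_mono)
          fix y
          have "\<bar>f y - f t\<bar> \<le> g c y + e / 3" using c by (auto simp: g_def)
          then have "ennreal \<bar>f y - f t\<bar> \<le> ennreal (g c y) + ennreal (e / 3)"
            using e by (subst ennreal_plus[symmetric]) (auto simp: g_def intro!: ennreal_leI simp del: ennreal_plus)
          then show "ennreal \<bar>f y - f t\<bar> * indicator {t..t + h} y \<le> ennreal (g c y) * indicator {t..t + h} y + ennreal (e / 3) * indicator {t..t + h} y"
            by (auto split: split_indicator)
        qed
        also have "\<dots> = ennreal (integral {t..t + h} (g c)) + ennreal (e / 3) * ennreal h"
          using h unfolding G[symmetric] g_def by (subst nn_integral_add) (auto simp: nn_integral_cmult_indicator)
        also have "\<dots> \<le> ennreal ((e / 3 + e / 3) * h) + ennreal (e / 3) * ennreal h"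
          using I by (intro add_right_mono ennreal_leI) simp
        also have "\<dots> = ennreal (e * h)"
          using e h by (simp add: ennreal_mult[symmetric] ennreal_plus[symmetric] algebra_simps del: ennreal_plus)
        finally show "(\<integral>\<^sup>+y. ennreal \<bar>f y - f t\<bar> * indicator {t..t + h} y \<partial>lborel) \<le> ennreal (e * h)" .
      qed
    qed
  qed
qed

lemma lebesgue_points:
  fixes f :: "real \<Rightarrow> real"
  assumes f [measurable]: "f \<in> borel_measurable borel" and B: "\<And>x. \<bar>f x\<bar> \<le> B"
  shows "AE t in lborel. \<forall>e>0. \<exists>d>0. \<forall>h. 0 < h \<and> h < d \<longrightarrow>
    (\<integral>\<^sup>+y. ennreal \<bar>f y - f t\<bar> * indicator {t - h..t + h} y \<partial>lborel) \<le> ennreal (e * h)"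
proof -
  note R = right_lebesgue_points[OF f B]
  have "AE t in lborel. \<forall>e>0. \<exists>d>0. \<forall>h. 0 < h \<and> h < d \<longrightarrow>
    (\<integral>\<^sup>+y. ennreal \<bar>f (- y) - f (- t)\<bar> * indicator {t..t + h} y \<partial>lborel) \<le> ennreal (e * h)"
    by (rule right_lebesgue_points[of "\<lambda>t. f (- t)" B]) (use B in auto)
  then obtain N where N: "N \<in> null_sets lborel" "\<And>t e. t \<notin> N \<Longrightarrow> e > 0 \<Longrightarrow> \<exists>d>0. \<forall>h. 0 < h \<and> h < d \<longrightarrow>
    (\<integral>\<^sup>+y. ennreal \<bar>f (- y) - f (- t)\<bar> * indicator {t..t + h} y \<partial>lborel) \<le> ennreal (e * h)"
    by (rule AE_E3) auto
  have "uminus -` N \<in> null_sets lborel"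
  proof (rule null_setsI)
    have Nb: "N \<in> sets borel" using N(1) by auto
    have "emeasure lborel N = emeasure (distr lborel borel uminus) N" by (simp add: lborel_distr_uminus)
    also have "\<dots> = emeasure lborel (uminus -` N)" using Nb by (subst emeasure_distr) auto
    finally show "emeasure lborel (uminus -` N) = 0" using N(1) by auto
    show "uminus -` N \<in> sets lborel" using measurable_sets[of uminus borel borel N] Nb by simp
  qed
  then have "AE t in lborel. t \<notin> uminus -` N" by (rule AE_not_in)
  then have L: "AE t in lborel. - t \<notin> N" by simp
  show ?thesis
    using R L
  proof eventually_elim
    case (elim t)
    show ?case
    proof (intro allI impI)
      fix e :: real assume e: "e > 0"
      obtain d1 where d1: "d1 > 0" "\<And>h. 0 < h \<Longrightarrow> h < d1 \<Longrightarrow> (\<integral>\<^sup>+y. ennreal \<bar>f y - f t\<bar> * indicator {t..t + h} y \<partial>lborel) \<le> ennreal (e / 2 * h)"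
        using elim(1) e by (meson half_gt_zero)
      obtain d2 where d2: "d2 > 0" "\<And>h. 0 < h \<Longrightarrow> h < d2 \<Longrightarrow> (\<integral>\<^sup>+y. ennreal \<bar>f (- y) - f (- (- t))\<bar> * indicator {- t..- t + h} y \<partial>lborel) \<le> ennreal (e / 2 * h)"
        using N(2)[OF elim(2), of "e / 2"] e by auto
      show "\<exists>d>0. \<forall>h. 0 < h \<and> h < d \<longrightarrow> (\<integral>\<^sup>+y. ennreal \<bar>f y - f t\<bar> * indicator {t - h..t + h} y \<partial>lborel) \<le> ennreal (e * h)"
      proof (intro exI[of _ "min d1 d2"] conjI allI impI)
        fix h assume h: "0 < h \<and> h < min d1 d2"
        have refl: "(\<integral>\<^sup>+y. ennreal \<bar>f y - f t\<bar> * indicator {t - h..t} y \<partial>lborel) = (\<integral>\<^sup>+y. ennreal \<bar>f (- y) - f t\<bar> * indicator {- t..- t + h} y \<partial>lborel)"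
          by (subst nn_integral_real_affine[of _ "-1" 0]) (auto intro!: nn_integral_cong split: split_indicator)
        have "(\<integral>\<^sup>+y. ennreal \<bar>f y - f t\<bar> * indicator {t - h..t + h} y \<partial>lborel)
          \<le> (\<integral>\<^sup>+y. ennreal \<bar>f y - f t\<bar> * indicator {t - h..t} y + ennreal \<bar>f y - f t\<bar> * indicator {t..t + h} y \<partial>lborel)"
          by (intro nn_integral_mono) (auto split: split_indicator)
        also have "\<dots> = (\<integral>\<^sup>+y. ennreal \<bar>f y - f t\<bar> * indicator {t - h..t} y \<partial>lborel) + (\<integral>\<^sup>+y. ennreal \<bar>f y - f t\<bar> * indicator {t..t + h} y \<partial>lborel)"
          by (rule nn_integral_add) measurable
        also have "\<dots> \<le> ennreal (e / 2 * h) + ennreal (e / 2 * h)"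
          unfolding refl using d1(2)[of h] d2(2)[of h] h by (intro add_mono) auto
        also have "\<dots> = ennreal (e * h)" using e h by (simp add: ennreal_plus[symmetric] del: ennreal_plus)
        finally show "(\<integral>\<^sup>+y. ennreal \<bar>f y - f t\<bar> * indicator {t - h..t + h} y \<partial>lborel) \<le> ennreal (e * h)" .
      qed (use d1 d2 in auto)
    qed
  qed
qed

section \<open>Approximate continuity and stability of jumps\<close>

lemma nn_integral_square:
  fixes g :: "real \<Rightarrow> ennreal"
  assumes [measurable]: "g \<in> borel_measurable borel" and r: "r > 0"
  shows "(\<integral>\<^sup>+y. g (snd y) * indicator ({s - r..s + r} \<times> {t - r..t + r}) y \<partial>lborel) = ennreal (2 * r) * (\<integral>\<^sup>+y. g y * indicator {t - r..t + r} y \<partial>lborel)"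
    "(\<integral>\<^sup>+y. g (fst y) * indicator ({t - r..t + r} \<times> {s - r..s + r}) y \<partial>lborel) = ennreal (2 * r) * (\<integral>\<^sup>+y. g y * indicator {t - r..t + r} y \<partial>lborel)"
proof -
  have m: "emeasure lborel {s - r..s + r} = ennreal (2 * r)" using r by simp
  have S [measurable]: "{s - r..s + r} \<times> {t - r..t + r} \<in> sets borel" "{t - r..t + r} \<times> {s - r..s + r} \<in> sets borel"
    by (intro borel_closed closed_Times; simp)+
  have "(\<integral>\<^sup>+y. g (snd y) * indicator ({s - r..s + r} \<times> {t - r..t + r}) y \<partial>(lborel \<Otimes>\<^sub>M lborel)) = (\<integral>\<^sup>+a. \<integral>\<^sup>+b. g b * indicator ({s - r..s + r} \<times> {t - r..t + r}) (a, b) \<partial>lborel \<partial>lborel)"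
    using lborel.nn_integral_fst[of "\<lambda>y. g (snd y) * indicator ({s - r..s + r} \<times> {t - r..t + r}) y" lborel] by (simp add: lborel_prod)
  also have "\<dots> = (\<integral>\<^sup>+a. indicator {s - r..s + r} a * (\<integral>\<^sup>+b. g b * indicator {t - r..t + r} b \<partial>lborel) \<partial>lborel)"
    by (intro nn_integral_cong) (auto simp: indicator_times split: split_indicator)
  also have "\<dots> = ennreal (2 * r) * (\<integral>\<^sup>+y. g y * indicator {t - r..t + r} y \<partial>lborel)"
    by (simp add: nn_integral_multc m)
  finally show "(\<integral>\<^sup>+y. g (snd y) * indicator ({s - r..s + r} \<times> {t - r..t + r}) y \<partial>lborel) = ennreal (2 * r) * (\<integral>\<^sup>+y. g y * indicator {t - r..t + r} y \<partial>lborel)"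
    by (simp add: lborel_prod)
  have "(\<integral>\<^sup>+y. g (fst y) * indicator ({t - r..t + r} \<times> {s - r..s + r}) y \<partial>(lborel \<Otimes>\<^sub>M lborel)) = (\<integral>\<^sup>+a. \<integral>\<^sup>+b. g a * indicator ({t - r..t + r} \<times> {s - r..s + r}) (a, b) \<partial>lborel \<partial>lborel)"
    using lborel.nn_integral_fst[of "\<lambda>y. g (fst y) * indicator ({t - r..t + r} \<times> {s - r..s + r}) y" lborel] by (simp add: lborel_prod)
  also have "\<dots> = (\<integral>\<^sup>+a. \<integral>\<^sup>+b. (g a * indicator {t - r..t + r} a) * indicator {s - r..s + r} b \<partial>lborel \<partial>lborel)"
    by (intro nn_integral_cong) (auto simp: indicator_times split: split_indicator)
  also have "\<dots> = (\<integral>\<^sup>+a. (g a * indicator {t - r..t + r} a) * ennreal (2 * r) \<partial>lborel)"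
    using m by (intro nn_integral_cong) (simp only: nn_integral_cmult_indicator borel_closed closed_atLeastAtMost sets_lborel)
  also have "\<dots> = ennreal (2 * r) * (\<integral>\<^sup>+y. g y * indicator {t - r..t + r} y \<partial>lborel)"
    by (subst nn_integral_multc) (auto simp: mult.commute)
  finally show "(\<integral>\<^sup>+y. g (fst y) * indicator ({t - r..t + r} \<times> {s - r..s + r}) y \<partial>lborel) = ennreal (2 * r) * (\<integral>\<^sup>+y. g y * indicator {t - r..t + r} y \<partial>lborel)"
    by (simp add: lborel_prod)
qed

text \<open>The ball is enlarged to a square, over which a function of one coordinate integrates to
  a one-dimensional integral times the side length.\<close>

lemma lebesgue_point_ball_average:
  fixes f :: "real \<Rightarrow> real" and \<pi> :: "real \<times> real \<Rightarrow> real"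
  assumes f [measurable]: "f \<in> borel_measurable borel" and \<pi>: "\<pi> = fst \<or> \<pi> = snd"
    and L: "\<forall>e>0. \<exists>d>0. \<forall>h. 0 < h \<and> h < d \<longrightarrow>
      (\<integral>\<^sup>+y. ennreal \<bar>f y - f (\<pi> x)\<bar> * indicator {\<pi> x - h..\<pi> x + h} y \<partial>lborel) \<le> ennreal (e * h)"
  shows "((\<lambda>r. (\<integral>\<^sup>+ y \<in> ball x r. ennreal \<bar>f (\<pi> y) - f (\<pi> x)\<bar> \<partial>lebesgue) / emeasure lebesgue (ball x r)) \<longlongrightarrow> 0) (at_right 0)"
proof (rule order_tendstoI)
  fix l :: ennreal assume "0 < l"
  then obtain e :: real where e: "0 < e" "ennreal e < l"
  proof -
    obtain l' where l': "0 < l'" "l' < l" using dense \<open>0 < l\<close> by blast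
    then have "l' < top" using order.strict_trans2 top_greatest by blast
    then obtain e where "l' = ennreal e" "e \<ge> 0" by (cases l') auto
    then show ?thesis using l' that[of e] by simp
  qed
  obtain d where d: "d > 0" "\<And>h. 0 < h \<Longrightarrow> h < d \<Longrightarrow> (\<integral>\<^sup>+y. ennreal \<bar>f y - f (\<pi> x)\<bar> * indicator {\<pi> x - h..\<pi> x + h} y \<partial>lborel) \<le> ennreal (e * h)"
    using L e(1) by blast
  have "(\<integral>\<^sup>+ y \<in> ball x r. ennreal \<bar>f (\<pi> y) - f (\<pi> x)\<bar> \<partial>lebesgue) / emeasure lebesgue (ball x r) < l" if r: "0 < r" "r < d" for r
  proof -
    have sub: "ball x r \<subseteq> {fst x - r..fst x + r} \<times> {snd x - r..snd x + r}"
    proof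
      fix y assume "y \<in> ball x r"
      then show "y \<in> {fst x - r..fst x + r} \<times> {snd x - r..snd x + r}"
        using dist_fst_le[of x y] dist_snd_le[of x y] by (auto simp: dist_real_def mem_Times_iff)
    qed
    have "(\<integral>\<^sup>+ y \<in> ball x r. ennreal \<bar>f (\<pi> y) - f (\<pi> x)\<bar> \<partial>lebesgue)
      \<le> (\<integral>\<^sup>+y. ennreal \<bar>f (\<pi> y) - f (\<pi> x)\<bar> * indicator ({fst x - r..fst x + r} \<times> {snd x - r..snd x + r}) y \<partial>lborel)"
      unfolding nn_integral_completion using sub by (intro nn_integral_mono) (auto split: split_indicator)
    also have "\<dots> = ennreal (2 * r) * (\<integral>\<^sup>+y. ennreal \<bar>f y - f (\<pi> x)\<bar> * indicator {\<pi> x - r..\<pi> x + r} y \<partial>lborel)"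
      using \<pi> nn_integral_square[of "\<lambda>y. ennreal \<bar>f y - f (\<pi> x)\<bar>" r] r by auto
    also have "\<dots> \<le> ennreal (2 * r) * ennreal (e * r)" using d(2)[OF r] by (rule mult_left_mono) simp
    also have "\<dots> = ennreal (e * (2 * r\<^sup>2))" using r e by (simp add: ennreal_mult[symmetric] power2_eq_square mult_ac)
    \<comment> \<open>Side length times the one-dimensional bound is
      \<open>2 * e * r\<^sup>2\<close>, and \<open>2 \<le> pi\<close> replaces it by the area of the
      ball.\<close>
    also have "\<dots> \<le> ennreal (e * (pi * r\<^sup>2))" using r e pi_ge_two by (intro ennreal_leI mult_left_mono mult_right_mono) auto
    also have "\<dots> = ennreal e * emeasure lebesgue (ball x r)"
      using r e by (simp add: emeasure_ball unit_ball_vol_2 ennreal_mult[symmetric] power2_eq_square)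
    finally have "(\<integral>\<^sup>+ y \<in> ball x r. ennreal \<bar>f (\<pi> y) - f (\<pi> x)\<bar> \<partial>lebesgue) / emeasure lebesgue (ball x r)
      \<le> ennreal e * emeasure lebesgue (ball x r) / emeasure lebesgue (ball x r)" by (rule divide_right_mono_ennreal)
    also have "\<dots> = ennreal e"
      using r by (subst ennreal_mult_divide_eq) (auto simp: emeasure_ball unit_ball_vol_2)
    finally show ?thesis using e by auto
  qed
  then show "\<forall>\<^sub>F r in at_right 0. (\<integral>\<^sup>+ y \<in> ball x r. ennreal \<bar>f (\<pi> y) - f (\<pi> x)\<bar> \<partial>lebesgue) / emeasure lebesgue (ball x r) < l"
    using d(1) eventually_at_right_real[of 0 d] by (auto elim!: eventually_mono)
qed auto

text \<open>Passing from balls to half-balls costs at most the factor \<open>2 ^ DIM('a)\<close>, so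
  averages of \<open>\<bar>f y - f0\<bar>\<close> vanish on half-balls too, and adding
  \<open>f\<close> merely shifts both traces by \<open>f0\<close>.\<close>

lemma approx_jump_add:
  fixes x :: "'a::euclidean_space"
  assumes f [measurable]: "f \<in> borel_measurable borel" and v [measurable]: "v \<in> borel_measurable borel" and j: "approx_jump v x a b \<nu>"
    and f0: "((\<lambda>r. (\<integral>\<^sup>+ y \<in> ball x r. ennreal \<bar>f y - f0\<bar> \<partial>lebesgue) / emeasure lebesgue (ball x r)) \<longlongrightarrow> 0) (at_right 0)"
  shows "approx_jump (\<lambda>y. f y + v y) x (f0 + a) (f0 + b) \<nu>"
proof -
  have \<nu>: "norm \<nu> = 1" and ab: "a \<noteq> b" using j by (auto simp: approx_jump_def)
  define K where "K = ennreal (2 ^ DIM('a))"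
  define F where "F r = (\<integral>\<^sup>+ y \<in> ball x r. ennreal \<bar>f y - f0\<bar> \<partial>lebesgue) / emeasure lebesgue (ball x r)" for r
  have half: "((\<lambda>r. (\<integral>\<^sup>+ y \<in> half_ball_plus x \<mu> r. ennreal \<bar>(f y + v y) - (f0 + c)\<bar> \<partial>lebesgue) / emeasure lebesgue (half_ball_plus x \<mu> r)) \<longlongrightarrow> 0) (at_right 0)"
    if lim: "((\<lambda>r. (\<integral>\<^sup>+ y \<in> half_ball_plus x \<mu> r. ennreal \<bar>v y - c\<bar> \<partial>lebesgue) / emeasure lebesgue (half_ball_plus x \<mu> r)) \<longlongrightarrow> 0) (at_right 0)"
      and \<mu>: "norm \<mu> = 1" for \<mu> c
  proof -
    define V where "V r = (\<integral>\<^sup>+ y \<in> half_ball_plus x \<mu> r. ennreal \<bar>v y - c\<bar> \<partial>lebesgue) / emeasure lebesgue (half_ball_plus x \<mu> r)" for r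
    have le: "(\<integral>\<^sup>+ y \<in> half_ball_plus x \<mu> r. ennreal \<bar>(f y + v y) - (f0 + c)\<bar> \<partial>lebesgue) / emeasure lebesgue (half_ball_plus x \<mu> r) \<le> K * F r + V r"
      if r: "r > 0" for r
    proof -
      define P where "P = emeasure lebesgue (half_ball_plus x \<mu> r)"
      define Q where "Q = emeasure lebesgue (ball x r)"
      have Q: "0 < Q" "Q < top" using r by (auto simp: Q_def emeasure_ball)
      have PQ: "inverse P \<le> K * inverse Q"
      proof -
        have "ennreal ((1/2) ^ DIM('a)) * Q \<le> P" unfolding P_def Q_def by (rule half_ball_plus_emeasure[OF r \<mu>])
        then have "inverse P \<le> inverse (ennreal ((1/2) ^ DIM('a)) * Q)" by (rule ennreal_inverse_antimono)
        also have "\<dots> = K * inverse Q"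
        proof -
          obtain q where q: "Q = ennreal q" "0 < q" using Q by (cases Q) auto
          show ?thesis unfolding q K_def using q(2)
            by (simp add: ennreal_mult[symmetric] inverse_ennreal power_one_over field_simps)
        qed
        finally show ?thesis .
      qed
      have "(\<integral>\<^sup>+ y \<in> half_ball_plus x \<mu> r. ennreal \<bar>(f y + v y) - (f0 + c)\<bar> \<partial>lebesgue)
        \<le> (\<integral>\<^sup>+ y. ennreal \<bar>f y - f0\<bar> * indicator (ball x r) y + ennreal \<bar>v y - c\<bar> * indicator (half_ball_plus x \<mu> r) y \<partial>lebesgue)"
      proof (rule nn_integral_mono)
        fix y
        have "ennreal \<bar>(f y + v y) - (f0 + c)\<bar> \<le> ennreal \<bar>f y - f0\<bar> + ennreal \<bar>v y - c\<bar>"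
          by (subst ennreal_plus[symmetric]) (auto intro!: ennreal_leI simp del: ennreal_plus)
        then show "ennreal \<bar>(f y + v y) - (f0 + c)\<bar> * indicator (half_ball_plus x \<mu> r) y
          \<le> ennreal \<bar>f y - f0\<bar> * indicator (ball x r) y + ennreal \<bar>v y - c\<bar> * indicator (half_ball_plus x \<mu> r) y"
          by (auto simp: half_ball_plus_def split: split_indicator)
      qed
      also have "\<dots> = (\<integral>\<^sup>+ y \<in> ball x r. ennreal \<bar>f y - f0\<bar> \<partial>lebesgue) + (\<integral>\<^sup>+ y \<in> half_ball_plus x \<mu> r. ennreal \<bar>v y - c\<bar> \<partial>lebesgue)"
      proof (rule nn_integral_add)
        have [measurable]: "half_ball_plus x \<mu> r \<in> sets borel" by (rule half_ball_borel(1))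
        have [measurable]: "ball x r \<in> sets borel" by simp
        show "(\<lambda>y. ennreal \<bar>f y - f0\<bar> * indicator (ball x r) y) \<in> borel_measurable lebesgue"
          by (rule measurable_completion) measurable
        show "(\<lambda>y. ennreal \<bar>v y - c\<bar> * indicator (half_ball_plus x \<mu> r) y) \<in> borel_measurable lebesgue"
          by (rule measurable_completion) measurable
      qed
      finally have "(\<integral>\<^sup>+ y \<in> half_ball_plus x \<mu> r. ennreal \<bar>(f y + v y) - (f0 + c)\<bar> \<partial>lebesgue) * inverse P
        \<le> ((\<integral>\<^sup>+ y \<in> ball x r. ennreal \<bar>f y - f0\<bar> \<partial>lebesgue) + (\<integral>\<^sup>+ y \<in> half_ball_plus x \<mu> r. ennreal \<bar>v y - c\<bar> \<partial>lebesgue)) * inverse P"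
        by (rule mult_right_mono) simp
      also have "\<dots> \<le> (\<integral>\<^sup>+ y \<in> ball x r. ennreal \<bar>f y - f0\<bar> \<partial>lebesgue) * (K * inverse Q) + (\<integral>\<^sup>+ y \<in> half_ball_plus x \<mu> r. ennreal \<bar>v y - c\<bar> \<partial>lebesgue) * inverse P"
        unfolding distrib_right by (intro add_right_mono mult_left_mono PQ) simp
      also have "\<dots> = K * F r + V r"
        unfolding F_def V_def P_def[symmetric] Q_def[symmetric] divide_ennreal_def by (simp only: mult_ac)
      finally show ?thesis unfolding P_def[symmetric] divide_ennreal_def .
    qed
    have "((\<lambda>r. K * F r + V r) \<longlongrightarrow> K * 0 + 0) (at_right 0)"
      using f0 lim unfolding F_def V_def by (intro tendsto_add ennreal_tendsto_cmult) (auto simp: K_def)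
    then have lim0: "((\<lambda>r. K * F r + V r) \<longlongrightarrow> 0) (at_right 0)" by simp
    have ev: "\<forall>\<^sub>F r in at_right 0. (\<integral>\<^sup>+ y \<in> half_ball_plus x \<mu> r. ennreal \<bar>(f y + v y) - (f0 + c)\<bar> \<partial>lebesgue) / emeasure lebesgue (half_ball_plus x \<mu> r) \<le> K * F r + V r"
      unfolding eventually_at_filter by (intro always_eventually allI impI le) simp
    show ?thesis by (rule tendsto_sandwich[OF always_eventually ev tendsto_const lim0]) simp
  qed
  show ?thesis
    using j ab \<nu> half[where \<mu> = \<nu> and c = a] half[where \<mu> = "- \<nu>" and c = b] unfolding approx_jump_def half_ball_minus_uminus by auto
qed

lemma approx_jump_cong_AE:
  fixes x :: "'a::euclidean_space"
  assumes ae: "AE y in lebesgue. y \<in> U \<longrightarrow> u y = u' y" and U: "open U" "x \<in> U"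
  shows "approx_jump u x a b \<nu> \<longleftrightarrow> approx_jump u' x a b \<nu>"
proof -
  obtain d where d: "d > 0" "ball x d \<subseteq> U" using U open_contains_ball by blast
  have half: "((\<lambda>r. (\<integral>\<^sup>+ y \<in> S r. ennreal \<bar>u y - c\<bar> \<partial>lebesgue) / emeasure lebesgue (S r)) \<longlongrightarrow> 0) (at_right 0)
    \<longleftrightarrow> ((\<lambda>r. (\<integral>\<^sup>+ y \<in> S r. ennreal \<bar>u' y - c\<bar> \<partial>lebesgue) / emeasure lebesgue (S r)) \<longlongrightarrow> 0) (at_right 0)"
    if S: "\<And>r. S r \<subseteq> ball x r" for c and S :: "real \<Rightarrow> 'a set"
  proof (rule tendsto_cong)
    have "(\<integral>\<^sup>+ y \<in> S r. ennreal \<bar>u y - c\<bar> \<partial>lebesgue) = (\<integral>\<^sup>+ y \<in> S r. ennreal \<bar>u' y - c\<bar> \<partial>lebesgue)" if r: "r < d" for r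
    proof (rule nn_integral_cong_AE)
      show "AE y in lebesgue. ennreal \<bar>u y - c\<bar> * indicator (S r) y = ennreal \<bar>u' y - c\<bar> * indicator (S r) y"
        using ae
      proof eventually_elim
        case (elim y)
        show ?case
        proof (cases "y \<in> S r")
          case True
          then have "y \<in> ball x r" using S by blast
          then have "y \<in> ball x d" using r by auto
          then have "y \<in> U" using d(2) by blast
          then show ?thesis using elim by simp
        qed simp
      qed
    qed
    then show "\<forall>\<^sub>F r in at_right 0. (\<integral>\<^sup>+ y \<in> S r. ennreal \<bar>u y - c\<bar> \<partial>lebesgue) / emeasure lebesgue (S r) = (\<integral>\<^sup>+ y \<in> S r. ennreal \<bar>u' y - c\<bar> \<partial>lebesgue) / emeasure lebesgue (S r)"
      using eventually_at_right_real[OF d(1)] by (auto elim!: eventually_mono)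
  qed
  show ?thesis
    unfolding approx_jump_def
    by (intro conj_cong refl half) (auto simp: half_ball_plus_def half_ball_minus_def)
qed

lemma jump_var_cong_AE:
  fixes U :: "'a::euclidean_space set"
  assumes ae: "AE y in lebesgue. y \<in> U \<longrightarrow> u y = u' y" and U: "open U"
  shows "jump_var \<alpha> U u = jump_var \<alpha> U u'"
proof -
  have "jump_set U u = jump_set U u'"
    unfolding jump_set_def by (intro Collect_cong conj_cong refl ex_cong1) (simp add: approx_jump_cong_AE[OF ae U])
  moreover have "jump_size u x = jump_size u' x" if "x \<in> U" for x
    unfolding jump_size_def approx_jump_cong_AE[OF ae U that] ..
  ultimately show ?thesis unfolding jump_var_def
    by (intro nn_integral_cong) (auto simp: jump_set_def split: split_indicator)
qed

text \<open>Only finitely many fibres of \<open>p\<close> carry more than an arbitrarily small part of the total mass.\<close>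

lemma suminf_fibres_eq_0:
  fixes c m :: "nat \<Rightarrow> real" and p :: "nat \<Rightarrow> 'b"
  assumes sm: "summable (\<lambda>n. \<bar>m n\<bar>)" and c: "\<And>n. \<bar>c n\<bar> \<le> \<bar>m n\<bar>"
    and fib: "\<And>s. (\<Sum>n. c n * of_bool (p n = s)) = 0"
  shows "(\<Sum>n. c n) = 0"
proof -
  have sum: "summable (\<lambda>n. \<bar>c n * of_bool (Q n)\<bar>)" "summable (\<lambda>n. c n * of_bool (Q n))" for Q
  proof -
    show "summable (\<lambda>n. \<bar>c n * of_bool (Q n)\<bar>)"
      by (rule summable_comparison_test'[OF sm, of 0]) (use c in \<open>auto simp: abs_mult\<close>)
    then show "summable (\<lambda>n. c n * of_bool (Q n))" by (rule summable_rabs_cancel)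
  qed
  have "\<bar>\<Sum>n. c n\<bar> \<le> 0 + e" if e: "e > 0" for e
  proof -
    have "(\<lambda>k. \<Sum>n. \<bar>m (n + k)\<bar>) \<longlonglongrightarrow> 0" using sm by (rule suminf_exist_split2)
    then have "eventually (\<lambda>k. (\<Sum>n. \<bar>m (n + k)\<bar>) < e) sequentially" using e by (rule order_tendstoD(2))
    then obtain k where k: "(\<Sum>n. \<bar>m (n + k)\<bar>) < e" by (auto simp: eventually_sequentially)
    \<comment> \<open>Fibres through the first \<open>k\<close> atoms are summed exactly and vanish;
      every atom outside these fibres has index at least \<open>k\<close> and belongs to the small
      tail.\<close>
    define S where "S = p ` {..<k}"
    have finS: "finite S" by (simp add: S_def)
    have "(\<Sum>n. c n) = (\<Sum>n. c n * of_bool (p n \<in> S) + c n * of_bool (p n \<notin> S))"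
      by (intro suminf_cong) auto
    also have "\<dots> = (\<Sum>n. c n * of_bool (p n \<in> S)) + (\<Sum>n. c n * of_bool (p n \<notin> S))"
      by (rule suminf_add[symmetric]) (rule sum)+
    also have "(\<Sum>n. c n * of_bool (p n \<in> S)) = (\<Sum>n. \<Sum>s\<in>S. c n * of_bool (p n = s))"
    proof (intro suminf_cong)
      fix n
      show "c n * of_bool (p n \<in> S) = (\<Sum>s\<in>S. c n * of_bool (p n = s))"
        using finS by (simp add: sum_distrib_left[symmetric] of_bool_def sum.delta)
    qed
    also have "\<dots> = (\<Sum>s\<in>S. \<Sum>n. c n * of_bool (p n = s))" by (rule suminf_sum) (rule sum)
    also have "\<dots> = 0" using fib by simp
    also have "\<bar>0 + (\<Sum>n. c n * of_bool (p n \<notin> S))\<bar> \<le> (\<Sum>n. \<bar>c n * of_bool (p n \<notin> S)\<bar>)"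
      using summable_rabs[OF sum(1)] by simp
    also have "\<dots> = (\<Sum>n. \<bar>c (n + k) * of_bool (p (n + k) \<notin> S)\<bar>) + (\<Sum>n<k. \<bar>c n * of_bool (p n \<notin> S)\<bar>)"
      by (rule suminf_split_initial_segment[OF sum(1)])
    also have "(\<Sum>n<k. \<bar>c n * of_bool (p n \<notin> S)\<bar>) = 0" by (auto simp: S_def intro!: sum.neutral)
    also have "(\<Sum>n. \<bar>c (n + k) * of_bool (p (n + k) \<notin> S)\<bar>) \<le> (\<Sum>n. \<bar>m (n + k)\<bar>)"
      by (intro suminf_le summable_ignore_initial_segment[OF sm] summable_ignore_initial_segment[OF sum(1)]) (use c in auto)
    finally show ?thesis using k by simp
  qed
  then have "\<bar>\<Sum>n. c n\<bar> \<le> 0" by (rule field_le_epsilon)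
  then show ?thesis by simp
qed

section \<open>Cancellation of the atoms on lines\<close>

lemma AE_lborel_fst_snd:
  fixes P :: "real \<Rightarrow> bool"
  assumes "AE t in lborel. P t"
  shows "AE x in lborel. P (fst (x :: real \<times> real))" "AE x in lborel. P (snd (x :: real \<times> real))"
proof -
  obtain N where N: "N \<in> null_sets lborel" "\<And>t. t \<notin> N \<Longrightarrow> P t"
    using assms by (rule AE_E3) auto
  have Nb: "N \<in> sets lborel" "emeasure lborel N = 0" using N(1) by auto
  have UNIV: "(UNIV :: real set) \<in> sets lborel" by simp
  have "N \<times> (UNIV :: real set) \<in> null_sets (lborel \<Otimes>\<^sub>M lborel)" "(UNIV :: real set) \<times> N \<in> null_sets (lborel \<Otimes>\<^sub>M lborel)"
    using lborel.emeasure_pair_measure_Times[OF Nb(1) UNIV] lborel.emeasure_pair_measure_Times[OF UNIV Nb(1)] Nb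
    by (auto intro!: null_setsI)
  then have "AE x in lborel. x \<notin> N \<times> (UNIV :: real set)" and "AE x in lborel. x \<notin> (UNIV :: real set) \<times> N"
    using AE_not_in unfolding lborel_prod by blast+
  then have "AE x in lborel. fst (x :: real \<times> real) \<notin> N" "AE x in lborel. snd (x :: real \<times> real) \<notin> N"
    by (simp_all add: mem_Times_iff)
  then show "AE x in lborel. P (fst (x :: real \<times> real))" "AE x in lborel. P (snd (x :: real \<times> real))"
    using N(2) by (auto elim: eventually_mono)
qed

lemma suminf_of_bool_diff:
  fixes m :: "nat \<Rightarrow> real"
  assumes sm: "summable (\<lambda>n. \<bar>m n\<bar>)" and "\<And>n. P n \<longleftrightarrow> Q n \<or> R n" "\<And>n. \<not> (Q n \<and> R n)"
  shows "(\<Sum>n. m n * of_bool (P n)) - (\<Sum>n. m n * of_bool (R n)) = (\<Sum>n. m n * of_bool (Q n))"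
proof -
  have sum: "summable (\<lambda>n. m n * of_bool (Q n))" for Q
    by (rule summable_rabs_cancel, rule summable_comparison_test'[OF sm, of 0]) (auto simp: abs_mult)
  show ?thesis
    unfolding suminf_diff[OF sum sum] by (intro suminf_cong) (use assms(2,3) in auto)
qed

lemma suminf_atoms_measurable:
  fixes m :: "nat \<Rightarrow> real"
  assumes [measurable]: "\<And>n. Measurable.pred borel (P n)"
  shows "(\<lambda>t. \<Sum>n. m n * of_bool (P n t)) \<in> borel_measurable (borel :: 'a::topological_space measure)"
proof -
  have "(\<lambda>t. m n * of_bool (P n t)) \<in> borel_measurable borel" for n by measurable
  then show ?thesis by measurable
qed

text \<open>At a Lebesgue point of \<open>ub\<close> the first summand is approximately continuous, so it cannot
  compensate a jump of \<open>v\<close>.\<close>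

lemma no_jump_on_line:
  fixes c1 c2 :: "real \<Rightarrow> real" and X :: "real \<Rightarrow> real \<times> real"
  assumes ub [measurable]: "ub \<in> borel_measurable borel" and B: "\<And>y. \<bar>ub y\<bar> \<le> B" and \<pi>: "\<pi> = fst \<or> \<pi> = snd"
    and v [measurable]: "v \<in> borel_measurable borel"
    and jv: "jump_var 1 U (\<lambda>x. ub (\<pi> x) + v x) = 0"
    and X: "\<And>t. \<pi> (X t) = t" "\<And>t. t \<in> {a<..<b} \<Longrightarrow> X t \<in> U"
    and line: "\<And>f. f \<in> borel_measurable borel \<Longrightarrow>
      (\<integral>\<^sup>+x. indicator (range X) x * f x \<partial>hausdorff_measure (Suc 0)) = (\<integral>\<^sup>+t. f (X t) \<partial>lborel)"
    and \<nu>: "norm \<nu> = 1" and R: "countable R"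
    and lim1: "\<And>t e. t \<notin> R \<Longrightarrow> e > 0 \<Longrightarrow> \<exists>r>0. \<forall>y\<in>ball (X t) r. (y - X t) \<bullet> \<nu> > 0 \<longrightarrow> \<bar>v y - c1 t\<bar> \<le> e"
    and lim2: "\<And>t e. t \<notin> R \<Longrightarrow> e > 0 \<Longrightarrow> \<exists>r>0. \<forall>y\<in>ball (X t) r. (y - X t) \<bullet> \<nu> \<le> 0 \<longrightarrow> \<bar>v y - c2 t\<bar> \<le> e"
    and c [measurable]: "c1 \<in> borel_measurable borel" "c2 \<in> borel_measurable borel"
  shows "AE t in lborel. t \<in> {a<..<b} \<longrightarrow> c1 t = c2 t"
proof -
  define J where "J t = c1 t - c2 t" for t
  define w where "w = (\<lambda>x. ub (\<pi> x) + v x)"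
  have [measurable]: "\<pi> \<in> borel_measurable borel" using \<pi> by auto
  have [measurable]: "J \<in> borel_measurable borel" "w \<in> borel_measurable borel" unfolding J_def w_def by measurable
  have "AE t in lborel. t \<notin> R"
    using R by (intro AE_not_in countable_imp_null_set_lborel)
  with lebesgue_points[OF ub B] have "AE t in lborel. t \<notin> R \<and> (\<forall>e>0. \<exists>d>0. \<forall>h. 0 < h \<and> h < d \<longrightarrow>
    (\<integral>\<^sup>+y. ennreal \<bar>ub y - ub t\<bar> * indicator {t - h..t + h} y \<partial>lborel) \<le> ennreal (e * h))"
    by eventually_elim blast
  then obtain N where N: "N \<in> null_sets lborel" and regular: "\<And>t. t \<notin> N \<Longrightarrow> t \<notin> R \<and> (\<forall>e>0. \<exists>d>0. \<forall>h. 0 < h \<and> h < d \<longrightarrow>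
    (\<integral>\<^sup>+y. ennreal \<bar>ub y - ub t\<bar> * indicator {t - h..t + h} y \<partial>lborel) \<le> ennreal (e * h))"
    by (rule AE_E3) auto
  have [measurable]: "N \<in> sets borel" using N by auto
  have jump: "X t \<in> jump_set U w \<and> jump_size w (X t) = \<bar>J t\<bar>"
    if t: "t \<in> {a<..<b}" "t \<notin> N" "J t \<noteq> 0" for t
  proof -
    have "approx_jump v (X t) (c1 t) (c2 t) \<nu>"
      by (rule two_sided_limits_jump(1)[OF v \<nu> lim1 lim2]) (use regular[OF t(2)] t(3) in \<open>auto simp: J_def\<close>)
    moreover have "((\<lambda>r. (\<integral>\<^sup>+ y \<in> ball (X t) r. ennreal \<bar>ub (\<pi> y) - ub (\<pi> (X t))\<bar> \<partial>lebesgue) / emeasure lebesgue (ball (X t) r)) \<longlongrightarrow> 0) (at_right 0)"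
      by (rule lebesgue_point_ball_average[OF ub \<pi>]) (use regular[OF t(2)] in \<open>simp add: X\<close>)
    ultimately have "approx_jump w (X t) (ub (\<pi> (X t)) + c1 t) (ub (\<pi> (X t)) + c2 t) \<nu>"
      unfolding w_def by (intro approx_jump_add) auto
    then have "X t \<in> jump_set U w" "jump_size w (X t) = \<bar>(ub (\<pi> (X t)) + c1 t) - (ub (\<pi> (X t)) + c2 t)\<bar>"
      unfolding jump_set_def using X(2)[OF t(1)] by (blast, intro jump_size_eq) auto
    then show ?thesis by (simp add: J_def)
  qed
  define G where "G = {a<..<b} - N"
  have [measurable]: "G \<in> sets borel" unfolding G_def by measurable
  \<comment> \<open>The jump of \<open>v\<close> along the line, integrated by length, is dominated
    by the total jump of \<open>w\<close>, which is 0. Monotonicity of the integral applies although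
    the jump set has not been shown to be measurable.\<close>
  have "(\<integral>\<^sup>+t. ennreal \<bar>J t\<bar> * indicator G t \<partial>lborel)
    = (\<integral>\<^sup>+x. indicator (range X) x * (ennreal \<bar>J (\<pi> x)\<bar> * indicator G (\<pi> x)) \<partial>hausdorff_measure (Suc 0))"
    by (subst line) (auto simp: X)
  also have "\<dots> \<le> (\<integral>\<^sup>+x. ennreal (jump_size w x powr 1) * indicator (jump_set U w) x \<partial>hausdorff_measure (Suc 0))"
  proof (rule nn_integral_mono)
    fix x :: "real \<times> real"
    show "indicator (range X) x * (ennreal \<bar>J (\<pi> x)\<bar> * indicator G (\<pi> x)) \<le> ennreal (jump_size w x powr 1) * indicator (jump_set U w) x"
    proof (cases "x \<in> range X")
      case True
      then obtain t where "x = X t" by blast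
      then show ?thesis using jump[of t] by (cases "J t = 0") (auto simp: X G_def split: split_indicator)
    qed simp
  qed
  also have "\<dots> = 0" using jv by (simp add: jump_var_def w_def)
  finally have "(\<integral>\<^sup>+t. ennreal \<bar>J t\<bar> * indicator G t \<partial>lborel) = 0" by simp
  then have "AE t in lborel. ennreal \<bar>J t\<bar> * indicator G t = 0" by (subst (asm) nn_integral_0_iff_AE) auto
  moreover have "AE t in lborel. t \<notin> N" by (rule AE_not_in[OF N])
  ultimately show ?thesis by eventually_elim (auto simp: G_def J_def)
qed

text \<open>The jump across a vertical line at height \<open>t\<close> is the mass of the atoms with
  corner on that line below \<open>t\<close>. If \<pi> is \<open>snd\<close>, vertical lines are the
  right ones to test: \<open>ub\<close> varies along them and almost every point is a Lebesgue
  point, whereas across a horizontal line \<open>ub\<close> could itself jump and compensate. The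
  second claim exchanges the coordinates.\<close>

lemma quadrant_mass_zero:
  fixes m p q :: "nat \<Rightarrow> real"
  assumes sm: "summable (\<lambda>n. \<bar>m n\<bar>)" and ub: "ub \<in> borel_measurable borel" and B: "\<And>y. \<bar>ub y\<bar> \<le> B"
  shows "jump_var 1 (box2 a1 b1 a2 b2) (\<lambda>x. ub (snd x) + (\<Sum>n. m n * indicator (quadrant (p n) (q n)) x)) = 0 \<Longrightarrow> s \<in> {a1<..<b1} \<Longrightarrow>
      AE t in lborel. t \<in> {a2<..<b2} \<longrightarrow> (\<Sum>n. m n * of_bool (p n = s \<and> q n < t)) = 0" (is "?j1 \<Longrightarrow> ?s1 \<Longrightarrow> ?A")
    and "jump_var 1 (box2 a1 b1 a2 b2) (\<lambda>x. ub (fst x) + (\<Sum>n. m n * indicator (quadrant (p n) (q n)) x)) = 0 \<Longrightarrow> s \<in> {a2<..<b2} \<Longrightarrow>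
      AE t in lborel. t \<in> {a1<..<b1} \<longrightarrow> (\<Sum>n. m n * of_bool (q n = s \<and> p n < t)) = 0" (is "?j2 \<Longrightarrow> ?s2 \<Longrightarrow> ?B")
proof -
  have v: "(\<lambda>x. \<Sum>n. m n * indicator (quadrant (p n) (q n)) x) \<in> borel_measurable borel" by measurable
  have meas: "(\<lambda>t. \<Sum>n. m n * of_bool (P n \<and> r n < t)) \<in> borel_measurable borel" for P and r :: "nat \<Rightarrow> real"
    by (rule suminf_atoms_measurable) measurable
  have diff: "(\<Sum>n. m n * of_bool (r n = s \<and> Q n)) = (\<Sum>n. m n * of_bool (r n \<le> s \<and> Q n)) - (\<Sum>n. m n * of_bool (r n < s \<and> Q n))"
    for Q and r :: "nat \<Rightarrow> real"
    by (rule suminf_of_bool_diff[OF sm, symmetric]) auto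
  have "range (Pair s) = {s} \<times> UNIV" "range (\<lambda>t. (t, s)) = UNIV \<times> {s}" by auto
  note line = vertical_line(1)[of _ s, folded this(1)] horizontal_line(1)[of _ s, folded this(2)]
  show ?A if j: ?j1 and s: ?s1
    unfolding diff right_minus_eq
  proof (rule no_jump_on_line[OF ub B _ v j, where X = "Pair s" and \<nu> = "(1, 0)" and R = "range q"])
    show "\<exists>r>0. \<forall>y\<in>ball (s, t) r. (y - (s, t)) \<bullet> (1, 0) > 0 \<longrightarrow>
        \<bar>(\<Sum>n. m n * indicator (quadrant (p n) (q n)) y) - (\<Sum>n. m n * of_bool (p n \<le> s \<and> q n < t))\<bar> \<le> e"
      "\<exists>r>0. \<forall>y\<in>ball (s, t) r. (y - (s, t)) \<bullet> (1, 0) \<le> 0 \<longrightarrow>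
        \<bar>(\<Sum>n. m n * indicator (quadrant (p n) (q n)) y) - (\<Sum>n. m n * of_bool (p n < s \<and> q n < t))\<bar> \<le> e"
      if "t \<notin> range q" "e > 0" for t e
      using quadrant_limits_1[OF sm, of q "(s, t)" e p] that by auto
  qed (use s line meas in \<open>auto simp: box2_def norm_Pair\<close>)
  show ?B if j: ?j2 and s: ?s2
    unfolding diff right_minus_eq
  proof (rule no_jump_on_line[OF ub B _ v j, where X = "\<lambda>t. (t, s)" and \<nu> = "(0, 1)" and R = "range p"])
    show "\<exists>r>0. \<forall>y\<in>ball (t, s) r. (y - (t, s)) \<bullet> (0, 1) > 0 \<longrightarrow>
        \<bar>(\<Sum>n. m n * indicator (quadrant (p n) (q n)) y) - (\<Sum>n. m n * of_bool (q n \<le> s \<and> p n < t))\<bar> \<le> e"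
      "\<exists>r>0. \<forall>y\<in>ball (t, s) r. (y - (t, s)) \<bullet> (0, 1) \<le> 0 \<longrightarrow>
        \<bar>(\<Sum>n. m n * indicator (quadrant (p n) (q n)) y) - (\<Sum>n. m n * of_bool (q n < s \<and> p n < t))\<bar> \<le> e"
      if "t \<notin> range p" "e > 0" for t e
      using quadrant_limits_2[OF sm, of p "(t, s)" e q] that by auto
  qed (use s line meas in \<open>auto simp: box2_def norm_Pair\<close>)
qed

text \<open>The atoms with \<open>a < p n < x\<close> are grouped by their value of
  \<open>p\<close>; each group lies on one line and cancels.\<close>

lemma suminf_atoms_eq:
  fixes m :: "nat \<Rightarrow> real" and p :: "nat \<Rightarrow> real"
  assumes sm: "summable (\<lambda>n. \<bar>m n\<bar>)" and fib: "\<And>n. p n \<in> {a<..<b} \<Longrightarrow> (\<Sum>k. m k * of_bool (p k = p n \<and> Q k)) = 0"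
    and x: "x < b"
  shows "(\<Sum>n. m n * of_bool (p n < x \<and> Q n)) = (\<Sum>n. m n * of_bool (p n < x \<and> p n \<le> a \<and> Q n))"
proof -
  have fin: "(\<Sum>n. m n * of_bool (p n < x \<and> a < p n \<and> Q n)) = 0"
  proof (rule suminf_fibres_eq_0[OF sm])
    show "\<bar>m n * of_bool (p n < x \<and> a < p n \<and> Q n)\<bar> \<le> \<bar>m n\<bar>" for n by (simp add: abs_mult)
    fix s
    show "(\<Sum>n. m n * of_bool (p n < x \<and> a < p n \<and> Q n) * of_bool (p n = s)) = 0"
    proof (cases "a < s \<and> s < x \<and> s \<in> range p")
      case True
      then obtain n where n: "s = p n" "p n \<in> {a<..<b}" using x by auto
      have "(\<Sum>k. m k * of_bool (p k < x \<and> a < p k \<and> Q k) * of_bool (p k = s)) = (\<Sum>k. m k * of_bool (p k = p n \<and> Q k))"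
        using True n(1) by (intro suminf_cong) auto
      then show ?thesis using fib[OF n(2)] by simp
    next
      case False
      then have "m n * of_bool (p n < x \<and> a < p n \<and> Q n) * of_bool (p n = s) = 0" for n by auto
      then show ?thesis by (simp only: suminf_zero)
    qed
  qed
  have "(\<Sum>n. m n * of_bool (p n < x \<and> Q n)) - (\<Sum>n. m n * of_bool (p n < x \<and> p n \<le> a \<and> Q n))
    = (\<Sum>n. m n * of_bool (p n < x \<and> a < p n \<and> Q n))"
    by (rule suminf_of_bool_diff[OF sm]) auto
  with fin show ?thesis by simp
qed

text \<open>After the cancellation only corners at or before the left end of the other coordinate's
  interval remain. Inside the box their quadrants no longer depend on that coordinate, so they join
  \<open>ub\<close> in a function of \<pi>.\<close>

lemma jump_free_one_variable:
  fixes m p q :: "nat \<Rightarrow> real"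
  assumes sm: "summable (\<lambda>n. \<bar>m n\<bar>)" and ub: "ub \<in> borel_measurable borel" and B: "\<And>y. \<bar>ub y\<bar> \<le> B"
    and \<pi>: "\<pi> = fst \<or> \<pi> = snd"
    and jv: "jump_var 1 (box2 a1 b1 a2 b2) (\<lambda>x. ub (\<pi> x) + (\<Sum>n. m n * indicator (quadrant (p n) (q n)) x)) = 0"
  shows "\<exists>f. AE x in lborel. x \<in> box2 a1 b1 a2 b2 \<longrightarrow> ub (\<pi> x) + (\<Sum>n. m n * indicator (quadrant (p n) (q n)) x) = f (\<pi> x)"
  using \<pi>
proof
  assume \<pi>: "\<pi> = snd"
  have "AE t in lborel. \<forall>k. p k \<in> {a1<..<b1} \<longrightarrow> t \<in> {a2<..<b2} \<longrightarrow> (\<Sum>n. m n * of_bool (p n = p k \<and> q n < t)) = 0"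
    unfolding AE_all_countable using quadrant_mass_zero(1)[OF sm ub B jv[unfolded \<pi>]] by auto
  from AE_lborel_fst_snd(2)[OF this]
  have "AE x in lborel. x \<in> box2 a1 b1 a2 b2 \<longrightarrow> ub (\<pi> x) + (\<Sum>n. m n * indicator (quadrant (p n) (q n)) x)
    = ub (\<pi> x) + (\<Sum>n. m n * of_bool (p n \<le> a1 \<and> q n < snd x))"
  proof eventually_elim
    case (elim x)
    show ?case
    proof
      assume x: "x \<in> box2 a1 b1 a2 b2"
      have "(\<Sum>n. m n * indicator (quadrant (p n) (q n)) x) = (\<Sum>n. m n * of_bool (p n < fst x \<and> q n < snd x))"
        by (intro suminf_cong) (cases x, auto simp: quadrant_def indicator_def)
      also have "\<dots> = (\<Sum>n. m n * of_bool (p n < fst x \<and> p n \<le> a1 \<and> q n < snd x))"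
        by (rule suminf_atoms_eq[OF sm, where b = b1]) (use elim x in \<open>auto simp: box2_def\<close>)
      also have "\<dots> = (\<Sum>n. m n * of_bool (p n \<le> a1 \<and> q n < snd x))"
        using x by (intro suminf_cong) (auto simp: box2_def)
      finally show "ub (\<pi> x) + (\<Sum>n. m n * indicator (quadrant (p n) (q n)) x)
        = ub (\<pi> x) + (\<Sum>n. m n * of_bool (p n \<le> a1 \<and> q n < snd x))" by simp
    qed
  qed
  then show ?thesis unfolding \<pi> by (intro exI[of _ "\<lambda>t. ub t + (\<Sum>n. m n * of_bool (p n \<le> a1 \<and> q n < t))"])
next
  assume \<pi>: "\<pi> = fst"
  have "AE t in lborel. \<forall>k. q k \<in> {a2<..<b2} \<longrightarrow> t \<in> {a1<..<b1} \<longrightarrow> (\<Sum>n. m n * of_bool (q n = q k \<and> p n < t)) = 0"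
    unfolding AE_all_countable using quadrant_mass_zero(2)[OF sm ub B jv[unfolded \<pi>]] by auto
  from AE_lborel_fst_snd(1)[OF this]
  have "AE x in lborel. x \<in> box2 a1 b1 a2 b2 \<longrightarrow> ub (\<pi> x) + (\<Sum>n. m n * indicator (quadrant (p n) (q n)) x)
    = ub (\<pi> x) + (\<Sum>n. m n * of_bool (q n \<le> a2 \<and> p n < fst x))"
  proof eventually_elim
    case (elim x)
    show ?case
    proof
      assume x: "x \<in> box2 a1 b1 a2 b2"
      have "(\<Sum>n. m n * indicator (quadrant (p n) (q n)) x) = (\<Sum>n. m n * of_bool (q n < snd x \<and> p n < fst x))"
        by (intro suminf_cong) (cases x, auto simp: quadrant_def indicator_def)
      also have "\<dots> = (\<Sum>n. m n * of_bool (q n < snd x \<and> q n \<le> a2 \<and> p n < fst x))"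
        by (rule suminf_atoms_eq[OF sm, where b = b2]) (use elim x in \<open>auto simp: box2_def\<close>)
      also have "\<dots> = (\<Sum>n. m n * of_bool (q n \<le> a2 \<and> p n < fst x))"
        using x by (intro suminf_cong) (auto simp: box2_def)
      finally show "ub (\<pi> x) + (\<Sum>n. m n * indicator (quadrant (p n) (q n)) x)
        = ub (\<pi> x) + (\<Sum>n. m n * of_bool (q n \<le> a2 \<and> p n < fst x))" by simp
    qed
  qed
  then show ?thesis unfolding \<pi> by (intro exI[of _ "\<lambda>t. ub t + (\<Sum>n. m n * of_bool (q n \<le> a2 \<and> p n < t))"])
qed

section \<open>The three assertions for functions on a box\<close>

lemma AE_lebesgue_on_box2:
  "(AE x in lebesgue_on (box2 a1 b1 a2 b2). P x) \<longleftrightarrow> (AE x in lborel. x \<in> box2 a1 b1 a2 b2 \<longrightarrow> P x)"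
  by (simp add: AE_restrict_space_iff AE_completion_iff)

lemma S_classI:
  assumes "u \<in> borel_measurable (lebesgue_on (box2 a1 b1 a2 b2))" and \<pi>: "\<pi> = fst \<or> \<pi> = snd"
    and "AE x in lborel. x \<in> box2 a1 b1 a2 b2 \<longrightarrow> u x = f (\<pi> x)"
  shows "S_class (box2 a1 b1 a2 b2) u"
  unfolding S_class_def AE_lebesgue_on_box2 using assms by auto

lemma borel_measurable_lebesgue_on:
  assumes "f \<in> borel_measurable borel"
  shows "f \<in> borel_measurable (lebesgue_on X)"
  using measurable_restrict_space1[OF measurable_completion, of f lborel borel] assms by simp

lemma bounded_borel_representative:
  fixes u :: "real \<times> real \<Rightarrow> real"
  assumes u: "u \<in> borel_measurable (lebesgue_on (box2 a1 b1 a2 b2))"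
    and B: "0 \<le> B" "AE x in lebesgue_on (box2 a1 b1 a2 b2). \<bar>u x\<bar> \<le> B"
  obtains w where "w \<in> borel_measurable borel" "\<And>x. \<bar>w x\<bar> \<le> B" "\<And>x. x \<notin> box2 a1 b1 a2 b2 \<Longrightarrow> w x = 0"
    "AE x in lborel. x \<in> box2 a1 b1 a2 b2 \<longrightarrow> u x = w x"
proof -
  let ?X = "box2 a1 b1 a2 b2"
  have "(\<lambda>x. indicator ?X x *\<^sub>R u x) \<in> borel_measurable lebesgue"
    using u by (subst (asm) borel_measurable_restrict_space_iff) auto
  from completion_ex_borel_measurable_real[OF this]
  obtain g where "g \<in> borel_measurable lborel" and ae: "AE x in lborel. indicator ?X x *\<^sub>R u x = g x" by blast
  then have [measurable]: "g \<in> borel_measurable borel" by simp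
  show thesis
  proof (rule that[of "\<lambda>x. indicator ?X x * max (- B) (min B (g x))"])
    show "(\<lambda>x. indicator ?X x * max (- B) (min B (g x))) \<in> borel_measurable borel" by measurable
    show "\<bar>indicator ?X x * max (- B) (min B (g x))\<bar> \<le> B" for x using B(1) by (auto split: split_indicator)
    show "AE x in lborel. x \<in> ?X \<longrightarrow> u x = indicator ?X x * max (- B) (min B (g x))"
      using ae B(2)[unfolded AE_lebesgue_on_box2] by eventually_elim (auto simp: abs_le_iff)
  qed simp
qed

text \<open>Converts the bound on the power sum of the masses into one on the sum of their moduli.
  The masses are at most 4 because \<open>u\<close> is bounded by 1.\<close>

lemma abs_le_4_powr:
  fixes x :: real
  assumes "\<bar>x\<bar> \<le> 4" "0 < \<theta>" "\<theta> \<le> 1"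
  shows "\<bar>x\<bar> \<le> 4 * \<bar>x\<bar> powr \<theta>"
proof -
  have "\<bar>x\<bar> / 4 = (\<bar>x\<bar> / 4) powr 1" by simp
  also have "\<dots> \<le> (\<bar>x\<bar> / 4) powr \<theta>" using assms by (intro powr_mono') auto
  also have "\<dots> \<le> \<bar>x\<bar> powr \<theta>" using assms by (intro powr_mono2) auto
  finally show ?thesis by simp
qed

context kernel
begin

lemma sbv_part:
  assumes \<theta>: "0 < \<theta>1" "0 < \<theta>2" "\<theta>1 + \<theta>2 < 1" and ab: "a1 < b1" "a2 < b2"
    and u: "u \<in> borel_measurable (lebesgue_on (box2 a1 b1 a2 b2))"
    and dec: "atom_decomposition (\<theta>1 + \<theta>2) (box2 a1 b1 a2 b2) K 1 K0 u \<pi> ub m p q" and \<pi>: "\<pi> = fst \<or> \<pi> = snd"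
  shows "\<exists>ub. S_class (box2 a1 b1 a2 b2) ub \<and>
          SBV (\<theta>1 + \<theta>2) (box2 a1 b1 a2 b2) (\<lambda>x. u x - ub x) \<and>
          Linf (box2 a1 b1 a2 b2) (\<lambda>x. u x - ub x) \<and>
          Linf_norm (box2 a1 b1 a2 b2) (\<lambda>x. u x - ub x)
            + enn2ereal (jump_var (\<theta>1 + \<theta>2) (box2 a1 b1 a2 b2) (\<lambda>x. u x - ub x))
          \<le> ereal (4 * K0 * (1 + (b1 - a1) + (b2 - a2)))"
proof -
  let ?\<theta> = "\<theta>1 + \<theta>2" and ?X = "box2 a1 b1 a2 b2"
  define v where "v = (\<lambda>x. \<Sum>n. m n * indicator (quadrant (p n) (q n)) x)"
  have \<theta>': "0 < ?\<theta>" "?\<theta> \<le> 1" using \<theta> by auto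
  have s\<theta>: "summable (\<lambda>n. \<bar>m n\<bar> powr ?\<theta>)" and K0: "(\<Sum>n. \<bar>m n\<bar> powr ?\<theta>) \<le> K0" and sm: "summable (\<lambda>n. \<bar>m n\<bar>)"
    and m4: "\<And>n. \<bar>m n\<bar> \<le> 4" and ae: "AE x in lborel. x \<in> ?X \<longrightarrow> u x = ub (\<pi> x) + v x"
    using dec by (auto simp: atom_decomposition_def v_def)
  have K00: "0 \<le> K0" using suminf_nonneg[OF s\<theta>] K0 by simp
  have [measurable]: "v \<in> borel_measurable borel" unfolding v_def by measurable
  then have vm: "v \<in> borel_measurable (lebesgue_on ?X)" by (rule borel_measurable_lebesgue_on)
  have sum4: "(\<Sum>n. \<bar>m n\<bar>) \<le> 4 * K0"
  proof -
    have "(\<Sum>n. \<bar>m n\<bar>) \<le> (\<Sum>n. 4 * \<bar>m n\<bar> powr ?\<theta>)"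
      by (intro suminf_le sm summable_mult s\<theta> abs_le_4_powr m4 \<theta>')
    also have "\<dots> \<le> 4 * K0" using K0 by (simp add: suminf_mult[OF s\<theta>])
    finally show ?thesis .
  qed
  have v4: "\<bar>v x\<bar> \<le> 4 * K0" for x
  proof -
    have s: "summable (\<lambda>n. \<bar>m n * indicator (quadrant (p n) (q n)) x\<bar>)"
      by (rule summable_comparison_test'[OF sm, of 0]) (auto simp: abs_mult split: split_indicator)
    have "\<bar>v x\<bar> \<le> (\<Sum>n. \<bar>m n * indicator (quadrant (p n) (q n)) x\<bar>)" unfolding v_def by (rule summable_rabs[OF s])
    also have "\<dots> \<le> (\<Sum>n. \<bar>m n\<bar>)" by (intro suminf_le s sm) (auto split: split_indicator)
    finally show ?thesis using sum4 by simp
  qed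
  have "Linf_norm ?X v \<le> ereal (4 * K0)"
    unfolding Linf_norm_def using vm v4 by (intro esssup_I) auto
  moreover have "enn2ereal (jump_var ?\<theta> ?X v) \<le> ereal (K0 * ((b1 - a1) + (b2 - a2)))"
  proof -
    have "jump_var ?\<theta> ?X v \<le> ennreal ((\<Sum>n. \<bar>m n\<bar> powr ?\<theta>) * ((b1 - a1) + (b2 - a2)))"
      unfolding v_def by (rule atoms_2d(2)[OF ab sm \<theta>' s\<theta>])
    also have "\<dots> \<le> ennreal (K0 * ((b1 - a1) + (b2 - a2)))" using K0 ab by (intro ennreal_leI mult_right_mono) auto
    finally have "enn2ereal (jump_var ?\<theta> ?X v) \<le> enn2ereal (ennreal (K0 * ((b1 - a1) + (b2 - a2))))"
      by (simp add: less_eq_ennreal.rep_eq)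
    then show ?thesis using K00 ab by (simp add: enn2ereal_ennreal)
  qed
  ultimately have "Linf_norm ?X v + enn2ereal (jump_var ?\<theta> ?X v) \<le> ereal (4 * K0) + ereal (K0 * ((b1 - a1) + (b2 - a2)))"
    by (rule add_mono)
  also have "\<dots> \<le> ereal (4 * K0 * (1 + (b1 - a1) + (b2 - a2)))"
  proof -
    have "0 \<le> K0 * ((b1 - a1) + (b2 - a2))" using K00 ab by simp
    then show ?thesis by (simp add: algebra_simps)
  qed
  finally have norm: "Linf_norm ?X v + enn2ereal (jump_var ?\<theta> ?X v) \<le> ereal (4 * K0 * (1 + (b1 - a1) + (b2 - a2)))" .
  \<comment> \<open>The witness is \<open>u - v\<close> rather than the rough summand itself: the
    difference from \<open>u\<close> is then exactly \<open>v\<close> at every point, and nothing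
    has to be transferred across null sets.\<close>
  have "S_class ?X (\<lambda>x. u x - v x)"
  proof (rule S_classI[OF _ \<pi>])
    show "(\<lambda>x. u x - v x) \<in> borel_measurable (lebesgue_on ?X)" using u vm by measurable
    show "AE x in lborel. x \<in> ?X \<longrightarrow> u x - v x = ub (\<pi> x)" using ae by eventually_elim auto
  qed
  moreover have "SBV ?\<theta> ?X v" unfolding v_def by (rule atoms_2d(1)[OF ab sm \<theta>' s\<theta>])
  moreover have "Linf ?X v" unfolding Linf_def using vm v4 by (intro conjI exI[of _ "4 * K0"]) auto
  ultimately show ?thesis using norm by (intro exI[of _ "\<lambda>x. u x - v x"]) simp
qed

text \<open>With \<open>c = 12 / \<rho>_const\<close> the root of \<open>c * E\<close> factorises,
  and \<open>c + sqrt c\<close> dominates the coefficients of both terms.\<close>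

lemma decomposition_constant:
  assumes "0 \<le> E" "0 \<le> L'"
  shows "4 * (4 * 1 * (12 * E / \<rho>_const + sqrt (12 * E / \<rho>_const))) * L'
    \<le> 16 * (12 / \<rho>_const + sqrt (12 / \<rho>_const)) * L' * (E + sqrt E)"
proof -
  define c where "c = 12 / \<rho>_const"
  have c: "0 \<le> c" using \<rho>_const_pos by (simp add: c_def)
  have "12 * E / \<rho>_const = c * E" by (simp add: c_def)
  then have "4 * (4 * 1 * (12 * E / \<rho>_const + sqrt (12 * E / \<rho>_const))) * L' = 16 * L' * (c * E + sqrt c * sqrt E)"
    by (simp add: real_sqrt_mult)
  also have "\<dots> \<le> 16 * L' * ((c + sqrt c) * (E + sqrt E))"
    using c assms by (intro mult_left_mono) (auto simp: algebra_simps)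
  finally show ?thesis by (simp add: c_def mult_ac)
qed

text \<open>No normalisation of \<open>u\<close> is available, so the decomposition is taken with
  \<open>B = max 1 M\<close>. The size of its bounds does not matter here: summable masses and a
  bounded rough summand suffice.\<close>

lemma jump_free_part:
  assumes \<theta>: "0 < \<theta>1" "0 < \<theta>2" "\<theta>1 + \<theta>2 < 1" and ab: "a1 < b1" "a2 < b2"
    and u: "Linf (box2 a1 b1 a2 b2) u" and fin: "energy \<theta>1 \<theta>2 \<rho> {a1<..<b1} {a2<..<b2} u < \<infinity>"
    and jv: "jump_var 1 (box2 a1 b1 a2 b2) u = 0"
  shows "S_class (box2 a1 b1 a2 b2) u"
proof -
  let ?X = "box2 a1 b1 a2 b2"
  obtain M where um: "u \<in> borel_measurable (lebesgue_on ?X)" and M: "AE x in lebesgue_on ?X. \<bar>u x\<bar> \<le> M"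
    using u by (auto simp: Linf_def)
  define B where "B = max 1 M"
  have B: "1 \<le> B" "0 \<le> B" "AE x in lebesgue_on ?X. \<bar>u x\<bar> \<le> B"
    using M by (auto simp: B_def elim!: eventually_mono)
  obtain w where w: "w \<in> borel_measurable borel" "\<And>x. \<bar>w x\<bar> \<le> B" "\<And>x. x \<notin> ?X \<Longrightarrow> w x = 0"
    and uw: "AE x in lborel. x \<in> ?X \<longrightarrow> u x = w x"
    using bounded_borel_representative[OF um B(2,3)] by blast
  have "energy \<theta>1 \<theta>2 \<rho> {a1<..<b1} {a2<..<b2} w < \<infinity>"
    using fin energy_cong[of \<rho> a1 b1 a2 b2 u w \<theta>1 \<theta>2] uw \<rho>_support by (simp add: AE_completion_iff)
  from decomposition_exists[OF \<theta> ab w(1) B(1) w(2,3) this]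
  obtain \<pi> ub m p q K0 where \<pi>: "\<pi> = fst \<or> \<pi> = snd"
    and dec: "atom_decomposition (\<theta>1 + \<theta>2) ?X ({a1 - 1..b1} \<times> {a2 - 1..b2}) B K0 w \<pi> ub m p q" by blast
  let ?u = "\<lambda>x. ub (\<pi> x) + (\<Sum>n. m n * indicator (quadrant (p n) (q n)) x)"
  have ub: "ub \<in> borel_measurable borel" "\<And>y. \<bar>ub y\<bar> \<le> B" and sm: "summable (\<lambda>n. \<bar>m n\<bar>)"
    and ae: "AE x in lborel. x \<in> ?X \<longrightarrow> w x = ?u x"
    using dec by (auto simp: atom_decomposition_def)
  have ae': "AE x in lborel. x \<in> ?X \<longrightarrow> u x = ?u x" using uw ae by eventually_elim auto
  then have "jump_var 1 ?X ?u = 0" using jv jump_var_cong_AE[of ?X u ?u 1] by (simp add: AE_completion_iff)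
  from jump_free_one_variable[OF sm ub \<pi> this]
  obtain f where "AE x in lborel. x \<in> ?X \<longrightarrow> ?u x = f (\<pi> x)" by blast
  with ae' have "AE x in lborel. x \<in> ?X \<longrightarrow> u x = f (\<pi> x)" by eventually_elim auto
  then show ?thesis by (rule S_classI[OF um \<pi>])
qed

end

text \<open>The additive constant \<open>c\<close> is an atom placed outside the interval.\<close>

lemma atoms_1d_plus_constant:
  fixes m p :: "nat \<Rightarrow> real" and c :: real
  assumes sm: "summable (\<lambda>n. \<bar>m n\<bar>)" and \<theta>: "0 < \<theta>" "\<theta> \<le> 1" and s\<theta>: "summable (\<lambda>n. \<bar>m n\<bar> powr \<theta>)"
  obtains g where "SBV \<theta> {a<..<b} g" "jump_var \<theta> {a<..<b} g \<le> ennreal (\<Sum>n. \<bar>m n\<bar> powr \<theta>)"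
    "\<And>x. x \<in> {a<..<b} \<Longrightarrow> g x = c + (\<Sum>n. m n * indicator {p n<..} x)"
proof -
  define m' p' where "m' = case_nat c m" and "p' = case_nat a p"
  define g where "g x = (\<Sum>n. m' n * indicator {p' n<..} x)" for x
  have sm': "summable (\<lambda>n. \<bar>m' n\<bar>)" using sm by (subst summable_Suc_iff[symmetric]) (simp add: m'_def)
  have "(\<lambda>n. ennreal (\<bar>m' (Suc n)\<bar> powr \<theta>) * indicator {a<..<b} (p' (Suc n))) sums (\<Sum>n. ennreal (\<bar>m n\<bar> powr \<theta>) * indicator {a<..<b} (p n))"
    unfolding m'_def p'_def by (auto intro: summable_sums)
  from sums_Suc[OF this] have "(\<Sum>n. ennreal (\<bar>m' n\<bar> powr \<theta>) * indicator {a<..<b} (p' n)) = (\<Sum>n. ennreal (\<bar>m n\<bar> powr \<theta>) * indicator {a<..<b} (p n))"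
    by (simp add: sums_iff p'_def)
  also have "\<dots> \<le> (\<Sum>n. ennreal (\<bar>m n\<bar> powr \<theta>))" by (intro suminf_le) (auto split: split_indicator)
  also have "\<dots> = ennreal (\<Sum>n. \<bar>m n\<bar> powr \<theta>)" by (rule suminf_ennreal2[OF _ s\<theta>]) simp
  finally have le: "(\<Sum>n. ennreal (\<bar>m' n\<bar> powr \<theta>) * indicator {a<..<b} (p' n)) \<le> ennreal (\<Sum>n. \<bar>m n\<bar> powr \<theta>)" .
  then have fin: "(\<Sum>n. ennreal (\<bar>m' n\<bar> powr \<theta>) * indicator {a<..<b} (p' n)) < \<infinity>"
    by (rule order.strict_trans1) simp
  show thesis
  proof (rule that[of g])
    show "SBV \<theta> {a<..<b} g" unfolding g_def by (rule atoms_1d(1)[OF sm' \<theta> fin])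
    show "jump_var \<theta> {a<..<b} g \<le> ennreal (\<Sum>n. \<bar>m n\<bar> powr \<theta>)"
      unfolding g_def by (rule order_trans[OF atoms_1d(2)[OF sm' \<theta> fin] le])
    fix x assume x: "x \<in> {a<..<b}"
    have s: "summable (\<lambda>n. m n * indicator {p n<..} x)"
      by (rule summable_rabs_cancel, rule summable_comparison_test'[OF sm, of 0]) (auto simp: abs_mult split: split_indicator)
    have "(\<lambda>n. m' (Suc n) * indicator {p' (Suc n)<..} x) sums (\<Sum>n. m n * indicator {p n<..} x)"
      unfolding m'_def p'_def using summable_sums[OF s] by simp
    from sums_Suc[OF this] show "g x = c + (\<Sum>n. m n * indicator {p n<..} x)"
      using x by (simp add: g_def sums_iff m'_def p'_def)
  qed
qed

text \<open>By Fubini some abscissa \<open>s\<close> in the interval is good for almost every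
  \<open>t\<close>, and the constant is \<open>g s\<close>.\<close>

lemma AE_pair_constant:
  fixes f g :: "real \<Rightarrow> real"
  assumes ab: "a1 < b1" and ae: "AE x in lborel. x \<in> box2 a1 b1 a2 b2 \<longrightarrow> f (snd x) = g (fst x)"
  obtains c where "AE t in lborel. t \<in> {a2<..<b2} \<longrightarrow> f t = c"
proof -
  have "AE s in lborel. AE t in lborel. (s, t) \<in> box2 a1 b1 a2 b2 \<longrightarrow> f t = g s"
    using lborel_pair.AE_pair[of "\<lambda>x. x \<in> box2 a1 b1 a2 b2 \<longrightarrow> f (snd x) = g (fst x)"] ae unfolding lborel_prod by simp
  then obtain N where N: "N \<in> null_sets lborel" "\<And>s. s \<notin> N \<Longrightarrow> AE t in lborel. (s, t) \<in> box2 a1 b1 a2 b2 \<longrightarrow> f t = g s"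
    by (rule AE_E3) auto
  have "\<not> {a1<..<b1} \<subseteq> N"
  proof
    assume "{a1<..<b1} \<subseteq> N"
    then have "{a1<..<b1} \<in> null_sets lborel" using N(1) null_sets_subset by (metis borel_open open_greaterThanLessThan sets_lborel)
    then show False using ab by auto
  qed
  then obtain s where s: "s \<in> {a1<..<b1}" "s \<notin> N" by blast
  from N(2)[OF s(2)] have "AE t in lborel. t \<in> {a2<..<b2} \<longrightarrow> f t = g s"
    by eventually_elim (use s(1) in \<open>simp add: box2_def\<close>)
  then show thesis by (rule that)
qed

text \<open>Each decomposition controls the jumps in one variable and leaves a rough function of the
  other. Comparing the two separates the variables: \<open>ub1\<close> differs from the atomic part
  in the second variable by a constant \<open>c\<close> only, which is moved into \<open>u1\<close>.
  Thus both summands are pure jump functions, and a constant one would put \<open>u\<close> into the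
  class \<open>S\<close>.\<close>

lemma sbv_of_two_decompositions:
  assumes \<theta>: "0 < \<theta>1" "\<theta>1 < 1" "0 < \<theta>2" "\<theta>2 < 1" and ab: "a1 < b1" "a2 < b2"
    and um: "u \<in> borel_measurable (lebesgue_on (box2 a1 b1 a2 b2))" and nS: "\<not> S_class (box2 a1 b1 a2 b2) u"
    and d1: "atom_decomposition \<theta>1 (box2 a1 b1 a2 b2) ({a1 - 1..b1} \<times> {a2 - 1}) B1 A1 u snd ub1 m1 p1 q1"
    and d2: "atom_decomposition \<theta>2 (box2 a1 b1 a2 b2) ({a1 - 1} \<times> {a2 - 1..b2}) B2 A2 u fst ub2 m2 p2 q2"
  shows "\<exists>u1 u2 :: real \<Rightarrow> real.
             SBV \<theta>1 {a1<..<b1} u1 \<and> SBV \<theta>2 {a2<..<b2} u2 \<and>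
             \<not> (\<exists>c. AE t in lebesgue_on {a1<..<b1}. u1 t = c) \<and>
             \<not> (\<exists>c. AE t in lebesgue_on {a2<..<b2}. u2 t = c) \<and>
             (AE x in lebesgue_on (box2 a1 b1 a2 b2). u x = u1 (fst x) + u2 (snd x)) \<and>
             jump_var \<theta>1 {a1<..<b1} u1 * jump_var \<theta>2 {a2<..<b2} u2 \<le> ennreal (A1 * A2)"
proof -
  let ?X = "box2 a1 b1 a2 b2"
  let ?g1 = "\<lambda>s. \<Sum>n. m1 n * indicator {p1 n<..} s" and ?g2 = "\<lambda>t. \<Sum>n. m2 n * indicator {q2 n<..} t"
  have s1: "summable (\<lambda>n. \<bar>m1 n\<bar>)" "summable (\<lambda>n. \<bar>m1 n\<bar> powr \<theta>1)" "(\<Sum>n. \<bar>m1 n\<bar> powr \<theta>1) \<le> A1"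
    and ae1: "AE x in lborel. x \<in> ?X \<longrightarrow> u x = ub1 (snd x) + (\<Sum>n. m1 n * indicator (quadrant (p1 n) (q1 n)) x)"
    and q1: "\<And>n. q1 n = a2 - 1"
    using d1 by (auto simp: atom_decomposition_def)
  have s2: "summable (\<lambda>n. \<bar>m2 n\<bar>)" "summable (\<lambda>n. \<bar>m2 n\<bar> powr \<theta>2)" "(\<Sum>n. \<bar>m2 n\<bar> powr \<theta>2) \<le> A2"
    and ae2: "AE x in lborel. x \<in> ?X \<longrightarrow> u x = ub2 (fst x) + (\<Sum>n. m2 n * indicator (quadrant (p2 n) (q2 n)) x)"
    and p2: "\<And>n. p2 n = a1 - 1"
    using d2 by (auto simp: atom_decomposition_def)
  have ae1': "AE x in lborel. x \<in> ?X \<longrightarrow> u x = ub1 (snd x) + ?g1 (fst x)"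
    using ae1 by eventually_elim (auto simp: indicator_quadrant q1 box2_def)
  have ae2': "AE x in lborel. x \<in> ?X \<longrightarrow> u x = ub2 (fst x) + ?g2 (snd x)"
    using ae2 by eventually_elim (auto simp: indicator_quadrant p2 box2_def)
  have "AE x in lborel. x \<in> ?X \<longrightarrow> ub1 (snd x) - ?g2 (snd x) = ub2 (fst x) - ?g1 (fst x)"
    using ae1' ae2' by eventually_elim auto
  then obtain c where c: "AE t in lborel. t \<in> {a2<..<b2} \<longrightarrow> ub1 t - ?g2 t = c"
    using AE_pair_constant[OF ab(1), of a2 b2 "\<lambda>t. ub1 t - ?g2 t" "\<lambda>s. ub2 s - ?g1 s"] by blast
  obtain u1 where u1: "SBV \<theta>1 {a1<..<b1} u1" "jump_var \<theta>1 {a1<..<b1} u1 \<le> ennreal (\<Sum>n. \<bar>m1 n\<bar> powr \<theta>1)"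
    "\<And>x. x \<in> {a1<..<b1} \<Longrightarrow> u1 x = c + ?g1 x"
    using atoms_1d_plus_constant[OF s1(1) \<theta>(1) less_imp_le[OF \<theta>(2)] s1(2)] by blast
  obtain u2 where u2: "SBV \<theta>2 {a2<..<b2} u2" "jump_var \<theta>2 {a2<..<b2} u2 \<le> ennreal (\<Sum>n. \<bar>m2 n\<bar> powr \<theta>2)"
    "\<And>x. x \<in> {a2<..<b2} \<Longrightarrow> u2 x = 0 + ?g2 x"
    using atoms_1d_plus_constant[OF s2(1) \<theta>(3) less_imp_le[OF \<theta>(4)] s2(2)] by blast
  have sum: "AE x in lborel. x \<in> ?X \<longrightarrow> u x = u1 (fst x) + u2 (snd x)"
    using ae1' AE_lborel_fst_snd(2)[OF c] by eventually_elim (auto simp: box2_def u1(3) u2(3))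
  have nc1: "\<not> (\<exists>c. AE t in lebesgue_on {a1<..<b1}. u1 t = c)"
  proof
    assume "\<exists>c. AE t in lebesgue_on {a1<..<b1}. u1 t = c"
    then obtain d where "AE t in lborel. t \<in> {a1<..<b1} \<longrightarrow> u1 t = d" by (auto simp: AE_restrict_space_iff AE_completion_iff)
    from AE_lborel_fst_snd(1)[OF this] sum have "AE x in lborel. x \<in> ?X \<longrightarrow> u x = d + u2 (snd x)"
      by eventually_elim (auto simp: box2_def)
    then show False using nS S_classI[OF um, of snd "\<lambda>t. d + u2 t"] by blast
  qed
  have nc2: "\<not> (\<exists>c. AE t in lebesgue_on {a2<..<b2}. u2 t = c)"
  proof
    assume "\<exists>c. AE t in lebesgue_on {a2<..<b2}. u2 t = c"
    then obtain d where "AE t in lborel. t \<in> {a2<..<b2} \<longrightarrow> u2 t = d" by (auto simp: AE_restrict_space_iff AE_completion_iff)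
    from AE_lborel_fst_snd(2)[OF this] sum have "AE x in lborel. x \<in> ?X \<longrightarrow> u x = u1 (fst x) + d"
      by eventually_elim (auto simp: box2_def)
    then show False using nS S_classI[OF um, of fst "\<lambda>t. u1 t + d"] by blast
  qed
  have nn: "0 \<le> (\<Sum>n. \<bar>m1 n\<bar> powr \<theta>1)" using suminf_nonneg[OF s1(2)] by simp
  have nn2: "0 \<le> (\<Sum>n. \<bar>m2 n\<bar> powr \<theta>2)" using suminf_nonneg[OF s2(2)] by simp
  have "jump_var \<theta>1 {a1<..<b1} u1 * jump_var \<theta>2 {a2<..<b2} u2 \<le> ennreal (\<Sum>n. \<bar>m1 n\<bar> powr \<theta>1) * ennreal (\<Sum>n. \<bar>m2 n\<bar> powr \<theta>2)"
    by (intro mult_mono u1 u2) auto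
  also have "\<dots> \<le> ennreal A1 * ennreal A2" using s1(3) s2(3) by (intro mult_mono ennreal_leI) auto
  also have "\<dots> = ennreal (A1 * A2)" using nn nn2 s1(3) s2(3) by (simp add: ennreal_mult)
  finally show ?thesis using u1(1) u2(1) nc1 nc2 sum by (auto simp: AE_lebesgue_on_box2)
qed

text \<open>\<alpha> and \<beta> are the variations along the two edges of the grid. If either tends
  to 0 on a subsequence, its atoms disappear in the limit and \<open>u\<close> is a function of one
  variable, against the hypothesis. So \<alpha> has a positive limit \<open>A\<close>, and the
  bounds of the two decompositions multiply to a quantity free of \<open>A\<close>.\<close>

lemma (in kernel) additive_part:
  assumes \<theta>: "0 < \<theta>1" "0 < \<theta>2" "\<theta>1 + \<theta>2 < 1" and ab: "a1 < b1" "a2 < b2"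
    and um: "u \<in> borel_measurable (lebesgue_on (box2 a1 b1 a2 b2))"
    and fin: "energy \<theta>1 \<theta>2 \<rho> {a1<..<b1} {a2<..<b2} u < \<infinity>"
    and f: "f1 \<in> borel_measurable borel" "f2 \<in> borel_measurable borel" "\<And>t. \<bar>f1 t\<bar> \<le> D" "\<And>t. \<bar>f2 t\<bar> \<le> D"
    and add: "AE x in lborel. x \<in> box2 a1 b1 a2 b2 \<longrightarrow> u x = f1 (fst x) + f2 (snd x)"
    and nS: "\<not> S_class (box2 a1 b1 a2 b2) u"
  shows "\<exists>u1 u2 :: real \<Rightarrow> real.
             SBV \<theta>1 {a1<..<b1} u1 \<and> SBV \<theta>2 {a2<..<b2} u2 \<and>
             \<not> (\<exists>c. AE t in lebesgue_on {a1<..<b1}. u1 t = c) \<and>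
             \<not> (\<exists>c. AE t in lebesgue_on {a2<..<b2}. u2 t = c) \<and>
             (AE x in lebesgue_on (box2 a1 b1 a2 b2). u x = u1 (fst x) + u2 (snd x)) \<and>
             jump_var \<theta>1 {a1<..<b1} u1 * jump_var \<theta>2 {a2<..<b2} u2
               \<le> ennreal (3 * enn2real (energy \<theta>1 \<theta>2 \<rho> {a1<..<b1} {a2<..<b2} u) / \<rho>_const)"
proof -
  let ?X = "box2 a1 b1 a2 b2"
  note [measurable] = f(1,2)
  define w where "w x = indicator ?X x * (f1 (fst x) + f2 (snd x))" for x
  have w: "w \<in> borel_measurable borel" unfolding w_def by measurable
  have wB: "\<bar>w x\<bar> \<le> 2 * D" for x
    using f(3)[of "fst x"] f(4)[of "snd x"] by (auto simp: w_def split: split_indicator)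
  have supp: "w x = 0" if "x \<notin> ?X" for x using that by (simp add: w_def)
  have wadd: "w x = f1 (fst x) + f2 (snd x)" if "x \<in> ?X" for x using that by (simp add: w_def)
  have uw: "AE x in lborel. x \<in> ?X \<longrightarrow> u x = w x" using add by eventually_elim (simp add: wadd)
  then have E: "energy \<theta>1 \<theta>2 \<rho> {a1<..<b1} {a2<..<b2} u = energy \<theta>1 \<theta>2 \<rho> {a1<..<b1} {a2<..<b2} w"
    using \<rho>_support by (intro energy_cong) (auto simp: AE_completion_iff)
  define M0 where "M0 = 12 * enn2real (energy \<theta>1 \<theta>2 \<rho> {a1<..<b1} {a2<..<b2} w) / \<rho>_const"
  obtain c1 c2 h l N N' U M where G: "grid_sequence a1 b1 a2 b2 w \<theta>1 \<theta>2 c1 c2 h l N N' U M" and M: "M \<longlonglongrightarrow> M0"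
    unfolding M0_def by (rule grid_sequence_exists[OF ab w wB supp fin[unfolded E]])
  interpret G: grid_sequence a1 b1 a2 b2 w \<theta>1 \<theta>2 c1 c2 h l N N' U M by (rule G)
  have \<theta>': "\<theta>1 < 1" "\<theta>2 < 1" using \<theta> by auto
  define \<alpha> where "\<alpha> k = (\<Sum>i<N k. \<bar>hdiff (U k) i 0\<bar> powr \<theta>1)" for k
  define \<beta> where "\<beta> k = (\<Sum>j<N' k. \<bar>vdiff (U k) 0 j\<bar> powr \<theta>2)" for k
  have first: "\<exists>ub m p q. atom_decomposition \<theta>1 ?X ({a1 - 1..b1} \<times> {a2 - 1}) (2 * D) A w snd ub m p q"
    if s: "strict_mono s" and A: "(\<lambda>k. \<alpha> (s k)) \<longlonglongrightarrow> A" for s A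
  proof -
    interpret s: grid_sequence a1 b1 a2 b2 w \<theta>1 \<theta>2 "c1 \<circ> s" "c2 \<circ> s" "h \<circ> s" "l \<circ> s" "N \<circ> s" "N' \<circ> s" "U \<circ> s" "M \<circ> s"
      by (rule G.grid_subsequence[OF s])
    show ?thesis
      by (rule s.additive_structure_1[OF \<theta>(1) \<theta>'(1) wB s.additive_energy(1)[OF wadd] _ A]) (auto simp: \<alpha>_def)
  qed
  have second: "\<exists>ub m p q. atom_decomposition \<theta>2 ?X ({a1 - 1} \<times> {a2 - 1..b2}) (2 * D) A w fst ub m p q"
    if s: "strict_mono s" and T: "\<And>k. \<beta> (s k) \<le> T k" "T \<longlonglongrightarrow> A" for s T A
  proof -
    interpret s: grid_sequence a1 b1 a2 b2 w \<theta>1 \<theta>2 "c1 \<circ> s" "c2 \<circ> s" "h \<circ> s" "l \<circ> s" "N \<circ> s" "N' \<circ> s" "U \<circ> s" "M \<circ> s"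
      by (rule G.grid_subsequence[OF s])
    show ?thesis
      by (rule s.additive_structure_2[OF \<theta>(2) \<theta>'(2) wB s.additive_energy(1)[OF wadd] _ T(2)]) (use T(1) in \<open>auto simp: \<beta>_def\<close>)
  qed
  have transfer: "atom_decomposition \<theta> ?X K B S w \<pi> ub m p q \<Longrightarrow> atom_decomposition \<theta> ?X K B S u \<pi> ub m p q" for \<theta> K B S \<pi> ub m p q
  proof -
    assume d: "atom_decomposition \<theta> ?X K B S w \<pi> ub m p q"
    then have "AE x in lborel. x \<in> ?X \<longrightarrow> w x = ub (\<pi> x) + (\<Sum>n. m n * indicator (quadrant (p n) (q n)) x)"
      by (simp add: atom_decomposition_def)
    with uw have "AE x in lborel. x \<in> ?X \<longrightarrow> u x = ub (\<pi> x) + (\<Sum>n. m n * indicator (quadrant (p n) (q n)) x)"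
      by eventually_elim auto
    with d show "atom_decomposition \<theta> ?X K B S u \<pi> ub m p q" by (simp add: atom_decomposition_def)
  qed
  have \<alpha>\<beta>: "0 \<le> \<alpha> k" "0 \<le> \<beta> k" "4 * (\<alpha> k * \<beta> k) \<le> M k" for k
    using G.additive_energy(2)[OF wadd, of k] by (auto simp: \<alpha>_def \<beta>_def intro!: sum_nonneg)
  show ?thesis
  proof (rule product_bound_alternative[OF \<alpha>\<beta> M])
    fix s assume "strict_mono (s :: nat \<Rightarrow> nat)" "(\<lambda>k. \<alpha> (s k)) \<longlonglongrightarrow> 0"
    from first[OF this] transfer obtain ub m p q where "atom_decomposition \<theta>1 ?X ({a1 - 1..b1} \<times> {a2 - 1}) (2 * D) 0 u snd ub m p q"
      by blast
    then show ?thesis using S_classI[OF um, of snd ub] atom_decomposition_zero[OF _ \<theta>(1)] nS by blast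
  next
    fix s T assume "strict_mono (s :: nat \<Rightarrow> nat)" "\<And>k. \<beta> (s k) \<le> T k" "T \<longlonglongrightarrow> 0"
    from second[OF this] transfer obtain ub m p q where "atom_decomposition \<theta>2 ?X ({a1 - 1} \<times> {a2 - 1..b2}) (2 * D) 0 u fst ub m p q"
      by blast
    then show ?thesis using S_classI[OF um, of fst ub] atom_decomposition_zero[OF _ \<theta>(2)] nS by blast
  next
    fix s A T assume s: "strict_mono (s :: nat \<Rightarrow> nat)" and A: "0 < A" "(\<lambda>k. \<alpha> (s k)) \<longlonglongrightarrow> A"
      and T: "\<And>k. \<beta> (s k) \<le> T k" "T \<longlonglongrightarrow> M0 / (4 * A)"
    obtain ub1 m1 p1 q1 where d1: "atom_decomposition \<theta>1 ?X ({a1 - 1..b1} \<times> {a2 - 1}) (2 * D) A u snd ub1 m1 p1 q1"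
      using first[OF s A(2)] transfer by blast
    obtain ub2 m2 p2 q2 where d2: "atom_decomposition \<theta>2 ?X ({a1 - 1} \<times> {a2 - 1..b2}) (2 * D) (M0 / (4 * A)) u fst ub2 m2 p2 q2"
      using second[OF s T] transfer by blast
    \<comment> \<open>The 12 in \<open>M0\<close> is divided by 4, the number of equal products in a
      cell energy.\<close>
    have eq: "A * (M0 / (4 * A)) = 3 * enn2real (energy \<theta>1 \<theta>2 \<rho> {a1<..<b1} {a2<..<b2} u) / \<rho>_const"
      using A(1) unfolding E M0_def by simp
    show ?thesis
      using sbv_of_two_decompositions[OF \<theta>(1) \<theta>'(1) \<theta>(2) \<theta>'(2) ab um nS d1 d2] unfolding eq .
  qed
qed

theorem theorem1p4:
  fixes \<theta>1 \<theta>2 :: real and \<rho> :: "real \<times> real \<Rightarrow> real"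
  assumes "\<theta>1 > 0" and "\<theta>2 > 0" and "\<theta>1 + \<theta>2 < 1"
    and "\<forall>z. \<rho> z \<ge> 0" and "integrable lborel \<rho>"
    and "\<exists>g. \<forall>z. \<rho> z = g (norm z)"
    and "\<forall>z. norm z \<ge> 1 \<longrightarrow> \<rho> z = 0"
    and "(\<integral>z. \<rho> z \<partial>lborel) = 1"
  shows "\<exists>C::real.
    (\<forall>a1 b1 a2 b2 (u :: real \<times> real \<Rightarrow> real).
       a1 < b1 \<and> a2 < b2 \<and>
       u \<in> borel_measurable (lebesgue_on (box2 a1 b1 a2 b2)) \<and>
       (AE x in lebesgue_on (box2 a1 b1 a2 b2). \<bar>u x\<bar> \<le> 1) \<and>
       energy \<theta>1 \<theta>2 \<rho> {a1<..<b1} {a2<..<b2} u < \<infinity>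
       \<longrightarrow>
       (\<exists>ub. S_class (box2 a1 b1 a2 b2) ub \<and>
          SBV (\<theta>1 + \<theta>2) (box2 a1 b1 a2 b2) (\<lambda>x. u x - ub x) \<and>
          Linf (box2 a1 b1 a2 b2) (\<lambda>x. u x - ub x) \<and>
          Linf_norm (box2 a1 b1 a2 b2) (\<lambda>x. u x - ub x)
            + enn2ereal (jump_var (\<theta>1 + \<theta>2) (box2 a1 b1 a2 b2) (\<lambda>x. u x - ub x))
          \<le> ereal (C * (1 + (b1 - a1) + (b2 - a2))
                 * (enn2real (energy \<theta>1 \<theta>2 \<rho> {a1<..<b1} {a2<..<b2} u)
                    + sqrt (enn2real (energy \<theta>1 \<theta>2 \<rho> {a1<..<b1} {a2<..<b2} u))))) \<and>
       (mu_zero (box2 a1 b1 a2 b2) u \<and> \<not> S_class (box2 a1 b1 a2 b2) u \<longrightarrow>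
          (\<exists>u1 u2 :: real \<Rightarrow> real.
             SBV \<theta>1 {a1<..<b1} u1 \<and> SBV \<theta>2 {a2<..<b2} u2 \<and>
             \<not> (\<exists>c. AE t in lebesgue_on {a1<..<b1}. u1 t = c) \<and>
             \<not> (\<exists>c. AE t in lebesgue_on {a2<..<b2}. u2 t = c) \<and>
             (AE x in lebesgue_on (box2 a1 b1 a2 b2). u x = u1 (fst x) + u2 (snd x)) \<and>
             jump_var \<theta>1 {a1<..<b1} u1 * jump_var \<theta>2 {a2<..<b2} u2
               \<le> ennreal C * energy \<theta>1 \<theta>2 \<rho> {a1<..<b1} {a2<..<b2} u))) \<and>
    (\<forall>a1 b1 a2 b2 (u :: real \<times> real \<Rightarrow> real).
       a1 < b1 \<and> a2 < b2 \<and>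
       Linf (box2 a1 b1 a2 b2) u \<and> BV (box2 a1 b1 a2 b2) u \<and>
       energy \<theta>1 \<theta>2 \<rho> {a1<..<b1} {a2<..<b2} u < \<infinity> \<and>
       jump_var 1 (box2 a1 b1 a2 b2) u = 0
       \<longrightarrow> S_class (box2 a1 b1 a2 b2) u)"
proof -
  obtain g where g: "\<And>z. \<rho> z = g (norm z)" using assms(6) by blast
  have radial: "\<rho> y = \<rho> z" if "norm y = norm z" for y z unfolding g that ..
  interpret kernel \<rho>
    by (rule kernel.intro) (use assms(4,5,7,8) radial in blast)+
  note \<theta> = assms(1-3)
  \<comment> \<open>One constant for both estimates. The factor 16 is 4 from
    \<open>grid_alternative\<close> with \<open>B = 1\<close> times 4 from
    \<open>abs_le_4_powr\<close>; the term with \<open>12 / \<rho>_const\<close> alone already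
    exceeds the \<open>3 / \<rho>_const\<close> of (ii).\<close>
  define C where "C = 16 * (12 / \<rho>_const + sqrt (12 / \<rho>_const))"
  have C3: "3 / \<rho>_const \<le> C" using \<rho>_const_pos by (simp add: C_def field_simps)
  show ?thesis
  proof (rule exI[of _ C], rule conjI; intro allI impI; elim conjE)
    fix a1 b1 a2 b2 :: real and u :: "real \<times> real \<Rightarrow> real"
    let ?X = "box2 a1 b1 a2 b2"
    let ?E = "energy \<theta>1 \<theta>2 \<rho> {a1<..<b1} {a2<..<b2}"
    assume ab: "a1 < b1" "a2 < b2" and um: "u \<in> borel_measurable (lebesgue_on ?X)"
      and u1: "AE x in lebesgue_on ?X. \<bar>u x\<bar> \<le> 1" and fin: "?E u < \<infinity>"
    obtain w where w: "w \<in> borel_measurable borel" "\<And>x. \<bar>w x\<bar> \<le> 1" "\<And>x. x \<notin> ?X \<Longrightarrow> w x = 0"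
      and uw: "AE x in lborel. x \<in> ?X \<longrightarrow> u x = w x"
      using bounded_borel_representative[OF um _ u1] by auto
    have E: "?E w = ?E u"
      using energy_cong[of \<rho> a1 b1 a2 b2 u w \<theta>1 \<theta>2] uw \<rho>_support by (simp add: AE_completion_iff)
    define K0 where "K0 = 4 * 1 * (12 * enn2real (?E u) / \<rho>_const + sqrt (12 * enn2real (?E u) / \<rho>_const))"
    obtain \<pi> ub m p q where \<pi>: "\<pi> = fst \<or> \<pi> = snd"
      and decw: "atom_decomposition (\<theta>1 + \<theta>2) ?X ({a1 - 1..b1} \<times> {a2 - 1..b2}) 1 K0 w \<pi> ub m p q"
      using decomposition_exists[OF \<theta> ab w(1) order_refl w(2,3) fin[folded E]] unfolding E K0_def by blast
    have ae: "AE x in lborel. x \<in> ?X \<longrightarrow> u x = ub (\<pi> x) + (\<Sum>n. m n * indicator (quadrant (p n) (q n)) x)"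
    proof -
      have "AE x in lborel. x \<in> ?X \<longrightarrow> w x = ub (\<pi> x) + (\<Sum>n. m n * indicator (quadrant (p n) (q n)) x)"
        using decw by (simp add: atom_decomposition_def)
      with uw show ?thesis by eventually_elim auto
    qed
    then have dec: "atom_decomposition (\<theta>1 + \<theta>2) ?X ({a1 - 1..b1} \<times> {a2 - 1..b2}) 1 K0 u \<pi> ub m p q"
      using decw by (simp add: atom_decomposition_def)
    have "4 * K0 * (1 + (b1 - a1) + (b2 - a2)) \<le> C * (1 + (b1 - a1) + (b2 - a2)) * (enn2real (?E u) + sqrt (enn2real (?E u)))"
      unfolding K0_def C_def using ab by (intro decomposition_constant) auto
    then have A: "\<exists>ub. S_class ?X ub \<and> SBV (\<theta>1 + \<theta>2) ?X (\<lambda>x. u x - ub x) \<and> Linf ?X (\<lambda>x. u x - ub x) \<and>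
        Linf_norm ?X (\<lambda>x. u x - ub x) + enn2ereal (jump_var (\<theta>1 + \<theta>2) ?X (\<lambda>x. u x - ub x))
        \<le> ereal (C * (1 + (b1 - a1) + (b2 - a2)) * (enn2real (?E u) + sqrt (enn2real (?E u))))" (is ?A)
      using sbv_part[OF \<theta> ab um dec \<pi>] by (meson ereal_less_eq(3) order_trans)
    have C: "\<exists>u1 u2. SBV \<theta>1 {a1<..<b1} u1 \<and> SBV \<theta>2 {a2<..<b2} u2 \<and>
        \<not> (\<exists>c. AE t in lebesgue_on {a1<..<b1}. u1 t = c) \<and> \<not> (\<exists>c. AE t in lebesgue_on {a2<..<b2}. u2 t = c) \<and>
        (AE x in lebesgue_on ?X. u x = u1 (fst x) + u2 (snd x)) \<and>
        jump_var \<theta>1 {a1<..<b1} u1 * jump_var \<theta>2 {a2<..<b2} u2 \<le> ennreal C * ?E u" (is ?C)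
      if mu: "mu_zero ?X u" and nS: "\<not> S_class ?X u"
    proof -
    have "ub \<in> borel_measurable borel" "\<And>y. \<bar>ub y\<bar> \<le> 1" "summable (\<lambda>n. \<bar>m n\<bar>)"
      using dec by (auto simp: atom_decomposition_def)
    from mu_zero_additive[OF mu ae \<pi> this]
    obtain f1 f2 D where f: "f1 \<in> borel_measurable borel" "f2 \<in> borel_measurable borel" "\<And>t. \<bar>f1 t\<bar> \<le> D" "\<And>t. \<bar>f2 t\<bar> \<le> D"
      "AE x in lborel. x \<in> ?X \<longrightarrow> u x = f1 (fst x) + f2 (snd x)" by blast
    have "ennreal (3 * enn2real (?E u) / \<rho>_const) \<le> ennreal C * ?E u"
    proof -
      have "ennreal (3 * enn2real (?E u) / \<rho>_const) \<le> ennreal (C * enn2real (?E u))"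
        using mult_right_mono[OF C3, of "enn2real (?E u)"] by (intro ennreal_leI) simp
      also have "\<dots> = ennreal C * ?E u"
        using fin \<rho>_const_pos by (simp add: ennreal_mult C_def ennreal_enn2real_if less_top)
      finally show ?thesis .
    qed
    with additive_part[OF \<theta> ab um fin f nS] show ?C by (meson order_trans)
    qed
    show "?A \<and> (mu_zero ?X u \<and> \<not> S_class ?X u \<longrightarrow> ?C)" using A C by blast
  next
    fix a1 b1 a2 b2 :: real and u :: "real \<times> real \<Rightarrow> real"
    assume "a1 < b1" "a2 < b2" "Linf (box2 a1 b1 a2 b2) u" "energy \<theta>1 \<theta>2 \<rho> {a1<..<b1} {a2<..<b2} u < \<infinity>"
      "jump_var 1 (box2 a1 b1 a2 b2) u = 0"
    then show "S_class (box2 a1 b1 a2 b2) u" by (rule jump_free_part[OF \<theta>])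
  qed
qed

end
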